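(* Let $M$ be a complete connected Riemannian manifold without boundary, $\mu\in[0,2]$, $\lambda>0$, and let $V:M\to(0,+\infty)$ be a continuous function such that \[ V\ge\lambda \ \text{ on } M \quad\text{if } \mu=0,\qquad \liminf_{x\to\infty}\,[\operatorname{dist}(x,o)^\mu V(x)]\ge\lambda \ \text{ for some } o\in M\quad\text{if } \mu>0. \] Let $u\in W^{1,2}_{\mathrm{loc}}(M)$. If $\Omega_+:=\{x\in M: u(x)>0\}$ has positive measure and \[ \Delta u\ge V u\qquad\text{weakly on }\Omega_+ , \] then for any $x_0\in M$ and any $q\in(1,+\infty)$ we have \[ \liminf_{R\to+\infty}\frac{1}{R^{1-\frac{\mu}{2}}}\log\int_{B_R(x_0)}u_+^q\ \ge\ \frac{2\sqrt{q-1}\,\sqrt{\lambda}}{1-\frac{\mu}{2}}\qquad\text{if }\mu\in[0,2), \] \[ \liminf_{R\to+\infty}\frac{1}{\log R}\log\int_{B_R(x_0)}u_+^q\ \ge\ 1+\sqrt{1+4(q-1)\lambda}>2\qquad\text{if }\mu=2, \] and in case $\mu=2$ \[ \lim_{R\to+\infty}\frac{1}{\log R}\log\int_{B_R(x_0)}u_+^q\ \ge\ 2\left(1+\sqrt{q-1}\,\sqrt{\lambda}\right) \] provided the limit exists.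
   Context: All integrals over $M$ or its subsets are with respect to the Riemannian volume measure; $\langle\cdot,\cdot\rangle$ is the Riemannian metric. $u_+:=\max\{u,0\}$; $B_R(x_0)$ is the geodesic ball of radius $R$ centered at $x_0$; $\operatorname{dist}$ is the Riemannian distance. $W^{1,2}_{\mathrm{loc}}(M)$ is the space of functions whose restriction to every relatively compact set $\Omega\subseteq M$ belongs to $W^{1,2}(\Omega)$, and $W^{1,2}_c(M)$ is its subspace of compactly supported functions. Integrals of non-negative functions may equal $+\infty$, with $\log(+\infty)=+\infty$, $\log 0=-\infty$; limits are understood in the extended sense. "$\Delta u\ge Vu$ weakly on $\Omega_+$" means \[ -\int_M\langle\nabla u,\nabla\varphi\rangle\ \ge\ \int_M V u\,\varphi\qquad\forall\,\varphi\in D^+(\Omega_+), \] where $D^+(\Omega_+):=\{\varphi\in W^{1,2}_c(M):\ \varphi\ge0\text{ on }M,\ \varphi=0\text{ and }\nabla\varphi=0\text{ a.e. on }M\setminus\Omega_+\}$. *)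

theory Defs
  imports "HOL-Analysis.Analysis"
begin

section \<open>Smooth maps and weak derivatives on open subsets of Euclidean space\<close>

primrec Ck_on :: "nat \<Rightarrow> ('a::real_normed_vector \<Rightarrow> 'b::real_normed_vector) \<Rightarrow> 'a set \<Rightarrow> bool" where
  "Ck_on 0 f S \<longleftrightarrow> continuous_on S f"
| "Ck_on (Suc k) f S \<longleftrightarrow> (\<forall>x\<in>S. f differentiable (at x)) \<and>
     (\<forall>v. Ck_on k (\<lambda>x. frechet_derivative f (at x) v) S)"

text \<open>Meant for open \<open>S\<close>: the derivatives are two-sided ones.\<close>

definition smooth_on :: "'a::real_normed_vector set \<Rightarrow> ('a \<Rightarrow> 'b::real_normed_vector) \<Rightarrow> bool" where
  "smooth_on S f \<longleftrightarrow> (\<forall>k. Ck_on k f S)"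

definition test_function :: "'a::euclidean_space set \<Rightarrow> ('a \<Rightarrow> real) \<Rightarrow> bool" where
  "test_function W \<psi> \<longleftrightarrow> smooth_on UNIV \<psi> \<and>
     (\<exists>K. compact K \<and> K \<subseteq> W \<and> (\<forall>x. x \<notin> K \<longrightarrow> \<psi> x = 0))"

definition locally_integrable_on :: "'a::euclidean_space set \<Rightarrow> ('a \<Rightarrow> real) \<Rightarrow> bool" where
  "locally_integrable_on W f \<longleftrightarrow> (\<forall>K. compact K \<and> K \<subseteq> W \<longrightarrow> set_integrable lborel K f)"

text \<open>\<open>h\<close> is the weak directional derivative of \<open>f\<close> along \<open>e\<close> on the open set \<open>W\<close>.\<close>

definition weak_derivative_on ::
  "'a::euclidean_space set \<Rightarrow> 'a \<Rightarrow> ('a \<Rightarrow> real) \<Rightarrow> ('a \<Rightarrow> real) \<Rightarrow> bool" where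
  "weak_derivative_on W e f h \<longleftrightarrow> locally_integrable_on W f \<and> locally_integrable_on W h \<and>
     (\<forall>\<psi>. test_function W \<psi> \<longrightarrow>
        (LINT x:W|lborel. f x * frechet_derivative \<psi> (at x) e) = - (LINT x:W|lborel. h x * \<psi> x))"


section \<open>Smooth manifolds\<close>

text \<open>The manifold is the whole type \<open>'a\<close> with its topology; a chart is a pair \<open>(U, \<phi>)\<close> of its
  domain and its coordinate map, whose values outside \<open>U\<close> are irrelevant. The smooth structure is
  given by an atlas, not necessarily a maximal one.\<close>

type_synonym ('a, 'n) chart = "'a set \<times> ('a \<Rightarrow> real ^ 'n)"

definition chart_inv :: "('a, 'n) chart \<Rightarrow> real ^ 'n \<Rightarrow> 'a" where
  "chart_inv c = inv_into (fst c) (snd c)"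

definition smooth_atlas ::
  "('a::{t2_space, second_countable_topology}, 'n::finite) chart set \<Rightarrow> bool" where
  "smooth_atlas A \<longleftrightarrow> (\<Union>c\<in>A. fst c) = UNIV \<and>
     (\<forall>c\<in>A. open (fst c) \<and> open (snd c ` fst c) \<and>
        homeomorphism (fst c) (snd c ` fst c) (snd c) (chart_inv c)) \<and>
     (\<forall>c\<in>A. \<forall>c'\<in>A. smooth_on (snd c ` (fst c \<inter> fst c')) (snd c' \<circ> chart_inv c))"

definition transition_derivative ::
  "('a, 'n::finite) chart \<Rightarrow> ('a, 'n) chart \<Rightarrow> 'a \<Rightarrow> real ^ 'n \<Rightarrow> real ^ 'n" where
  "transition_derivative c c' p = frechet_derivative (snd c' \<circ> chart_inv c) (at (snd c p))"

text \<open>A tangent vector at \<open>p\<close> is the family of its component vectors in all charts of the atlas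
  around \<open>p\<close>, related by the transformation law; at other charts the family is 0, so that tangent
  vectors are equal iff their components are.\<close>

type_synonym ('a, 'n) tangent = "('a, 'n) chart \<Rightarrow> real ^ 'n"

definition tangent_space :: "('a, 'n::finite) chart set \<Rightarrow> 'a \<Rightarrow> ('a, 'n) tangent set" where
  "tangent_space A p = {v.
     (\<forall>c. c \<notin> A \<or> p \<notin> fst c \<longrightarrow> v c = 0) \<and>
     (\<forall>c\<in>A. \<forall>c'\<in>A. p \<in> fst c \<inter> fst c' \<longrightarrow> v c' = transition_derivative c c' p (v c))}"

definition coord_vector ::
  "('a, 'n::finite) chart set \<Rightarrow> ('a, 'n) chart \<Rightarrow> 'a \<Rightarrow> 'n \<Rightarrow> ('a, 'n) tangent" where
  "coord_vector A c p i =
     (\<lambda>c'. if c' \<in> A \<and> p \<in> fst c' then transition_derivative c c' p (axis i 1) else 0)"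


section \<open>Riemannian metrics\<close>

type_synonym ('a, 'n) metric = "'a \<Rightarrow> ('a, 'n) tangent \<Rightarrow> ('a, 'n) tangent \<Rightarrow> real"

definition metric_matrix ::
  "('a, 'n::finite) chart set \<Rightarrow> ('a, 'n) metric \<Rightarrow> ('a, 'n) chart \<Rightarrow> 'a \<Rightarrow> real ^ 'n ^ 'n" where
  "metric_matrix A g c p = (\<chi> i j. g p (coord_vector A c p i) (coord_vector A c p j))"

definition riemannian_metric :: "('a, 'n::finite) chart set \<Rightarrow> ('a, 'n) metric \<Rightarrow> bool" where
  "riemannian_metric A g \<longleftrightarrow>
     (\<forall>p. \<forall>v\<in>tangent_space A p. \<forall>w\<in>tangent_space A p.
        g p v w = g p w v \<and>
        (\<forall>z\<in>tangent_space A p. \<forall>a. g p (\<lambda>c. a *\<^sub>R v c + w c) z = a * g p v z + g p w z) \<and>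
        (v \<noteq> (\<lambda>_. 0) \<longrightarrow> g p v v > 0)) \<and>
     (\<forall>c\<in>A. \<forall>i j. smooth_on (snd c ` fst c) (\<lambda>x. metric_matrix A g c (chart_inv c x) $ i $ j))"

definition riemannian_manifold ::
  "('a::{t2_space, second_countable_topology}, 'n::finite) chart set \<Rightarrow> ('a, 'n) metric \<Rightarrow> bool" where
  "riemannian_manifold A g \<longleftrightarrow> smooth_atlas A \<and> riemannian_metric A g"

text \<open>The Borel measure with density \<open>sqrt (det g)\<close> in every chart; the characterization
  determines it uniquely.\<close>

definition riemannian_volume ::
  "('a::topological_space, 'n::finite) chart set \<Rightarrow> ('a, 'n) metric \<Rightarrow> 'a measure" where
  "riemannian_volume A g = (THE m. sets m = sets borel \<and>
     (\<forall>c\<in>A. \<forall>B\<in>sets borel. B \<subseteq> fst c \<longrightarrow>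
        emeasure m B =
          (\<integral>\<^sup>+x\<in>snd c ` B. ennreal (sqrt (det (metric_matrix A g c (chart_inv c x)))) \<partial>lborel)))"


section \<open>Riemannian distance\<close>

definition C1_curve_on ::
  "('a::topological_space, 'n::finite) chart set \<Rightarrow> (real \<Rightarrow> 'a) \<Rightarrow> real \<Rightarrow> real \<Rightarrow> bool" where
  "C1_curve_on A \<gamma> a b \<longleftrightarrow> continuous_on {a..b} \<gamma> \<and>
     (\<forall>c\<in>A. \<exists>D. (\<forall>t\<in>{a..b} \<inter> \<gamma> -` fst c.
          ((snd c \<circ> \<gamma>) has_vector_derivative D t) (at t within {a..b})) \<and>
        continuous_on ({a..b} \<inter> \<gamma> -` fst c) D)"

definition piecewise_C1_curve ::
  "('a::topological_space, 'n::finite) chart set \<Rightarrow> (real \<Rightarrow> 'a) \<Rightarrow> bool" where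
  "piecewise_C1_curve A \<gamma> \<longleftrightarrow> (\<exists>n \<tau>. \<tau> 0 = (0::real) \<and> \<tau> n = 1 \<and>
     (\<forall>i<n. \<tau> i < \<tau> (Suc i) \<and> C1_curve_on A \<gamma> (\<tau> i) (\<tau> (Suc i))))"

definition velocity :: "('a, 'n::finite) chart set \<Rightarrow> (real \<Rightarrow> 'a) \<Rightarrow> real \<Rightarrow> ('a, 'n) tangent" where
  "velocity A \<gamma> t =
     (\<lambda>c. if c \<in> A \<and> \<gamma> t \<in> fst c then vector_derivative (snd c \<circ> \<gamma>) (at t) else 0)"

text \<open>The velocity is unspecified at the finitely many break points, which do not affect the
  integral.\<close>

definition curve_length ::
  "('a, 'n::finite) chart set \<Rightarrow> ('a, 'n) metric \<Rightarrow> (real \<Rightarrow> 'a) \<Rightarrow> real" where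
  "curve_length A g \<gamma> =
     integral {0..1} (\<lambda>t. sqrt (g (\<gamma> t) (velocity A \<gamma> t) (velocity A \<gamma> t)))"

definition rdist ::
  "('a::topological_space, 'n::finite) chart set \<Rightarrow> ('a, 'n) metric \<Rightarrow> 'a \<Rightarrow> 'a \<Rightarrow> real" where
  "rdist A g x y =
     (INF \<gamma>\<in>{\<gamma>. piecewise_C1_curve A \<gamma> \<and> \<gamma> 0 = x \<and> \<gamma> 1 = y}. curve_length A g \<gamma>)"

definition geodesic_ball ::
  "('a::topological_space, 'n::finite) chart set \<Rightarrow> ('a, 'n) metric \<Rightarrow> 'a \<Rightarrow> real \<Rightarrow> 'a set" where
  "geodesic_ball A g x R = {y. rdist A g x y < R}"

text \<open>Completeness as a metric space; by Hopf--Rinow this is the same as geodesic completeness.\<close>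

definition complete_connected_riemannian_manifold ::
  "('a::{t2_space, second_countable_topology}, 'n::finite) chart set \<Rightarrow> ('a, 'n) metric \<Rightarrow> bool" where
  "complete_connected_riemannian_manifold A g \<longleftrightarrow>
     riemannian_manifold A g \<and> connected (UNIV :: 'a set) \<and>
     Metric_space.mcomplete UNIV (rdist A g)"

definition at_manifold_infinity ::
  "('a::topological_space, 'n::finite) chart set \<Rightarrow> ('a, 'n) metric \<Rightarrow> 'a \<Rightarrow> 'a filter" where
  "at_manifold_infinity A g p = filtercomap (\<lambda>x. rdist A g x p) at_top"


section \<open>Sobolev functions\<close>

text \<open>\<open>X\<close> is a measurable vector field on the open set \<open>\<Omega>\<close> with \<open>g(X, \<partial>\<^sub>i) = \<partial>\<^sub>i u\<close> weakly, for the
  coordinate fields \<open>\<partial>\<^sub>i\<close> of every chart. Elements of Sobolev spaces are represented by everywhere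
  defined Borel functions.\<close>

definition is_weak_gradient ::
  "('a::topological_space, 'n::finite) chart set \<Rightarrow> ('a, 'n) metric \<Rightarrow> 'a set \<Rightarrow>
     ('a \<Rightarrow> real) \<Rightarrow> ('a \<Rightarrow> ('a, 'n) tangent) \<Rightarrow> bool" where
  "is_weak_gradient A g \<Omega> u X \<longleftrightarrow>
     (\<forall>p\<in>\<Omega>. X p \<in> tangent_space A p) \<and>
     (\<forall>c\<in>A. set_borel_measurable borel (fst c \<inter> \<Omega>) (\<lambda>p. X p c)) \<and>
     (\<forall>c\<in>A. \<forall>i. weak_derivative_on (snd c ` (fst c \<inter> \<Omega>)) (axis i 1) (u \<circ> chart_inv c)
        (\<lambda>x. g (chart_inv c x) (X (chart_inv c x)) (coord_vector A c (chart_inv c x) i)))"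

definition W12 ::
  "('a::topological_space, 'n::finite) chart set \<Rightarrow> ('a, 'n) metric \<Rightarrow> 'a set \<Rightarrow> ('a \<Rightarrow> real) set" where
  "W12 A g \<Omega> = {u. set_borel_measurable borel \<Omega> u \<and>
     set_integrable (riemannian_volume A g) \<Omega> (\<lambda>x. (u x)\<^sup>2) \<and>
     (\<exists>X. is_weak_gradient A g \<Omega> u X \<and>
        set_integrable (riemannian_volume A g) \<Omega> (\<lambda>x. g x (X x) (X x)))}"

definition W12_loc ::
  "('a::topological_space, 'n::finite) chart set \<Rightarrow> ('a, 'n) metric \<Rightarrow> ('a \<Rightarrow> real) set" where
  "W12_loc A g = {u. \<forall>\<Omega>. open \<Omega> \<and> compact (closure \<Omega>) \<longrightarrow> u \<in> W12 A g \<Omega>}"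

definition W12_c ::
  "('a::topological_space, 'n::finite) chart set \<Rightarrow> ('a, 'n) metric \<Rightarrow> ('a \<Rightarrow> real) set" where
  "W12_c A g = {u \<in> W12_loc A g. \<exists>K. compact K \<and> (AE x in riemannian_volume A g. x \<notin> K \<longrightarrow> u x = 0)}"

text \<open>A choice among weak gradients on the whole manifold, which agree almost everywhere.\<close>

definition gradient ::
  "('a::topological_space, 'n::finite) chart set \<Rightarrow> ('a, 'n) metric \<Rightarrow>
     ('a \<Rightarrow> real) \<Rightarrow> 'a \<Rightarrow> ('a, 'n) tangent" where
  "gradient A g u = (SOME X. is_weak_gradient A g UNIV u X)"

definition D_plus ::
  "('a::topological_space, 'n::finite) chart set \<Rightarrow> ('a, 'n) metric \<Rightarrow> 'a set \<Rightarrow> ('a \<Rightarrow> real) set" where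
  "D_plus A g \<Omega> = {\<phi> \<in> W12_c A g.
     (AE x in riemannian_volume A g. \<phi> x \<ge> 0) \<and>
     (AE x in riemannian_volume A g. x \<notin> \<Omega> \<longrightarrow> \<phi> x = 0 \<and> gradient A g \<phi> x = (\<lambda>_. 0))}"

definition weakly_subsolution_on ::
  "('a::topological_space, 'n::finite) chart set \<Rightarrow> ('a, 'n) metric \<Rightarrow>
     ('a \<Rightarrow> real) \<Rightarrow> 'a set \<Rightarrow> ('a \<Rightarrow> real) \<Rightarrow> bool" where
  "weakly_subsolution_on A g V \<Omega> u \<longleftrightarrow> (\<forall>\<phi>\<in>D_plus A g \<Omega>.
     - (LINT x|riemannian_volume A g. g x (gradient A g u x) (gradient A g \<phi> x))
       \<ge> (LINT x|riemannian_volume A g. V x * u x * \<phi> x))"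

definition ext_ln :: "ennreal \<Rightarrow> ereal" where
  "ext_ln a = (if a = 0 then -\<infinity> else if a = \<infinity> then \<infinity> else ereal (ln (enn2real a)))"

end

(* Test the inequality with f(u) eta(r)^2, where r is the distance from x0 and f is a bounded C^1
   truncation of t^(q-1) with f^2 <= f' t^q / (q-1). Completing the square removes the gradient of u, and
   letting f increase to t^(q-1) gives (q-1) INT V u_+^q eta(r)^2 <= INT u_+^q eta'(r)^2.
   For b^2 < (q-1) lambda choose eta = exp(-b Phi(r + C)) times a cutoff, with Phi'(t) = t^(-mu/2) and C so
   large that (q-1) V >= (b^2 + delta) (r + C)^(-mu). Only the cutoff region, which lies outside B_R,
   contributes to the right-hand side, so the mass there is at least a constant times
   exp(2b Phi(R + C)). For mu = 2 a cutoff on [R, 2R] gains the further factor R^2. This gives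
   2 + 2 sqrt((q-1) lambda) as a lower bound for the lower limit, which implies both claims.

   The analysis behind this: closed balls are compact (Hopf-Rinow), the distance is differentiable almost
   everywhere with gradient of norm at most 1 (Rademacher), and the test function is weakly
   differentiable by mollification of u in charts. *)
theory Submission
  imports Defs
begin

text \<open>The condition f^2 \<le> f' t^q / (q - 1) makes the completed square work pointwise, so
  nothing about u_+^q has to be known beforehand. This matters because u is only locally square
  integrable: for q > 2 both sides of the weighted inequality may be infinite. They are therefore
  extended integrals, and a term is cancelled only where it is known to be finite. Bounded f and f'
  keep the test function in the Sobolev class.

  For \<eta> = exp(-b \<Phi>) one has \<eta>'^2 \<le> b^2 \<Phi>'^2 \<eta>^2, which the left-hand
  side absorbs with the margin \<delta> to spare; this is the origin of the threshold b^2 < (q - 1)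
  \<lambda>. The shift C costs nothing, since \<Phi> is increasing.

  For \<mu> = 2 the constant claimed for the lower limit is the smaller of the two: its root is at
  most 1 + 2 sqrt((q - 1) \<lambda>).

  The distance need not be differentiable everywhere. Its gradient is replaced by an everywhere
  defined Borel field of norm at most 1 that represents the derivative almost everywhere in each
  chart.\<close>

abbreviation Borel :: "('a::topological_space => 'b::topological_space) set" where
 "Borel \<equiv> borel_measurable borel"

abbreviation dderiv :: "'a::real_normed_vector => ('a => 'b::real_normed_vector) => 'a => 'b" where
 "dderiv e f x \<equiv> frechet_derivative f (at x) e"

abbreviation tends_to :: "(nat => 'a::topological_space) => 'a => bool" (infixr "---->" 60) where
 "X ----> a \<equiv> filterlim X (nhds a) sequentially"

notation scaleR (infixr "*R" 75)

section \<open>Smooth bump functions\<close>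

lemma Ck_on_const: "Ck_on k (\<lambda>_. c) UNIV"
 by (induction k arbitrary: c) auto

lemma Ck_on_cmult:
 fixes f :: "'a::real_normed_vector => real"
 assumes "Ck_on k f UNIV"
 shows "Ck_on k (\<lambda>x. c * f x) UNIV"
 using assms
proof (induction k arbitrary: f)
 case 0
 then show ?case by (auto intro!: continuous_intros)
next
 case (Suc k)
 have d: "f differentiable (at x)" for x using Suc.prems by simp
 have "frechet_derivative (\<lambda>x. c * f x) (at x) = (\<lambda>v. c * dderiv v f x)" for x
  using d[of x] by (intro frechet_derivative_at[symmetric] has_derivative_mult_right)
   (simp add: frechet_derivative_works)
 then show ?case using Suc d by auto
qed

lemma Ck_on_add:
 fixes f g :: "'a::real_normed_vector => real"
 assumes "Ck_on k f UNIV" "Ck_on k g UNIV"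
 shows "Ck_on k (\<lambda>x. f x + g x) UNIV"
 using assms
proof (induction k arbitrary: f g)
 case 0
 then show ?case by (auto intro!: continuous_intros)
next
 case (Suc k)
 have d: "f differentiable (at x)" "g differentiable (at x)" for x using Suc.prems by simp_all
 have "frechet_derivative (\<lambda>x. f x + g x) (at x)
   = (\<lambda>v. dderiv v f x + dderiv v g x)" for x
  using d[of x] by (intro frechet_derivative_at[symmetric] has_derivative_add)
   (simp_all add: frechet_derivative_works)
 then show ?case using Suc d by auto
qed

text \<open>\<open>Ck_on (Suc k)\<close> does not contain \<open>Ck_on k\<close> as a conjunct, so
  the induction descends to the derivatives. The product rule relies on it, because it leaves one
  factor undifferentiated.\<close>

lemma Ck_on_Suc_imp:
 assumes "Ck_on (Suc k) f UNIV"
 shows "Ck_on k f UNIV"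
 using assms
proof (induction k arbitrary: f)
 case 0
 then show ?case by (auto intro: differentiable_imp_continuous_on simp: differentiable_on_def
    differentiable_at_withinI)
next
 case (Suc k)
 from Suc.prems have "f differentiable (at x)" "Ck_on k (\<lambda>x. dderiv v f x) UNIV" for x v
  by (auto simp del: Ck_on.simps(2) simp: Ck_on.simps(2)[of "Suc k" f] intro!: Suc.IH)
 then show ?case by simp
qed

lemma Ck_on_mult:
 fixes f g :: "'a::real_normed_vector => real"
 assumes "Ck_on k f UNIV" "Ck_on k g UNIV"
 shows "Ck_on k (\<lambda>x. f x * g x) UNIV"
 using assms
proof (induction k arbitrary: f g)
 case 0
 then show ?case by (auto intro!: continuous_intros)
next
 case (Suc k)
 have d: "f differentiable (at x)" "g differentiable (at x)" for x using Suc.prems by simp_all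
 have "frechet_derivative (\<lambda>x. f x * g x) (at x)
   = (\<lambda>v. f x * dderiv v g x + dderiv v f x * g x)" for x
  using d[of x] by (intro frechet_derivative_at[symmetric] has_derivative_mult)
   (simp_all add: frechet_derivative_works)
 moreover have "Ck_on k f UNIV" "Ck_on k g UNIV" using Suc.prems Ck_on_Suc_imp by blast+
 ultimately show ?case using Suc d by (auto intro!: Ck_on_add)
qed

lemma smooth_on_prod:
 fixes f :: "'i => 'a::real_normed_vector => real"
 assumes "finite I" "!!i. i \<in> I ==> smooth_on UNIV (f i)"
 shows "smooth_on UNIV (\<lambda>x. \<Prod>i\<in>I. f i x)"
 using assms
 by (induction I rule: finite_induct) (auto simp: smooth_on_def Ck_on_const intro!: Ck_on_mult)

text \<open>The functions \<open>p(1/t) exp(-1/t)\<close> (extended by 0) with a polynomial \<open>p\<close> are closed under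
 differentiation; \<open>p = 1\<close> is the usual flat function.\<close>

definition flat :: "real poly => real => real" where
 "flat p t = (if t > 0 then poly p (1 / t) * exp (- (1 / t)) else 0)"

text \<open>With s = 1/t, the derivative (p' - p) exp(-s) in s is multiplied by -s^2. The sign turns
  p' - p into p - p', and \<open>[:0, 0, 1:]\<close> is s^2.\<close>

definition flat_deriv :: "real poly => real poly" where
 "flat_deriv p = (p - pderiv p) * [:0, 0, 1:]"

lemma flat_poly_limit:
 fixes p :: "real poly"
 shows "((\<lambda>t. poly p (1 / t) * exp (- (1 / t))) \<longlongrightarrow> 0) (at_right 0)"
proof -
 have *: "((\<lambda>s::real. poly p s * exp (- s)) \<longlongrightarrow> 0) at_top"
 proof -
  have "((\<lambda>s. \<Sum>i\<le>degree p. coeff p i * (s ^ i / exp s)) \<longlongrightarrow> (\<Sum>i\<le>degree p. coeff p i * 0)) at_top"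
   by (intro tendsto_intros tendsto_power_div_exp_0)
  moreover have "(\<lambda>s. \<Sum>i\<le>degree p. coeff p i * (s ^ i / exp s)) = (\<lambda>s. poly p s * exp (- s))"
   by (intro ext) (simp add: poly_altdef exp_minus divide_inverse sum_distrib_left mult_ac)
  ultimately show ?thesis by simp
 qed
 have "filterlim (\<lambda>t::real. 1 / t) at_top (at_right 0)"
  using filterlim_inverse_at_top_right by (simp add: inverse_eq_divide)
 from filterlim_compose[OF * this] show ?thesis .
qed

lemma flat_has_derivative: "(flat p has_real_derivative flat (flat_deriv p) t) (at t)"
proof -
 consider "t < 0" | "t = 0" | "t > 0" by linarith
 then show ?thesis
 proof cases
  case 1
  have "((\<lambda>_. 0) has_real_derivative 0) (at t)" by simp
  then have "(flat p has_real_derivative 0) (at t)"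
   by (rule has_field_derivative_transform_within_open[where S="{..<0}"])
    (use 1 in \<open>auto simp: flat_def\<close>)
  then show ?thesis using 1 by (simp add: flat_def)
 next
  case 2
  \<comment> \<open>Dividing by h adds one factor 1/h, so the quotient has the form treated in
    \<open>flat_poly_limit\<close>, with the polynomial \<open>pCons 0 p\<close>.\<close>
  have r: "((\<lambda>h. flat p h / h) \<longlongrightarrow> 0) (at_right 0)"
   by (rule Lim_transform_eventually[OF flat_poly_limit[of "pCons 0 p"]])
    (auto simp: eventually_at_filter flat_def)
  have l: "((\<lambda>h. flat p h / h) \<longlongrightarrow> 0) (at_left 0)"
   by (rule Lim_transform_eventually[OF tendsto_const]) (auto simp: eventually_at_filter flat_def)
  have "((\<lambda>h. flat p h / h) \<longlongrightarrow> 0) (at 0)"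
   using l r by (simp add: filterlim_split_at)
  then show ?thesis using 2 by (simp add: DERIV_def flat_def)
 next
  case 3
  have "((\<lambda>t. poly p (1 / t) * exp (- (1 / t))) has_real_derivative flat (flat_deriv p) t) (at t)"
   using 3 by (auto intro!: derivative_eq_intros DERIV_chain2[OF poly_DERIV]
     simp: flat_def flat_deriv_def field_simps power2_eq_square)
  then show ?thesis
   by (rule has_field_derivative_transform_within_open[where S="{0<..}"])
    (use 3 in \<open>auto simp: flat_def\<close>)
 qed
qed

lemma smooth_on_flat_affine: "smooth_on UNIV (\<lambda>x::'a::euclidean_space. flat p (x \<bullet> a + b))"
proof -
 have D: "((\<lambda>x. flat q (x \<bullet> a + b)) has_derivative (\<lambda>v. flat (flat_deriv q) (x \<bullet> a + b) * (v \<bullet> a))) (at x)"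
  for q and x :: 'a
 proof -
  have "((\<lambda>x. x \<bullet> a + b) has_derivative (\<lambda>v. v \<bullet> a)) (at x)"
   by (auto intro!: derivative_eq_intros)
  from has_derivative_compose[OF this flat_has_derivative[of q "x \<bullet> a + b", unfolded has_field_derivative_def]]
  show ?thesis by (simp add: mult_ac)
 qed
 have "Ck_on k (\<lambda>x. flat q (x \<bullet> a + b)) UNIV" for k q
 proof (induction k arbitrary: q)
  case 0
  have "(\<lambda>x. flat q (x \<bullet> a + b)) differentiable_on (UNIV :: 'a set)"
   using D unfolding differentiable_on_def differentiable_def by (meson has_derivative_at_withinI)
  then show ?case by (simp add: differentiable_imp_continuous_on)
 next
  case (Suc k)
  have "frechet_derivative (\<lambda>x. flat q (x \<bullet> a + b)) (at x)
    = (\<lambda>v. flat (flat_deriv q) (x \<bullet> a + b) * (v \<bullet> a))" for x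
   using frechet_derivative_at[OF D] by metis
  then have "(\<lambda>x. frechet_derivative (\<lambda>x. flat q (x \<bullet> a + b)) (at x) v)
    = (\<lambda>x. (v \<bullet> a) * flat (flat_deriv q) (x \<bullet> a + b))" for v
   by (auto simp: mult_ac)
  moreover have "(\<lambda>x. flat q (x \<bullet> a + b)) differentiable (at x)" for x
   using D differentiable_def by blast
  ultimately show ?case using Ck_on_cmult[OF Suc] by simp
 qed
 then show ?thesis by (simp add: smooth_on_def)
qed

text \<open>A product of one-dimensional profiles, positive exactly on the open cube of half side
  \<epsilon> when \<epsilon> > 0. Each factor is an affine function followed by a flat one, so no
  smoothness of a norm enters.\<close>

definition flat_box :: "real => 'a::euclidean_space => real" where
 "flat_box \<epsilon> x = (\<Prod>b\<in>Basis. flat 1 (x \<bullet> b + \<epsilon>) * flat 1 (x \<bullet> (- b) + \<epsilon>))"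

lemma smooth_flat_box: "smooth_on UNIV (flat_box \<epsilon> :: 'a::euclidean_space => real)"
proof -
 have "smooth_on UNIV (\<lambda>x::'a. \<Prod>b\<in>Basis. flat 1 (x \<bullet> b + \<epsilon>) * flat 1 (x \<bullet> (- b) + \<epsilon>))"
  by (rule smooth_on_prod) (use smooth_on_flat_affine in \<open>auto simp: smooth_on_def intro!: Ck_on_mult simp del: inner_minus_right\<close>)
 then show ?thesis by (simp add: flat_box_def[abs_def])
qed

lemma flat_nonneg: "0 \<le> flat 1 t" and flat_le_1: "flat 1 t \<le> 1"
 and flat_pos: "t > 0 ==> 0 < flat 1 t" and flat_zero: "t \<le> 0 ==> flat 1 t = 0"
 by (auto simp: flat_def)

lemma flat_box_nonneg: "0 \<le> flat_box \<epsilon> x"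
 by (auto simp: flat_box_def flat_nonneg intro!: prod_nonneg)

lemma flat_box_pos: "\<epsilon> > 0 ==> norm x < \<epsilon> ==> 0 < flat_box \<epsilon> x"
 by (auto simp: flat_box_def intro!: prod_pos mult_pos_pos flat_pos dest: Basis_le_norm[of _ x])

text \<open>The cube of half side \<epsilon> lies in the ball of radius \<epsilon> times the
  dimension, by the l1 bound on the norm. This is why \<open>mollifier_exists\<close> divides its
  radius by the dimension.\<close>

lemma flat_box_zero:
 fixes x :: "'a::euclidean_space" and \<epsilon> :: real
 assumes "\<epsilon> > 0" "norm x \<ge> \<epsilon> * DIM('a)"
 shows "flat_box \<epsilon> x = 0"
proof (rule ccontr)
 assume "flat_box \<epsilon> x \<noteq> 0"
 then have "\<bar>x \<bullet> b\<bar> < \<epsilon>" if "b \<in> Basis" for b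
  using that flat_zero[of "x \<bullet> b + \<epsilon>"] flat_zero[of "x \<bullet> (-b) + \<epsilon>"]
  by (fastforce simp: flat_box_def)
 then have "(\<Sum>b\<in>Basis. \<bar>x \<bullet> b\<bar>) < (\<Sum>b\<in>(Basis::'a set). \<epsilon>)"
  by (intro sum_strict_mono) auto
 then show False using norm_le_l1[of x] assms by (simp add: mult_ac)
qed

lemma smooth_on_UNIV_imp_continuous: "smooth_on UNIV f ==> continuous_on UNIV f"
 unfolding smooth_on_def by (metis Ck_on.simps(1))

lemma smooth_on_UNIV_imp_differentiable: "smooth_on UNIV f ==> f differentiable (at x)"
 unfolding smooth_on_def by (metis Ck_on.simps(2) UNIV_I)

lemma smooth_on_UNIV_imp_deriv_continuous:
 "smooth_on UNIV f ==> continuous_on UNIV (\<lambda>x. dderiv v f x)"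
 unfolding smooth_on_def by (metis Ck_on.simps)

text \<open>Used with c = -1, to read \<eta>(x - y) as a test function in y.\<close>

lemma Ck_on_affine:
 fixes f :: "'a::real_normed_vector => real"
 assumes "Ck_on k f UNIV"
 shows "Ck_on k (\<lambda>x. f (c *R x + a)) UNIV"
 using assms
proof (induction k arbitrary: f)
 case 0
 then show ?case
  by (auto intro!: continuous_intros elim: continuous_on_compose2)
next
 case (Suc k)
 have "((\<lambda>x. f (c *R x + a)) has_derivative (\<lambda>v. c * dderiv v f (c *R x + a))) (at x)" for x
 proof -
  have fd: "(f has_derivative frechet_derivative f (at (c *R x + a))) (at (c *R x + a))"
   using Suc.prems frechet_derivative_works by auto
  have "((\<lambda>x. c *R x + a) has_derivative (\<lambda>v. c *R v)) (at x)"
   by (auto intro!: derivative_eq_intros)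
  from has_derivative_compose[OF this fd] show ?thesis
   using linear_cmul[OF has_derivative_linear[OF fd]] by simp
 qed
 then have "frechet_derivative (\<lambda>x. f (c *R x + a)) (at x) = (\<lambda>v. c * dderiv v f (c *R x + a))"
  and "(\<lambda>x. f (c *R x + a)) differentiable (at x)" for x
  by (metis frechet_derivative_at, auto simp: differentiable_def)
 moreover have "Ck_on k (\<lambda>x. c * dderiv v f (c *R x + a)) UNIV" for v
  using Suc.prems by (intro Ck_on_cmult Suc.IH) auto
 ultimately show ?case by simp
qed

lemma flat_box_integrable: "integrable lborel (flat_box \<epsilon> :: 'a::euclidean_space => real)"
 and flat_box_integral_pos: "\<epsilon> > 0 ==> 0 < (LINT x|lborel. flat_box \<epsilon> (x :: 'a::euclidean_space))"
proof -
 let ?f = "flat_box \<epsilon> :: 'a => real"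
 have cont: "continuous_on UNIV ?f"
  by (rule smooth_on_UNIV_imp_continuous[OF smooth_flat_box])
 show int: "integrable lborel ?f"
 proof (cases "\<epsilon> > 0")
  case True
  have "integrable lborel (\<lambda>x. indicator (cball 0 (\<epsilon> * DIM('a))) x *R ?f x)"
   using borel_integrable_compact[of "cball 0 (\<epsilon> * DIM('a))" ?f] cont continuous_on_subset by auto
  moreover have "(\<lambda>x. indicator (cball 0 (\<epsilon> * DIM('a))) x *R ?f x) = ?f"
   using flat_box_zero[OF True] by (force simp: indicator_def)
  ultimately show ?thesis by simp
 next
  case False
  \<comment> \<open>For \<epsilon> \<le> 0 the two inequalities that define the cube exclude each
    other in every coordinate.\<close>
  have "?f x = 0" for x
  proof -
   obtain b :: 'a where b: "b \<in> Basis" using nonempty_Basis by blast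
   have "flat 1 (x \<bullet> b + \<epsilon>) * flat 1 (x \<bullet> (- b) + \<epsilon>) = 0"
    using False by (cases "x \<bullet> b \<le> 0") (auto simp: flat_zero)
   then show ?thesis unfolding flat_box_def using b by (metis (mono_tags, lifting) finite_Basis prod_zero)
  qed
  then have "?f = (\<lambda>_. 0)" by auto
  then show ?thesis by simp
 qed
 assume e: "\<epsilon> > 0"
 have "(LINT x|lborel. ?f x) \<noteq> 0"
 proof
  assume "(LINT x|lborel. ?f x) = 0"
  then have "AE x in lborel. ?f x = 0"
   using int integral_nonneg_eq_0_iff_AE[of lborel ?f] flat_box_nonneg by (metis (no_types, lifting) AE_I2)
  then have "AE x in lborel. x \<notin> ball (0::'a) \<epsilon>"
   by (rule eventually_mono) (use flat_box_pos[OF e] in force)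
  then have "ball (0::'a) \<epsilon> \<in> null_sets lborel" by (subst (asm) AE_iff_null_sets[symmetric]) auto
  then have "negligible (ball (0::'a) \<epsilon>)" using negligible_iff_null_sets null_sets_completionI by blast
  then show False using e open_not_negligible[of "ball (0::'a) \<epsilon>"] by simp
 qed
 moreover have "0 \<le> (LINT x|lborel. ?f x)" by (simp add: flat_box_nonneg)
 ultimately show "0 < (LINT x|lborel. ?f x)" by linarith
qed

lemma mollifier_exists:
 assumes "\<epsilon> > 0"
 obtains \<eta> :: "'a::euclidean_space => real"
 where "smooth_on UNIV \<eta>" "!!x. 0 \<le> \<eta> x" "!!x. norm x \<ge> \<epsilon> ==> \<eta> x = 0"
  "integrable lborel \<eta>" "(LINT x|lborel. \<eta> x) = 1"
proof -
 define d where "d = \<epsilon> / DIM('a)"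
 define I where "I = (LINT x|lborel. flat_box d (x :: 'a))"
 have d: "d > 0" using assms by (simp add: d_def)
 have I: "I > 0" unfolding I_def by (rule flat_box_integral_pos[OF d])
 show ?thesis
 proof
  show "smooth_on UNIV (\<lambda>x::'a. (1/I) * flat_box d x)"
   using smooth_flat_box Ck_on_cmult unfolding smooth_on_def by blast
  show "0 \<le> (1/I) * flat_box d x" for x :: 'a using I flat_box_nonneg[of d x] by simp
  show "(1/I) * flat_box d x = 0" if "norm x \<ge> \<epsilon>" for x :: 'a
   using flat_box_zero[OF d, of x] that by (simp add: d_def)
  show "integrable lborel (\<lambda>x::'a. (1/I) * flat_box d x)"
   by (simp add: flat_box_integrable)
  show "(LINT x|lborel. (1/I) * flat_box d (x::'a)) = 1"
   using I by (simp add: I_def)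
 qed
qed

section \<open>Mollification\<close>

lemma lborel_shift:
 fixes f :: "'a::euclidean_space => real"
 assumes [measurable]: "f \<in> Borel"
 shows "(LINT x|lborel. f (x + z)) = (LINT x|lborel. f x)"
  and "integrable lborel (\<lambda>x. f (x + z)) \<longleftrightarrow> integrable lborel f"
proof -
 have d: "distr lborel borel ((+) z) = (lborel :: 'a measure)" by (rule lborel_distr_plus)
 show "(LINT x|lborel. f (x + z)) = (LINT x|lborel. f x)"
  by (subst (2) d[symmetric], subst integral_distr) (auto simp: add.commute)
 show "integrable lborel (\<lambda>x. f (x + z)) \<longleftrightarrow> integrable lborel f"
  by (subst (2) d[symmetric], subst integrable_distr_eq) (auto simp: add.commute)
qed

lemma nn_lborel_shift:
 fixes f :: "'a::euclidean_space => ennreal"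
 assumes [measurable]: "f \<in> Borel"
 shows "(\<integral>\<^sup>+ x. f (x + z) \<partial>lborel) = (\<integral>\<^sup>+ x. f x \<partial>lborel)"
 by (subst (2) lborel_distr_plus[of z, symmetric], subst nn_integral_distr) (auto simp: add.commute)

text \<open>The error f - g enters twice, once shifted and once not, with the same L1 norm by
  translation invariance. So continuity of translations passes to L1 limits.\<close>

lemma translation_L1_approx:
 fixes f g :: "'a::euclidean_space => real"
 assumes f: "integrable lborel f" and g: "integrable lborel g"
 shows "(LINT x|lborel. \<bar>f (x + z) - f x\<bar>)
   \<le> (LINT x|lborel. \<bar>g (x + z) - g x\<bar>) + 2 * (LINT x|lborel. \<bar>f x - g x\<bar>)"
proof -
 have [measurable]: "f \<in> Borel" "g \<in> Borel"
  using f g by (auto dest: borel_measurable_integrable)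
 have sh: "integrable lborel (\<lambda>x. f (x + z))" "integrable lborel (\<lambda>x. g (x + z))"
  using f g by (simp_all add: lborel_shift)
 have "(LINT x|lborel. \<bar>f (x + z) - f x\<bar>) \<le>
   (LINT x|lborel. \<bar>g (x + z) - g x\<bar> + (\<bar>f (x + z) - g (x + z)\<bar> + \<bar>f x - g x\<bar>))"
  using f g sh by (intro integral_mono) auto
 also have "\<dots> = (LINT x|lborel. \<bar>g (x + z) - g x\<bar>)
   + ((LINT x|lborel. \<bar>f (x + z) - g (x + z)\<bar>) + (LINT x|lborel. \<bar>f x - g x\<bar>))"
  using f g sh by simp
 also have "(LINT x|lborel. \<bar>f (x + z) - g (x + z)\<bar>) = (LINT x|lborel. \<bar>f x - g x\<bar>)"
  using lborel_shift(1)[of "\<lambda>x. \<bar>f x - g x\<bar>" z] by simp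
 finally show ?thesis by simp
qed

lemma translation_L1_open:
 fixes U :: "'a::euclidean_space set"
 assumes U: "open U" "emeasure lborel U < \<infinity>" and z: "z ----> 0"
 shows "(\<lambda>n. LINT x|lborel. \<bar>indicat_real U (x + z n) - indicat_real U x\<bar>) ----> 0"
proof -
 have [measurable]: "U \<in> sets borel" using U by simp
 have iU: "integrable lborel (indicat_real U)"
  using U by (intro integrable_real_indicator) auto
 have sh: "integrable lborel (\<lambda>x. indicat_real U (x + w))" for w
  using iU by (simp add: lborel_shift)
 have pr: "integrable lborel (\<lambda>x. indicat_real U x * indicat_real U (x + w))" for w
  by (rule Bochner_Integration.integrable_bound[OF iU]) (auto simp: indicator_def)
 \<comment> \<open>Pointwise |1_A - 1_B| = 1_A + 1_B - 2 1_A 1_B, and the shift preserves the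
   integral of an indicator. Only the product still depends on the shift, and it is dominated by the
   indicator of U.\<close>
 have eq: "(LINT x|lborel. \<bar>indicat_real U (x + w) - indicat_real U x\<bar>)
   = 2 * (LINT x|lborel. indicat_real U x) - 2 * (LINT x|lborel. indicat_real U x * indicat_real U (x + w))" for w
 proof -
  have "(LINT x|lborel. \<bar>indicat_real U (x + w) - indicat_real U x\<bar>)
   = (LINT x|lborel. indicat_real U (x + w) + indicat_real U x - 2 * (indicat_real U x * indicat_real U (x + w)))"
   by (rule Bochner_Integration.integral_cong) (auto simp: indicator_def)
  also have "\<dots> = (LINT x|lborel. indicat_real U (x + w)) + (LINT x|lborel. indicat_real U x)
    - 2 * (LINT x|lborel. indicat_real U x * indicat_real U (x + w))"
   using iU sh[of w] pr[of w] by simp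
  also have "(LINT x|lborel. indicat_real U (x + w)) = (LINT x|lborel. indicat_real U x)"
   by (rule lborel_shift) simp
  finally show ?thesis by simp
 qed
 have "(\<lambda>n. LINT x|lborel. indicat_real U x * indicat_real U (x + z n)) ----> (LINT x|lborel. indicat_real U x)"
 proof (rule integral_dominated_convergence[where w = "indicat_real U"])
  show "AE x in lborel. (\<lambda>n. indicat_real U x * indicat_real U (x + z n)) ----> indicat_real U x"
  proof (intro AE_I2)
   fix x :: 'a
   show "(\<lambda>n. indicat_real U x * indicat_real U (x + z n)) ----> indicat_real U x"
   proof (cases "x \<in> U")
    case True
    have "(\<lambda>n. x + z n) ----> x" using tendsto_add[OF tendsto_const z] by simp
    \<comment> \<open>Openness of U enters here: small shifts do not push a point out of U. For a
      point outside U the product vanishes anyway.\<close>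
    then have "\<forall>\<^sub>F n in sequentially. x + z n \<in> U" using True U(1) by (metis topological_tendstoD)
    then have "\<forall>\<^sub>F n in sequentially. indicat_real U x * indicat_real U (x + z n) = indicat_real U x"
     by eventually_elim (use True in auto)
    then show ?thesis by (rule tendsto_eventually)
   qed simp
  qed
 qed (auto simp: iU indicator_def)
 then have "(\<lambda>n. 2 * (LINT x|lborel. indicat_real U x)
   - 2 * (LINT x|lborel. indicat_real U x * indicat_real U (x + z n)))
   ----> 2 * (LINT x|lborel. indicat_real U x) - 2 * (LINT x|lborel. indicat_real U x)"
  by (intro tendsto_intros)
 then show ?thesis unfolding eq by simp
qed

text \<open>Continuity of translations in \<open>L\<^sup>1\<close>. For an open set this is dominated convergence, since the
 symmetric difference has twice the measure of the part that leaves the set.\<close>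

lemma translation_L1:
 fixes f :: "'a::euclidean_space => real"
 assumes "integrable lborel f" and z: "z ----> 0"
 shows "(\<lambda>n. LINT x|lborel. \<bar>f (x + z n) - f x\<bar>) ----> 0"
proof -
 define P where "P f \<longleftrightarrow> (\<lambda>n. LINT x|lborel. \<bar>f (x + z n) - f x\<bar>) ----> 0" for f :: "'a => real"
 have approx: "P f"
  if f: "integrable lborel f"
   and g: "!!e. e > 0 ==> \<exists>g. integrable lborel g \<and> P g \<and> (LINT x|lborel. \<bar>f x - g x\<bar>) < e"
  for f :: "'a => real"
  unfolding P_def
 proof (rule LIMSEQ_I)
  fix e :: real assume "e > 0"
  then obtain g where g: "integrable lborel g" "P g" "(LINT x|lborel. \<bar>f x - g x\<bar>) < e / 4"
   using g[of "e/4"] by auto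
  obtain N where N: "!!n. n \<ge> N ==> (LINT x|lborel. \<bar>g (x + z n) - g x\<bar>) < e / 2"
   using LIMSEQ_D[OF g(2)[unfolded P_def], of "e/2"] \<open>e > 0\<close> by auto
  have "norm ((LINT x|lborel. \<bar>f (x + z n) - f x\<bar>) - 0) < e" if "n \<ge> N" for n
   using translation_L1_approx[OF f g(1), of "z n"] N[OF that] g(3) by simp
  then show "\<exists>N. \<forall>n\<ge>N. norm ((LINT x|lborel. \<bar>f (x + z n) - f x\<bar>) - 0) < e" by blast
 qed
 have scale: "P (\<lambda>x. f x * c)" if "P f" for f c
 proof -
  have "(\<lambda>n. (LINT x|lborel. \<bar>f (x + z n) - f x\<bar>) * \<bar>c\<bar>) ----> 0 * \<bar>c\<bar>"
   using that unfolding P_def by (intro tendsto_intros)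
  then show ?thesis unfolding P_def
   by (simp add: left_diff_distrib[symmetric] abs_mult)
 qed
 have "P f" using assms(1)
 proof (induction rule: integrable_induct)
  case (base A c)
  have A: "A \<in> sets borel" "emeasure lborel A < \<infinity>" using base by auto
  have iA: "integrable lborel (indicat_real A)" using A by (intro integrable_real_indicator) auto
  have "P (indicat_real A)"
  proof (rule approx[OF iA])
   fix e :: real assume "e > 0"
   \<comment> \<open>Outer regularity replaces a Borel set by an open one at an L1 cost below
     e.\<close>
   then obtain U where U: "open U" "A \<subseteq> U" "emeasure lborel (U - A) < ennreal e"
    using outer_regular_lborel[OF A(1)] by metis
   have "emeasure lborel U = emeasure lborel A + emeasure lborel (U - A)"
    using A U by (subst plus_emeasure) (auto simp: Un_absorb1)
   also have "\<dots> < \<infinity>" using A U(3) by (simp add: order.strict_trans[OF _ ennreal_less_top])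
   finally have Uf: "emeasure lborel U < \<infinity>" .
   have iU: "integrable lborel (indicat_real U)" using U Uf by (intro integrable_real_indicator) auto
   have "(LINT x|lborel. \<bar>indicat_real A x - indicat_real U x\<bar>) = (LINT x|lborel. indicat_real (U - A) x)"
    using U(2) by (intro Bochner_Integration.integral_cong) (auto simp: indicator_def)
   also have "\<dots> = measure lborel (U - A)" by simp
   also have "\<dots> < e"
    using U(3) \<open>e > 0\<close> by (simp add: measure_def enn2real_less_iff order.strict_trans[OF _ ennreal_less_top])
   finally show "\<exists>g. integrable lborel g \<and> P g \<and> (LINT x|lborel. \<bar>indicat_real A x - g x\<bar>) < e"
    using translation_L1_open[OF U(1) Uf z] iU unfolding P_def by blast
  qed
  from scale[OF this, of c] show ?case by simp
 next
  case (add f g)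
  have [measurable]: "f \<in> Borel" "g \<in> Borel"
   using add by (auto dest: borel_measurable_integrable)
  have sh: "integrable lborel (\<lambda>x. f (x + w))" "integrable lborel (\<lambda>x. g (x + w))" for w
   using add by (simp_all add: lborel_shift)
  have "(\<lambda>n. (LINT x|lborel. \<bar>f (x + z n) - f x\<bar>) + (LINT x|lborel. \<bar>g (x + z n) - g x\<bar>)) ----> 0 + 0"
   using add unfolding P_def by (intro tendsto_add)
  then have lim0: "(\<lambda>n. (LINT x|lborel. \<bar>f (x + z n) - f x\<bar>) + (LINT x|lborel. \<bar>g (x + z n) - g x\<bar>)) ----> 0"
   by simp
  show ?case unfolding P_def
  proof (rule Lim_null_comparison[OF _ lim0])
   show "\<forall>\<^sub>F n in sequentially. norm (LINT x|lborel. \<bar>f (x + z n) + g (x + z n) - (f x + g x)\<bar>)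
    \<le> (LINT x|lborel. \<bar>f (x + z n) - f x\<bar>) + (LINT x|lborel. \<bar>g (x + z n) - g x\<bar>)"
   proof (rule always_eventually, rule allI)
    fix n
    have "(LINT x|lborel. \<bar>f (x + z n) + g (x + z n) - (f x + g x)\<bar>)
     \<le> (LINT x|lborel. \<bar>f (x + z n) - f x\<bar> + \<bar>g (x + z n) - g x\<bar>)"
     using add sh by (intro integral_mono) auto
    also have "\<dots> = (LINT x|lborel. \<bar>f (x + z n) - f x\<bar>) + (LINT x|lborel. \<bar>g (x + z n) - g x\<bar>)"
     using add sh by simp
    finally show "norm (LINT x|lborel. \<bar>f (x + z n) + g (x + z n) - (f x + g x)\<bar>)
     \<le> (LINT x|lborel. \<bar>f (x + z n) - f x\<bar>) + (LINT x|lborel. \<bar>g (x + z n) - g x\<bar>)" by simp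
   qed
  qed
 next
  case (lim f s)
  show ?case
  proof (rule approx[OF lim(4)])
   fix e :: real assume e: "e > 0"
   have "(\<lambda>i. LINT x|lborel. \<bar>f x - s i x\<bar>) ----> (LINT x|(lborel :: 'a measure). 0)"
   \<comment> \<open>The approximants satisfy |s i| \<le> 2 |f|, hence the majorant 3 |f|.\<close>
   proof (rule integral_dominated_convergence[where w = "\<lambda>x. 3 * \<bar>f x\<bar>"])
    show "AE x in lborel. (\<lambda>i. \<bar>f x - s i x\<bar>) ----> 0"
    proof (intro AE_I2)
     fix x :: 'a assume x: "x \<in> space lborel"
     have "(\<lambda>i. \<bar>f x - s i x\<bar>) ----> \<bar>f x - f x\<bar>"
      by (intro tendsto_intros lim(2)[OF x])
     then show "(\<lambda>i. \<bar>f x - s i x\<bar>) ----> 0" by simp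
    qed
    show "AE x in lborel. norm \<bar>f x - s i x\<bar> \<le> 3 * \<bar>f x\<bar>" for i
    proof (intro AE_I2)
     fix x :: 'a assume "x \<in> space lborel"
     from lim(3)[OF this, of i] show "norm \<bar>f x - s i x\<bar> \<le> 3 * \<bar>f x\<bar>" by simp
    qed
   qed (use lim in auto)
   then obtain i where "(LINT x|lborel. \<bar>f x - s i x\<bar>) < e"
    using order_tendstoD(2)[of _ 0 sequentially e] e by (auto simp: eventually_sequentially)
   then show "\<exists>g. integrable lborel g \<and> P g \<and> (LINT x|lborel. \<bar>f x - g x\<bar>) < e"
    using lim(1,5) by blast
  qed
 qed
 then show ?thesis by (simp add: P_def)
qed

section \<open>Convolution with a mollifier\<close>

definition mollify :: "('a::euclidean_space => real) => ('a => real) => 'a => real" where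
 "mollify h f x = (LINT y|lborel. f y * h (x - y))"

definition mollifier :: "real => ('a::euclidean_space => real) => bool" where
 "mollifier \<epsilon> h \<longleftrightarrow> smooth_on UNIV h \<and> (\<forall>x. 0 \<le> h x) \<and> (\<forall>x. norm x \<ge> \<epsilon> --> h x = 0) \<and>
   integrable lborel h \<and> (LINT x|lborel. h x) = 1"

lemma mollifier_borel: "mollifier \<epsilon> h ==> h \<in> Borel"
 unfolding mollifier_def by (metis borel_measurable_continuous_onI smooth_on_UNIV_imp_continuous)

lemma lborel_reflect:
 fixes f :: "'a::euclidean_space => real"
 assumes [measurable]: "f \<in> Borel"
 shows "(LINT y|lborel. f (x - y)) = (LINT y|lborel. f y)"
  "integrable lborel (\<lambda>y. f (x - y)) \<longleftrightarrow> integrable lborel f"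
proof -
 have d: "lborel = distr lborel borel (\<lambda>y::'a. x + - 1 *R y)"
  using lborel_affine[of "-1" x] by (simp add: density_1 one_ennreal_def[symmetric])
 show "(LINT y|lborel. f (x - y)) = (LINT y|lborel. f y)"
  by (subst (2) d, subst integral_distr) auto
 show "integrable lborel (\<lambda>y. f (x - y)) \<longleftrightarrow> integrable lborel f"
  by (subst (2) d, subst integrable_distr_eq) auto
qed

lemma mollifier_bounded:
 fixes h :: "'a::euclidean_space => real"
 assumes "mollifier \<epsilon> h"
 obtains B where "!!x. h x \<le> B"
proof -
 have "continuous_on (cball 0 \<epsilon>) h"
  using assms smooth_on_UNIV_imp_continuous continuous_on_subset by (metis mollifier_def subset_UNIV)
 then have "bounded (h ` cball 0 \<epsilon>)" by (intro compact_imp_bounded compact_continuous_image compact_cball)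
 then obtain B where B: "\<forall>x\<in>cball 0 \<epsilon>. \<bar>h x\<bar> \<le> B"
  by (auto simp: bounded_iff)
 have "h x \<le> \<bar>B\<bar>" for x
  using bspec[OF B, of x] assms by (cases "norm x \<le> \<epsilon>") (auto simp: mollifier_def)
 then show ?thesis by (rule that)
qed

lemma mollify_integrand_integrable:
 assumes f: "integrable lborel f" and h: "mollifier \<epsilon> h"
 shows "integrable lborel (\<lambda>y. f y * h (x - y))" "integrable lborel (\<lambda>z. f (x - z) * h z)"
  "mollify h f x = (LINT z|lborel. f (x - z) * h z)"
proof -
 have [measurable]: "f \<in> Borel" using f by (auto dest: borel_measurable_integrable)
 note [measurable] = mollifier_borel[OF h]
 obtain B where B: "!!x. h x \<le> B" using mollifier_bounded[OF h] by blast
 have pos: "!!x. 0 \<le> h x" using h by (simp add: mollifier_def)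
 show *: "integrable lborel (\<lambda>y. f y * h (x - y))"
 proof (rule Bochner_Integration.integrable_bound)
  show "integrable lborel (\<lambda>y. f y * B)" using f by simp
  show "AE y in lborel. norm (f y * h (x - y)) \<le> norm (f y * B)"
  proof (intro AE_I2)
   fix y
   have "\<bar>h (x - y)\<bar> \<le> \<bar>B\<bar>" using B[of "x - y"] pos[of "x - y"] by simp
   then show "norm (f y * h (x - y)) \<le> norm (f y * B)"
    by (simp add: abs_mult mult_left_mono)
  qed
 qed simp
 show "integrable lborel (\<lambda>z. f (x - z) * h z)"
  using * lborel_reflect(2)[of "\<lambda>z. f (x - z) * h z" x] by simp
 show "mollify h f x = (LINT z|lborel. f (x - z) * h z)"
  unfolding mollify_def using lborel_reflect(1)[of "\<lambda>z. f (x - z) * h z" x] by simp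
qed

text \<open>Since the mollifier has mass one, mollify h f - f is an average of the differences f(x -
  z) - f(x), and Fubini bounds its L1 norm by the average of the translation errors. The estimate
  runs in extended integrals because integrability of the mollification is one of its
  conclusions.\<close>

lemma mollify_L1_le:
 fixes f :: "'a::euclidean_space => real"
 assumes f: "integrable lborel f" and h: "mollifier \<epsilon> h"
  and e: "!!z. norm z < \<epsilon> ==> (LINT x|lborel. \<bar>f (x + z) - f x\<bar>) \<le> e"
  and e0: "0 \<le> e"
 shows "integrable lborel (mollify h f)" "(LINT x|lborel. \<bar>mollify h f x - f x\<bar>) \<le> e"
proof -
 have [measurable]: "f \<in> Borel" using f by (auto dest: borel_measurable_integrable)
 note [measurable] = mollifier_borel[OF h]
 have pos: "!!x. 0 \<le> h x" and int: "integrable lborel h" "(LINT x|lborel. h x) = 1"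
  and supp: "!!x. norm x \<ge> \<epsilon> ==> h x = 0"
  using h by (auto simp: mollifier_def)
 have m[measurable]: "mollify h f \<in> Borel"
  unfolding mollify_def by measurable
 have diff: "mollify h f x - f x = (LINT z|lborel. (f (x - z) - f x) * h z)" for x
  using mollify_integrand_integrable[OF f h, of x] int by (simp add: left_diff_distrib)
 have "(\<integral>\<^sup>+ x. ennreal \<bar>mollify h f x - f x\<bar> \<partial>lborel)
   \<le> (\<integral>\<^sup>+ x. (\<integral>\<^sup>+ z. ennreal (\<bar>f (x - z) - f x\<bar> * h z) \<partial>lborel) \<partial>lborel)"
 proof (rule nn_integral_mono)
  fix x :: 'a
  have i: "integrable lborel (\<lambda>z. \<bar>f (x - z) - f x\<bar> * h z)"
  proof -
   have "integrable lborel (\<lambda>z. (f (x - z) - f x) * h z)"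
    using mollify_integrand_integrable(2)[OF f h, of x] int by (simp add: left_diff_distrib)
   from integrable_abs[OF this] show ?thesis using pos by (simp add: abs_mult)
  qed
  have "\<bar>mollify h f x - f x\<bar> \<le> (LINT z|lborel. \<bar>(f (x - z) - f x) * h z\<bar>)"
   unfolding diff by (rule integral_abs_bound)
  also have "\<dots> = (LINT z|lborel. \<bar>f (x - z) - f x\<bar> * h z)" using pos by (simp add: abs_mult)
  finally have "ennreal \<bar>mollify h f x - f x\<bar> \<le> ennreal (LINT z|lborel. \<bar>f (x - z) - f x\<bar> * h z)"
   by (rule ennreal_leI)
  also have "\<dots> = (\<integral>\<^sup>+ z. ennreal (\<bar>f (x - z) - f x\<bar> * h z) \<partial>lborel)"
   using pos by (intro nn_integral_eq_integral[symmetric] i) auto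
  finally show "ennreal \<bar>mollify h f x - f x\<bar> \<le> \<dots>" .
 qed
 also have "\<dots> = (\<integral>\<^sup>+ z. (\<integral>\<^sup>+ x. ennreal (\<bar>f (x - z) - f x\<bar> * h z) \<partial>lborel) \<partial>lborel)"
  by (rule lborel_pair.Fubini') measurable
 also have "\<dots> \<le> (\<integral>\<^sup>+ z. ennreal e * ennreal (h z) \<partial>lborel)"
 proof (rule nn_integral_mono)
  fix z :: 'a
  show "(\<integral>\<^sup>+ x. ennreal (\<bar>f (x - z) - f x\<bar> * h z) \<partial>lborel) \<le> ennreal e * ennreal (h z)"
  proof (cases "norm z < \<epsilon>")
   case True
   have "integrable lborel (\<lambda>x. \<bar>f (x + (- z)) - f x\<bar>)"
    using f lborel_shift(2)[of f "-z"] by (intro integrable_abs Bochner_Integration.integrable_diff) auto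
   then have "(\<integral>\<^sup>+ x. ennreal \<bar>f (x + (- z)) - f x\<bar> \<partial>lborel) = ennreal (LINT x|lborel. \<bar>f (x + (- z)) - f x\<bar>)"
    by (intro nn_integral_eq_integral) auto
   also have "\<dots> \<le> ennreal e" using e[of "-z"] True by (intro ennreal_leI) simp
   finally have *: "(\<integral>\<^sup>+ x. ennreal \<bar>f (x - z) - f x\<bar> \<partial>lborel) \<le> ennreal e" by simp
   have "(\<integral>\<^sup>+ x. ennreal (\<bar>f (x - z) - f x\<bar> * h z) \<partial>lborel)
     = (\<integral>\<^sup>+ x. ennreal \<bar>f (x - z) - f x\<bar> \<partial>lborel) * ennreal (h z)"
    using pos by (simp add: ennreal_mult nn_integral_multc)
   then show ?thesis using * by (simp add: mult_right_mono)
  next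
   case False
   then show ?thesis using supp[of z] by simp
  qed
 qed
 also have "\<dots> = ennreal e * ennreal 1"
  using pos int by (simp add: nn_integral_cmult nn_integral_eq_integral)
 finally have bd: "(\<integral>\<^sup>+ x. ennreal \<bar>mollify h f x - f x\<bar> \<partial>lborel) \<le> ennreal e" by simp
 then have id: "integrable lborel (\<lambda>x. mollify h f x - f x)"
  by (intro integrableI_bounded) (auto intro: order.strict_trans1 ennreal_less_top)
 from Bochner_Integration.integrable_add[OF this f] show "integrable lborel (mollify h f)" by simp
 have "ennreal (LINT x|lborel. \<bar>mollify h f x - f x\<bar>) \<le> ennreal e"
  using bd id by (subst nn_integral_eq_integral[symmetric]) auto
 then show "(LINT x|lborel. \<bar>mollify h f x - f x\<bar>) \<le> e" using e0 by simp
qed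

lemma translation_L1_uniform:
 fixes f :: "'a::euclidean_space => real"
 assumes f: "integrable lborel f" and e: "e > 0"
 obtains d where "d > 0" "!!z. norm z < d ==> (LINT x|lborel. \<bar>f (x + z) - f x\<bar>) \<le> e"
proof -
 have "((\<lambda>z. LINT x|lborel. \<bar>f (x + z) - f x\<bar>) \<longlongrightarrow> 0) (at 0)"
  unfolding tendsto_at_iff_sequentially using translation_L1[OF f] by (auto simp: o_def)
 from order_tendstoD(2)[OF this e] obtain d where "d > 0"
  "!!z. z \<noteq> 0 ==> norm z < d ==> (LINT x|lborel. \<bar>f (x + z) - f x\<bar>) < e"
  unfolding eventually_at by auto
 then have "(LINT x|lborel. \<bar>f (x + z) - f x\<bar>) \<le> e" if "norm z < d" for z
  using that e by (cases "z = 0") (auto intro: less_imp_le)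
 with \<open>d > 0\<close> show ?thesis by (rule that)
qed

lemma mollify_L1_tendsto:
 fixes f :: "'a::euclidean_space => real"
 assumes f: "integrable lborel f" and h: "!!n. mollifier (\<epsilon> n) (h n)" and \<epsilon>: "\<epsilon> ----> 0"
 shows "(\<lambda>n. LINT x|lborel. \<bar>mollify (h n) f x - f x\<bar>) ----> 0"
proof (rule LIMSEQ_I)
 fix e :: real assume "e > 0"
 then obtain d where d: "d > 0" "!!z. norm z < d ==> (LINT x|lborel. \<bar>f (x + z) - f x\<bar>) \<le> e/2"
  using translation_L1_uniform[OF f, of "e/2"] by auto
 obtain N where N: "!!n. n \<ge> N ==> \<epsilon> n < d"
  using order_tendstoD(2)[OF \<epsilon> d(1)] by (auto simp: eventually_sequentially)
 have "norm ((LINT x|lborel. \<bar>mollify (h n) f x - f x\<bar>) - 0) < e" if "n \<ge> N" for n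
  using mollify_L1_le(2)[OF f h[of n], of "e/2"] d(2) N[OF that] \<open>e > 0\<close> by fastforce
 then show "\<exists>N. \<forall>n\<ge>N. norm ((LINT x|lborel. \<bar>mollify (h n) f x - f x\<bar>) - 0) < e" by blast
qed

text \<open>Twice the L1 norm of f bounds every translation error, so no smallness of \<epsilon> is
  involved.\<close>

lemma mollify_integrable:
 fixes f :: "'a::euclidean_space => real"
 assumes f: "integrable lborel f" and h: "mollifier \<epsilon> h"
 shows "integrable lborel (mollify h f)"
proof (rule mollify_L1_le(1)[OF f h])
 have [measurable]: "f \<in> Borel" using f by (auto dest: borel_measurable_integrable)
 fix z :: 'a
 have "(LINT x|lborel. \<bar>f (x + z) - f x\<bar>) \<le> (LINT x|lborel. \<bar>f (x + z)\<bar> + \<bar>f x\<bar>)"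
  using f lborel_shift(2)[of f z] by (intro integral_mono) auto
 also have "\<dots> = 2 * (LINT x|lborel. \<bar>f x\<bar>)"
  using f lborel_shift(2)[of f z] lborel_shift(1)[of "\<lambda>x. \<bar>f x\<bar>" z] by simp
 finally show "(LINT x|lborel. \<bar>f (x + z) - f x\<bar>) \<le> 2 * (LINT x|lborel. \<bar>f x\<bar>)" .
qed simp

lemma mollifier_ex: "\<epsilon> > 0 ==> \<exists>h :: 'a::euclidean_space => real. mollifier \<epsilon> h"
 unfolding mollifier_def by (erule mollifier_exists) blast

lemma test_function_mollifier:
 fixes h :: "'a::euclidean_space => real"
 assumes h: "mollifier \<epsilon> h" and "cball x \<epsilon> \<subseteq> W"
 shows "test_function W (\<lambda>y. h (x - y))"
 unfolding test_function_def
proof (intro conjI exI)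
 have "Ck_on k (\<lambda>y. h ((-1) *R y + x)) UNIV" for k
  using h unfolding mollifier_def smooth_on_def by (intro Ck_on_affine) auto
 then show "smooth_on UNIV (\<lambda>y. h (x - y))" by (simp add: smooth_on_def)
 show "compact (cball x \<epsilon>)" "cball x \<epsilon> \<subseteq> W" using assms by auto
 show "\<forall>y. y \<notin> cball x \<epsilon> --> h (x - y) = 0"
  using h by (auto simp: mollifier_def dist_norm)
qed

text \<open>The fundamental lemma of the calculus of variations. Mollifying k at a point of K means
  testing it with a bump around that point, which gives 0, while the mollifications approximate k in
  L1; hence the integral of |k| over K is below every positive bound.\<close>

lemma weak_zero_imp_AE_zero:
 fixes W :: "'a::euclidean_space set"
 assumes W: "open W" and k: "locally_integrable_on W k"
  and z: "!!\<psi>. test_function W \<psi> ==> (LINT x:W|lborel. k x * \<psi> x) = 0"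
 shows "AE x in lborel. x \<in> W --> k x = 0"
proof -
 have K: "AE x in lborel. x \<in> K --> k x = 0" if K: "compact K" "K \<subseteq> W" for K
 proof -
  obtain d where d: "d > 0" "(\<Union>x\<in>K. cball x d) \<subseteq> W"
   using compact_subset_open_imp_cball_epsilon_subset[OF K(1) W K(2)] by blast
  \<comment> \<open>k is only locally integrable, so it is cut off to a compact neighbourhood of K
    that still contains the supports of all bumps of radius at most d centred in K.\<close>
  define L where "L = (\<Union>x\<in>K. cball x d)"
  have L: "compact L" "L \<subseteq> W" "K \<subseteq> L"
   using d K compact_minkowski_sum_cball[OF K(1), of d] by (auto simp: L_def)
  define k1 where "k1 = (\<lambda>x. indicator L x * k x)"
  have k1: "integrable lborel k1"
   using k L unfolding locally_integrable_on_def set_integrable_def k1_def by auto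
  have [measurable]: "k1 \<in> Borel" "K \<in> sets borel"
   using k1 K by (auto dest: borel_measurable_integrable simp: compact_imp_closed)
  have iK: "integrable lborel (\<lambda>x. indicator K x * k1 x)"
   using integrable_real_mult_indicator[of K lborel k1] k1 by (simp add: mult.commute)
  have "(LINT x|lborel. \<bar>indicator K x * k1 x\<bar>) \<le> e" if e: "e > 0" for e
  proof -
   obtain d' where d': "d' > 0" "!!z. norm z < d' ==> (LINT x|lborel. \<bar>k1 (x + z) - k1 x\<bar>) \<le> e"
    using translation_L1_uniform[OF k1 e] by blast
   define \<epsilon> where "\<epsilon> = min d d'"
   have \<epsilon>: "\<epsilon> > 0" "\<epsilon> \<le> d" "\<epsilon> \<le> d'" using d d' by (auto simp: \<epsilon>_def)
   obtain h :: "'a => real" where h: "mollifier \<epsilon> h" using mollifier_ex[OF \<epsilon>(1)] by blast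
   have "mollify h k1 x = 0" if "x \<in> K" for x
   proof -
    have "cball x \<epsilon> \<subseteq> L" using that \<epsilon>(2) by (auto simp: L_def)
    then have out: "h (x - y) = 0" if "y \<notin> L" for y
     using h that by (metis dist_norm linear mem_cball mollifier_def subsetD)
    have "mollify h k1 x = (LINT y:W|lborel. k y * h (x - y))"
     unfolding mollify_def set_lebesgue_integral_def k1_def
     using L(2) out by (intro Bochner_Integration.integral_cong) (auto simp: indicator_def)
    also have "\<dots> = 0"
     using \<open>cball x \<epsilon> \<subseteq> L\<close> L(2) by (intro z test_function_mollifier[OF h]) auto
    finally show ?thesis .
   qed
   then have "(LINT x|lborel. \<bar>indicator K x * k1 x\<bar>) \<le> (LINT x|lborel. \<bar>mollify h k1 x - k1 x\<bar>)"
    using iK k1 mollify_integrable[OF k1 h]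
    by (intro integral_mono) (auto simp: indicator_def)
   also have "\<dots> \<le> e"
    using d' \<epsilon> e by (intro mollify_L1_le(2)[OF k1 h]) auto
   finally show ?thesis .
  qed
  then have "(LINT x|lborel. \<bar>indicator K x * k1 x\<bar>) \<le> 0" by (rule field_le_epsilon[of _ 0, simplified])
  then have "(LINT x|lborel. \<bar>indicator K x * k1 x\<bar>) = 0"
   by (simp add: order.antisym)
  then have "AE x in lborel. \<bar>indicator K x * k1 x\<bar> = 0"
   using integral_nonneg_eq_0_iff_AE[OF integrable_abs[OF iK]] by auto
  then show ?thesis
   by (rule eventually_mono) (use L in \<open>auto simp: k1_def indicator_def split: if_splits\<close>)
 qed
 obtain C where C: "!!n. compact (C n)" "!!n. C n \<subseteq> W" "!!n. C n \<subseteq> interior (C (Suc n))" "\<Union>(range C) = W"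
  using open_Union_compact_subsets[OF W] by metis
 have "AE x in lborel. \<forall>n. x \<in> C n --> k x = 0"
  using K C by (subst AE_all_countable) auto
 then show ?thesis by (rule eventually_mono) (use C in auto)
qed

section \<open>Weak derivatives of composite functions\<close>

lemma smooth_line_derivative:
 fixes p :: "'a::euclidean_space => real"
 assumes "smooth_on UNIV p"
 shows "((\<lambda>s. p (x + s *R e)) has_real_derivative dderiv e p (x + s *R e)) (at s)"
proof -
 have d: "(p has_derivative frechet_derivative p (at (x + s *R e))) (at (x + s *R e))"
  using smooth_on_UNIV_imp_differentiable[OF assms] frechet_derivative_works by blast
 have "((\<lambda>s. x + s *R e) has_derivative (\<lambda>h. h *R e)) (at s)"
  by (auto intro!: derivative_eq_intros)
 from has_derivative_compose[OF this d] show ?thesis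
  using linear_cmul[OF has_derivative_linear[OF d]]
  by (simp add: has_field_derivative_def mult.commute[of _ "frechet_derivative _ _ _"])
qed

lemma smooth_deriv_zero:
 fixes p :: "'a::euclidean_space => real"
 assumes "closed K" "!!x. x \<notin> K ==> p x = 0" "x \<notin> K"
 shows "dderiv e p x = 0"
proof -
 have "(p has_derivative (\<lambda>_. 0)) (at x)"
  by (rule has_derivative_transform_within_open[of "\<lambda>_. 0" _ _ _ "- K"]) (use assms in auto)
 then show ?thesis using frechet_derivative_at by metis
qed

lemma smooth_compact_Lipschitz:
 fixes p :: "'a::euclidean_space => real"
 assumes s: "smooth_on UNIV p" and K: "compact K" "!!x. x \<notin> K ==> p x = 0"
 obtains C where "C \<ge> 0" "!!x. \<bar>dderiv e p x\<bar> \<le> C"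
  "!!x s. \<bar>p (x + s *R e) - p x\<bar> \<le> C * \<bar>s\<bar>" "!!x. \<bar>p x\<bar> \<le> C"
proof -
 have bd: "bounded ((\<lambda>x. dderiv e p x) ` K)" "bounded (p ` K)"
  using K continuous_on_subset[OF smooth_on_UNIV_imp_deriv_continuous[OF s]]
   continuous_on_subset[OF smooth_on_UNIV_imp_continuous[OF s]]
  by (auto intro!: compact_imp_bounded compact_continuous_image)
 then obtain C1 C2 where C1: "\<forall>x\<in>K. \<bar>dderiv e p x\<bar> \<le> C1" and C2: "\<forall>x\<in>K. \<bar>p x\<bar> \<le> C2"
  by (auto simp: bounded_iff)
 define C where "C = max 0 (max C1 C2)"
 have 1: "\<bar>dderiv e p x\<bar> \<le> C" for x
  using C1 smooth_deriv_zero[OF compact_imp_closed[OF K(1)] K(2)]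
  by (cases "x \<in> K") (auto simp: C_def le_max_iff_disj)
 have 2: "\<bar>p x\<bar> \<le> C" for x using C2 K by (cases "x \<in> K") (auto simp: C_def)
 have 3: "\<bar>p (x + s *R e) - p x\<bar> \<le> C * \<bar>s\<bar>" for x s
  using field_differentiable_bound[of UNIV "\<lambda>s. p (x + s *R e)" "\<lambda>s. dderiv e p (x + s *R e)" C s 0]
   smooth_line_derivative[OF s] 1 by auto
 show ?thesis by (rule that[of C]) (use 1 2 3 in \<open>auto simp: C_def\<close>)
qed

text \<open>Integration by parts against a function that is merely Lipschitz in direction \<open>e\<close>: shift the
 difference quotient from the test function to \<open>w\<close>.\<close>

lemma difference_quotient_by_parts:
 fixes p w k :: "'a::euclidean_space => real"
 assumes s: "smooth_on UNIV p" and K: "compact K" "!!x. x \<notin> K ==> p x = 0"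
  and d: "d > 0" and L: "L = (\<Union>x\<in>K. cball x d)"
  and w[measurable]: "(\<lambda>x. indicator L x * w x) \<in> Borel"
  and M: "!!x. x \<in> L ==> \<bar>w x\<bar> \<le> M"
  and lip: "!!x s. x \<in> K ==> norm (s *R e) \<le> d ==> \<bar>w (x + s *R e) - w x\<bar> \<le> \<Lambda> * \<bar>s\<bar>"
  and k[measurable]: "(\<lambda>x. k x * p x) \<in> Borel"
  and der: "AE x in lborel. x \<in> K --> ((\<lambda>s. w (x + s *R e)) has_real_derivative k x) (at 0)"
 shows "(LINT x|lborel. w x * dderiv e p x) = - (LINT x|lborel. k x * p x)"
proof -
 obtain C where C: "C \<ge> 0" "!!x. \<bar>dderiv e p x\<bar> \<le> C"
  "!!x s. \<bar>p (x + s *R e) - p x\<bar> \<le> C * \<bar>s\<bar>" "!!x. \<bar>p x\<bar> \<le> C"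
  using smooth_compact_Lipschitz[OF s K] by metis
 have Lc: "compact L" and KL: "K \<subseteq> L"
  using compact_minkowski_sum_cball[OF K(1), of d] d by (auto simp: L)
 have [measurable]: "L \<in> sets borel" "K \<in> sets borel" using Lc K(1) by (auto simp: compact_imp_closed)
 have [measurable]: "p \<in> Borel"
  using smooth_on_UNIV_imp_continuous[OF s] by (rule borel_measurable_continuous_onI)
 have iL: "integrable lborel (\<lambda>x. indicat_real L x * c)" and iK: "integrable lborel (\<lambda>x. indicat_real K x * c)" for c
  using Lc K(1) emeasure_compact_finite by (auto intro!: integrable_mult_left integrable_real_indicator)
 \<comment> \<open>Positive step sizes tending to 0 for which a shift by j n along e has length at
   most d; the added 1 covers e = 0.\<close>
 define j where "j n = d / ((norm e + 1) * (real n + 1))" for n :: nat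
 have ne: "norm e + 1 > 0" by (smt (verit) norm_ge_zero)
 have jpos: "j n > 0" for n using d ne by (simp add: j_def)
 have jle: "norm (j n *R e) \<le> d" "norm ((- j n) *R e) \<le> d" for n
 proof -
  have "norm e / (norm e + 1) \<le> 1" "1 / (real n + 1) \<le> 1" using ne by simp_all
  then have "norm e / (norm e + 1) * (1 / (real n + 1)) \<le> 1 * 1" by (intro mult_mono) auto
  then have "d * (norm e / (norm e + 1) * (1 / (real n + 1))) \<le> d * 1" using d by (intro mult_left_mono) auto
  then show "norm (j n *R e) \<le> d" "norm ((- j n) *R e) \<le> d" using jpos[of n] d by (simp_all add: j_def mult_ac)
 qed
 have j0: "j ----> 0"
 proof -
  have "(\<lambda>n. d / (norm e + 1) * inverse (real (Suc n))) ----> d / (norm e + 1) * 0"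
   by (intro tendsto_intros LIMSEQ_inverse_real_of_nat)
  then show ?thesis by (simp add: j_def[abs_def] divide_inverse mult_ac add.commute[of 1])
 qed
 have s0: "filterlim j (at 0) sequentially"
  using j0 jpos by (auto simp: filterlim_at intro!: always_eventually) (metis less_irrefl)
 have s0': "filterlim (\<lambda>n. - j n) (at 0) sequentially"
  using tendsto_minus[OF j0] jpos by (auto simp: filterlim_at intro!: always_eventually) (metis less_irrefl)
 \<comment> \<open>w is controlled only on L, hence the truncation. At points of K and at their
   small shifts w1 and w agree.\<close>
 define w1 where "w1 x = indicator L x * w x" for x
 have w1[measurable]: "w1 \<in> Borel" using w by (simp add: w1_def[abs_def])
 have w1M: "\<bar>w1 x\<bar> \<le> indicat_real L x * M" for x using M[of x] by (auto simp: w1_def indicator_def)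
 have iwp: "integrable lborel (\<lambda>x. w1 x * p (x + z))" for z
 proof (rule Bochner_Integration.integrable_bound[OF iL[of "M * C"]])
  show "AE x in lborel. norm (w1 x * p (x + z)) \<le> norm (indicat_real L x * (M * C))"
  proof (intro AE_I2)
   fix x
   have "\<bar>w1 x\<bar> * \<bar>p (x + z)\<bar> \<le> (indicat_real L x * M) * C"
    using w1M[of x] C(4)[of "x + z"] by (intro mult_mono) auto
   then have "norm (w1 x * p (x + z)) \<le> indicat_real L x * (M * C)"
    by (simp add: abs_mult mult.assoc)
   then show "norm (w1 x * p (x + z)) \<le> norm (indicat_real L x * (M * C))"
    by (rule order_trans) simp
  qed
 qed simp
 have L1: "(\<lambda>n. LINT x|lborel. w1 x * ((p (x + j n *R e) - p x) / j n))
   ----> (LINT x|lborel. w1 x * dderiv e p x)"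
 proof (rule integral_dominated_convergence[where w = "\<lambda>x. indicat_real L x * (M * C)"])
  show "(\<lambda>x. w1 x * dderiv e p x) \<in> borel_measurable lborel"
   using borel_measurable_continuous_onI[OF smooth_on_UNIV_imp_deriv_continuous[OF s, of e]] by measurable
  show "AE x in lborel. (\<lambda>n. w1 x * ((p (x + j n *R e) - p x) / j n)) ----> w1 x * dderiv e p x"
  proof (intro AE_I2 tendsto_mult[OF tendsto_const])
   fix x
   have "((\<lambda>h. (p (x + h *R e) - p x) / h) \<longlongrightarrow> dderiv e p x) (at 0)"
    using smooth_line_derivative[OF s, of x e 0] by (simp add: has_field_derivative_iff)
   then show "(\<lambda>n. (p (x + j n *R e) - p x) / j n) ----> dderiv e p x"
    by (rule filterlim_compose[OF _ s0])
  qed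
  show "AE x in lborel. norm (w1 x * ((p (x + j n *R e) - p x) / j n)) \<le> indicat_real L x * (M * C)" for n
  proof (intro AE_I2)
   fix x
   have "\<bar>(p (x + j n *R e) - p x) / j n\<bar> \<le> C"
    using C(3)[of x "j n"] jpos[of n] by (simp add: abs_divide divide_le_eq)
   with w1M[of x] have "\<bar>w1 x\<bar> * \<bar>(p (x + j n *R e) - p x) / j n\<bar> \<le> (indicat_real L x * M) * C"
    by (intro mult_mono) auto
   then show "norm (w1 x * ((p (x + j n *R e) - p x) / j n)) \<le> indicat_real L x * (M * C)"
    by (simp add: abs_mult mult.assoc)
  qed
 qed (use iL in simp_all)
 \<comment> \<open>Summation by parts: a translation moves the increment from p to w1 and reverses
   the step, which explains the quotients with step - j n.\<close>
 have eq: "(LINT x|lborel. w1 x * ((p (x + j n *R e) - p x) / j n))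
   = - (LINT x|lborel. ((w1 (x + (- j n) *R e) - w1 x) / (- j n)) * p x)" for n
 proof -
  have "(LINT x|lborel. w1 x * ((p (x + j n *R e) - p x) / j n))
    = ((LINT x|lborel. w1 x * p (x + j n *R e)) - (LINT x|lborel. w1 x * p (x + 0))) / j n"
  proof -
   have "(LINT x|lborel. w1 x * p (x + j n *R e)) - (LINT x|lborel. w1 x * p (x + 0))
     = (LINT x|lborel. w1 x * p (x + j n *R e) - w1 x * p (x + 0))"
    by (rule Bochner_Integration.integral_diff[symmetric]) (rule iwp)+
   then show ?thesis
    by (simp only: integral_divide_zero[symmetric]) (simp add: right_diff_distrib)
  qed
  also have "(LINT x|lborel. w1 x * p (x + j n *R e)) = (LINT x|lborel. w1 (x + (- j n) *R e) * p x)"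
   using lborel_shift(1)[of "\<lambda>x. w1 x * p (x + j n *R e)" "(- j n) *R e"] by simp
  also have "((LINT x|lborel. w1 (x + (- j n) *R e) * p x) - (LINT x|lborel. w1 x * p (x + 0))) / j n
   = (LINT x|lborel. (w1 (x + (- j n) *R e) - w1 x) / j n * p x)"
  proof -
   have "(LINT x|lborel. w1 (x + (- j n) *R e) * p x) - (LINT x|lborel. w1 x * p (x + 0))
     = (LINT x|lborel. w1 (x + (- j n) *R e) * p x - w1 x * p (x + 0))"
   proof (rule Bochner_Integration.integral_diff[symmetric])
    show "integrable lborel (\<lambda>x. w1 (x + (- j n) *R e) * p x)"
     using iwp[of "j n *R e"] lborel_shift(2)[of "\<lambda>x. w1 x * p (x + j n *R e)" "(- j n) *R e"]
     by simp
   qed (rule iwp)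
   then show ?thesis
    by (simp only: integral_divide_zero[symmetric]) (simp add: left_diff_distrib)
  qed
  finally show ?thesis by simp
 qed
 have L2: "(\<lambda>n. LINT x|lborel. ((w1 (x + (- j n) *R e) - w1 x) / (- j n)) * p x) ----> (LINT x|lborel. k x * p x)"
 proof (rule integral_dominated_convergence[where w = "\<lambda>x. indicat_real K x * (\<Lambda> * C)"])
  have inL: "x \<in> L" "x + (- j n) *R e \<in> L" if "x \<in> K" for x n
   using that KL d jle(1)[of n] by (auto simp: L dist_norm intro!: bexI[of _ x])
  show "AE x in lborel. (\<lambda>n. ((w1 (x + (- j n) *R e) - w1 x) / (- j n)) * p x) ----> k x * p x"
   using der
  proof eventually_elim
   case (elim x)
   show ?case
   proof (cases "x \<in> K")
    case True
    have "((\<lambda>h. (w (x + h *R e) - w x) / h) \<longlongrightarrow> k x) (at 0)"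
     using elim True by (simp add: has_field_derivative_iff)
    then have "(\<lambda>n. (w (x + (- j n) *R e) - w x) / (- j n)) ----> k x"
     by (rule filterlim_compose[OF _ s0'])
    then show ?thesis using inL[OF True] by (intro tendsto_mult[OF _ tendsto_const]) (simp add: w1_def)
   qed (simp add: K)
  qed
  show "AE x in lborel. norm (((w1 (x + (- j n) *R e) - w1 x) / (- j n)) * p x) \<le> indicat_real K x * (\<Lambda> * C)" for n
  proof (intro AE_I2)
   fix x
   show "norm (((w1 (x + (- j n) *R e) - w1 x) / (- j n)) * p x) \<le> indicat_real K x * (\<Lambda> * C)"
   proof (cases "x \<in> K")
    case True
    have "\<bar>w1 (x + (- j n) *R e) - w1 x\<bar> \<le> \<Lambda> * j n"
     using lip[OF True jle(2)[of n]] jpos[of n] inL[OF True] by (simp add: w1_def)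
    then have q: "\<bar>(w1 (x + (- j n) *R e) - w1 x) / (- j n)\<bar> \<le> \<Lambda>"
     using jpos[of n] by (simp add: abs_divide divide_le_eq)
    then have "\<bar>(w1 (x + (- j n) *R e) - w1 x) / (- j n)\<bar> * \<bar>p x\<bar> \<le> \<Lambda> * C"
     using C(4)[of x] abs_ge_zero order_trans[OF abs_ge_zero q] by (intro mult_mono) auto
    then show ?thesis using True by (simp add: abs_mult)
   qed (simp add: K)
  qed
 qed (use iK in simp_all)
 have "(\<lambda>n. - (LINT x|lborel. ((w1 (x + (- j n) *R e) - w1 x) / (- j n)) * p x)) ----> - (LINT x|lborel. k x * p x)"
  by (rule tendsto_minus[OF L2])
 then have "(LINT x|lborel. w1 x * dderiv e p x) = - (LINT x|lborel. k x * p x)"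
  by (rule LIMSEQ_unique[OF L1[unfolded eq]])
 moreover have "w1 x * dderiv e p x = w x * dderiv e p x" for x
  using smooth_deriv_zero[OF compact_imp_closed[OF K(1)] K(2)] KL by (cases "x \<in> K") (auto simp: w1_def)
 ultimately show ?thesis by simp
qed

text \<open>Differentiation under the integral, dominated by |f| times a Lipschitz constant of the
  mollifier along e. The second claim is the Lipschitz bound that
  \<open>difference_quotient_by_parts\<close> asks of its factor w.\<close>

lemma mollify_line_derivative:
 fixes f \<eta> :: "'a::euclidean_space => real"
 assumes f: "integrable lborel f" and \<eta>: "mollifier \<epsilon> \<eta>"
 shows "((\<lambda>s. mollify \<eta> f (x + s *R e)) has_real_derivative
   (LINT y|lborel. f y * dderiv e \<eta> (x - y))) (at 0)"
  and "\<exists>\<Lambda>. \<forall>x s. \<bar>mollify \<eta> f (x + s *R e) - mollify \<eta> f x\<bar> \<le> \<Lambda> * \<bar>s\<bar>"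
proof -
 have [measurable]: "f \<in> Borel" using f by (auto dest: borel_measurable_integrable)
 note [measurable] = mollifier_borel[OF \<eta>]
 have s: "smooth_on UNIV \<eta>" using \<eta> by (simp add: mollifier_def)
 note [measurable] = borel_measurable_continuous_onI[OF smooth_on_UNIV_imp_deriv_continuous[OF s, of e]]
 obtain C where C: "C \<ge> 0" "!!x s. \<bar>\<eta> (x + s *R e) - \<eta> x\<bar> \<le> C * \<bar>s\<bar>"
  using smooth_compact_Lipschitz[OF s compact_cball[of 0 \<epsilon>], of e] \<eta> unfolding mollifier_def
  by (metis linear mem_cball_0)
 have diff: "mollify \<eta> f (x + s *R e) - mollify \<eta> f x
   = (LINT y|lborel. f y * (\<eta> (x - y + s *R e) - \<eta> (x - y)))" for x s
  unfolding mollify_def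
  by (subst Bochner_Integration.integral_diff[symmetric])
   (auto simp: right_diff_distrib diff_add_eq intro!: mollify_integrand_integrable(1)[OF f \<eta>])
 have le: "\<bar>f y * (\<eta> (x - y + s *R e) - \<eta> (x - y))\<bar> \<le> \<bar>f y\<bar> * C * \<bar>s\<bar>" for x y s
  using mult_left_mono[OF C(2)[of "x - y" s], of "\<bar>f y\<bar>"] by (simp add: abs_mult mult_ac)
 have "\<bar>mollify \<eta> f (x + s *R e) - mollify \<eta> f x\<bar> \<le> (LINT y|lborel. \<bar>f y\<bar> * C) * \<bar>s\<bar>" for x s
 proof -
  have "\<bar>mollify \<eta> f (x + s *R e) - mollify \<eta> f x\<bar> \<le> (LINT y|lborel. \<bar>f y * (\<eta> (x - y + s *R e) - \<eta> (x - y))\<bar>)"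
   unfolding diff by (rule integral_abs_bound)
  also have "\<dots> \<le> (LINT y|lborel. \<bar>f y\<bar> * C * \<bar>s\<bar>)"
   using f le[of _ x s] C by (intro integral_mono') auto
  finally show ?thesis by simp
 qed
 then show "\<exists>\<Lambda>. \<forall>x s. \<bar>mollify \<eta> f (x + s *R e) - mollify \<eta> f x\<bar> \<le> \<Lambda> * \<bar>s\<bar>" by blast
 show "((\<lambda>s. mollify \<eta> f (x + s *R e)) has_real_derivative
   (LINT y|lborel. f y * dderiv e \<eta> (x - y))) (at 0)"
  unfolding has_field_derivative_iff tendsto_at_iff_sequentially
 proof (intro allI impI)
  fix X :: "nat => real" assume X: "\<forall>i. X i \<in> UNIV - {0}" "X ----> 0"
  have "(\<lambda>n. LINT y|lborel. f y * ((\<eta> (x - y + X n *R e) - \<eta> (x - y)) / X n))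
   ----> (LINT y|lborel. f y * dderiv e \<eta> (x - y))"
  proof (rule integral_dominated_convergence[where w = "\<lambda>y. \<bar>f y\<bar> * C"])
   show "AE y in lborel. (\<lambda>n. f y * ((\<eta> (x - y + X n *R e) - \<eta> (x - y)) / X n))
     ----> f y * dderiv e \<eta> (x - y)"
   proof (intro AE_I2 tendsto_mult[OF tendsto_const])
    fix y
    have "((\<lambda>h. (\<eta> (x - y + h *R e) - \<eta> (x - y)) / h) \<longlongrightarrow> dderiv e \<eta> (x - y)) (at 0)"
     using smooth_line_derivative[OF s, of "x - y" e 0] by (simp add: has_field_derivative_iff)
    then show "(\<lambda>n. (\<eta> (x - y + X n *R e) - \<eta> (x - y)) / X n) ----> dderiv e \<eta> (x - y)"
     unfolding tendsto_at_iff_sequentially using X by (auto simp: o_def)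
   qed
   show "AE y in lborel. norm (f y * ((\<eta> (x - y + X n *R e) - \<eta> (x - y)) / X n)) \<le> \<bar>f y\<bar> * C" for n
    using le[of _ x "X n"] X(1) by (intro AE_I2) (auto simp: abs_divide abs_mult divide_le_eq)
  qed (use f in auto)
  then show "((\<lambda>xa. (mollify \<eta> f (x + xa *R e) - mollify \<eta> f (x + 0 *R e)) / (xa - 0)) \<circ> X)
    ----> (LINT y|lborel. f y * dderiv e \<eta> (x - y))"
   using diff by (simp add: o_def)
 qed
qed

text \<open>The derivative of the mollified function falls on the mollifier, and the weak derivative
  takes it back. The sign from differentiating \<eta>(x - y) in y cancels the one in the definition
  of the weak derivative.\<close>

lemma mollify_weak_derivative:
 fixes u h :: "'a::euclidean_space => real"
 assumes wd: "weak_derivative_on W e u h" and \<eta>: "mollifier \<epsilon> \<eta>" and x: "cball x \<epsilon> \<subseteq> L" "L \<subseteq> W"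
 shows "(LINT y|lborel. (indicator L y * u y) * dderiv e \<eta> (x - y))
   = mollify \<eta> (\<lambda>y. indicator L y * h y) x"
proof -
 have s: "smooth_on UNIV \<eta>" using \<eta> by (simp add: mollifier_def)
 have out: "\<eta> (x - y) = 0" if "y \<notin> L" for y
  using \<eta> that x by (metis dist_norm linear mem_cball mollifier_def subsetD)
 have fd: "frechet_derivative (\<lambda>y. \<eta> (x - y)) (at y) e = - dderiv e \<eta> (x - y)" for y
 proof -
  have d: "(\<eta> has_derivative frechet_derivative \<eta> (at (x - y))) (at (x - y))"
   using smooth_on_UNIV_imp_differentiable[OF s] frechet_derivative_works by blast
  have "((\<lambda>y. x - y) has_derivative (\<lambda>v. - v)) (at y)" by (auto intro!: derivative_eq_intros)
  from has_derivative_compose[OF this d]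
  have "frechet_derivative (\<lambda>y. \<eta> (x - y)) (at y) = (\<lambda>v. frechet_derivative \<eta> (at (x - y)) (- v))"
   using frechet_derivative_at by metis
  then show ?thesis using linear_neg[OF has_derivative_linear[OF d]] by simp
 qed
 have out': "dderiv e \<eta> (x - y) = 0" if "y \<notin> L" for y
 proof -
  have "x - y \<notin> cball 0 \<epsilon>" using that x by (auto simp: dist_norm subset_iff norm_minus_commute)
  then show ?thesis using \<eta> by (intro smooth_deriv_zero[of "cball 0 \<epsilon>"]) (auto simp: mollifier_def)
 qed
 have "(LINT y:W|lborel. u y * frechet_derivative (\<lambda>y. \<eta> (x - y)) (at y) e) = - (LINT y:W|lborel. h y * \<eta> (x - y))"
  using wd test_function_mollifier[OF \<eta>, of x W] x unfolding weak_derivative_on_def by blast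
 moreover have "(LINT y:W|lborel. u y * frechet_derivative (\<lambda>y. \<eta> (x - y)) (at y) e)
   = - (LINT y|lborel. (indicator L y * u y) * dderiv e \<eta> (x - y))"
  unfolding set_lebesgue_integral_def fd
  by (subst Bochner_Integration.integral_minus[symmetric])
   (use x(2) out' in \<open>auto simp: indicator_def intro!: Bochner_Integration.integral_cong\<close>)
 moreover have "(LINT y:W|lborel. h y * \<eta> (x - y)) = mollify \<eta> (\<lambda>y. indicator L y * h y) x"
  unfolding set_lebesgue_integral_def mollify_def
  using x(2) out by (auto simp: indicator_def intro!: Bochner_Integration.integral_cong)
 ultimately show ?thesis by simp
qed

text \<open>\<open>local_lipschitz\<close> carries a time parameter, here the dummy set
  \<open>{0}\<close>. On a compact set the local constants combine into one.\<close>

lemma locally_Lipschitz_line: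
 fixes B :: "'a::euclidean_space => real"
 assumes lip: "local_lipschitz {0::real} W (\<lambda>_. B)" and L: "compact L" "L \<subseteq> W"
 obtains \<Lambda> M where "\<Lambda> \<ge> 0" "!!x y. x \<in> L ==> y \<in> L ==> \<bar>B y - B x\<bar> \<le> \<Lambda> * norm (y - x)"
  "!!x. x \<in> L ==> \<bar>B x\<bar> \<le> M"
proof -
 have lipL: "local_lipschitz {0::real} L (\<lambda>_. B)" by (rule local_lipschitz_subset[OF lip]) (use L in auto)
 obtain \<Lambda> where \<Lambda>: "\<Lambda>-lipschitz_on L B"
  using local_lipschitz_compact_implies_lipschitz[OF lipL L(1), of thesis] by (auto simp: continuous_on_sing)
 have "bounded (B ` L)"
  using lipschitz_on_continuous_on[OF \<Lambda>] L(1) by (intro compact_imp_bounded compact_continuous_image)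
 then obtain M where "\<forall>x\<in>L. \<bar>B x\<bar> \<le> M" by (auto simp: bounded_iff)
 then show ?thesis
  using \<Lambda> that[of \<Lambda> M] by (auto simp: lipschitz_on_def dist_norm dist_real_def)
qed

lemma integrable_bounded_mult:
 fixes z F :: "'a => real"
 assumes z: "integrable M z" and F: "F \<in> borel_measurable M" and le: "!!x. \<bar>F x\<bar> \<le> C"
 shows "integrable M (\<lambda>x. F x * z x)"
proof (rule Bochner_Integration.integrable_bound[OF integrable_mult_right[OF z, of C]])
 show "(\<lambda>x. F x * z x) \<in> borel_measurable M" using F borel_measurable_integrable[OF z] by measurable
 have "\<bar>F x\<bar> \<le> \<bar>C\<bar>" for x using le[of x] by linarith
 then show "AE x in M. norm (F x * z x) \<le> norm (C * z x)" by (intro AE_I2) (simp add: abs_mult mult_right_mono)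
qed

text \<open>The chain and product rule for \<open>f(u) B\<close>: mollify \<open>u\<close>, so that \<open>f(u) B\<close> becomes Lipschitz along
 \<open>e\<close>, and pass to the limit along an almost everywhere convergent subsequence.\<close>

lemma weak_derivative_chain_product:
 fixes u h B b :: "'a::euclidean_space => real" and f f' :: "real => real"
 assumes W: "open W" and wd: "weak_derivative_on W e u h"
  and f: "!!t. (f has_real_derivative f' t) (at t)" "continuous_on UNIV f'"
  and fb: "!!t. \<bar>f t\<bar> \<le> C" "!!t. \<bar>f' t\<bar> \<le> C"
  and B: "local_lipschitz {0::real} W (\<lambda>_. B)"
  and b: "(\<lambda>x. indicator W x * b x) \<in> Borel"
  and bb: "!!K. compact K ==> K \<subseteq> W ==> \<exists>M. \<forall>x\<in>K. \<bar>b x\<bar> \<le> M"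
  and der: "AE x in lborel. x \<in> W --> ((\<lambda>s. B (x + s *R e)) has_real_derivative b x) (at 0)"
 shows "weak_derivative_on W e (\<lambda>x. f (u x) * B x) (\<lambda>x. f' (u x) * h x * B x + f (u x) * b x)"
proof -
 have C0: "C \<ge> 0" using fb(1)[of 0] by linarith
 have Bc: "continuous_on W B" using local_lipschitz_continuous_on[OF B, of 0] by simp
 have fm[measurable]: "f \<in> Borel" "f' \<in> Borel"
 proof -
  have "continuous_on UNIV f" using f(1) DERIV_isCont continuous_at_imp_continuous_on by blast
  then show "f \<in> Borel" "f' \<in> Borel"
   using f(2) by (auto intro: borel_measurable_continuous_onI)
 qed
 have meas: "(\<lambda>x. indicator L x * u x) \<in> Borel" "integrable lborel (\<lambda>x. indicator L x * u x)"
  "(\<lambda>x. indicator L x * h x) \<in> Borel" "integrable lborel (\<lambda>x. indicator L x * h x)"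
  "(\<lambda>x. indicator L x * B x) \<in> Borel" "(\<lambda>x. indicator L x * b x) \<in> Borel"
  if L: "compact L" "L \<subseteq> W" for L
 proof -
  show i: "integrable lborel (\<lambda>x. indicator L x * u x)" "integrable lborel (\<lambda>x. indicator L x * h x)"
   using wd L unfolding weak_derivative_on_def locally_integrable_on_def set_integrable_def by auto
  then show "(\<lambda>x. indicator L x * u x) \<in> Borel" "(\<lambda>x. indicator L x * h x) \<in> Borel"
   by (auto dest: borel_measurable_integrable)
  have "(\<lambda>x. indicator L x *R B x) \<in> Borel"
   using L Bc by (intro borel_measurable_continuous_on_indicator) (auto simp: compact_imp_closed continuous_on_subset)
  then show "(\<lambda>x. indicator L x * B x) \<in> Borel" by simp
  have [measurable]: "L \<in> sets borel" using L by (simp add: compact_imp_closed)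
  have "(\<lambda>x. indicator L x * (indicator W x * b x)) = (\<lambda>x. indicator L x * b x)"
   using L by (auto simp: indicator_def fun_eq_iff)
  moreover have "(\<lambda>x. indicator L x * (indicator W x * b x)) \<in> Borel"
   using b by measurable
  ultimately show "(\<lambda>x. indicator L x * b x) \<in> Borel" by simp
 qed
 have loc1: "locally_integrable_on W (\<lambda>x. f (u x) * B x)"
  and loc2: "locally_integrable_on W (\<lambda>x. f' (u x) * h x * B x + f (u x) * b x)"
  unfolding locally_integrable_on_def set_integrable_def
 proof (safe)
  fix K :: "'a set" assume K: "compact K" "K \<subseteq> W"
  note m[measurable] = meas(1,3,5,6)[OF K]
  have [measurable]: "K \<in> sets borel" using K by (simp add: compact_imp_closed)
  obtain M where M: "!!x. x \<in> K ==> \<bar>B x\<bar> \<le> M" using locally_Lipschitz_line[OF B K] by metis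
  obtain M' where M': "!!x. x \<in> K ==> \<bar>b x\<bar> \<le> M'" using bb[OF K] by blast
  have iK: "integrable lborel (\<lambda>x. indicat_real K x)"
   using K(1) emeasure_compact_finite by (auto intro!: integrable_real_indicator)
  have bd: "\<bar>y * (indicator K x * B x)\<bar> \<le> C * \<bar>M\<bar>" "\<bar>y * (indicator K x * b x)\<bar> \<le> C * \<bar>M'\<bar>" if "\<bar>y\<bar> \<le> C" for x y
   unfolding abs_mult[of y] using that C0 M[of x] M'[of x] by (auto simp: indicator_def intro!: mult_mono)
  \<comment> \<open>u and h are known to be measurable only after truncation to a compact set. The
    indicators are moved inside f and f' so that measurability becomes visible.\<close>
  have eq: "(\<lambda>x. indicator K x *R (f (u x) * B x)) = (\<lambda>x. (f (indicator K x * u x) * (indicator K x * B x)) * indicator K x)"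
   "(\<lambda>x. indicator K x *R (f' (u x) * h x * B x + f (u x) * b x))
    = (\<lambda>x. (f' (indicator K x * u x) * (indicator K x * B x)) * (indicator K x * h x) + (f (indicator K x * u x) * (indicator K x * b x)) * indicator K x)"
   by (auto simp: indicator_def fun_eq_iff)
  show "integrable lborel (\<lambda>x. indicator K x *R (f (u x) * B x))"
   unfolding eq by (rule integrable_bounded_mult[OF iK _ bd(1)[OF fb(1)]]) measurable
  show "integrable lborel (\<lambda>x. indicator K x *R (f' (u x) * h x * B x + f (u x) * b x))"
   unfolding eq
  proof (rule Bochner_Integration.integrable_add)
   show "integrable lborel (\<lambda>x. (f' (indicator K x * u x) * (indicator K x * B x)) * (indicator K x * h x))"
    by (rule integrable_bounded_mult[OF meas(4)[OF K] _ bd(1)[OF fb(2)]]) measurable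
   show "integrable lborel (\<lambda>x. (f (indicator K x * u x) * (indicator K x * b x)) * indicator K x)"
    by (rule integrable_bounded_mult[OF iK _ bd(2)[OF fb(1)]]) measurable
  qed
 qed
 have "(LINT x:W|lborel. f (u x) * B x * dderiv e p x)
   = - (LINT x:W|lborel. (f' (u x) * h x * B x + f (u x) * b x) * p x)" if t: "test_function W p" for p
 proof -
  obtain K where s: "smooth_on UNIV p" and K: "compact K" "K \<subseteq> W" "!!x. x \<notin> K ==> p x = 0"
   using t unfolding test_function_def by blast
  obtain \<delta> where \<delta>: "\<delta> > 0" "(\<Union>x\<in>K. cball x \<delta>) \<subseteq> W"
   using compact_subset_open_imp_cball_epsilon_subset[OF K(1) W K(2)] by blast
  \<comment> \<open>Two nested neighbourhoods: L1 leaves room for the difference quotients on K, and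
    a ball of radius d around a point of L1 still lies in L, so that mollification commutes with the
    weak derivative there.\<close>
  define L where "L = (\<Union>x\<in>K. cball x \<delta>)"
  define d where "d = \<delta> / 2"
  define L1 where "L1 = (\<Union>x\<in>K. cball x d)"
  have d: "d > 0" using \<delta> by (simp add: d_def)
  have L: "compact L" "L \<subseteq> W" and L1: "compact L1" "L1 \<subseteq> L" and KL1: "K \<subseteq> L1"
   using \<delta> compact_minkowski_sum_cball[OF K(1)] by (auto simp: L_def L1_def d_def)
  have L1L: "cball x d \<subseteq> L" if "x \<in> L1" for x
  proof -
   obtain x' where x': "x' \<in> K" "dist x' x \<le> d" using \<open>x \<in> L1\<close> by (auto simp: L1_def)
   have "cball x d \<subseteq> cball x' \<delta>"
   proof
    fix y assume "y \<in> cball x d"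
    then show "y \<in> cball x' \<delta>" using x' dist_triangle[of x' y x] by (simp add: d_def)
   qed
   then show ?thesis using x' by (auto simp: L_def)
  qed
  define u1 where "u1 = (\<lambda>x. indicator L x * u x)"
  define h1 where "h1 = (\<lambda>x. indicator L x * h x)"
  note m[measurable] = meas(1,3,5,6)[OF L]
  have u1: "integrable lborel u1" and h1: "integrable lborel h1"
   using meas(2,4)[OF L] by (auto simp: u1_def h1_def)
  have [measurable]: "u1 \<in> Borel" "h1 \<in> Borel"
   using meas(1,3)[OF L] by (auto simp: u1_def h1_def)
  have [measurable]: "L \<in> sets borel" "L1 \<in> sets borel" "K \<in> sets borel"
   using L L1 K by (auto simp: compact_imp_closed)
  have [measurable]: "p \<in> Borel"
   using smooth_on_UNIV_imp_continuous[OF s] by (rule borel_measurable_continuous_onI)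
  note dmeas[measurable] = borel_measurable_continuous_onI[OF smooth_on_UNIV_imp_deriv_continuous[OF s, of e]]
  obtain \<Lambda> M where \<Lambda>: "\<Lambda> \<ge> 0" "!!x y. x \<in> L ==> y \<in> L ==> \<bar>B y - B x\<bar> \<le> \<Lambda> * norm (y - x)"
   and M: "!!x. x \<in> L ==> \<bar>B x\<bar> \<le> M" using locally_Lipschitz_line[OF B L] by metis
  obtain M' where M': "!!x. x \<in> L ==> \<bar>b x\<bar> \<le> M'" using bb[OF L] by blast
  obtain Cp where Cp: "Cp \<ge> 0" "!!x. \<bar>dderiv e p x\<bar> \<le> Cp" "!!x. \<bar>p x\<bar> \<le> Cp"
   using smooth_compact_Lipschitz[OF s K(1,3)] by metis
  have "\<exists>\<eta>. \<forall>n::nat. mollifier (d / (real n + 1)) (\<eta> n :: 'a => real)"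
   using d by (intro choice allI mollifier_ex) (simp add: field_simps)
  then obtain \<eta> :: "nat => 'a => real" where \<eta>: "!!n. mollifier (d / (real n + 1)) (\<eta> n)" by blast
  have d0: "(\<lambda>n. d / (real n + 1)) ----> 0"
   using tendsto_mult[OF tendsto_const[of d] LIMSEQ_inverse_real_of_nat]
   by (simp add: divide_inverse add.commute)
  define U where "U n = mollify (\<eta> n) u1" for n
  define H where "H n = mollify (\<eta> n) h1" for n
  have Um[measurable]: "U n \<in> Borel" and Hm[measurable]: "H n \<in> Borel"
   and Hi: "integrable lborel (H n)" for n
   using mollify_integrable[OF u1 \<eta>] mollify_integrable[OF h1 \<eta>]
   by (auto simp: U_def H_def dest: borel_measurable_integrable)
  have Uder: "((\<lambda>s. U n (x + s *R e)) has_real_derivative H n x) (at 0)" if "x \<in> L1" for n x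
  proof -
   have "cball x (d / (real n + 1)) \<subseteq> cball x d" using d by (intro subset_cball) (simp add: field_simps)
   then have "(LINT y|lborel. u1 y * dderiv e (\<eta> n) (x - y)) = H n x"
    unfolding u1_def H_def h1_def using L1L[OF that] L(2)
    by (intro mollify_weak_derivative[OF wd \<eta>]) auto
   then show ?thesis using mollify_line_derivative(1)[OF u1 \<eta>, of n x e] by (simp add: U_def)
  qed
  define w where "w n x = f (U n x) * B x" for n x
  define k where "k n x = f' (U n x) * H n x * B x + f (U n x) * b x" for n x
  have psiK: "p x = indicat_real K x * p x" for x using K(3) by (auto simp: indicator_def)
  have by_parts: "(LINT x|lborel. w n x * dderiv e p x) = - (LINT x|lborel. k n x * p x)" for n
  proof -
   obtain \<Lambda>' where \<Lambda>': "!!x s. \<bar>U n (x + s *R e) - U n x\<bar> \<le> \<Lambda>' * \<bar>s\<bar>"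
    using mollify_line_derivative(2)[OF u1 \<eta>, of n e] unfolding U_def by blast
   show ?thesis
   \<comment> \<open>Along e, f(U n) has the Lipschitz constant C \<Lambda>' and B has \<Lambda>
     |e|; the product rule for differences combines them with the bounds M and C.\<close>
   proof (rule difference_quotient_by_parts[OF s K(1,3) d L1_def, where M = "C * M" and \<Lambda> = "C * \<Lambda>' * M + C * (\<Lambda> * norm e)"])
    have "(\<lambda>x. indicator L1 x * w n x) = (\<lambda>x. indicator L1 x * (f (U n x) * (indicator L x * B x)))"
     using L1 by (auto simp: w_def indicator_def fun_eq_iff)
    then show "(\<lambda>x. indicator L1 x * w n x) \<in> Borel" by simp
    have "(\<lambda>x. k n x * p x) = (\<lambda>x. (f' (U n x) * H n x * (indicator L x * B x) + f (U n x) * (indicator L x * b x)) * p x)"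
     using L1 KL1 K(3) by (auto simp: k_def indicator_def fun_eq_iff)
    then show "(\<lambda>x. k n x * p x) \<in> Borel" by simp
    show "\<bar>w n x\<bar> \<le> C * M" if "x \<in> L1" for x
     using that L1 M[of x] fb(1)[of "U n x"] C0 by (auto simp: w_def abs_mult intro!: mult_mono)
    show "\<bar>w n (x + s *R e) - w n x\<bar> \<le> (C * \<Lambda>' * M + C * (\<Lambda> * norm e)) * \<bar>s\<bar>"
     if x: "x \<in> K" "norm (s *R e) \<le> d" for x s
    proof -
     have in_L: "x \<in> L" "x + s *R e \<in> L"
      using x L1 KL1 d by (auto simp: L_def d_def dist_norm intro!: bexI[of _ x])
     have 1: "\<bar>f (U n (x + s *R e)) - f (U n x)\<bar> \<le> C * (\<Lambda>' * \<bar>s\<bar>)"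
     proof -
      have "norm (f (U n (x + s *R e)) - f (U n x)) \<le> C * norm (U n (x + s *R e) - U n x)"
       by (rule field_differentiable_bound[of UNIV f f']) (use f(1) fb(2) in auto)
      also have "\<dots> \<le> C * (\<Lambda>' * \<bar>s\<bar>)" using \<Lambda>'[of x s] C0 by (intro mult_left_mono) auto
      finally show ?thesis by simp
     qed
     have 2: "\<bar>B (x + s *R e) - B x\<bar> \<le> \<Lambda> * (\<bar>s\<bar> * norm e)" using \<Lambda>(2)[OF in_L] by simp
     have "w n (x + s *R e) - w n x = (f (U n (x + s *R e)) - f (U n x)) * B x
       + f (U n (x + s *R e)) * (B (x + s *R e) - B x)" by (simp add: w_def algebra_simps)
     then have "\<bar>w n (x + s *R e) - w n x\<bar> \<le> \<bar>f (U n (x + s *R e)) - f (U n x)\<bar> * \<bar>B x\<bar>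
       + \<bar>f (U n (x + s *R e))\<bar> * \<bar>B (x + s *R e) - B x\<bar>"
      by (metis abs_mult abs_triangle_ineq)
     also have "\<dots> \<le> (C * (\<Lambda>' * \<bar>s\<bar>)) * M + C * (\<Lambda> * (\<bar>s\<bar> * norm e))"
      using 1 2 M[OF in_L(1)] fb(1)[of "U n (x + s *R e)"] C0 order_trans[OF abs_ge_zero 1]
      by (intro add_mono mult_mono) auto
     finally show ?thesis by (simp add: algebra_simps)
    qed
    show "AE x in lborel. x \<in> K --> ((\<lambda>s. w n (x + s *R e)) has_real_derivative k n x) (at 0)"
     using der
    proof eventually_elim
     case (elim x)
     show ?case
     proof
      assume x: "x \<in> K"
      have "((\<lambda>s. f (U n (x + s *R e))) has_real_derivative f' (U n x) * H n x) (at 0)"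
       using DERIV_chain2[OF f(1)[of "U n (x + 0 *R e)"] Uder[of x n]] x KL1 by auto
      from DERIV_mult[OF this, of "\<lambda>s. B (x + s *R e)" "b x"]
      show "((\<lambda>s. w n (x + s *R e)) has_real_derivative k n x) (at 0)"
       using elim x K(2) by (auto simp: w_def k_def mult_ac)
     qed
    qed
   qed
  qed
  obtain r :: "nat => nat" where r: "strict_mono r" "AE x in lborel. (\<lambda>n. U (r n) x - u1 x) ----> 0"
   using tendsto_L1_AE_subseq[of lborel "\<lambda>n x. U n x - u1 x"] mollify_L1_tendsto[OF u1 \<eta> d0]
    mollify_integrable[OF u1 \<eta>] u1 by (auto simp: U_def)
  have Uae: "AE x in lborel. (\<lambda>n. U (r n) x) ----> u1 x"
   using r(2) by eventually_elim (simp add: LIM_zero_iff)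
  have HL: "(\<lambda>n. LINT x|lborel. \<bar>H (r n) x - h1 x\<bar>) ----> 0"
   using LIMSEQ_subseq_LIMSEQ[OF mollify_L1_tendsto[OF h1 \<eta> d0] r(1)] by (simp add: o_def H_def)
  have fcont: "isCont f t" "isCont f' t" for t
   using DERIV_isCont[OF f(1)] f(2) by (blast, simp add: continuous_on_eq_continuous_at)
  have iL: "integrable lborel (\<lambda>x. indicat_real L x * c)" for c
   using L(1) emeasure_compact_finite by (auto intro!: integrable_mult_left integrable_real_indicator)
  define B1 where "B1 x = indicator L x * B x" for x
  define b1 where "b1 x = indicator L x * b x" for x
  have [measurable]: "B1 \<in> Borel" "b1 \<in> Borel"
   using m by (auto simp: B1_def[abs_def] b1_def[abs_def])
  have B1M: "\<bar>B1 x\<bar> \<le> \<bar>M\<bar>" "\<bar>B1 x\<bar> \<le> indicat_real L x * \<bar>M\<bar>" "\<bar>b1 x\<bar> \<le> indicat_real L x * \<bar>M'\<bar>" for x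
   using M[of x] M'[of x] by (auto simp: B1_def b1_def indicator_def)
  have lim1: "(\<lambda>n. LINT x|lborel. f (U (r n) x) * B1 x * dderiv e p x)
    ----> (LINT x|lborel. f (u1 x) * B1 x * dderiv e p x)"
  proof (rule integral_dominated_convergence[where w = "\<lambda>x. indicat_real L x * (C * \<bar>M\<bar> * Cp)"])
   show "AE x in lborel. (\<lambda>n. f (U (r n) x) * B1 x * dderiv e p x)
     ----> f (u1 x) * B1 x * dderiv e p x"
    using Uae by eventually_elim (intro tendsto_mult tendsto_const isCont_tendsto_compose[OF fcont(1)])
   show "AE x in lborel. norm (f (U (r n) x) * B1 x * dderiv e p x) \<le> indicat_real L x * (C * \<bar>M\<bar> * Cp)" for n
   proof (intro AE_I2)
    fix x
    have "\<bar>f (U (r n) x)\<bar> * \<bar>B1 x\<bar> * \<bar>dderiv e p x\<bar> \<le> C * (indicat_real L x * \<bar>M\<bar>) * Cp"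
     using fb B1M Cp C0 by (intro mult_mono) auto
    then show "norm (f (U (r n) x) * B1 x * dderiv e p x) \<le> indicat_real L x * (C * \<bar>M\<bar> * Cp)"
     by (simp add: abs_mult mult_ac)
   qed
  qed (use iL in simp_all)
  have bound2: "norm (f t * b1 x * p x) \<le> indicat_real L x * (C * \<bar>M'\<bar> * Cp)" for t x
  proof -
   have "\<bar>f t\<bar> * \<bar>b1 x\<bar> * \<bar>p x\<bar> \<le> C * (indicat_real L x * \<bar>M'\<bar>) * Cp"
    using fb B1M Cp C0 by (intro mult_mono) auto
   then show ?thesis by (simp add: abs_mult mult_ac)
  qed
  have lim2: "(\<lambda>n. LINT x|lborel. f (U (r n) x) * b1 x * p x) ----> (LINT x|lborel. f (u1 x) * b1 x * p x)"
  proof (rule integral_dominated_convergence[where w = "\<lambda>x. indicat_real L x * (C * \<bar>M'\<bar> * Cp)"])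
   show "AE x in lborel. (\<lambda>n. f (U (r n) x) * b1 x * p x) ----> f (u1 x) * b1 x * p x"
    using Uae by eventually_elim (intro tendsto_mult tendsto_const isCont_tendsto_compose[OF fcont(1)])
  qed (use iL bound2 in simp_all)
  have i2: "integrable lborel (\<lambda>x. f (v x) * b1 x * p x)" if v[measurable]: "v \<in> Borel" for v
   by (rule Bochner_Integration.integrable_bound[OF iL[of "C * \<bar>M'\<bar> * Cp"]])
    (use order_trans[OF bound2 abs_ge_self] in simp_all)
  have bound3: "\<bar>f' t * z * B1 x * p x\<bar> \<le> \<bar>z\<bar> * (C * \<bar>M\<bar> * Cp)" for t z x
  proof -
   have "\<bar>f' t\<bar> * \<bar>B1 x\<bar> * \<bar>p x\<bar> \<le> C * \<bar>M\<bar> * Cp"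
    using fb B1M(1) Cp C0 by (intro mult_mono) auto
   from mult_left_mono[OF this, of "\<bar>z\<bar>"] show ?thesis by (simp add: abs_mult mult_ac)
  qed
  have i3: "integrable lborel (\<lambda>x. f' (v x) * z x * B1 x * p x)"
   if [measurable]: "v \<in> Borel" and z: "integrable lborel z" for v z
  proof (rule Bochner_Integration.integrable_bound[OF integrable_mult_left[OF integrable_abs[OF z], of "C * \<bar>M\<bar> * Cp"]])
   have [measurable]: "z \<in> Borel" using z by (auto dest: borel_measurable_integrable)
   show "(\<lambda>x. f' (v x) * z x * B1 x * p x) \<in> borel_measurable lborel" by measurable
   show "AE x in lborel. norm (f' (v x) * z x * B1 x * p x) \<le> norm (\<bar>z x\<bar> * (C * \<bar>M\<bar> * Cp))"
    using order_trans[OF bound3 abs_ge_self] by (intro AE_I2) simp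
  qed
  \<comment> \<open>The factor H converges only in L1 and comes with no integrable majorant. It is
    split into h1, to which dominated convergence applies, and H - h1, which is small in L1 while
    its coefficient stays bounded.\<close>
  have lim3a: "(\<lambda>n. LINT x|lborel. f' (U (r n) x) * h1 x * B1 x * p x) ----> (LINT x|lborel. f' (u1 x) * h1 x * B1 x * p x)"
  proof (rule integral_dominated_convergence[where w = "\<lambda>x. \<bar>h1 x\<bar> * (C * \<bar>M\<bar> * Cp)"])
   show "AE x in lborel. (\<lambda>n. f' (U (r n) x) * h1 x * B1 x * p x) ----> f' (u1 x) * h1 x * B1 x * p x"
    using Uae by eventually_elim (intro tendsto_mult tendsto_const isCont_tendsto_compose[OF fcont(2)])
  qed (use h1 bound3 in simp_all)
  have lim3b: "(\<lambda>n. LINT x|lborel. f' (U (r n) x) * (H (r n) x - h1 x) * B1 x * p x) ----> 0"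
  proof (rule Lim_null_comparison)
   have "(\<lambda>n. (LINT x|lborel. \<bar>H (r n) x - h1 x\<bar>) * (C * \<bar>M\<bar> * Cp)) ----> 0 * (C * \<bar>M\<bar> * Cp)"
    by (intro tendsto_mult HL tendsto_const)
   then show "(\<lambda>n. (LINT x|lborel. \<bar>H (r n) x - h1 x\<bar>) * (C * \<bar>M\<bar> * Cp)) ----> 0" by simp
   show "\<forall>\<^sub>F n in sequentially. norm (LINT x|lborel. f' (U (r n) x) * (H (r n) x - h1 x) * B1 x * p x)
     \<le> (LINT x|lborel. \<bar>H (r n) x - h1 x\<bar>) * (C * \<bar>M\<bar> * Cp)"
   proof (intro always_eventually allI)
    fix n
    have "\<bar>LINT x|lborel. f' (U (r n) x) * (H (r n) x - h1 x) * B1 x * p x\<bar>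
      \<le> (LINT x|lborel. \<bar>f' (U (r n) x) * (H (r n) x - h1 x) * B1 x * p x\<bar>)" by (rule integral_abs_bound)
    also have "\<dots> \<le> (LINT x|lborel. \<bar>H (r n) x - h1 x\<bar> * (C * \<bar>M\<bar> * Cp))"
     using bound3 Hi h1 C0 Cp(1) by (intro integral_mono') auto
    finally show "norm (LINT x|lborel. f' (U (r n) x) * (H (r n) x - h1 x) * B1 x * p x)
     \<le> (LINT x|lborel. \<bar>H (r n) x - h1 x\<bar>) * (C * \<bar>M\<bar> * Cp)" by simp
   qed
  qed
  have psiL: "p x = 0" if "x \<notin> L" for x using K(3) KL1 L1 that by blast
  note iA = i3[OF Um h1] and iB = i3[OF Um Bochner_Integration.integrable_diff[OF Hi h1]]
  have kint: "(LINT x|lborel. k (r n) x * p x)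
   = (LINT x|lborel. f' (U (r n) x) * h1 x * B1 x * p x) + (LINT x|lborel. f' (U (r n) x) * (H (r n) x - h1 x) * B1 x * p x)
    + (LINT x|lborel. f (U (r n) x) * b1 x * p x)" for n
  proof -
   have "(LINT x|lborel. k (r n) x * p x) = (LINT x|lborel. (f' (U (r n) x) * h1 x * B1 x * p x
     + f' (U (r n) x) * (H (r n) x - h1 x) * B1 x * p x) + f (U (r n) x) * b1 x * p x)"
    by (intro Bochner_Integration.integral_cong refl)
     (auto simp: k_def B1_def b1_def indicator_def algebra_simps psiL)
   also have "\<dots> = (LINT x|lborel. f' (U (r n) x) * h1 x * B1 x * p x + f' (U (r n) x) * (H (r n) x - h1 x) * B1 x * p x)
    + (LINT x|lborel. f (U (r n) x) * b1 x * p x)"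
    by (rule Bochner_Integration.integral_add[OF Bochner_Integration.integrable_add[OF iA iB] i2[OF Um]])
   also have "(LINT x|lborel. f' (U (r n) x) * h1 x * B1 x * p x + f' (U (r n) x) * (H (r n) x - h1 x) * B1 x * p x)
     = (LINT x|lborel. f' (U (r n) x) * h1 x * B1 x * p x) + (LINT x|lborel. f' (U (r n) x) * (H (r n) x - h1 x) * B1 x * p x)"
    by (rule Bochner_Integration.integral_add[OF iA iB])
   finally show ?thesis .
  qed
  have limk: "(\<lambda>n. - (LINT x|lborel. k (r n) x * p x)) ---->
    - ((LINT x|lborel. f' (u1 x) * h1 x * B1 x * p x) + 0 + (LINT x|lborel. f (u1 x) * b1 x * p x))"
   unfolding kint by (intro tendsto_minus tendsto_add lim3a lim3b lim2)
  have zd: "dderiv e p x = 0" if "x \<notin> K" for x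
   using smooth_deriv_zero[OF compact_imp_closed[OF K(1)] K(3) that] .
  have zdL: "dderiv e p x = 0" if "x \<notin> L" for x using zd KL1 L1 that by blast
  have wint: "(LINT x|lborel. w (r n) x * dderiv e p x)
    = (LINT x|lborel. f (U (r n) x) * B1 x * dderiv e p x)" for n
   by (intro Bochner_Integration.integral_cong refl) (auto simp: w_def B1_def indicator_def zdL)
  have "(LINT x|lborel. f (u1 x) * B1 x * dderiv e p x)
    = - ((LINT x|lborel. f' (u1 x) * h1 x * B1 x * p x) + 0 + (LINT x|lborel. f (u1 x) * b1 x * p x))"
   using LIMSEQ_unique[OF lim1 limk[folded by_parts, unfolded wint]] .
  also have "\<dots> = - (LINT x|lborel. f' (u1 x) * h1 x * B1 x * p x + f (u1 x) * b1 x * p x)"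
   using i2[OF \<open>u1 \<in> Borel\<close>]
   by (subst Bochner_Integration.integral_add[OF i3[OF \<open>u1 \<in> Borel\<close> h1]]) auto
  finally have main: "(LINT x|lborel. f (u1 x) * B1 x * dderiv e p x)
   = - (LINT x|lborel. f' (u1 x) * h1 x * B1 x * p x + f (u1 x) * b1 x * p x)" .
  have "(LINT x:W|lborel. f (u x) * B x * dderiv e p x)
   = (LINT x|lborel. f (u1 x) * B1 x * dderiv e p x)"
   unfolding set_lebesgue_integral_def using L(2)
   by (intro Bochner_Integration.integral_cong refl) (auto simp: u1_def B1_def indicator_def zdL)
  moreover have "(LINT x:W|lborel. (f' (u x) * h x * B x + f (u x) * b x) * p x)
   = (LINT x|lborel. f' (u1 x) * h1 x * B1 x * p x + f (u1 x) * b1 x * p x)"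
   unfolding set_lebesgue_integral_def using L(2)
   by (intro Bochner_Integration.integral_cong refl)
    (auto simp: u1_def h1_def B1_def b1_def indicator_def algebra_simps psiL)
  ultimately show ?thesis using main by simp
 qed
 with loc1 loc2 show ?thesis unfolding weak_derivative_on_def by blast
qed

section \<open>Almost everywhere differentiability of Lipschitz functions\<close>

lemma negligible_iff_emeasure_lborel:
 assumes "E \<in> sets borel"
 shows "negligible E \<longleftrightarrow> emeasure lborel E = 0"
 using assms by (simp add: negligible_iff_null_sets null_sets_completion_iff null_sets_def)

lemma emeasure_interval_eq:
 assumes "mono g" "continuous_on UNIV g" "a \<le> b"
 shows "emeasure (interval_measure g) {a..b} = ennreal (g b - g a)"
 using assms by (intro emeasure_interval_measure_Icc) (auto simp: mono_def)

text \<open>Cover \<open>E\<close> by disjoint intervals on which \<open>g\<close> grows slower than \<open>p\<close>, and inside these by disjoint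
 intervals on which it grows faster than \<open>q\<close>. Since \<open>g\<close> is monotone, \<open>q\<close> times the total length of
 the latter is at most \<open>p\<close> times the total length of the former.\<close>

lemma oscillation_set_cover:
 fixes g :: "real => real"
 assumes mono: "mono g" and cont: "continuous_on UNIV g" and pq: "0 < p" "p < q"
  and E: "E \<in> sets borel" and U: "open U" "E \<subseteq> U"
  and low: "!!x d. x \<in> E ==> d > 0 ==> \<exists>h. 0 < \<bar>h\<bar> \<and> \<bar>h\<bar> < d \<and> (g (x + h) - g x) / h < p"
  and high: "!!x d. x \<in> E ==> d > 0 ==> \<exists>h. 0 < \<bar>h\<bar> \<and> \<bar>h\<bar> < d \<and> (g (x + h) - g x) / h > q"
 shows "emeasure lborel E \<le> ennreal (p / q) * emeasure lborel U"
proof -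
 \<comment> \<open>The Vitali covering theorem speaks of closed balls; here an interval is indexed
   by the pair of its end points.\<close>
 define ctr :: "real \<times> real => real" where "ctr = (\<lambda>i. (fst i + snd i) / 2)"
 define rad :: "real \<times> real => real" where "rad = (\<lambda>i. (snd i - fst i) / 2)"
 have cb: "cball (ctr i) (rad i) = {fst i..snd i}" for i
 proof -
  have "ctr i - rad i = fst i" "ctr i + rad i = snd i" by (simp_all add: ctr_def rad_def field_simps)
  then show ?thesis by (simp add: cball_eq_atLeastAtMost)
 qed
 \<comment> \<open>A quotient with negative step at x is the slope of g over [x + h, x], so steps of
   both signs give an interval containing x.\<close>
 have ivl: "\<exists>i. fst i < snd i \<and> x \<in> {fst i..snd i} \<and> {fst i..snd i} \<subseteq> ball x d \<and> rad i < d \<and>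
   (g (x + h) - g x) / h = (g (snd i) - g (fst i)) / (snd i - fst i)" if h: "0 < \<bar>h\<bar>" "\<bar>h\<bar> < d" for x h d
 proof (cases "h > 0")
  case True
  then show ?thesis using h by (intro exI[of _ "(x, x + h)"]) (auto simp: dist_real_def rad_def)
 next
  case False
  then have "(g (x + h) - g x) / h = (g x - g (x + h)) / (- h)" by (simp add: minus_divide_left minus_divide_right)
  then show ?thesis using h False by (intro exI[of _ "(x + h, x)"]) (auto simp: dist_real_def rad_def)
 qed
 define K1 where "K1 = {i. fst i < snd i \<and> {fst i..snd i} \<subseteq> U \<and> g (snd i) - g (fst i) < p * (snd i - fst i)}"
 obtain C1 where C1: "countable C1" "C1 \<subseteq> K1"
   "pairwise (\<lambda>i j. disjnt (cball (ctr i) (rad i)) (cball (ctr j) (rad j))) C1"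
   "negligible (E - (\<Union>i\<in>C1. cball (ctr i) (rad i)))"
 proof (rule Vitali_covering_theorem_cballs[of K1 rad E ctr])
  fix x d :: real assume x: "x \<in> E" "0 < d"
  obtain d' where d': "d' > 0" "ball x d' \<subseteq> U" using x U openE by blast
  obtain h where h: "0 < \<bar>h\<bar>" "\<bar>h\<bar> < min d d'" "(g (x + h) - g x) / h < p"
   using low[OF x(1), of "min d d'"] x d' by auto
  obtain i where i: "fst i < snd i" "x \<in> {fst i..snd i}" "{fst i..snd i} \<subseteq> ball x (min d d')" "rad i < min d d'"
   "(g (x + h) - g x) / h = (g (snd i) - g (fst i)) / (snd i - fst i)" using ivl[OF h(1,2)] by blast
  have "ball x (min d d') \<subseteq> ball x d'" by (rule subset_ball) simp
  then have "{fst i..snd i} \<subseteq> U" using i(3) d'(2) by blast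
  then have "i \<in> K1" using i(1,5) h(3) by (simp add: K1_def divide_less_eq)
  then show "\<exists>i. i \<in> K1 \<and> x \<in> cball (ctr i) (rad i) \<and> rad i < d" using i cb by (intro exI[of _ i]) auto
 qed (auto simp: K1_def rad_def)
 \<comment> \<open>Dropping the end points of the first intervals, a countable set, leaves every
   point room for smaller intervals inside its own.\<close>
 define E' where "E' = E \<inter> (\<Union>i\<in>C1. {fst i<..<snd i})"
 define K2 where "K2 = {i. fst i < snd i \<and> (\<exists>j\<in>C1. {fst i..snd i} \<subseteq> {fst j..snd j}) \<and> g (snd i) - g (fst i) > q * (snd i - fst i)}"
 obtain C2 where C2: "countable C2" "C2 \<subseteq> K2"
   "pairwise (\<lambda>i j. disjnt (cball (ctr i) (rad i)) (cball (ctr j) (rad j))) C2"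
   "negligible (E' - (\<Union>i\<in>C2. cball (ctr i) (rad i)))"
 proof (rule Vitali_covering_theorem_cballs[of K2 rad E' ctr])
  fix x d :: real assume x: "x \<in> E'" "0 < d"
  then obtain j where j: "j \<in> C1" "x \<in> {fst j<..<snd j}" and xE: "x \<in> E" by (auto simp: E'_def)
  obtain d' where d': "d' > 0" "ball x d' \<subseteq> {fst j<..<snd j}"
   using j(2) open_greaterThanLessThan openE by metis
  obtain h where h: "0 < \<bar>h\<bar>" "\<bar>h\<bar> < min d d'" "(g (x + h) - g x) / h > q"
   using high[OF xE, of "min d d'"] x d' by auto
  obtain i where i: "fst i < snd i" "x \<in> {fst i..snd i}" "{fst i..snd i} \<subseteq> ball x (min d d')" "rad i < min d d'"
   "(g (x + h) - g x) / h = (g (snd i) - g (fst i)) / (snd i - fst i)" using ivl[OF h(1,2)] by blast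
  have "ball x (min d d') \<subseteq> ball x d'" by (rule subset_ball) simp
  then have "{fst i..snd i} \<subseteq> ball x d'" using i(3) by blast
  then have "{fst i..snd i} \<subseteq> {fst j..snd j}"
   using d'(2) by (meson greaterThanLessThan_subseteq_atLeastAtMost_iff order_refl order_trans)
  then have "i \<in> K2" using i(1,5) h(3) j(1) unfolding K2_def by (auto simp: less_divide_eq)
  then show "\<exists>i. i \<in> K2 \<and> x \<in> cball (ctr i) (rad i) \<and> rad i < d" using i cb by (intro exI[of _ i]) auto
 qed (auto simp: K2_def rad_def)
 define I1 where "I1 = (\<Union>i\<in>C1. {fst i..snd i})"
 define I2 where "I2 = (\<Union>i\<in>C2. {fst i..snd i})"
 have dj: "disjoint_family_on (\<lambda>i. {fst i..snd i}) C1" "disjoint_family_on (\<lambda>i. {fst i..snd i}) C2"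
  using C1(3) C2(3) unfolding cb disjoint_family_on_def pairwise_def disjnt_def by auto
 have [measurable]: "I1 \<in> sets borel" "I2 \<in> sets borel" "E \<in> sets borel" "E' \<in> sets borel"
  using C1(1) C2(1) E by (auto simp: I1_def I2_def E'_def intro!: sets.countable_UN' sets.Int)
 \<comment> \<open>Under the measure with distribution function g, total increases over disjoint
   intervals are measures of unions, so the inclusion I2 \<subseteq> I1 compares the two
   families.\<close>
 let ?G = "interval_measure g"
 have I21: "I2 \<subseteq> I1" unfolding I2_def I1_def
 proof (rule UN_least)
  fix i assume "i \<in> C2"
  then obtain j where "j \<in> C1" "{fst i..snd i} \<subseteq> {fst j..snd j}" using C2(2) unfolding K2_def by blast
  then show "{fst i..snd i} \<subseteq> (\<Union>i\<in>C1. {fst i..snd i})" by blast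
 qed
 have I1U: "I1 \<subseteq> U" using C1(2) unfolding I1_def K1_def by blast
 have neg: "negligible (E - I2)"
 proof -
  have "E - I2 \<subseteq> (E - I1) \<union> (E' - I2) \<union> (fst ` C1 \<union> snd ` C1)"
  proof
   fix x assume x: "x \<in> E - I2"
   show "x \<in> (E - I1) \<union> (E' - I2) \<union> (fst ` C1 \<union> snd ` C1)"
   proof (rule ccontr)
    assume c: "x \<notin> (E - I1) \<union> (E' - I2) \<union> (fst ` C1 \<union> snd ` C1)"
    then obtain i where i: "i \<in> C1" "fst i \<le> x" "x \<le> snd i" using x by (auto simp: I1_def)
    then have "x \<noteq> fst i" "x \<noteq> snd i" using c by auto
    then have "x \<in> {fst i<..<snd i}" using i by auto
    then have "x \<in> E'" using i(1) x by (auto simp: E'_def)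
    then show False using c x by auto
   qed
  qed
  moreover have "negligible (fst ` C1 \<union> snd ` C1)"
   using C1(1) by (simp add: negligible_iff_null_sets countable_imp_null_set_lborel null_sets_completionI)
  moreover have "negligible (E - I1)" "negligible (E' - I2)"
   using C1(4) C2(4) by (simp_all add: cb I1_def I2_def)
  ultimately show ?thesis by (meson negligible_Un negligible_subset)
 qed
 have "emeasure lborel E \<le> emeasure lborel ((E - I2) \<union> I2)" by (intro emeasure_mono) auto
 also have "\<dots> \<le> emeasure lborel (E - I2) + emeasure lborel I2" by (intro emeasure_subadditive) auto
 also have "emeasure lborel (E - I2) = 0" using neg by (subst (asm) negligible_iff_emeasure_lborel) auto
 finally have 1: "emeasure lborel E \<le> emeasure lborel I2" by simp
 have "emeasure lborel I2 = (\<integral>\<^sup>+i. emeasure lborel {fst i..snd i} \<partial>count_space C2)"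
  unfolding I2_def using C2(1) dj(2) by (intro emeasure_UN_countable) auto
 also have "\<dots> \<le> (\<integral>\<^sup>+i. ennreal (1 / q) * emeasure ?G {fst i..snd i} \<partial>count_space C2)"
 proof (rule nn_integral_mono)
  fix i assume "i \<in> space (count_space C2)"
  then have "fst i < snd i" "q * (snd i - fst i) \<le> g (snd i) - g (fst i)" using C2(2) by (auto simp: K2_def)
  then show "emeasure lborel {fst i..snd i} \<le> ennreal (1 / q) * emeasure ?G {fst i..snd i}"
   using pq by (auto simp: emeasure_interval_eq[OF mono cont] ennreal_mult'[symmetric] field_simps intro!: ennreal_leI)
 qed
 also have "\<dots> = ennreal (1 / q) * (\<integral>\<^sup>+i. emeasure ?G {fst i..snd i} \<partial>count_space C2)"
  by (rule nn_integral_cmult) simp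
 also have "(\<integral>\<^sup>+i. emeasure ?G {fst i..snd i} \<partial>count_space C2) = emeasure ?G I2"
  unfolding I2_def using C2(1) dj(2) by (intro emeasure_UN_countable[symmetric]) auto
 also have "\<dots> \<le> emeasure ?G I1" using I21 by (intro emeasure_mono) auto
 also have "\<dots> = (\<integral>\<^sup>+i. emeasure ?G {fst i..snd i} \<partial>count_space C1)"
  unfolding I1_def using C1(1) dj(1) by (intro emeasure_UN_countable) auto
 also have "\<dots> \<le> (\<integral>\<^sup>+i. ennreal p * emeasure lborel {fst i..snd i} \<partial>count_space C1)"
 proof (rule nn_integral_mono)
  fix i assume "i \<in> space (count_space C1)"
  then have "fst i < snd i" "g (snd i) - g (fst i) \<le> p * (snd i - fst i)" using C1(2) by (auto simp: K1_def)
  then show "emeasure ?G {fst i..snd i} \<le> ennreal p * emeasure lborel {fst i..snd i}"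
   using pq by (simp add: emeasure_interval_eq[OF mono cont] ennreal_mult'[symmetric] ennreal_leI)
 qed
 also have "\<dots> = ennreal p * (\<integral>\<^sup>+i. emeasure lborel {fst i..snd i} \<partial>count_space C1)"
  by (rule nn_integral_cmult) simp
 also have "(\<integral>\<^sup>+i. emeasure lborel {fst i..snd i} \<partial>count_space C1) = emeasure lborel I1"
  unfolding I1_def using C1(1) dj(1) by (intro emeasure_UN_countable[symmetric]) auto
 also have "\<dots> \<le> emeasure lborel U" using I1U U(1) by (intro emeasure_mono) auto
 finally have "emeasure lborel I2 \<le> ennreal (1 / q) * (ennreal p * emeasure lborel U)"
  by (simp add: mult_left_mono)
 also have "\<dots> = ennreal (p / q) * emeasure lborel U"
  using pq by (simp add: mult.assoc[symmetric] ennreal_mult'[symmetric])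
 finally show ?thesis using 1 by (rule order_trans[rotated])
qed

text \<open>Open sets U shrinking to E turn the covering estimate into |E| \<le> (p/q) |E|, which
  forces |E| = 0 when |E| is finite; bounded pieces of E ensure that. For p \<le> 0 the set is
  empty, because the quotients of a monotone function are nonnegative.\<close>

lemma oscillation_set_null:
 fixes g :: "real => real"
 assumes mono: "mono g" and cont: "continuous_on UNIV g" and pq: "p < q"
  and E: "E \<in> sets borel"
  and low: "!!x d. x \<in> E ==> d > 0 ==> \<exists>h. 0 < \<bar>h\<bar> \<and> \<bar>h\<bar> < d \<and> (g (x + h) - g x) / h < p"
  and high: "!!x d. x \<in> E ==> d > 0 ==> \<exists>h. 0 < \<bar>h\<bar> \<and> \<bar>h\<bar> < d \<and> (g (x + h) - g x) / h > q"
 shows "emeasure lborel E = 0"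
proof (cases "p > 0")
 case False
 have "(g (x + h) - g x) / h \<ge> 0" if "h \<noteq> 0" for x h
 proof (cases "h > 0")
  case True
  then show ?thesis using monoD[OF mono, of x "x + h"] by simp
 next
  case False
  then show ?thesis using monoD[OF mono, of "x + h" x] that by (intro divide_nonpos_neg) auto
 qed
 moreover have "\<exists>h. h \<noteq> 0 \<and> (g (x + h) - g x) / h < p" if "x \<in> E" for x using low[OF that, of 1] by auto
 ultimately have "E = {}" using False by (metis all_not_in_conv less_le_trans not_le)
 then show ?thesis by simp
next
 case True
 have bdd: "emeasure lborel (E \<inter> {-real n..real n}) = 0" for n :: nat
 proof -
  let ?E = "E \<inter> {-real n..real n}"
  have Eb: "?E \<in> sets borel" using E by auto
  have fin: "emeasure lborel ?E < \<infinity>"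
  proof -
   have "emeasure lborel ?E \<le> emeasure lborel {-real n..real n}" by (intro emeasure_mono) auto
   also have "\<dots> < \<infinity>" by (simp add: emeasure_lborel_Icc_eq)
   finally show ?thesis .
  qed
  define m where "m = measure lborel ?E"
  have em: "emeasure lborel ?E = ennreal m" unfolding m_def using fin by (simp add: emeasure_eq_ennreal_measure)
  have "m \<le> p / q * m + \<epsilon>" if "\<epsilon> > 0" for \<epsilon>
  proof -
   define e where "e = \<epsilon> * q / p"
   have e: "e > 0" using that True pq by (simp add: e_def)
   obtain U where U: "open U" "?E \<subseteq> U" "emeasure lborel (U - ?E) < ennreal e"
    using outer_regular_lborel[OF Eb e] by metis
   have "emeasure lborel U = emeasure lborel ?E + emeasure lborel (U - ?E)"
    using Eb U by (subst plus_emeasure) (auto simp: Un_absorb1)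
   also have "\<dots> \<le> ennreal m + ennreal e" using U(3) em by (intro add_mono) auto
   also have "\<dots> = ennreal (m + e)" using e by (simp add: m_def)
   finally have Ule: "emeasure lborel U \<le> ennreal (m + e)" .
   have "ennreal m \<le> ennreal (p / q) * emeasure lborel U"
    unfolding em[symmetric] using low high by (intro oscillation_set_cover[OF mono cont True pq Eb U(1,2)]) auto
   also have "\<dots> \<le> ennreal (p / q) * ennreal (m + e)" using Ule by (intro mult_left_mono) auto
   also have "\<dots> = ennreal (p / q * (m + e))" using True pq by (simp add: ennreal_mult'[symmetric])
   finally have "m \<le> p / q * (m + e)"
    using True pq e by (subst (asm) ennreal_le_iff) (auto simp: m_def)
   moreover have "p / q * e = \<epsilon>" using True pq by (simp add: e_def)
   ultimately show ?thesis by (simp add: distrib_left)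
  qed
  then have "m \<le> p / q * m" by (rule field_le_epsilon)
  then have "(1 - p / q) * m \<le> 0" by (simp add: algebra_simps)
  moreover have "1 - p / q > 0" using True pq by simp
  ultimately have "m \<le> 0" by (simp add: mult_le_0_iff)
  then show ?thesis using em by (simp add: ennreal_eq_0_iff)
 qed
 have "E = (\<Union>n. E \<inter> {-real n..real n})"
 proof -
  have "\<exists>n. x \<in> {-real n..real n}" for x
  proof -
   obtain n :: nat where "\<bar>x\<bar> \<le> real n" using real_arch_simple by blast
   then show ?thesis by (intro exI[of _ n]) auto
  qed
  then show ?thesis by blast
 qed
 moreover have "emeasure lborel (\<Union>n. E \<inter> {-real n..real n}) = 0"
  using bdd E by (intro emeasure_UN_eq_0) auto
 ultimately show ?thesis by simp
qed

text \<open>Fubini along an arbitrary direction, without choosing coordinates: average the translation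
 invariance of Lebesgue measure over \<open>t \<in> [0, 1]\<close>.\<close>

lemma null_if_null_on_lines:
 fixes N :: "'a::euclidean_space set"
 assumes N[measurable]: "N \<in> sets borel"
  and lines: "!!x. emeasure lborel {t::real. x + t *R v \<in> N} = 0"
 shows "emeasure lborel N = 0"
proof -
 have "emeasure lborel N = (\<integral>\<^sup>+t. indicator {0..1::real} t * emeasure lborel N \<partial>lborel)"
  by (simp add: nn_integral_multc)
 also have "\<dots> = (\<integral>\<^sup>+t. indicator {0..1::real} t * (\<integral>\<^sup>+x. indicator N (x + t *R v) \<partial>lborel) \<partial>lborel)"
  by (intro nn_integral_cong) (simp add: nn_lborel_shift[of "indicator N"])
 also have "\<dots> = (\<integral>\<^sup>+t. (\<integral>\<^sup>+x. indicator {0..1::real} t * indicator N (x + t *R v) \<partial>lborel) \<partial>lborel)"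
  by (intro nn_integral_cong nn_integral_cmult[symmetric]) measurable
 also have "\<dots> = (\<integral>\<^sup>+x. (\<integral>\<^sup>+t. indicator {0..1::real} t * indicator N (x + t *R v) \<partial>lborel) \<partial>lborel)"
  by (rule lborel_pair.Fubini') measurable
 also have "\<dots> = 0"
 proof -
  have "(\<integral>\<^sup>+t. indicator {0..1::real} t * indicator N (x + t *R v) \<partial>lborel) = 0" for x
  proof -
   have "(\<integral>\<^sup>+t. indicator {0..1::real} t * indicator N (x + t *R v) \<partial>lborel)
     \<le> (\<integral>\<^sup>+t. indicator {t. x + t *R v \<in> N} t \<partial>lborel)"
    by (intro nn_integral_mono) (auto simp: indicator_def)
   also have "\<dots> = emeasure lborel {t. x + t *R v \<in> N}"
    by (intro nn_integral_indicator) measurable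
   finally show ?thesis using lines[of x] by simp
  qed
  then show ?thesis by simp
 qed
 finally show ?thesis .
qed

text \<open>If the lower and upper limits at 0 differed, rationals p < q would fit strictly between
  them; rational bounds keep the number of exceptional sets countable. The bound B makes the common
  value finite.\<close>

lemma convergent_if_no_oscillation:
 fixes \<phi> :: "real => real"
 assumes bd: "!!h. \<bar>\<phi> h\<bar> \<le> B"
  and osc: "!!p q. p \<in> \<rat> ==> q \<in> \<rat> ==> p < q ==> \<not> ((\<exists>\<^sub>F h in at 0. \<phi> h < p) \<and> (\<exists>\<^sub>F h in at 0. \<phi> h > q))"
 obtains l where "(\<phi> \<longlongrightarrow> l) (at 0)"
proof -
 let ?s = "Limsup (at 0) (\<lambda>h. ereal (\<phi> h))" and ?i = "Liminf (at 0) (\<lambda>h. ereal (\<phi> h))"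
 have "?i = ?s"
 proof (rule ccontr)
  assume "?i \<noteq> ?s"
  moreover have "?i \<le> ?s" by (rule Liminf_le_Limsup) simp
  ultimately have "?i < ?s" by simp
  then obtain r where r: "?i < ereal r" "ereal r < ?s" using ereal_dense2 by blast
  then obtain r' where r': "ereal r < ereal r'" "ereal r' < ?s" using ereal_dense2 by blast
  \<comment> \<open>p and q are taken on either side of the midpoint of r and r', which gives p <
    q.\<close>
  obtain p where p: "p \<in> \<rat>" "r < p" "p < (r + r') / 2" using Rats_dense_in_real[of r "(r + r')/2"] r' by auto
  obtain q where q: "q \<in> \<rat>" "(r + r') / 2 < q" "q < r'" using Rats_dense_in_real[of "(r + r')/2" r'] r' by auto
  have "\<exists>\<^sub>F h in at 0. \<phi> h < p"
  proof (rule ccontr)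
   assume "\<not> (\<exists>\<^sub>F h in at 0. \<phi> h < p)"
   then have "\<forall>\<^sub>F h in at 0. ereal p \<le> ereal (\<phi> h)" by (simp add: not_frequently not_less)
   then have "ereal p \<le> ?i" by (rule Liminf_bounded)
   from le_less_trans[OF this r(1)] show False using p(2) by simp
  qed
  moreover have "\<exists>\<^sub>F h in at 0. \<phi> h > q"
  proof (rule ccontr)
   assume "\<not> (\<exists>\<^sub>F h in at 0. \<phi> h > q)"
   then have "\<forall>\<^sub>F h in at 0. ereal (\<phi> h) \<le> ereal q" by (simp add: not_frequently not_less)
   then have "?s \<le> ereal q" by (rule Limsup_bounded)
   from less_le_trans[OF r'(2) this] show False using q(3) by simp
  qed
  ultimately show False using osc[of p q] p q by auto
 qed
 then have lim: "((\<lambda>h. ereal (\<phi> h)) \<longlongrightarrow> ?i) (at 0)" by (intro tendsto_Liminf) auto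
 have "ereal (- B) \<le> ?s" unfolding \<open>?i = ?s\<close>[symmetric] by (rule Liminf_bounded) (use bd in \<open>auto simp: abs_le_iff minus_le_iff intro!: always_eventually\<close>)
 moreover have "?s \<le> ereal B" by (rule Limsup_bounded) (use bd in \<open>auto simp: abs_le_iff intro!: always_eventually\<close>)
 ultimately obtain l where "?s = ereal l" by (cases ?s) auto
 then have "(\<phi> \<longlongrightarrow> l) (at 0)" using lim \<open>?i = ?s\<close> by simp
 then show ?thesis by (rule that)
qed

text \<open>On a line in direction v, adding a linear term of slope L |v| makes F monotone. So the
  set where the quotients oscillate across p < q is null on each such line, and therefore
  null.\<close>

lemma Lipschitz_directional_derivative_AE:
 fixes F :: "'a::euclidean_space => real"
 assumes F: "L-lipschitz_on UNIV F"
 shows "AE x in lborel. \<exists>l. ((\<lambda>s. F (x + s *R v)) has_real_derivative l) (at 0)"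
proof -
 have Fc: "continuous_on UNIV F" by (rule lipschitz_on_continuous_on[OF F])
 then have [measurable]: "F \<in> Borel" by (rule borel_measurable_continuous_onI)
 have L0: "L \<ge> 0" using F lipschitz_on_nonneg by blast
 define Q where "Q x h = (F (x + h *R v) - F x) / h" for x h
 have lip: "\<bar>F (x + s *R v) - F (x + t *R v)\<bar> \<le> L * norm v * \<bar>s - t\<bar>" for x s t
  using lipschitz_onD[OF F, of "x + s *R v" "x + t *R v"]
  by (simp add: dist_norm dist_real_def scaleR_diff_left[symmetric] mult_ac)
 have Qb: "\<bar>Q x h\<bar> \<le> L * norm v" for x h
  using lip[of x h 0] L0 by (cases "h = 0") (auto simp: Q_def abs_divide divide_le_eq)
 \<comment> \<open>Values below p and above q for arbitrarily small steps, expressed with countably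
   many radii: for each radius the points form a union of open sets, so E is Borel.\<close>
 define E where "E p q = {x. (\<forall>n::nat. \<exists>h. 0 < \<bar>h\<bar> \<and> \<bar>h\<bar> < 1 / (real n + 1) \<and> Q x h < p) \<and>
   (\<forall>n::nat. \<exists>h. 0 < \<bar>h\<bar> \<and> \<bar>h\<bar> < 1 / (real n + 1) \<and> Q x h > q)}" for p q
 have Qc: "continuous_on UNIV (\<lambda>x. Q x h)" for h
  unfolding Q_def divide_inverse by (intro continuous_intros continuous_on_compose2[OF Fc]) auto
 have Em[measurable]: "E p q \<in> sets borel" for p q
 proof -
  have "E p q = (\<Inter>n::nat. \<Union>h\<in>{h. 0 < \<bar>h\<bar> \<and> \<bar>h\<bar> < 1 / (real n + 1)}. {x. Q x h < p}) \<inter>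
    (\<Inter>n::nat. \<Union>h\<in>{h. 0 < \<bar>h\<bar> \<and> \<bar>h\<bar> < 1 / (real n + 1)}. {x. Q x h > q})"
   by (auto simp: E_def)
  moreover have "open {x. Q x h < p}" "open {x. Q x h > q}" for h
   by (intro open_Collect_less Qc continuous_on_const)+
  ultimately show ?thesis by (auto intro!: sets.Int sets.countable_INT'' borel_open[OF open_UN])
 qed
 have E0: "emeasure lborel (E p q) = 0" if pq: "p < q" for p q
 proof (rule null_if_null_on_lines[OF Em])
  fix x
  define g where "g t = F (x + t *R v) + L * norm v * t" for t
  have mono: "mono g"
  proof (rule monoI)
   fix s t :: real assume "s \<le> t"
   then show "g s \<le> g t" using lip[of x s t] by (simp add: g_def abs_le_iff algebra_simps)
  qed
  have cont: "continuous_on UNIV g"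
   unfolding g_def by (intro continuous_intros continuous_on_compose2[OF Fc]) auto
  have Qg: "(g (t + h) - g t) / h = Q (x + t *R v) h + L * norm v" if "h \<noteq> 0" for t h
   using that by (simp add: g_def Q_def field_simps scaleR_add_left add.assoc)
  have ex: "\<exists>n::nat. 1 / (real n + 1) < d" if "d > 0" for d :: real
   using reals_Archimedean[OF that] by (auto simp: inverse_eq_divide add.commute)
  show "emeasure lborel {t. x + t *R v \<in> E p q} = 0"
  proof (rule oscillation_set_null[OF mono cont, of "p + L * norm v" "q + L * norm v"])
   show "{t. x + t *R v \<in> E p q} \<in> sets borel" by measurable
   fix t d :: real assume t: "t \<in> {t. x + t *R v \<in> E p q}" and d: "d > 0"
   obtain n :: nat where n: "1 / (real n + 1) < d" using ex[OF d] by blast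
   from t obtain h h' where "0 < \<bar>h\<bar>" "\<bar>h\<bar> < 1 / (real n + 1)" "Q (x + t *R v) h < p"
    "0 < \<bar>h'\<bar>" "\<bar>h'\<bar> < 1 / (real n + 1)" "Q (x + t *R v) h' > q"
    unfolding E_def by blast
   with n Qg[of h t] Qg[of h' t]
   show "\<exists>h. 0 < \<bar>h\<bar> \<and> \<bar>h\<bar> < d \<and> (g (t + h) - g t) / h < p + L * norm v"
    by (intro exI[of _ h]) auto
   from n Qg[of h t] Qg[of h' t] \<open>0 < \<bar>h'\<bar>\<close> \<open>\<bar>h'\<bar> < 1 / (real n + 1)\<close> \<open>Q (x + t *R v) h' > q\<close>
   show "\<exists>h. 0 < \<bar>h\<bar> \<and> \<bar>h\<bar> < d \<and> q + L * norm v < (g (t + h) - g t) / h"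
    by (intro exI[of _ h']) auto
  qed (use pq in simp)
 qed
 have "AE x in lborel. \<forall>p\<in>\<rat>. \<forall>q\<in>\<rat>. p < q --> x \<notin> E p q"
 proof -
  have "AE x in lborel. p < q --> x \<notin> E p q" for p q
   using E0[of p q] by (cases "p < q") (auto intro!: AE_not_in simp: null_sets_def)
  then show ?thesis by (simp add: AE_ball_countable countable_rat)
 qed
 then show ?thesis
 proof eventually_elim
  case (elim x)
  have fr: "\<exists>h. 0 < \<bar>h\<bar> \<and> \<bar>h\<bar> < 1 / (real n + 1) \<and> P h" if fr: "\<exists>\<^sub>F h in at (0::real). P h" for P and n :: nat
  proof -
   have "\<forall>\<^sub>F h in at (0::real). h \<noteq> 0 \<and> \<bar>h\<bar> < 1 / (real n + 1)"
    by (auto simp: eventually_at intro!: exI[of _ "1 / (real n + 1)"])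
   from frequently_ex[OF frequently_eventually_frequently[OF fr this]] show ?thesis by auto
  qed
  obtain l where "(Q x \<longlongrightarrow> l) (at 0)"
  proof (rule convergent_if_no_oscillation[of "Q x" "L * norm v"])
   fix p q :: real assume pq: "p \<in> \<rat>" "q \<in> \<rat>" "p < q"
   show "\<not> ((\<exists>\<^sub>F h in at 0. Q x h < p) \<and> (\<exists>\<^sub>F h in at 0. q < Q x h))"
   proof
    assume "(\<exists>\<^sub>F h in at 0. Q x h < p) \<and> (\<exists>\<^sub>F h in at 0. q < Q x h)"
    then have "x \<in> E p q" using fr[of "\<lambda>h. Q x h < p"] fr[of "\<lambda>h. q < Q x h"] unfolding E_def by simp
    then show False using elim pq by blast
   qed
  qed (use Qb in auto)
  then show ?case by (intro exI[of _ l]) (simp add: Q_def[abs_def] has_field_derivative_iff)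
 qed
qed

lemma frechet_derivative_test_sum:
 fixes \<psi> :: "'a::euclidean_space => real"
 assumes "smooth_on UNIV \<psi>"
 shows "dderiv v \<psi> x = (\<Sum>b\<in>Basis. (v \<bullet> b) * dderiv b \<psi> x)"
proof -
 have "linear (frechet_derivative \<psi> (at x))"
  using smooth_on_UNIV_imp_differentiable[OF assms] linear_frechet_derivative by blast
 then have "frechet_derivative \<psi> (at x) (\<Sum>b\<in>Basis. (v \<bullet> b) *R b) = (\<Sum>b\<in>Basis. (v \<bullet> b) * dderiv b \<psi> x)"
  by (simp add: linear_sum linear_cmul)
 then show ?thesis by (simp add: euclidean_representation)
qed

text \<open>The derivative of a smooth \<psi> is linear in the direction. Integration by parts
  transfers this to the derivatives of F, so the two sides have the same integral against every test
  function.\<close>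

lemma Lipschitz_derivative_linear_AE:
 fixes F :: "'a::euclidean_space => real"
 assumes F: "L-lipschitz_on UNIV F"
  and D: "!!v. D v \<in> Borel"
  and der: "!!v. AE x in lborel. ((\<lambda>s. F (x + s *R v)) has_real_derivative D v x) (at 0)"
  and bd: "!!v x. \<bar>D v x\<bar> \<le> L * norm v"
 shows "AE x in lborel. D v x = (\<Sum>b\<in>Basis. (v \<bullet> b) * D b x)"
proof -
 note [measurable] = D
 define k where "k x = D v x - (\<Sum>b\<in>Basis. (v \<bullet> b) * D b x)" for x
 have Fc: "continuous_on UNIV F" by (rule lipschitz_on_continuous_on[OF F])
 have [measurable]: "F \<in> Borel" by (rule borel_measurable_continuous_onI[OF Fc])
 have iK: "integrable lborel (\<lambda>x. indicat_real K x * g x)"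
  if K: "compact K" and g[measurable]: "g \<in> Borel" and b: "!!x. x \<in> K ==> \<bar>g x\<bar> \<le> c" for K :: "'a set" and g c
 proof (rule Bochner_Integration.integrable_bound)
  have [measurable]: "K \<in> sets borel" using K by (simp add: compact_imp_closed)
  show "integrable lborel (\<lambda>x. indicat_real K x * c)"
   using K emeasure_compact_finite by (auto intro!: integrable_mult_left integrable_real_indicator)
  show "(\<lambda>x. indicat_real K x * g x) \<in> borel_measurable lborel" by measurable
  show "AE x in lborel. norm (indicat_real K x * g x) \<le> norm (indicat_real K x * c)"
   using b by (intro AE_I2) (force simp: indicator_def)
 qed
 have "AE x in lborel. x \<in> UNIV --> k x = 0"
 proof (rule weak_zero_imp_AE_zero)
  show "locally_integrable_on UNIV k"
   unfolding locally_integrable_on_def set_integrable_def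
  proof (intro allI impI)
   fix K :: "'a set" assume "compact K \<and> K \<subseteq> UNIV"
   then show "integrable lborel (\<lambda>x. indicat_real K x *R k x)"
    unfolding real_scaleR_def
   proof (intro iK[where c = "L * norm v + (\<Sum>b\<in>Basis. \<bar>v \<bullet> b\<bar> * (L * norm b))"])
    show "k \<in> Borel" unfolding k_def by measurable
    show "\<bar>k x\<bar> \<le> L * norm v + (\<Sum>b\<in>Basis. \<bar>v \<bullet> b\<bar> * (L * norm b))" for x
    proof -
     have "\<bar>k x\<bar> \<le> \<bar>D v x\<bar> + \<bar>\<Sum>b\<in>Basis. (v \<bullet> b) * D b x\<bar>" unfolding k_def by (rule abs_triangle_ineq4)
     also have "\<bar>\<Sum>b\<in>Basis. (v \<bullet> b) * D b x\<bar> \<le> (\<Sum>b\<in>Basis. \<bar>(v \<bullet> b) * D b x\<bar>)" by (rule sum_abs)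
     also have "\<dots> \<le> (\<Sum>b\<in>Basis. \<bar>v \<bullet> b\<bar> * (L * norm b))"
     proof (rule sum_mono)
      fix b :: 'a
      show "\<bar>(v \<bullet> b) * D b x\<bar> \<le> \<bar>v \<bullet> b\<bar> * (L * norm b)"
       unfolding abs_mult by (rule mult_left_mono[OF bd]) simp
     qed
     finally show ?thesis using bd[of v x] by linarith
    qed
   qed simp
  qed
  fix \<psi> :: "'a => real" assume "test_function UNIV \<psi>"
  then obtain K where s: "smooth_on UNIV \<psi>" and K: "compact K" "!!x. x \<notin> K ==> \<psi> x = 0"
   unfolding test_function_def by blast
  have [measurable]: "\<psi> \<in> Borel"
   using smooth_on_UNIV_imp_continuous[OF s] by (rule borel_measurable_continuous_onI)
  define L1 where "L1 = (\<Union>x\<in>K. cball x 1)"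
  have L1: "compact L1" using compact_minkowski_sum_cball[OF K(1)] by (simp add: L1_def)
  have [measurable]: "L1 \<in> sets borel" using L1 by (simp add: compact_imp_closed)
  have "bounded (F ` L1)" "bounded (\<psi> ` K)"
   using L1 K(1) continuous_on_subset[OF Fc] continuous_on_subset[OF smooth_on_UNIV_imp_continuous[OF s]]
   by (auto intro!: compact_imp_bounded compact_continuous_image)
  then obtain M M2 where M: "\<forall>x\<in>L1. \<bar>F x\<bar> \<le> M" and M2: "\<forall>x\<in>K. \<bar>\<psi> x\<bar> \<le> M2" by (auto simp: bounded_iff)
  have by_parts: "(LINT x|lborel. F x * dderiv w \<psi> x) = - (LINT x|lborel. D w x * \<psi> x)" for w
  proof (rule difference_quotient_by_parts[OF s K _ L1_def, where M = M and \<Lambda> = "L * norm w"])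
   show "\<bar>F (x + t *R w) - F x\<bar> \<le> L * norm w * \<bar>t\<bar>" for x t
    using lipschitz_onD[OF F, of "x + t *R w" x] by (simp add: dist_norm dist_real_def mult_ac)
   show "AE x in lborel. x \<in> K --> ((\<lambda>s. F (x + s *R w)) has_real_derivative D w x) (at 0)"
    using der[of w] by eventually_elim simp
  qed (use M in auto)
  have i\<psi>: "integrable lborel (\<lambda>x. D w x * \<psi> x)" for w
  proof -
   have "\<bar>D w x * \<psi> x\<bar> \<le> L * norm w * M2" if "x \<in> K" for x
    using bd[of w x] M2 that order_trans[OF abs_ge_zero bd[of w x]] by (auto simp: abs_mult intro!: mult_mono)
   then have "integrable lborel (\<lambda>x. indicat_real K x * (D w x * \<psi> x))" by (intro iK[OF K(1)]) auto
   moreover have "(\<lambda>x. indicat_real K x * (D w x * \<psi> x)) = (\<lambda>x. D w x * \<psi> x)"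
    using K(2) by (auto simp: indicator_def fun_eq_iff)
   ultimately show ?thesis by simp
  qed
  have iF: "integrable lborel (\<lambda>x. F x * dderiv w \<psi> x)" for w
  proof -
   have z: "dderiv w \<psi> x = 0" if "x \<notin> K" for x
    by (rule smooth_deriv_zero[OF compact_imp_closed[OF K(1)] K(2) that])
   have "continuous_on UNIV (\<lambda>x. F x * dderiv w \<psi> x)"
    using Fc smooth_on_UNIV_imp_deriv_continuous[OF s] by (intro continuous_intros)
   then have "integrable lborel (\<lambda>x. indicat_real K x *R (F x * dderiv w \<psi> x))"
    using K(1) continuous_on_subset by (intro borel_integrable_compact) blast+
   moreover have "(\<lambda>x. indicat_real K x *R (F x * dderiv w \<psi> x)) = (\<lambda>x. F x * dderiv w \<psi> x)"
    using z by (auto simp: indicator_def fun_eq_iff)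
   ultimately show ?thesis by simp
  qed
  have "(LINT x|lborel. k x * \<psi> x) = (LINT x|lborel. D v x * \<psi> x - (\<Sum>b\<in>Basis. (v \<bullet> b) * (D b x * \<psi> x)))"
   by (intro Bochner_Integration.integral_cong refl) (simp add: k_def left_diff_distrib sum_distrib_right mult.assoc)
  also have "\<dots> = (LINT x|lborel. D v x * \<psi> x) - (\<Sum>b\<in>Basis. (v \<bullet> b) * (LINT x|lborel. D b x * \<psi> x))"
   using i\<psi> by (subst Bochner_Integration.integral_diff) (auto simp: Bochner_Integration.integral_sum)
  also have "\<dots> = - (LINT x|lborel. F x * dderiv v \<psi> x)
    + (\<Sum>b\<in>Basis. (v \<bullet> b) * (LINT x|lborel. F x * dderiv b \<psi> x))"
   by (simp add: by_parts sum_negf)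
  also have "(\<Sum>b\<in>Basis. (v \<bullet> b) * (LINT x|lborel. F x * dderiv b \<psi> x))
    = (LINT x|lborel. (\<Sum>b\<in>Basis. (v \<bullet> b) * (F x * dderiv b \<psi> x)))"
   using iF by (subst Bochner_Integration.integral_sum) auto
  also have "\<dots> = (LINT x|lborel. F x * dderiv v \<psi> x)"
   by (intro Bochner_Integration.integral_cong refl)
    (simp add: frechet_derivative_test_sum[OF s, of _ v] sum_distrib_left mult_ac)
  finally show "(LINT x:UNIV|lborel. k x * \<psi> x) = 0" by (simp add: set_lebesgue_integral_def)
 qed simp
 then show ?thesis by eventually_elim (simp add: k_def)
qed

text \<open>For a Lipschitz function, a linear family of directional derivatives along a dense set of directions
 is a derivative, because finitely many directions approximate the unit sphere.\<close>

lemma Lipschitz_differentiable_dense: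
 fixes F :: "'a::euclidean_space => real"
 assumes F: "L-lipschitz_on UNIV F" and S: "!!X. open X ==> X \<noteq> {} ==> \<exists>d\<in>S. d \<in> X"
  and der: "!!v. v \<in> S ==> ((\<lambda>s. F (x + s *R v)) has_real_derivative (v \<bullet> a)) (at 0)"
 shows "(F has_derivative (\<lambda>v. v \<bullet> a)) (at x)"
 unfolding has_derivative_at_alt
proof (intro conjI allI impI)
 show "bounded_linear (\<lambda>v. v \<bullet> a)" by (rule bounded_linear_inner_left)
 fix e :: real assume e: "e > 0"
 have L0: "L \<ge> 0" using F lipschitz_on_nonneg by blast
 \<comment> \<open>Per unit of |y - x| there are three errors: L \<epsilon> for moving the direction
   w to d in F, \<epsilon> for the derivative along d, and |a| \<epsilon> for moving d back to w in
   the linear part.\<close>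
 define \<epsilon> where "\<epsilon> = e / (L + norm a + 1)"
 have den: "L + norm a + 1 > 0" using L0 by (smt (verit) norm_ge_zero)
 then have \<epsilon>: "\<epsilon> > 0" using e by (simp add: \<epsilon>_def)
 have "sphere (0::'a) 1 \<subseteq> (\<Union>d\<in>S. ball d \<epsilon>)"
 proof
  fix u :: 'a
  obtain d where "d \<in> S" "d \<in> ball u \<epsilon>" using S[of "ball u \<epsilon>"] \<epsilon> by auto
  then show "u \<in> (\<Union>d\<in>S. ball d \<epsilon>)" by (auto simp: dist_commute)
 qed
 then obtain T where T: "T \<subseteq> S" "finite T" "sphere (0::'a) 1 \<subseteq> (\<Union>d\<in>T. ball d \<epsilon>)"
  using compactE_image[OF compact_sphere, of S "\<lambda>d. ball d \<epsilon>" 0 1] by auto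
 have "\<exists>\<delta>>0. \<forall>s. \<bar>s\<bar> < \<delta> --> \<bar>F (x + s *R d) - F x - s * (d \<bullet> a)\<bar> \<le> \<epsilon> * \<bar>s\<bar>" if "d \<in> T" for d
 proof -
  have "((\<lambda>s. F (x + s *R d)) has_derivative (\<lambda>s. (d \<bullet> a) * s)) (at 0)"
   using der[of d] that T(1) by (auto simp: has_field_derivative_def)
  then obtain \<delta> where "\<delta> > 0" "!!s. norm (s - 0) < \<delta> ==>
    norm (F (x + s *R d) - F (x + 0 *R d) - (d \<bullet> a) * (s - 0)) \<le> \<epsilon> * norm (s - 0)"
   unfolding has_derivative_at_alt using \<epsilon> by blast
  then show ?thesis by (intro exI[of _ \<delta>]) (auto simp: mult.commute)
 qed
 then obtain \<delta> where \<delta>: "!!d. d \<in> T ==> \<delta> d > 0"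
  "!!d s. d \<in> T ==> \<bar>s\<bar> < \<delta> d ==> \<bar>F (x + s *R d) - F x - s * (d \<bullet> a)\<bar> \<le> \<epsilon> * \<bar>s\<bar>" by metis
 define \<delta>0 where "\<delta>0 = Min (insert 1 (\<delta> ` T))"
 have \<delta>0: "\<delta>0 > 0" "!!d. d \<in> T ==> \<delta>0 \<le> \<delta> d" using T(2) \<delta>(1) by (auto simp: \<delta>0_def)
 show "\<exists>\<delta>>0. \<forall>y. norm (y - x) < \<delta> --> norm (F y - F x - (y - x) \<bullet> a) \<le> e * norm (y - x)"
 proof (intro exI[of _ \<delta>0] conjI allI impI \<delta>0(1))
  fix y assume y: "norm (y - x) < \<delta>0"
  show "norm (F y - F x - (y - x) \<bullet> a) \<le> e * norm (y - x)"
  proof (cases "y = x")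
   case False
   define s where "s = norm (y - x)"
   define w where "w = (y - x) /\<^sub>R s"
   have s: "s > 0" using False by (simp add: s_def)
   have yw: "y = x + s *R w" using s by (simp add: w_def)
   have "norm w = 1" using s by (simp add: w_def s_def)
   then obtain d where d: "d \<in> T" "norm (d - w) < \<epsilon>" using T(3) by (auto simp: dist_norm subset_iff)
   have 1: "\<bar>F y - F (x + s *R d)\<bar> \<le> L * s * \<epsilon>"
   proof -
    have "\<bar>F y - F (x + s *R d)\<bar> \<le> L * norm (s *R (w - d))"
     using lipschitz_onD[OF F, of y "x + s *R d"] by (simp add: yw dist_norm dist_real_def scaleR_diff_right)
    also have "\<dots> = L * s * norm (d - w)" using s by (simp add: norm_minus_commute)
    also have "\<dots> \<le> L * s * \<epsilon>" using d(2) L0 s by (intro mult_left_mono) auto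
    finally show ?thesis .
   qed
   have 2: "\<bar>F (x + s *R d) - F x - s * (d \<bullet> a)\<bar> \<le> \<epsilon> * s"
    using \<delta>(2)[OF d(1), of s] \<delta>0(2)[OF d(1)] y s by (simp add: s_def)
   have 3: "\<bar>s * (d \<bullet> a) - (y - x) \<bullet> a\<bar> \<le> s * norm a * \<epsilon>"
   proof -
    have "\<bar>s * (d \<bullet> a) - (y - x) \<bullet> a\<bar> = s * \<bar>(d - w) \<bullet> a\<bar>"
     using s by (simp add: yw inner_diff_left right_diff_distrib[symmetric] abs_mult)
    also have "\<dots> \<le> s * (norm (d - w) * norm a)" using s Cauchy_Schwarz_ineq2 by (intro mult_left_mono) auto
    also have "\<dots> \<le> s * (\<epsilon> * norm a)" using s d(2) by (intro mult_left_mono mult_right_mono) auto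
    finally show ?thesis by (simp add: mult_ac)
   qed
   have "\<bar>F y - F x - (y - x) \<bullet> a\<bar> \<le> L * s * \<epsilon> + \<epsilon> * s + s * norm a * \<epsilon>" using 1 2 3 by linarith
   also have "\<dots> = (\<epsilon> * (L + norm a + 1)) * s" by (simp add: algebra_simps)
   also have "\<epsilon> * (L + norm a + 1) = e" using den by (simp add: \<epsilon>_def)
   finally show ?thesis by (simp add: s_def)
  qed simp
 qed
qed

text \<open>Outside one null set the derivatives exist in all directions of a countable dense set
  and depend linearly on the direction; by \<open>Lipschitz_differentiable_dense\<close> this is
  enough.\<close>

theorem Rademacher:
 fixes F :: "'a::euclidean_space => real"
 assumes F: "L-lipschitz_on UNIV F"
 shows "AE x in lborel. F differentiable (at x)"
proof -
 have Fc: "continuous_on UNIV F" by (rule lipschitz_on_continuous_on[OF F])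
 have [measurable]: "F \<in> Borel" by (rule borel_measurable_continuous_onI[OF Fc])
 have L0: "L \<ge> 0" using F lipschitz_on_nonneg by blast
 define q where "q v n x = (F (x + (1 / (real n + 1)) *R v) - F x) / (1 / (real n + 1))" for v x and n :: nat
 \<comment> \<open>The limit along one sequence of steps, with value 0 where it fails to exist:
   Borel and bounded everywhere, and equal to the directional derivative wherever that
   exists.\<close>
 define D where "D v x = (if Cauchy (\<lambda>n. q v n x) then lim (\<lambda>n. q v n x) else 0)" for v x
 have qm[measurable]: "(\<lambda>x. q v n x) \<in> Borel" for v n unfolding q_def by measurable
 have Dm: "D v \<in> Borel" for v unfolding D_def[abs_def] by measurable
 have qb: "\<bar>q v n x\<bar> \<le> L * norm v" for v n x
 proof -
  define t where "t = 1 / (real n + 1)"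
  have t: "t > 0" by (simp add: t_def)
  have "\<bar>F (x + t *R v) - F x\<bar> \<le> L * norm v * t"
   using lipschitz_onD[OF F, of "x + t *R v" x] t by (simp add: dist_norm dist_real_def mult_ac)
  then show ?thesis using t unfolding q_def t_def[symmetric] by (simp add: abs_divide pos_divide_le_eq)
 qed
 have Db: "\<bar>D v x\<bar> \<le> L * norm v" for v x
 proof (cases "Cauchy (\<lambda>n. q v n x)")
  case True
  then have "(\<lambda>n. \<bar>q v n x\<bar>) ----> \<bar>D v x\<bar>" by (auto simp: D_def Cauchy_convergent_iff convergent_LIMSEQ_iff intro!: tendsto_intros)
  then show ?thesis by (rule LIMSEQ_le_const2) (use qb in auto)
 qed (use L0 in \<open>simp add: D_def\<close>)
 have n0: "filterlim (\<lambda>n. 1 / (real n + 1)) (at 0) sequentially"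
  using LIMSEQ_inverse_real_of_nat by (auto simp: filterlim_at inverse_eq_divide add.commute)
 have der: "AE x in lborel. ((\<lambda>s. F (x + s *R v)) has_real_derivative D v x) (at 0)" for v
  using Lipschitz_directional_derivative_AE[OF F, of v]
 proof eventually_elim
  case (elim x)
  then obtain l where l: "((\<lambda>s. F (x + s *R v)) has_real_derivative l) (at 0)" by blast
  then have "((\<lambda>h. (F (x + h *R v) - F x) / h) \<longlongrightarrow> l) (at 0)" by (simp add: has_field_derivative_iff)
  from filterlim_compose[OF this n0] have "(\<lambda>n. q v n x) ----> l" by (simp add: q_def)
  then have "D v x = l" by (auto simp: D_def limI LIMSEQ_imp_Cauchy)
  with l show ?case by simp
 qed
 obtain S :: "'a set" where S: "countable S" "!!X. open X ==> X \<noteq> {} ==> \<exists>d\<in>S. d \<in> X"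
  using countable_dense_setE by blast
 have "AE x in lborel. \<forall>v\<in>S. ((\<lambda>s. F (x + s *R v)) has_real_derivative D v x) (at 0) \<and>
   D v x = (\<Sum>b\<in>Basis. (v \<bullet> b) * D b x)"
  using S(1) der Lipschitz_derivative_linear_AE[OF F Dm der Db]
  by (auto simp: AE_ball_countable)
 then show ?thesis
 proof eventually_elim
  case (elim x)
  define a where "a = (\<Sum>b\<in>Basis. D b x *R b)"
  have "(F has_derivative (\<lambda>v. v \<bullet> a)) (at x)"
  proof (rule Lipschitz_differentiable_dense[OF F S(2)])
   fix v assume "v \<in> S"
   then show "((\<lambda>s. F (x + s *R v)) has_real_derivative v \<bullet> a) (at 0)"
    using elim by (auto simp: a_def inner_sum_right mult.commute)
  qed
  then show ?case by (auto simp: differentiable_def)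
 qed
qed

lemma AE_lborel_local:
 fixes W :: "'a::euclidean_space set"
 assumes "!!x. x \<in> W ==> \<exists>U. open U \<and> x \<in> U \<and> (AE y in lborel. y \<in> U --> P y)"
 shows "AE x in lborel. x \<in> W --> P x"
proof -
 define \<F> where "\<F> = {U. open U \<and> (AE y in lborel. y \<in> U --> P y)}"
 obtain \<F>' where F': "\<F>' \<subseteq> \<F>" "countable \<F>'" "\<Union>\<F>' = \<Union>\<F>"
  using Lindelof[of \<F>] unfolding \<F>_def by blast
 have "AE x in lborel. \<forall>U\<in>\<F>'. x \<in> U --> P x"
  using F' by (subst AE_ball_countable) (auto simp: \<F>_def)
 moreover have "W \<subseteq> \<Union>\<F>'" using assms unfolding F'(3) \<F>_def by blast
 ultimately show ?thesis by (elim eventually_mono) blast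
qed

text \<open>Near each point F is extended to the whole space by composing it with the nearest-point
  projection onto a small closed ball, which is 1-Lipschitz. Countably many such neighbourhoods
  cover W.\<close>

corollary Rademacher_local:
 fixes F :: "'a::euclidean_space => real"
 assumes W: "open W" and F: "local_lipschitz {0::real} W (\<lambda>_. F)"
 shows "AE x in lborel. x \<in> W --> F differentiable (at x)"
proof (rule AE_lborel_local)
 fix x assume x: "x \<in> W"
 obtain u L where u: "u > 0" "L-lipschitz_on (cball x u \<inter> W) F"
  using local_lipschitzE[OF F _ x, of 0] by (metis IntI insertI1 mem_cball dist_self less_imp_le)
 obtain r where r: "r > 0" "cball x r \<subseteq> W" using W x open_contains_cball by blast
 define d where "d = min u r"
 have d: "d > 0" "cball x d \<subseteq> cball x u \<inter> W" using u(1) r by (auto simp: d_def)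
 have L: "L-lipschitz_on (cball x d) F" by (rule lipschitz_on_subset[OF u(2) d(2)])
 define G where "G = (\<lambda>y. F (closest_point (cball x d) y))"
 have "L-lipschitz_on UNIV G"
 proof (rule lipschitz_onI)
  show "0 \<le> L" using L lipschitz_on_nonneg by blast
  fix y z
  have c: "closest_point (cball x d) w \<in> cball x d" for w using d(1) by (intro closest_point_in_set) auto
  have "dist (G y) (G z) \<le> L * dist (closest_point (cball x d) y) (closest_point (cball x d) z)"
   unfolding G_def by (rule lipschitz_onD[OF L c c])
  also have "\<dots> \<le> L * dist y z"
   using d(1) \<open>0 \<le> L\<close> by (intro mult_left_mono closest_point_lipschitz) auto
  finally show "dist (G y) (G z) \<le> L * dist y z" .
 qed
 from Rademacher[OF this] have "AE y in lborel. y \<in> ball x d --> F differentiable (at y)"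
 proof eventually_elim
  case (elim y)
  show ?case
  proof
   assume y: "y \<in> ball x d"
   from elim obtain D where "(G has_derivative D) (at y)" by (auto simp: differentiable_def)
   then have "(F has_derivative D) (at y)"
   proof (rule has_derivative_transform_within_open[OF _ open_ball y])
    fix z assume "z \<in> ball x d"
    then show "G z = F z" by (simp add: G_def closest_point_self)
   qed
   then show "F differentiable (at y)" by (auto simp: differentiable_def)
  qed
 qed
 then show "\<exists>U. open U \<and> x \<in> U \<and> (AE y in lborel. y \<in> U --> F differentiable (at y))"
  using d(1) by (intro exI[of _ "ball x d"]) auto
qed

section \<open>Tangent vectors and the metric in charts\<close>

text \<open>Extends \<open>coord_vector\<close> from the coordinate basis to all component vectors w
  in the chart c.\<close>

definition chart_vector ::
 "('a, 'n::finite) chart set => ('a, 'n) chart => 'a => real ^ 'n => ('a, 'n) tangent" where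
 "chart_vector A c p w = (\<lambda>c'. if c' \<in> A \<and> p \<in> fst c' then transition_derivative c c' p w else 0)"

section \<open>Charts, transition maps and tangent vectors\<close>

locale manifold =
 fixes A :: "('a::{t2_space, second_countable_topology}, 'n::finite) chart set"
 assumes atlas: "smooth_atlas A"
begin

lemma chart_exists: "\<exists>c\<in>A. p \<in> fst c"
 using atlas unfolding smooth_atlas_def by blast

lemma chart_open: "c \<in> A ==> open (fst c)" "c \<in> A ==> open (snd c ` fst c)"
 using atlas unfolding smooth_atlas_def by blast+

lemma chart_homeo: "c \<in> A ==> homeomorphism (fst c) (snd c ` fst c) (snd c) (chart_inv c)"
 using atlas unfolding smooth_atlas_def by blast

lemma chart_cont: "c \<in> A ==> continuous_on (fst c) (snd c)"
 "c \<in> A ==> continuous_on (snd c ` fst c) (chart_inv c)"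
 using chart_homeo unfolding homeomorphism_def by blast+

lemma chart_inv_chart [simp]: "c \<in> A ==> p \<in> fst c ==> chart_inv c (snd c p) = p"
 by (rule homeomorphism_apply1[OF chart_homeo])

lemma chart_chart_inv [simp]: "c \<in> A ==> x \<in> snd c ` fst c ==> snd c (chart_inv c x) = x"
 by (rule homeomorphism_apply2[OF chart_homeo])

lemma chart_inv_in [simp]: "c \<in> A ==> x \<in> snd c ` fst c ==> chart_inv c x \<in> fst c"
 by auto

lemma chart_inj: "c \<in> A ==> inj_on (snd c) (fst c)"
 by (rule inj_on_inverseI[of _ "chart_inv c"]) simp

lemma chart_image_open:
 assumes "c \<in> A" "open S" "S \<subseteq> fst c"
 shows "open (snd c ` S)"
proof -
 have "openin (top_of_set (fst c)) S" using assms chart_open(1)[OF assms(1)] by (simp add: openin_open_eq)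
 from homeomorphism_imp_open_map[OF chart_homeo[OF assms(1)] this]
 show ?thesis using chart_open(2)[OF assms(1)] by (simp add: openin_open_eq)
qed

lemma chart_inv_image_open:
 assumes "c \<in> A" "open S" "S \<subseteq> snd c ` fst c"
 shows "open (chart_inv c ` S)"
proof -
 have "openin (top_of_set (snd c ` fst c)) S" using assms chart_open(2)[OF assms(1)] by (simp add: openin_open_eq)
 from homeomorphism_imp_open_map[OF homeomorphism_symD[OF chart_homeo[OF assms(1)]] this]
 show ?thesis using chart_open(1)[OF assms(1)] by (simp add: openin_open_eq)
qed

lemma transition_domain_open: "c \<in> A ==> c' \<in> A ==> open (snd c ` (fst c \<inter> fst c'))"
 by (intro chart_image_open open_Int chart_open) auto

lemma transition_smooth:
 assumes "c \<in> A" "c' \<in> A" "x \<in> snd c ` (fst c \<inter> fst c')"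
 shows "((snd c' \<circ> chart_inv c) has_derivative transition_derivative c c' (chart_inv c x)) (at x)"
proof -
 have "smooth_on (snd c ` (fst c \<inter> fst c')) (snd c' \<circ> chart_inv c)"
  using atlas assms unfolding smooth_atlas_def by blast
 then have "Ck_on (Suc 0) (snd c' \<circ> chart_inv c) (snd c ` (fst c \<inter> fst c'))" unfolding smooth_on_def by blast
 then have "(snd c' \<circ> chart_inv c) differentiable (at x)" using assms(3) unfolding Ck_on.simps(2) by blast
 moreover have "snd c (chart_inv c x) = x" using assms by auto
 ultimately show ?thesis unfolding transition_derivative_def by (simp add: frechet_derivative_works)
qed

lemma transition_derivative_cont:
 assumes "c \<in> A" "c' \<in> A"
 shows "continuous_on (snd c ` (fst c \<inter> fst c')) (\<lambda>x. transition_derivative c c' (chart_inv c x) v)"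
proof -
 have "smooth_on (snd c ` (fst c \<inter> fst c')) (snd c' \<circ> chart_inv c)"
  using atlas assms unfolding smooth_atlas_def by blast
 then have "Ck_on (Suc 0) (snd c' \<circ> chart_inv c) (snd c ` (fst c \<inter> fst c'))" unfolding smooth_on_def by blast
 then have "continuous_on (snd c ` (fst c \<inter> fst c')) (\<lambda>x. dderiv v (snd c' \<circ> chart_inv c) x)" by simp
 then show ?thesis
  by (rule continuous_on_eq) (use assms in \<open>auto simp: transition_derivative_def\<close>)
qed

lemma transition_has_derivative:
 assumes "c \<in> A" "c' \<in> A" "p \<in> fst c" "p \<in> fst c'"
 shows "((snd c' \<circ> chart_inv c) has_derivative transition_derivative c c' p) (at (snd c p))"
 using transition_smooth[of c c' "snd c p"] assms by auto

lemma transition_linear: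
 assumes "c \<in> A" "c' \<in> A" "p \<in> fst c" "p \<in> fst c'"
 shows "linear (transition_derivative c c' p)"
 by (rule has_derivative_linear[OF transition_has_derivative[OF assms]])

lemma transition_self:
 assumes "c \<in> A" "p \<in> fst c"
 shows "transition_derivative c c p v = v"
proof -
 have "((\<lambda>x. x) has_derivative (\<lambda>v. v)) (at (snd c p))" by simp
 then have "((snd c \<circ> chart_inv c) has_derivative (\<lambda>v. v)) (at (snd c p))"
  by (rule has_derivative_transform_within_open[OF _ chart_open(2)[OF assms(1)]]) (use assms in auto)
 from has_derivative_unique[OF transition_has_derivative[OF assms(1,1,2,2)] this] show ?thesis by metis
qed

lemma transition_cocycle:
 assumes c: "c \<in> A" "c' \<in> A" "c'' \<in> A" and p: "p \<in> fst c" "p \<in> fst c'" "p \<in> fst c''"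
 shows "transition_derivative c' c'' p (transition_derivative c c' p v) = transition_derivative c c'' p v"
proof -
 have "((snd c'' \<circ> chart_inv c') has_derivative transition_derivative c' c'' p) (at ((snd c' \<circ> chart_inv c) (snd c p)))"
  using transition_has_derivative[OF c(2,3) p(2,3)] c p by simp
 from has_derivative_compose[OF transition_has_derivative[OF c(1,2) p(1,2)] this]
 have "((\<lambda>x. (snd c'' \<circ> chart_inv c') ((snd c' \<circ> chart_inv c) x)) has_derivative
   (\<lambda>v. transition_derivative c' c'' p (transition_derivative c c' p v))) (at (snd c p))" .
 then have "((snd c'' \<circ> chart_inv c) has_derivative
   (\<lambda>v. transition_derivative c' c'' p (transition_derivative c c' p v))) (at (snd c p))"
  by (rule has_derivative_transform_within_open[OF _ transition_domain_open[OF c(1,2)]]) (use c p in auto)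
 from has_derivative_unique[OF transition_has_derivative[OF c(1,3) p(1,3)] this] show ?thesis by metis
qed

lemma coord_vector_eq: "coord_vector A c p i = chart_vector A c p (axis i 1)"
 by (simp add: coord_vector_def chart_vector_def)

lemma chart_vector_in:
 assumes "c \<in> A" "p \<in> fst c"
 shows "chart_vector A c p w \<in> tangent_space A p"
 unfolding tangent_space_def
proof (intro CollectI conjI allI ballI impI)
 fix c' assume "c' \<notin> A \<or> p \<notin> fst c'"
 then show "chart_vector A c p w c' = 0" by (auto simp: chart_vector_def)
next
 fix c' c'' assume c': "c' \<in> A" "c'' \<in> A" "p \<in> fst c' \<inter> fst c''"
 have "transition_derivative c' c'' p (transition_derivative c c' p w) = transition_derivative c c'' p w"
  by (rule transition_cocycle) (use assms c' in auto)
 then show "chart_vector A c p w c'' = transition_derivative c' c'' p (chart_vector A c p w c')"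
  using c' by (simp add: chart_vector_def)
qed

lemma chart_vector_self: "c \<in> A ==> p \<in> fst c ==> chart_vector A c p w c = w"
 by (simp add: chart_vector_def transition_self)

lemma tangent_eq_chart_vector:
 assumes "v \<in> tangent_space A p" "c \<in> A" "p \<in> fst c"
 shows "v = chart_vector A c p (v c)"
proof
 fix c'
 show "v c' = chart_vector A c p (v c) c'"
 proof (cases "c' \<in> A \<and> p \<in> fst c'")
  case True
  then have "p \<in> fst c \<inter> fst c'" using assms(3) by simp
  then have "v c' = transition_derivative c c' p (v c)"
   using assms(1,2) True unfolding tangent_space_def by blast
  then show ?thesis using True by (simp add: chart_vector_def)
 next
  case False
  then have "v c' = 0" using assms(1) unfolding tangent_space_def by blast
  then show ?thesis using False by (auto simp: chart_vector_def)
 qed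
qed

lemma chart_vector_linear:
 assumes "c \<in> A" "p \<in> fst c"
 shows "chart_vector A c p (a *R w + z) = (\<lambda>c'. a *R chart_vector A c p w c' + chart_vector A c p z c')"
proof
 fix c'
 show "chart_vector A c p (a *R w + z) c' = a *R chart_vector A c p w c' + chart_vector A c p z c'"
 proof (cases "c' \<in> A \<and> p \<in> fst c'")
  case True
  then have "linear (transition_derivative c c' p)" using transition_linear assms by blast
  then show ?thesis using True by (simp add: chart_vector_def linear_add linear_cmul)
 qed (auto simp: chart_vector_def)
qed

lemma chart_vector_0: "c \<in> A ==> p \<in> fst c ==> chart_vector A c p 0 = (\<lambda>_. 0)"
 by (rule ext) (auto simp: chart_vector_def linear_0[OF transition_linear])

lemma zero_in_tangent: "(\<lambda>_. 0) \<in> tangent_space A p"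
proof -
 obtain c where c: "c \<in> A" "p \<in> fst c" using chart_exists by blast
 show ?thesis using chart_vector_in[OF c, of 0] chart_vector_0[OF c] by simp
qed

lemma tangent_lin:
 assumes "v \<in> tangent_space A p" "w \<in> tangent_space A p"
 shows "(\<lambda>c. a *R v c + w c) \<in> tangent_space A p"
proof -
 obtain c where c: "c \<in> A" "p \<in> fst c" using chart_exists by blast
 define vc where "vc = v c"
 define wc where "wc = w c"
 have v: "v = chart_vector A c p vc" and w: "w = chart_vector A c p wc"
  unfolding vc_def wc_def by (rule tangent_eq_chart_vector[OF assms(1) c], rule tangent_eq_chart_vector[OF assms(2) c])
 show ?thesis unfolding v w chart_vector_linear[OF c, symmetric] by (rule chart_vector_in[OF c])
qed

lemma chart_image_eq: "c \<in> A ==> B \<subseteq> fst c ==> snd c ` B = {x \<in> snd c ` fst c. chart_inv c x \<in> B}"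
proof (intro set_eqI iffI)
 fix x assume c: "c \<in> A" "B \<subseteq> fst c" and x: "x \<in> snd c ` B"
 then obtain p where "p \<in> B" "x = snd c p" by blast
 then show "x \<in> {x \<in> snd c ` fst c. chart_inv c x \<in> B}" using c by auto
next
 fix x assume c: "c \<in> A" "B \<subseteq> fst c" and x: "x \<in> {x \<in> snd c ` fst c. chart_inv c x \<in> B}"
 then have "x = snd c (chart_inv c x)" by simp
 then show "x \<in> snd c ` B" using x by blast
qed

lemma chart_inv_image_eq: "c \<in> A ==> S \<subseteq> snd c ` fst c ==> chart_inv c ` S = {p \<in> fst c. snd c p \<in> S}"
proof (intro set_eqI iffI)
 fix p assume c: "c \<in> A" "S \<subseteq> snd c ` fst c" and p: "p \<in> chart_inv c ` S"
 then obtain x where "x \<in> S" "p = chart_inv c x" by blast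
 then show "p \<in> {p \<in> fst c. snd c p \<in> S}" using c by auto
next
 fix p assume c: "c \<in> A" "S \<subseteq> snd c ` fst c" and p: "p \<in> {p \<in> fst c. snd c p \<in> S}"
 then have "p = chart_inv c (snd c p)" by simp
 then show "p \<in> chart_inv c ` S" using p by blast
qed

lemma countable_atlas:
 obtains C :: "nat => ('a, 'n) chart" where "!!n. C n \<in> A" "(\<Union>n. fst (C n)) = UNIV"
proof -
 have "!!S. S \<in> fst ` A ==> openin (top_of_set UNIV) S" using chart_open(1) by auto
 from Lindelof_openin[OF this] obtain \<F> where F: "\<F> \<subseteq> fst ` A" "countable \<F>" "\<Union>\<F> = \<Union>(fst ` A)" by metis
 have UF: "\<Union>\<F> = UNIV" using F(3) chart_exists by auto
 then have ne: "\<F> \<noteq> {}" by auto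
 define C where "C n = (SOME c. c \<in> A \<and> fst c = from_nat_into \<F> n)" for n
 have C: "C n \<in> A \<and> fst (C n) = from_nat_into \<F> n" for n
 proof -
  have "from_nat_into \<F> n \<in> fst ` A" using F(1) from_nat_into[OF ne] by blast
  then have "\<exists>c. c \<in> A \<and> fst c = from_nat_into \<F> n" by auto
  then show ?thesis unfolding C_def by (rule someI_ex)
 qed
 have "(\<Union>n. fst (C n)) = UNIV"
  using C UF range_from_nat_into[OF ne F(2)] by simp
 with C show ?thesis by (intro that[of C]) auto
qed

lemma chart_image_borel:
 assumes "c \<in> A" "B \<in> sets borel" "B \<subseteq> fst c"
 shows "snd c ` B \<in> sets borel"
proof -
 have m: "(\<lambda>x. if x \<in> snd c ` fst c then chart_inv c x else undefined) \<in> Borel"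
  using chart_cont(2)[OF assms(1)] chart_open(2)[OF assms(1)]
  by (intro borel_measurable_continuous_on_if) auto
 have "snd c ` B = (snd c ` fst c) \<inter> ((\<lambda>x. if x \<in> snd c ` fst c then chart_inv c x else undefined) -` B \<inter> space borel)"
  unfolding chart_image_eq[OF assms(1,3)] by auto
 then show ?thesis using measurable_sets[OF m assms(2)] chart_open(2)[OF assms(1)] by auto
qed

lemma chart_inv_image_borel:
 assumes "c \<in> A" "S \<in> sets borel" "S \<subseteq> snd c ` fst c"
 shows "chart_inv c ` S \<in> sets borel"
proof -
 have m: "(\<lambda>x. if x \<in> fst c then snd c x else 0) \<in> Borel"
  using chart_cont(1)[OF assms(1)] chart_open(1)[OF assms(1)]
  by (intro borel_measurable_continuous_on_if) auto
 have "chart_inv c ` S = (fst c) \<inter> ((\<lambda>x. if x \<in> fst c then snd c x else 0) -` S \<inter> space borel)"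
  unfolding chart_inv_image_eq[OF assms(1,3)] by auto
 then show ?thesis using measurable_sets[OF m assms(2)] chart_open(1)[OF assms(1)] by auto
qed

text \<open>Supplies the compact coordinate neighbourhoods on which the metric is compared with the
  Euclidean one.\<close>

lemma coordinate_ball:
 assumes "open S" "p \<in> S" and c: "c \<in> A" "p \<in> fst c"
 obtains r where "r > 0" "cball (snd c p) r \<subseteq> snd c ` fst c" "chart_inv c ` cball (snd c p) r \<subseteq> S"
  "compact (chart_inv c ` cball (snd c p) r)" "open (chart_inv c ` ball (snd c p) r)"
  "p \<in> chart_inv c ` ball (snd c p) r"
proof -
 have "open (snd c ` (S \<inter> fst c))" using assms(1) chart_open(1)[OF c(1)] c(1) by (intro chart_image_open open_Int) auto
 moreover have "snd c p \<in> snd c ` (S \<inter> fst c)" using assms by auto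
 ultimately obtain r where r: "r > 0" "cball (snd c p) r \<subseteq> snd c ` (S \<inter> fst c)"
  using open_contains_cball by blast
 have sub: "cball (snd c p) r \<subseteq> snd c ` fst c" using r(2) by auto
 have "chart_inv c ` cball (snd c p) r \<subseteq> S"
 proof
  fix y assume "y \<in> chart_inv c ` cball (snd c p) r"
  then obtain z where "z \<in> S \<inter> fst c" "y = chart_inv c (snd c z)" using r(2) by blast
  then show "y \<in> S" using c by simp
 qed
 moreover have "compact (chart_inv c ` cball (snd c p) r)"
  using sub chart_cont(2)[OF c(1)] continuous_on_subset by (intro compact_continuous_image) auto
 moreover have "open (chart_inv c ` ball (snd c p) r)"
  using sub ball_subset_cball by (intro chart_inv_image_open[OF c(1)]) auto
 moreover have "p \<in> chart_inv c ` ball (snd c p) r"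
  using r(1) c by (intro image_eqI[of _ _ "snd c p"]) auto
 ultimately show ?thesis using r(1) sub that by blast
qed

end

section \<open>The metric in coordinates\<close>

locale riemannian = manifold A for A :: "('a::{t2_space, second_countable_topology}, 'n::finite) chart set" +
 fixes g :: "('a, 'n) metric"
 assumes metric: "riemannian_metric A g"
begin

abbreviation G :: "('a, 'n) chart => 'a => real ^ 'n ^ 'n" where
 "G \<equiv> metric_matrix A g"

lemma g_sym: "v \<in> tangent_space A p ==> w \<in> tangent_space A p ==> g p v w = g p w v"
 using metric unfolding riemannian_metric_def by blast

lemma g_lin:
 "v \<in> tangent_space A p ==> w \<in> tangent_space A p ==> z \<in> tangent_space A p ==>
  g p (\<lambda>c. a *R v c + w c) z = a * g p v z + g p w z"
 using metric unfolding riemannian_metric_def by blast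

lemma g_pos: "v \<in> tangent_space A p ==> v \<noteq> (\<lambda>_. 0) ==> g p v v > 0"
 using metric unfolding riemannian_metric_def by blast

lemma g_zero: "z \<in> tangent_space A p ==> g p (\<lambda>_. 0) z = 0"
 using g_lin[OF zero_in_tangent zero_in_tangent, of z p 1] by simp

lemma g_nonneg: "v \<in> tangent_space A p ==> g p v v \<ge> 0"
 using g_pos g_zero[OF zero_in_tangent] by (cases "v = (\<lambda>_. 0)") (auto simp: less_imp_le)

lemma g_lin_right:
 assumes "v \<in> tangent_space A p" "w \<in> tangent_space A p" "z \<in> tangent_space A p"
 shows "g p z (\<lambda>c. a *R v c + w c) = a * g p z v + g p z w"
 using g_lin[OF assms, of a] g_sym[OF assms(3) tangent_lin[OF assms(1,2)], of a]
  g_sym[OF assms(3) assms(1)] g_sym[OF assms(3) assms(2)] by simp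

lemma g_Cauchy_Schwarz:
 assumes v: "v \<in> tangent_space A p" and w: "w \<in> tangent_space A p"
 shows "(g p v w)\<^sup>2 \<le> g p v v * g p w w"
proof (cases "w = (\<lambda>_. 0)")
 case True
 then show ?thesis using g_zero v g_sym zero_in_tangent by simp
next
 case False
 then have pos: "g p w w > 0" using g_pos w by blast
 \<comment> \<open>The minimizer of the quadratic polynomial t \<mapsto> |t w + v|^2.\<close>
 define t where "t = - (g p v w) / g p w w"
 have "0 \<le> g p (\<lambda>c. t *R w c + v c) (\<lambda>c. t *R w c + v c)" by (intro g_nonneg tangent_lin v w)
 also have "\<dots> = t * (t * g p w w + g p w v) + (t * g p v w + g p v v)"
  using g_lin[OF w v tangent_lin[OF w v]] g_lin_right[OF w v w] g_lin_right[OF w v v] by simp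
 also have "\<dots> = t\<^sup>2 * g p w w + 2 * t * g p v w + g p v v"
  using g_sym[OF v w] by (simp add: algebra_simps power2_eq_square)
 also have "\<dots> = g p v v - (g p v w)\<^sup>2 / g p w w"
  using pos by (simp add: t_def power2_eq_square field_simps)
 finally show ?thesis using pos by (simp add: field_simps)
qed

lemma g_chart:
 assumes c: "c \<in> A" "p \<in> fst c"
 shows "g p (chart_vector A c p w) (chart_vector A c p z) = w \<bullet> (G c p *v z)"
proof -
 have lin1: "g p (chart_vector A c p (\<Sum>i\<in>I. (a i) *R e i)) X = (\<Sum>i\<in>I. a i * g p (chart_vector A c p (e i)) X)"
  if "finite I" "X \<in> tangent_space A p" for I a X and e :: "'i => real ^ 'n"
  using that(1)
 proof (induction I rule: finite_induct)
  case empty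
  then show ?case using chart_vector_0[OF c] g_zero[OF that(2)] by simp
 next
  case (insert i I)
  then show ?case
   using g_lin[OF chart_vector_in[OF c] chart_vector_in[OF c] that(2)] by (simp add: chart_vector_linear[OF c])
 qed
 have dec: "w = (\<Sum>i\<in>UNIV. (w $ i) *R axis i 1)" for w :: "real ^ 'n"
  by (simp add: vec_eq_iff axis_def if_distrib cong: if_cong)
 have "g p (chart_vector A c p w) (chart_vector A c p z)
   = (\<Sum>i\<in>UNIV. w $ i * g p (chart_vector A c p (axis i 1)) (chart_vector A c p z))"
  by (subst dec[of w]) (simp add: lin1 chart_vector_in[OF c])
 also have "\<dots> = (\<Sum>i\<in>UNIV. w $ i * (\<Sum>j\<in>UNIV. z $ j * g p (chart_vector A c p (axis j 1)) (chart_vector A c p (axis i 1))))"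
  by (subst dec[of z], subst g_sym) (auto simp: lin1 chart_vector_in[OF c])
 also have "\<dots> = w \<bullet> (G c p *v z)"
  using g_sym[OF chart_vector_in[OF c] chart_vector_in[OF c]]
  by (simp add: inner_vec_def matrix_vector_mult_def metric_matrix_def coord_vector_eq mult_ac)
 finally show ?thesis .
qed

lemma g_tangent:
 assumes "v \<in> tangent_space A p" "w \<in> tangent_space A p" "c \<in> A" "p \<in> fst c"
 shows "g p v w = v c \<bullet> (G c p *v w c)"
 using g_chart[OF assms(3,4), of "v c" "w c"]
 by (simp only: tangent_eq_chart_vector[OF assms(1,3,4), symmetric] tangent_eq_chart_vector[OF assms(2,3,4), symmetric])

lemma G_pos:
 assumes "c \<in> A" "p \<in> fst c" "w \<noteq> 0"
 shows "w \<bullet> (G c p *v w) > 0"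
proof -
 have "chart_vector A c p w \<noteq> (\<lambda>_. 0)" using chart_vector_self[OF assms(1,2), of w] assms(3) by auto
 from g_pos[OF chart_vector_in[OF assms(1,2)] this] show ?thesis using g_chart[OF assms(1,2), of w w] by simp
qed

lemma G_invertible:
 assumes "c \<in> A" "p \<in> fst c"
 shows "det (G c p) \<noteq> 0"
proof -
 have "\<forall>x. G c p *v x = 0 --> x = 0" using G_pos[OF assms] by (metis inner_zero_right less_irrefl)
 then show ?thesis by (metis invertible_det_nz invertible_left_inverse matrix_left_invertible_ker)
qed

lemma G_entry_cont: "c \<in> A ==> continuous_on (snd c ` fst c) (\<lambda>x. G c (chart_inv c x) $ i $ j)"
proof -
 assume "c \<in> A"
 then have "smooth_on (snd c ` fst c) (\<lambda>x. G c (chart_inv c x) $ i $ j)"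
  using metric unfolding riemannian_metric_def by blast
 then show ?thesis unfolding smooth_on_def by (metis Ck_on.simps(1))
qed

lemma G_quadratic_cont:
 "c \<in> A ==> continuous_on ((snd c ` fst c) \<times> UNIV) (\<lambda>(x, w). w \<bullet> (G c (chart_inv c x) *v w))"
 unfolding case_prod_unfold inner_vec_def matrix_vector_mult_def vec_lambda_beta inner_real_def
 by (intro continuous_intros continuous_on_compose2[OF G_entry_cont continuous_on_fst[OF continuous_on_id]]) auto

text \<open>With J the Jacobian matrix of the transition map, G = J^T G' J. The determinant of J is
  the factor that a change of variables will compensate.\<close>

lemma G_transition:
 assumes c: "c \<in> A" "c' \<in> A" and p: "p \<in> fst c" "p \<in> fst c'"
 shows "det (G c p) = (det (matrix (transition_derivative c c' p)))\<^sup>2 * det (G c' p)"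
proof -
 let ?J = "matrix (transition_derivative c c' p)"
 have lin: "linear (transition_derivative c c' p)" by (rule transition_linear[OF c p])
 have J: "?J *v w = transition_derivative c c' p w" for w
  using matrix_vector_mul(2)[OF lin] by metis
 have cv: "chart_vector A c p w = chart_vector A c' p (?J *v w)" for w
 proof -
  have "chart_vector A c p w c' = ?J *v w" using c p by (simp add: J chart_vector_def)
  then show ?thesis using tangent_eq_chart_vector[OF chart_vector_in[OF c(1) p(1)] c(2) p(2), of w] by metis
 qed
 have "w \<bullet> (G c p *v z) = w \<bullet> ((transpose ?J ** G c' p ** ?J) *v z)" for w z
 proof -
  define X where "X = G c' p *v (?J *v z)"
  have 1: "w \<bullet> (G c p *v z) = (?J *v w) \<bullet> X"
   using g_chart[OF c(1) p(1), of w z] g_chart[OF c(2) p(2), of "?J *v w" "?J *v z"]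
   unfolding cv[symmetric] X_def by simp
  have 2: "(?J *v w) \<bullet> X = w \<bullet> (X v* ?J)"
   unfolding inner_commute[of "?J *v w" X] inner_commute[of w] by (rule dot_lmul_matrix[symmetric])
  have 3: "X v* ?J = (transpose ?J ** G c' p ** ?J) *v z"
   unfolding X_def transpose_matrix_vector[symmetric] matrix_vector_mul_assoc matrix_mul_assoc ..
  show ?thesis unfolding 1 2 3 ..
 qed
 then have "G c p *v z = (transpose ?J ** G c' p ** ?J) *v z" for z
  by (rule vector_eq_ldot[THEN iffD1, OF allI])
 then have "G c p = transpose ?J ** G c' p ** ?J" unfolding matrix_eq by blast
 then show ?thesis by (simp add: det_mul det_transpose power2_eq_square mult_ac)
qed

end

section \<open>Change of variables and the Riemannian volume\<close>

text \<open>The library states the change of variables formula for coordinates indexed by a well-ordered finite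
 type; an arbitrary finite index type is transported to a well-ordered copy of it.\<close>

typedef ('n::finite) ordered_index = "UNIV :: 'n set" ..

text \<open>An arbitrary injection fixes the order. It has no geometric meaning: Lebesgue measure
  and determinants do not change when coordinates are relabelled.\<close>

definition index_rank :: "'n::finite => nat" where
 "index_rank = (SOME f. inj f)"

lemma inj_index_rank: "inj (index_rank :: 'n::finite => nat)"
proof -
 have "\<exists>f :: 'n => nat. inj f"
  using finite_imp_inj_to_nat_seg[OF finite, of UNIV] by auto
 then show ?thesis unfolding index_rank_def by (rule someI_ex)
qed

instantiation ordered_index :: (finite) linorder
begin

definition less_eq_ordered_index :: "'a ordered_index => 'a ordered_index => bool" where
 "less_eq_ordered_index a b \<longleftrightarrow> index_rank (Rep_ordered_index a) \<le> index_rank (Rep_ordered_index b)"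
definition less_ordered_index :: "'a ordered_index => 'a ordered_index => bool" where
 "less_ordered_index a b \<longleftrightarrow> index_rank (Rep_ordered_index a) < index_rank (Rep_ordered_index b)"

instance
 by standard (auto simp: less_eq_ordered_index_def less_ordered_index_def Rep_ordered_index_inject
   dest!: injD[OF inj_index_rank])

end

instance ordered_index :: (finite) finite
proof
 have "(UNIV :: 'a ordered_index set) = Abs_ordered_index ` UNIV"
  by (metis Rep_ordered_index_inverse surjI)
 then show "finite (UNIV :: 'a ordered_index set)" by (metis finite finite_imageI)
qed

instance ordered_index :: (finite) wellorder
proof
 fix P :: "'a ordered_index => bool" and a
 assume step: "!!x. (!!y. y < x ==> P y) ==> P x"
 show "P a"
  by (induction a rule: measure_induct_rule[of "\<lambda>a. index_rank (Rep_ordered_index a)"])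
   (rule step, simp add: less_ordered_index_def)
qed

abbreviation (input) "to_ord \<equiv> Abs_ordered_index"
abbreviation (input) "of_ord \<equiv> Rep_ordered_index"

lemma of_to [simp]: "Rep_ordered_index (Abs_ordered_index i) = i"
 by (simp add: Abs_ordered_index_inverse)

lemma to_of [simp]: "Abs_ordered_index (Rep_ordered_index i) = i"
 by (simp add: Rep_ordered_index_inverse)

definition reindex :: "real ^ 'n::finite => real ^ 'n ordered_index" where
 "reindex x = (\<chi> i. x $ Rep_ordered_index i)"

definition unreindex :: "real ^ 'n::finite ordered_index => real ^ 'n" where
 "unreindex y = (\<chi> i. y $ Abs_ordered_index i)"

lemma unreindex_reindex [simp]: "unreindex (reindex x) = x" "reindex (unreindex y) = y"
 by (simp_all add: reindex_def unreindex_def vec_eq_iff)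

lemma linear_reindex: "linear reindex" "linear unreindex"
 by (auto simp: reindex_def unreindex_def vec_eq_iff intro!: linearI)

lemma reindex_bounded_linear: "bounded_linear reindex" "bounded_linear unreindex"
 using linear_reindex linear_conv_bounded_linear by blast+

lemma reindex_measurable [measurable]: "reindex \<in> Borel" "unreindex \<in> Borel"
 using reindex_bounded_linear by (auto intro!: borel_measurable_continuous_onI linear_continuous_on)

lemma prod_Basis_vec: "(\<Prod>b\<in>(Basis :: (real ^ 'n::finite) set). f b) = (\<Prod>i\<in>UNIV. f (axis i 1))"
proof -
 have B: "(Basis :: (real ^ 'n) set) = (\<lambda>i. axis i 1) ` UNIV" by (auto simp: Basis_vec_def)
 have "inj (\<lambda>i::'n. axis i (1::real))" by (auto simp: inj_on_def axis_eq_axis)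
 then show ?thesis unfolding B by (subst prod.reindex) (auto simp: o_def)
qed

lemma distr_reindex: "distr lborel borel reindex = (lborel :: (real ^ 'n::finite ordered_index) measure)"
proof (rule lborel_eqI[symmetric])
 fix l u :: "real ^ 'n ordered_index"
 assume lu: "!!b. b \<in> Basis ==> l \<bullet> b \<le> u \<bullet> b"
 have le: "l $ i \<le> u $ i" for i using lu[of "axis i 1"] by (auto simp: inner_axis Basis_vec_def)
 have "reindex -` box l u = box (unreindex l) (unreindex u)"
 proof (intro set_eqI)
  fix x :: "real ^ 'n"
  have "x \<in> reindex -` box l u \<longleftrightarrow> (\<forall>i. l $ i < x $ Rep_ordered_index i \<and> x $ Rep_ordered_index i < u $ i)"
   by (simp add: mem_box_cart reindex_def)
  also have "\<dots> \<longleftrightarrow> (\<forall>i. l $ Abs_ordered_index i < x $ i \<and> x $ i < u $ Abs_ordered_index i)"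
   by (metis of_to to_of)
  finally show "x \<in> reindex -` box l u \<longleftrightarrow> x \<in> box (unreindex l) (unreindex u)"
   by (simp add: mem_box_cart unreindex_def)
 qed
 then have "emeasure (distr lborel borel reindex) (box l u) = emeasure lborel (box (unreindex l) (unreindex u))"
  by (subst emeasure_distr) auto
 also have "\<dots> = ennreal (\<Prod>b\<in>Basis. (unreindex u - unreindex l) \<bullet> b)"
  using le by (intro emeasure_lborel_box) (auto simp: Basis_vec_def inner_axis unreindex_def)
 also have "(\<Prod>b\<in>Basis. (unreindex u - unreindex l) \<bullet> b) = (\<Prod>i\<in>UNIV. u $ Abs_ordered_index i - l $ Abs_ordered_index i)"
  by (simp add: prod_Basis_vec inner_axis unreindex_def)
 also have "\<dots> = (\<Prod>i\<in>UNIV. u $ i - l $ i)"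
  by (rule prod.reindex_bij_witness[of _ Rep_ordered_index Abs_ordered_index]) auto
 also have "\<dots> = (\<Prod>b\<in>Basis. (u - l) \<bullet> b)" by (simp add: prod_Basis_vec inner_axis)
 finally show "emeasure (distr lborel borel reindex) (box l u) = ennreal (\<Prod>b\<in>Basis. (u - l) \<bullet> b)" .
qed simp

text \<open>In the Leibniz formula the permutations are conjugated by the relabelling, which
  preserves their sign.\<close>

lemma det_reindex:
 fixes M :: "real ^ 'n::finite ^ 'n"
 shows "det (\<chi> i j. M $ Rep_ordered_index i $ Rep_ordered_index j) = det M"
proof -
 let ?r = "Rep_ordered_index :: 'n ordered_index => 'n" and ?a = "Abs_ordered_index :: 'n => 'n ordered_index"
 have injs: "inj ?r" "inj ?a" by (metis injI to_of, metis injI of_to)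
 have bijs: "bij_betw ?r UNIV UNIV" "bij_betw ?a UNIV UNIV"
  using injs by (auto intro!: bijI surjI[of ?r ?a] surjI[of ?a ?r])
 let ?f = "\<lambda>p. map_permutation UNIV ?a p" and ?h = "\<lambda>p. map_permutation UNIV ?r p"
 have app: "?h p (?r i) = ?r (p i)" for p i by (rule map_permutation_apply) (use injs in auto)
 have "(\<Sum>p | p permutes UNIV. of_int (sign p) * (\<Prod>i\<in>UNIV. M $ i $ p i))
  = (\<Sum>p | p permutes UNIV. of_int (sign p) * (\<Prod>i\<in>UNIV. M $ ?r i $ ?r (p i)))"
 proof (rule sum.reindex_bij_witness[of _ ?h ?f])
  fix p :: "'n => 'n" assume p: "p \<in> {p. p permutes UNIV}"
  show 1: "?h (?f p) = p"
   using p bijs by (intro map_permutation_compose_inv[where A=UNIV and B=UNIV]) auto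
  show "?f p \<in> {p. p permutes UNIV}"
   using p by (auto intro!: map_permutation_permutes bijs)
  have "sign (?f p) = sign p" using p injs by (intro sign_map_permutation) auto
  moreover have "?r (?f p i) = p (?r i)" for i using app[of "?f p" i] 1 by simp
  moreover have "(\<Prod>i\<in>UNIV. M $ ?r i $ p (?r i)) = (\<Prod>i\<in>UNIV. M $ i $ p i)"
   by (rule prod.reindex_bij_witness[of _ ?a ?r]) auto
  ultimately show "of_int (sign (?f p)) * (\<Prod>i\<in>UNIV. M $ ?r i $ ?r (?f p i)) = of_int (sign p) * (\<Prod>i\<in>UNIV. M $ i $ p i)"
   by simp
 next
  fix p :: "'n ordered_index => 'n ordered_index" assume p: "p \<in> {p. p permutes UNIV}"
  show "?f (?h p) = p"
   using p bijs by (intro map_permutation_compose_inv[where A=UNIV and B=UNIV]) auto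
  show "?h p \<in> {p. p permutes UNIV}"
   using p by (auto intro!: map_permutation_permutes bijs)
 qed
 then show ?thesis by (simp add: det_def)
qed

text \<open>The change of variables theorem relates finite measure of the image to integrability of
  the Jacobian. The identity of extended values also covers the divergent case, in which neither
  side can be finite.\<close>

lemma emeasure_differentiable_image_ordered:
 fixes f :: "real ^ 'n::{finite,wellorder} => real ^ 'n::_"
 assumes S: "S \<in> sets borel" and der: "!!x. x \<in> S ==> (f has_derivative f' x) (at x)"
  and inj: "inj_on f S" and fS: "f ` S \<in> sets borel"
  and m: "(\<lambda>x. indicator S x * \<bar>det (matrix (f' x))\<bar>) \<in> Borel"
 shows "emeasure lborel (f ` S) = (\<integral>\<^sup>+x\<in>S. ennreal \<bar>det (matrix (f' x))\<bar> \<partial>lborel)"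
proof -
 have SL: "S \<in> sets lebesgue" using S by auto
 have der': "(f has_derivative f' x) (at x within S)" if "x \<in> S" for x
  using der[OF that] by (rule has_derivative_at_withinI)
 have nn: "(\<integral>\<^sup>+x\<in>S. ennreal \<bar>det (matrix (f' x))\<bar> \<partial>lborel) = (\<integral>\<^sup>+x. ennreal (indicator S x * \<bar>det (matrix (f' x))\<bar>) \<partial>lborel)"
  by (intro nn_integral_cong) (auto simp: indicator_def)
 have restr: "(\<lambda>x. indicat_real S x * \<bar>det (matrix (f' x))\<bar>) = (\<lambda>x. if x \<in> S then \<bar>det (matrix (f' x))\<bar> else 0)"
  by (auto simp: indicator_def)
 have il: "(\<lambda>x. \<bar>det (matrix (f' x))\<bar>) integrable_on S \<longleftrightarrow> (\<lambda>x. indicator S x * \<bar>det (matrix (f' x))\<bar>) integrable_on UNIV"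
  unfolding restr by (simp add: integrable_restrict_UNIV)
 have em: "emeasure lebesgue (f ` S) = emeasure lborel (f ` S)" using fS by simp
 show ?thesis
 proof (cases "(\<lambda>x. \<bar>det (matrix (f' x))\<bar>) integrable_on S")
  case True
  then have m1: "f ` S \<in> lmeasurable" and m2: "measure lebesgue (f ` S) = integral S (\<lambda>x. \<bar>det (matrix (f' x))\<bar>)"
   using measurable_differentiable_image_eq[OF SL der' inj] measure_differentiable_image_eq[OF SL der' inj] by auto
  have "((\<lambda>x. indicator S x * \<bar>det (matrix (f' x))\<bar>) has_integral integral S (\<lambda>x. \<bar>det (matrix (f' x))\<bar>)) UNIV"
   unfolding restr has_integral_restrict_UNIV using True by (rule integrable_integral)
  then have "(\<integral>\<^sup>+x. ennreal (indicator S x * \<bar>det (matrix (f' x))\<bar>) \<partial>lborel) = ennreal (integral S (\<lambda>x. \<bar>det (matrix (f' x))\<bar>))"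
   using m by (intro nn_integral_has_integral_lborel) auto
  then show ?thesis using m1 m2 em nn by (simp add: emeasure_eq_measure2)
 next
  case False
  then have "f ` S \<notin> lmeasurable" using measurable_differentiable_image_eq[OF SL der' inj] by auto
  then have 1: "emeasure lborel (f ` S) = \<infinity>"
   using fS em by (auto simp: fmeasurable_def less_top[symmetric])
  have "(\<integral>\<^sup>+x. ennreal (indicator S x * \<bar>det (matrix (f' x))\<bar>) \<partial>lborel) = \<infinity>"
  proof (rule ccontr)
   assume "(\<integral>\<^sup>+x. ennreal (indicator S x * \<bar>det (matrix (f' x))\<bar>) \<partial>lborel) \<noteq> \<infinity>"
   then have "integrable lborel (\<lambda>x. indicator S x * \<bar>det (matrix (f' x))\<bar>)"
    using m by (intro integrableI_nonneg) (auto simp: less_top[symmetric])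
   then show False using False il has_integral_integral_lborel has_integral_integrable by blast
  qed
  then show ?thesis using 1 nn by simp
 qed
qed

lemma emeasure_differentiable_image:
 fixes f :: "real ^ 'n::finite => real ^ 'n"
 assumes S[measurable]: "S \<in> sets borel" and der: "!!x. x \<in> S ==> (f has_derivative f' x) (at x)"
  and inj: "inj_on f S" and fS[measurable]: "f ` S \<in> sets borel"
  and m[measurable]: "(\<lambda>x. indicator S x * \<bar>det (matrix (f' x))\<bar>) \<in> Borel"
 shows "emeasure lborel (f ` S) = (\<integral>\<^sup>+x\<in>S. ennreal \<bar>det (matrix (f' x))\<bar> \<partial>lborel)"
proof -
 define F where "F = reindex \<circ> f \<circ> unreindex"
 define F' where "F' y = reindex \<circ> f' (unreindex y) \<circ> unreindex" for y
 have pre: "reindex ` X = unreindex -` X" for X :: "(real ^ 'n) set"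
  by (auto simp: image_iff) (metis unreindex_reindex(2))
 have meas: "reindex ` X \<in> sets borel" if "X \<in> sets borel" for X :: "(real ^ 'n) set"
  unfolding pre using measurable_sets[OF reindex_measurable(2) that] by simp
 have em: "emeasure lborel (reindex ` X) = emeasure lborel X" if "X \<in> sets borel" for X :: "(real ^ 'n) set"
 proof -
  have "emeasure lborel (reindex ` X) = emeasure (distr lborel borel reindex) (reindex ` X)" by (simp add: distr_reindex)
  also have "\<dots> = emeasure lborel (reindex -` reindex ` X)" using meas[OF that] by (subst emeasure_distr) auto
  also have "reindex -` reindex ` X = X" by (auto simp: image_iff) (metis unreindex_reindex(1))
  finally show ?thesis .
 qed
 have F_im: "F ` (reindex ` S) = reindex ` (f ` S)" by (auto simp: F_def image_iff)
 have det: "det (matrix (F' y)) = det (matrix (f' (unreindex y)))" for y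
 proof -
  have ax: "unreindex (axis j 1) = axis (Rep_ordered_index j) (1::real)" for j :: "'n ordered_index"
   by (auto simp: unreindex_def vec_eq_iff axis_def)
  have "matrix (F' y) = (\<chi> i j. matrix (f' (unreindex y)) $ Rep_ordered_index i $ Rep_ordered_index j)"
   by (simp add: matrix_def F'_def reindex_def vec_eq_iff ax)
  then show ?thesis by (simp only: det_reindex)
 qed
 have ind: "indicator (reindex ` S) y = indicator S (unreindex y)" for y :: "real ^ 'n ordered_index"
  unfolding pre by (simp add: indicator_def)
 have "emeasure lborel (f ` S) = emeasure lborel (F ` (reindex ` S))" by (simp add: F_im em fS)
 also have "\<dots> = (\<integral>\<^sup>+y\<in>reindex ` S. ennreal \<bar>det (matrix (F' y))\<bar> \<partial>lborel)"
 proof (rule emeasure_differentiable_image_ordered)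
  show "reindex ` S \<in> sets borel" "F ` reindex ` S \<in> sets borel" by (simp_all add: meas S F_im fS)
  show "inj_on F (reindex ` S)"
   using inj by (auto simp: F_def inj_on_def) (metis unreindex_reindex(1))
  show "(F has_derivative F' y) (at y)" if "y \<in> reindex ` S" for y
  proof -
   have "unreindex y \<in> S" using that by auto
   then have "(f has_derivative f' (unreindex y)) (at (unreindex y))" by (rule der)
   from has_derivative_compose[OF bounded_linear_imp_has_derivative[OF reindex_bounded_linear(2)] this]
   have "((\<lambda>y. f (unreindex y)) has_derivative (\<lambda>v. f' (unreindex y) (unreindex v))) (at y)" .
   from bounded_linear.has_derivative[OF reindex_bounded_linear(1) this]
   show ?thesis by (simp add: F_def F'_def o_def)
  qed
  have "(\<lambda>y. indicator S (unreindex y) * \<bar>det (matrix (f' (unreindex y)))\<bar>) \<in> Borel"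
   by (rule measurable_compose[OF reindex_measurable(2) m])
  then show "(\<lambda>y. indicator (reindex ` S) y * \<bar>det (matrix (F' y))\<bar>) \<in> Borel"
   unfolding ind det .
 qed
 also have "\<dots> = (\<integral>\<^sup>+y. ennreal (indicator S (unreindex y) * \<bar>det (matrix (f' (unreindex y)))\<bar>) \<partial>lborel)"
  unfolding det ind by (intro nn_integral_cong) (auto simp: indicator_def)
 also have "\<dots> = (\<integral>\<^sup>+x. ennreal (indicator S x * \<bar>det (matrix (f' x))\<bar>) \<partial>lborel)"
  unfolding distr_reindex[symmetric]
  by (subst nn_integral_distr) (auto intro!: measurable_compose[OF reindex_measurable(2)] m measurable_ennreal)
 also have "\<dots> = (\<integral>\<^sup>+x\<in>S. ennreal \<bar>det (matrix (f' x))\<bar> \<partial>lborel)"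
  by (intro nn_integral_cong) (auto simp: indicator_def)
 finally show ?thesis .
qed

text \<open>Pushing the measure with density |det f'| on S forward under f gives Lebesgue measure on
  the image of S. This is checked on Borel sets and then holds for every nonnegative
  integrand.\<close>

lemma nn_integral_change_of_variables:
 fixes f :: "real ^ 'n::finite => real ^ 'n" and h :: "real ^ 'n => ennreal"
 assumes S[measurable]: "S \<in> sets borel" and der: "!!x. x \<in> S ==> (f has_derivative f' x) (at x)"
  and inj: "inj_on f S" and fS: "!!B. B \<in> sets borel ==> B \<subseteq> S ==> f ` B \<in> sets borel"
  and m[measurable]: "(\<lambda>x. indicator S x * \<bar>det (matrix (f' x))\<bar>) \<in> Borel"
  and h[measurable]: "h \<in> Borel"
 shows "(\<integral>\<^sup>+y\<in>f ` S. h y \<partial>lborel) = (\<integral>\<^sup>+x\<in>S. ennreal \<bar>det (matrix (f' x))\<bar> * h (f x) \<partial>lborel)"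
proof -
 have [measurable]: "f ` S \<in> sets borel" using fS[of S] S by simp
 have fm: "(\<lambda>x. indicator S x *R f x) \<in> Borel"
  using der by (intro borel_measurable_continuous_on_indicator S)
   (meson continuous_at_imp_continuous_on has_derivative_continuous)
 \<comment> \<open>f is under control only on S. It is replaced by 0 off S, where the density D
   vanishes.\<close>
 define f1 where "f1 = (\<lambda>x. indicator S x *R f x)"
 have [measurable]: "f1 \<in> Borel" using fm by (simp add: f1_def)
 have f1: "x \<in> S ==> f1 x = f x" for x by (simp add: f1_def)
 define D where "D x = ennreal (indicator S x * \<bar>det (matrix (f' x))\<bar>)" for x
 have [measurable]: "D \<in> Borel" unfolding D_def[abs_def] by measurable
 let ?M = "distr (density lborel D) borel f1" and ?N = "density lborel (indicator (f ` S))"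
 have "?M = ?N"
 proof (rule measure_eqI)
  fix B assume "B \<in> sets ?M"
  then have B[measurable]: "B \<in> sets borel" by simp
  define E where "E = S \<inter> f1 -` B"
  have E[measurable]: "E \<in> sets borel" unfolding E_def using measurable_sets[of f1 borel borel B] by auto
  have fE: "f ` E = f ` S \<inter> B" by (auto simp: E_def f1)
  have "emeasure ?M B = (\<integral>\<^sup>+x. D x * indicator (f1 -` B) x \<partial>lborel)"
   using measurable_sets[of f1 borel borel B] by (subst emeasure_distr) (auto simp: emeasure_density)
  also have "\<dots> = (\<integral>\<^sup>+x\<in>E. ennreal \<bar>det (matrix (f' x))\<bar> \<partial>lborel)"
   by (intro nn_integral_cong) (auto simp: D_def E_def indicator_def)
  also have "\<dots> = emeasure lborel (f ` E)"
  proof (rule emeasure_differentiable_image[symmetric, OF E])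
   show "inj_on f E" using inj by (rule inj_on_subset) (auto simp: E_def)
   show "f ` E \<in> sets borel" by (rule fS[OF E]) (auto simp: E_def)
   have "(\<lambda>x. indicator E x * (indicator S x * \<bar>det (matrix (f' x))\<bar>)) \<in> Borel" by measurable
   moreover have "(\<lambda>x. indicator E x * (indicator S x * \<bar>det (matrix (f' x))\<bar>)) = (\<lambda>x. indicator E x * \<bar>det (matrix (f' x))\<bar>)"
    by (auto simp: E_def indicator_def)
   ultimately show "(\<lambda>x. indicator E x * \<bar>det (matrix (f' x))\<bar>) \<in> Borel" by simp
  qed (use der in \<open>auto simp: E_def\<close>)
  also have "\<dots> = emeasure ?N B"
  proof -
   have "emeasure ?N B = (\<integral>\<^sup>+y. indicator (f ` S \<inter> B) y \<partial>lborel)"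
    by (simp add: emeasure_density indicator_inter_arith)
   then show ?thesis by (simp add: fE)
  qed
  finally show "emeasure ?M B = emeasure ?N B" .
 qed simp
 then have "(\<integral>\<^sup>+y. h y \<partial>?M) = (\<integral>\<^sup>+y. h y \<partial>?N)" by simp
 then have "(\<integral>\<^sup>+x. D x * h (f1 x) \<partial>lborel) = (\<integral>\<^sup>+y. indicator (f ` S) y * h y \<partial>lborel)"
  by (simp add: nn_integral_distr nn_integral_density)
 moreover have "(\<integral>\<^sup>+x. D x * h (f1 x) \<partial>lborel) = (\<integral>\<^sup>+x\<in>S. ennreal \<bar>det (matrix (f' x))\<bar> * h (f x) \<partial>lborel)"
  by (intro nn_integral_cong) (auto simp: D_def f1 indicator_def)
 ultimately show ?thesis by (simp add: mult.commute)
qed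

section \<open>Construction and uniqueness of the Riemannian volume\<close>

context riemannian
begin

definition vol_density :: "('a, 'n) chart => real ^ 'n => ennreal" where
 "vol_density c x = (if x \<in> snd c ` fst c then ennreal (sqrt (det (G c (chart_inv c x)))) else 0)"

definition chart_volume :: "('a, 'n) chart => 'a set => ennreal" where
 "chart_volume c B = emeasure (density lborel (vol_density c)) (snd c ` B)"

lemma det_G_cont: "c \<in> A ==> continuous_on (snd c ` fst c) (\<lambda>x. sqrt (det (G c (chart_inv c x))))"
 unfolding det_def by (intro continuous_intros G_entry_cont)

lemma vol_density_measurable [measurable]: "c \<in> A ==> vol_density c \<in> Borel"
proof -
 assume c: "c \<in> A"
 have "(\<lambda>x. if x \<in> snd c ` fst c then sqrt (det (G c (chart_inv c x))) else 0) \<in> Borel"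
  using det_G_cont[OF c] chart_open(2)[OF c] by (intro borel_measurable_continuous_on_if) auto
 then have "(\<lambda>x. ennreal (if x \<in> snd c ` fst c then sqrt (det (G c (chart_inv c x))) else 0)) \<in> Borel"
  by measurable
 moreover have "(\<lambda>x. ennreal (if x \<in> snd c ` fst c then sqrt (det (G c (chart_inv c x))) else 0)) = vol_density c"
  by (auto simp: vol_density_def fun_eq_iff)
 ultimately show ?thesis by simp
qed

lemma chart_volume_eq:
 assumes c: "c \<in> A" and B: "B \<in> sets borel" "B \<subseteq> fst c"
 shows "chart_volume c B = (\<integral>\<^sup>+x\<in>snd c ` B. vol_density c x \<partial>lborel)"
  and "chart_volume c B = (\<integral>\<^sup>+x\<in>snd c ` B. ennreal (sqrt (det (metric_matrix A g c (chart_inv c x)))) \<partial>lborel)"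
proof -
 have [measurable]: "snd c ` B \<in> sets borel" using chart_image_borel[OF c B] .
 show 1: "chart_volume c B = (\<integral>\<^sup>+x\<in>snd c ` B. vol_density c x \<partial>lborel)"
  unfolding chart_volume_def using c by (simp add: emeasure_density)
 show "chart_volume c B = (\<integral>\<^sup>+x\<in>snd c ` B. ennreal (sqrt (det (metric_matrix A g c (chart_inv c x)))) \<partial>lborel)"
  unfolding 1 using B(2) by (intro nn_integral_cong) (auto simp: vol_density_def indicator_def)
qed

text \<open>Change of variables by the transition map: by \<open>G_transition\<close> the absolute
  value of its Jacobian is the quotient of the two densities.\<close>

lemma chart_volume_change:
 assumes c: "c \<in> A" "c' \<in> A" and B: "B \<in> sets borel" "B \<subseteq> fst c" "B \<subseteq> fst c'"
 shows "chart_volume c B = chart_volume c' B"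
proof -
 define \<tau> where "\<tau> = snd c' \<circ> chart_inv c"
 define S where "S = snd c ` B"
 define J where "J x = transition_derivative c c' (chart_inv c x)" for x
 have Sb: "S \<in> sets borel" unfolding S_def by (rule chart_image_borel[OF c(1) B(1,2)])
 have S': "x \<in> snd c ` (fst c \<inter> fst c')" if "x \<in> S" for x using that B unfolding S_def by blast
 have \<tau>im: "\<tau> ` (snd c ` E) = snd c' ` E" if "E \<subseteq> fst c" for E
  using that c by (force simp: \<tau>_def image_iff)
 have detc: "continuous_on (snd c ` (fst c \<inter> fst c')) (\<lambda>x. \<bar>det (matrix (J x))\<bar>)"
  unfolding det_def matrix_def J_def
  by (simp, intro continuous_intros transition_derivative_cont[OF c])
 have "(\<integral>\<^sup>+y\<in>\<tau> ` S. vol_density c' y \<partial>lborel)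
   = (\<integral>\<^sup>+x\<in>S. ennreal \<bar>det (matrix (J x))\<bar> * vol_density c' (\<tau> x) \<partial>lborel)"
 proof (rule nn_integral_change_of_variables[OF Sb])
  show "(\<tau> has_derivative J x) (at x)" if "x \<in> S" for x
   unfolding \<tau>_def J_def by (rule transition_smooth[OF c S'[OF that]])
  show "inj_on \<tau> S"
  proof (rule inj_onI)
   fix x y assume x: "x \<in> S" and y: "y \<in> S" and eq: "\<tau> x = \<tau> y"
   obtain p where p: "p \<in> B" "x = snd c p" using x unfolding S_def by blast
   obtain q where q: "q \<in> B" "y = snd c q" using y unfolding S_def by blast
   have pc: "p \<in> fst c" "p \<in> fst c'" "q \<in> fst c" "q \<in> fst c'" using p(1) q(1) B by auto
   have "snd c' p = snd c' q" using eq unfolding \<tau>_def p(2) q(2) by (simp add: c pc)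
   then have "p = q" using inj_onD[OF chart_inj[OF c(2)]] pc by blast
   then show "x = y" using p q by simp
  qed
  show "\<tau> ` E \<in> sets borel" if E: "E \<in> sets borel" "E \<subseteq> S" for E
  proof -
   have Ec: "E \<subseteq> snd c ` fst c" using E(2) B unfolding S_def by blast
   have E1: "chart_inv c ` E \<in> sets borel" by (rule chart_inv_image_borel[OF c(1) E(1) Ec])
   have "chart_inv c ` E \<subseteq> B"
   proof
    fix p assume "p \<in> chart_inv c ` E"
    then obtain q where "q \<in> B" "p = chart_inv c (snd c q)" using E(2) unfolding S_def by blast
    then show "p \<in> B" using c(1) B(2) by auto
   qed
   then have "chart_inv c ` E \<subseteq> fst c'" using B by blast
   from chart_image_borel[OF c(2) E1 this] show ?thesis by (simp add: \<tau>_def image_comp)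
  qed
  have "(\<lambda>x. indicator S x *R \<bar>det (matrix (J x))\<bar>) \<in> Borel"
   using continuous_on_subset[OF detc] S' by (intro borel_measurable_continuous_on_indicator Sb) blast
  then show "(\<lambda>x. indicator S x * \<bar>det (matrix (J x))\<bar>) \<in> Borel" by simp
  show "vol_density c' \<in> Borel" by (rule vol_density_measurable[OF c(2)])
 qed
 also have "\<dots> = (\<integral>\<^sup>+x\<in>S. vol_density c x \<partial>lborel)"
 proof (rule nn_integral_cong)
  fix x :: "real ^ 'n"
  show "ennreal \<bar>det (matrix (J x))\<bar> * vol_density c' (\<tau> x) * indicator S x = vol_density c x * indicator S x"
  proof (cases "x \<in> S")
   case True
   then obtain p where p: "p \<in> B" "x = snd c p" unfolding S_def by blast
   have pc: "p \<in> fst c" "p \<in> fst c'" using p B by auto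
   have "det (G c p) = (det (matrix (J x)))\<^sup>2 * det (G c' p)"
    unfolding J_def p(2) chart_inv_chart[OF c(1) pc(1)] by (rule G_transition[OF c pc])
   then have "sqrt (det (G c p)) = \<bar>det (matrix (J x))\<bar> * sqrt (det (G c' p))"
    by (simp add: real_sqrt_mult)
   then have "ennreal (sqrt (det (G c p))) = ennreal \<bar>det (matrix (J x))\<bar> * ennreal (sqrt (det (G c' p)))"
    by (simp add: ennreal_mult')
   moreover have "vol_density c x = ennreal (sqrt (det (G c p)))"
    using pc c by (simp add: vol_density_def p(2))
   moreover have "vol_density c' (\<tau> x) = ennreal (sqrt (det (G c' p)))"
    using pc c by (simp add: vol_density_def p(2) \<tau>_def)
   ultimately show ?thesis by simp
  qed simp
 qed
 finally have "(\<integral>\<^sup>+y\<in>snd c' ` B. vol_density c' y \<partial>lborel) = (\<integral>\<^sup>+x\<in>snd c ` B. vol_density c x \<partial>lborel)"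
  unfolding S_def \<tau>im[OF B(2)] .
 then show ?thesis using chart_volume_eq(1) c B by simp
qed

lemma chart_volume_sums:
 assumes c: "c \<in> A" and B: "!!i::nat. B i \<in> sets borel" "!!i. B i \<subseteq> fst c" "disjoint_family B"
 shows "(\<Sum>i. chart_volume c (B i)) = chart_volume c (\<Union>i. B i)"
proof -
 have "disjoint_family (\<lambda>i. snd c ` B i)"
  using B(2,3) inj_on_image_Int[OF chart_inj[OF c], symmetric] unfolding disjoint_family_on_def by simp
 moreover have "range (\<lambda>i. snd c ` B i) \<subseteq> sets borel" using chart_image_borel[OF c] B by auto
 ultimately show ?thesis unfolding chart_volume_def image_UN by (intro suminf_emeasure) auto
qed

definition atlas_seq :: "nat => ('a, 'n) chart" where
 "atlas_seq = (SOME C. (\<forall>n. C n \<in> A) \<and> (\<Union>n. fst (C n)) = UNIV)"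

lemma atlas_seq: "atlas_seq n \<in> A" "(\<Union>n. fst (atlas_seq n)) = UNIV"
proof -
 have "\<exists>C :: nat => ('a, 'n) chart. (\<forall>n. C n \<in> A) \<and> (\<Union>n. fst (C n)) = UNIV"
  using countable_atlas by metis
 from someI_ex[OF this, folded atlas_seq_def] show "atlas_seq n \<in> A" "(\<Union>n. fst (atlas_seq n)) = UNIV" by auto
qed

text \<open>Disjoint Borel sets, each inside one chart, that cover the manifold. They select a chart
  for every point in a measurable way.\<close>

definition piece :: "nat => 'a set" where
 "piece = disjointed (\<lambda>n. fst (atlas_seq n))"

lemma piece: "piece n \<in> sets borel" "piece n \<subseteq> fst (atlas_seq n)" "disjoint_family piece" "(\<Union>n. piece n) = UNIV"
proof -
 show "piece n \<in> sets borel"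
 proof -
  have "range (\<lambda>n. fst (atlas_seq n)) \<subseteq> sets borel" using chart_open(1)[OF atlas_seq(1)] by auto
  from sets.range_disjointed_sets'[OF this] show ?thesis unfolding piece_def by auto
 qed
 show "piece n \<subseteq> fst (atlas_seq n)" unfolding piece_def by (rule disjointed_subset)
 show "disjoint_family piece" unfolding piece_def by (rule disjoint_family_disjointed)
 show "(\<Union>n. piece n) = UNIV" unfolding piece_def UN_disjointed_eq by (rule atlas_seq(2))
qed

definition total_volume :: "'a set => ennreal" where
 "total_volume B = (\<Sum>k. chart_volume (atlas_seq k) (B \<inter> piece k))"

lemma total_volume_chart:
 assumes c: "c \<in> A" and B: "B \<in> sets borel" "B \<subseteq> fst c"
 shows "total_volume B = chart_volume c B"
proof -
 have "chart_volume (atlas_seq k) (B \<inter> piece k) = chart_volume c (B \<inter> piece k)" for k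
  using piece(1,2)[of k] B by (intro chart_volume_change[OF atlas_seq(1) c]) auto
 then have "total_volume B = (\<Sum>k. chart_volume c (B \<inter> piece k))" by (simp add: total_volume_def)
 also have "\<dots> = chart_volume c (\<Union>k. B \<inter> piece k)"
  using piece(1,3) B by (intro chart_volume_sums[OF c]) (auto simp: disjoint_family_on_def)
 also have "(\<Union>k. B \<inter> piece k) = B" using piece(4) by (metis Int_UN_distrib inf_top_right)
 finally show ?thesis .
qed

text \<open>The condition under the definite description in \<open>riemannian_volume\<close>, named
  so that its unique solvability can be proved.\<close>

definition volume_spec :: "'a measure => bool" where
 "volume_spec m \<longleftrightarrow> sets m = sets borel \<and> (\<forall>c\<in>A. \<forall>B\<in>sets borel. B \<subseteq> fst c -->
   emeasure m B = (\<integral>\<^sup>+x\<in>snd c ` B. ennreal (sqrt (det (metric_matrix A g c (chart_inv c x)))) \<partial>lborel))"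

lemma volume_spec_total: "volume_spec m ==> B \<in> sets borel ==> emeasure m B = total_volume B"
proof -
 assume m: "volume_spec m" and B: "B \<in> sets borel"
 have s: "sets m = sets borel" using m by (simp add: volume_spec_def)
 have "emeasure m B = emeasure m (\<Union>k. B \<inter> piece k)" using piece(4) by (metis Int_UN_distrib inf_top_right)
 also have "\<dots> = (\<Sum>k. emeasure m (B \<inter> piece k))"
  using piece(1,3) B s by (intro suminf_emeasure[symmetric]) (auto simp: disjoint_family_on_def)
 also have "\<dots> = total_volume B"
  unfolding total_volume_def
 proof (rule suminf_cong)
  fix k
  have Bk: "B \<inter> piece k \<in> sets borel" "B \<inter> piece k \<subseteq> fst (atlas_seq k)" using piece(1,2)[of k] B by auto
  show "emeasure m (B \<inter> piece k) = chart_volume (atlas_seq k) (B \<inter> piece k)"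
   unfolding chart_volume_eq(2)[OF atlas_seq(1) Bk]
   using m Bk atlas_seq(1)[of k] unfolding volume_spec_def by blast
 qed
 finally show ?thesis .
qed

lemma volume_spec_ex: "\<exists>m. volume_spec m"
proof -
 define m where "m = measure_of UNIV (sets borel) total_volume"
 have s: "sets m = sets borel" unfolding m_def using sets.sigma_sets_eq[of "borel :: 'a measure"] by simp
 have em: "emeasure m B = total_volume B" if "B \<in> sets borel" for B
 proof (rule emeasure_measure_of[OF m_def])
  show "positive (sets m) total_volume"
   by (simp add: positive_def total_volume_def chart_volume_def)
  show "countably_additive (sets m) total_volume"
   unfolding countably_additive_def s
  proof (intro allI impI)
   fix B :: "nat => 'a set" assume B: "range B \<subseteq> sets borel" "disjoint_family B" "\<Union>(range B) \<in> sets borel"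
   \<comment> \<open>A double series of nonnegative terms; writing the inner one as an integral over
     counting measure justifies the exchange of summations.\<close>
   have "(\<Sum>i. total_volume (B i)) = (\<Sum>i. \<integral>\<^sup>+k. chart_volume (atlas_seq k) (B i \<inter> piece k) \<partial>count_space UNIV)"
    unfolding total_volume_def by (simp add: nn_integral_count_space_nat)
   also have "\<dots> = (\<integral>\<^sup>+k. (\<Sum>i. chart_volume (atlas_seq k) (B i \<inter> piece k)) \<partial>count_space UNIV)"
    by (rule nn_integral_suminf[symmetric]) simp
   also have "(\<lambda>k. \<Sum>i. chart_volume (atlas_seq k) (B i \<inter> piece k)) = (\<lambda>k. chart_volume (atlas_seq k) (\<Union>(range B) \<inter> piece k))"
   proof
    fix k
    have "(\<Sum>i. chart_volume (atlas_seq k) (B i \<inter> piece k)) = chart_volume (atlas_seq k) (\<Union>i. B i \<inter> piece k)"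
     using B piece(1,2)[of k] by (intro chart_volume_sums[OF atlas_seq(1)]) (auto simp: disjoint_family_on_def)
    then show "(\<Sum>i. chart_volume (atlas_seq k) (B i \<inter> piece k)) = chart_volume (atlas_seq k) (\<Union>(range B) \<inter> piece k)"
     by simp
   qed
   finally show "(\<Sum>i. total_volume (B i)) = total_volume (\<Union>(range B))"
    unfolding total_volume_def by (simp add: nn_integral_count_space_nat)
  qed
 qed (use that s in auto)
 have "volume_spec m"
  unfolding volume_spec_def
 proof (intro conjI ballI impI s)
  fix c and B :: "'a set" assume "c \<in> A" "B \<in> sets borel" "B \<subseteq> fst c"
  then show "emeasure m B = (\<integral>\<^sup>+x\<in>snd c ` B. ennreal (sqrt (det (metric_matrix A g c (chart_inv c x)))) \<partial>lborel)"
   using em total_volume_chart chart_volume_eq(2) by simp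
 qed
 then show ?thesis ..
qed

abbreviation vol :: "'a measure" where
 "vol \<equiv> riemannian_volume A g"

lemma vol_spec: "volume_spec vol"
proof -
 have "\<exists>!m. volume_spec m"
 proof (rule ex_ex1I[OF volume_spec_ex])
  fix m m' :: "'a measure" assume m: "volume_spec m" "volume_spec m'"
  show "m = m'"
  proof (rule measure_eqI)
   show "sets m = sets m'" using m by (simp add: volume_spec_def)
   show "emeasure m B = emeasure m' B" if "B \<in> sets m" for B
   proof -
    have "B \<in> sets borel" using m(1) that by (simp add: volume_spec_def)
    then show ?thesis using volume_spec_total[OF m(1)] volume_spec_total[OF m(2)] by simp
   qed
  qed
 qed
 from theI'[OF this] show ?thesis unfolding riemannian_volume_def volume_spec_def .
qed

lemma sets_vol [simp, measurable_cong]: "sets vol = sets borel"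
 using vol_spec by (simp add: volume_spec_def)

lemma space_vol [simp]: "space vol = UNIV"
 using sets_eq_imp_space_eq[OF sets_vol] by simp

lemma emeasure_vol: "c \<in> A ==> B \<in> sets borel ==> B \<subseteq> fst c ==> emeasure vol B = chart_volume c B"
 using volume_spec_total[OF vol_spec] total_volume_chart by simp

lemma vol_null_if_chart_null:
 assumes c: "c \<in> A" and B: "B \<in> sets borel" "B \<subseteq> fst c" and null: "emeasure lborel (snd c ` B) = 0"
 shows "emeasure vol B = 0"
proof -
 have [measurable]: "snd c ` B \<in> sets borel" by (rule chart_image_borel[OF c B])
 have "AE x in lborel. x \<notin> snd c ` B" using null by (intro AE_not_in) (auto simp: null_sets_def)
 then have "(\<integral>\<^sup>+x\<in>snd c ` B. vol_density c x \<partial>lborel) = (\<integral>\<^sup>+x. 0 \<partial>(lborel :: (real ^ 'n) measure))"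
  by (intro nn_integral_cong_AE) (auto elim!: eventually_mono simp: indicator_def)
 then show ?thesis using emeasure_vol[OF c B] chart_volume_eq(1)[OF c B] by simp
qed

text \<open>The volume has a density in each chart, so Lebesgue null sets of coordinates are null
  for it; countably many charts cover the manifold even if the atlas is uncountable.\<close>

lemma AE_vol_if_AE_charts:
 assumes "!!c. c \<in> A ==> AE x in lborel. x \<in> snd c ` fst c --> P (chart_inv c x)"
 shows "AE p in vol. P p"
proof -
 have "AE p in vol. p \<in> fst c --> P p" if c: "c \<in> A" for c
 proof -
  obtain N where N: "N \<in> null_sets lborel" "{x. \<not> (x \<in> snd c ` fst c --> P (chart_inv c x))} \<subseteq> N"
   using assms[OF c] by (auto elim: AE_E simp: eventually_ae_filter)
  define S where "S = N \<inter> snd c ` fst c"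
  have Sb: "S \<in> sets borel" "S \<subseteq> snd c ` fst c" using N(1) chart_open(2)[OF c] by (auto simp: S_def null_sets_def)
  have S0: "emeasure lborel S = 0"
  proof -
   have "emeasure lborel S \<le> emeasure lborel N" using N(1) by (intro emeasure_mono) (auto simp: S_def null_sets_def)
   then show ?thesis using N(1) by (simp add: null_sets_def)
  qed
  define B where "B = chart_inv c ` S"
  have B: "B \<in> sets borel" unfolding B_def by (rule chart_inv_image_borel[OF c Sb])
  have B': "B \<subseteq> fst c" using Sb(2) c by (auto simp: B_def)
  have "snd c ` B = S"
  proof -
   have "snd c (chart_inv c x) = x" if "x \<in> S" for x using Sb(2) that c by (intro chart_chart_inv) auto
   then show ?thesis unfolding B_def image_image by simp
  qed
  then have "emeasure vol B = 0" using vol_null_if_chart_null[OF c B B'] S0 by simp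
  then have "AE p in vol. p \<notin> B" using B by (intro AE_not_in) (auto simp: null_sets_def)
  then show ?thesis
  proof eventually_elim
   case (elim p)
   show ?case
   proof
    assume p: "p \<in> fst c"
    show "P p"
    proof (rule ccontr)
     assume "\<not> P p"
     then have "snd c p \<in> N" using N(2) p c by auto
     then have "p \<in> B" unfolding B_def S_def using p c by (intro image_eqI[of _ _ "snd c p"]) auto
     then show False using elim by simp
    qed
   qed
  qed
 qed
 then have "AE p in vol. \<forall>n. p \<in> fst (atlas_seq n) --> P p"
  unfolding AE_all_countable using atlas_seq(1) by blast
 then show ?thesis
 proof eventually_elim
  case (elim p)
  have "p \<in> (\<Union>n. fst (atlas_seq n))" using atlas_seq(2) by simp
  then show ?case using elim by blast
 qed
qed

lemma vol_coordinate_ball_finite: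
 assumes c: "c \<in> A" and K: "compact K" "K \<subseteq> snd c ` fst c"
 shows "emeasure vol (chart_inv c ` K) < \<infinity>"
proof -
 have Kb: "K \<in> sets borel" using K by (simp add: compact_imp_closed)
 have B: "chart_inv c ` K \<in> sets borel" "chart_inv c ` K \<subseteq> fst c"
  using chart_inv_image_borel[OF c Kb K(2)] K(2) c by auto
 have im: "snd c ` chart_inv c ` K = K"
 proof -
  have "snd c (chart_inv c x) = x" if "x \<in> K" for x using K(2) that c by (intro chart_chart_inv) auto
  then show ?thesis unfolding image_image by simp
 qed
 have "bounded ((\<lambda>x. sqrt (det (G c (chart_inv c x)))) ` K)"
  using K continuous_on_subset[OF det_G_cont[OF c]] by (intro compact_imp_bounded compact_continuous_image) auto
 then obtain M where M: "\<forall>x\<in>K. \<bar>sqrt (det (G c (chart_inv c x)))\<bar> \<le> M" by (auto simp: bounded_iff)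
 have "emeasure vol (chart_inv c ` K) = (\<integral>\<^sup>+x\<in>K. vol_density c x \<partial>lborel)"
  unfolding emeasure_vol[OF c B] chart_volume_eq(1)[OF c B] im ..
 also have "\<dots> \<le> (\<integral>\<^sup>+x. ennreal M * indicator K x \<partial>lborel)"
 proof (rule nn_integral_mono)
  fix x :: "real ^ 'n"
  show "vol_density c x * indicator K x \<le> ennreal M * indicator K x"
   using M by (cases "x \<in> K") (auto simp: vol_density_def intro!: ennreal_leI dest!: bspec[of K _ x])
 qed
 also have "\<dots> = ennreal M * emeasure lborel K" using Kb by (simp add: nn_integral_cmult_indicator)
 also have "\<dots> < \<infinity>" using emeasure_compact_finite[OF K(1)] by (simp add: ennreal_mult_less_top)
 finally show ?thesis .
qed

lemma vol_compact_finite: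
 assumes K: "compact K"
 shows "emeasure vol K < \<infinity>"
proof -
 have "\<exists>U. open U \<and> p \<in> U \<and> emeasure vol U < \<infinity>" for p
 proof -
  obtain c where c: "c \<in> A" "p \<in> fst c" using chart_exists by blast
  obtain r where r: "r > 0" "cball (snd c p) r \<subseteq> snd c ` fst c" "chart_inv c ` cball (snd c p) r \<subseteq> UNIV"
   "compact (chart_inv c ` cball (snd c p) r)" "open (chart_inv c ` ball (snd c p) r)" "p \<in> chart_inv c ` ball (snd c p) r"
   by (rule coordinate_ball[OF open_UNIV UNIV_I c])
  have "emeasure vol (chart_inv c ` ball (snd c p) r) \<le> emeasure vol (chart_inv c ` cball (snd c p) r)"
   using r(4) ball_subset_cball by (intro emeasure_mono) (auto simp: compact_imp_closed)
  also have "\<dots> < \<infinity>" by (rule vol_coordinate_ball_finite[OF c(1) compact_cball r(2)])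
  finally show ?thesis using r(5,6) by blast
 qed
 then obtain U where U: "!!p. open (U p)" "!!p. p \<in> U p" "!!p. emeasure vol (U p) < \<infinity>" by metis
 obtain T where T: "T \<subseteq> K" "finite T" "K \<subseteq> (\<Union>p\<in>T. U p)"
  using compactE_image[OF K, of K U] U(1,2) by blast
 have "emeasure vol K \<le> emeasure vol (\<Union>p\<in>T. U p)" using T(3) U(1) by (intro emeasure_mono) (auto intro!: borel_open)
 also have "\<dots> \<le> (\<Sum>p\<in>T. emeasure vol (U p))" using T(2) U(1) by (intro emeasure_subadditive_finite) auto
 also have "\<dots> < \<infinity>" using T(2) U(3) by simp
 finally show ?thesis .
qed

end

section \<open>The Riemannian distance\<close>

context riemannian
begin

definition speed :: "(real => 'a) => real => real" where
 "speed f t = sqrt (g (f t) (velocity A f t) (velocity A f t))"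

text \<open>One-sided derivatives at the ends of a C^1 piece make the speed continuous on the closed
  interval. \<open>velocity\<close>, built on two-sided derivatives, agrees with it in the
  interior.\<close>

definition velocity_within :: "(real => 'a) => real => real => real => ('a, 'n) tangent" where
 "velocity_within f a b t =
   (\<lambda>c. if c \<in> A \<and> f t \<in> fst c then vector_derivative (snd c \<circ> f) (at t within {a..b}) else 0)"

definition speed_within :: "(real => 'a) => real => real => real => real" where
 "speed_within f a b t = sqrt (g (f t) (velocity_within f a b t) (velocity_within f a b t))"

lemma C1_curve_derivative:
 assumes "C1_curve_on A f a b" "a < b" "t \<in> {a..b}" "c \<in> A" "f t \<in> fst c"
 shows "((snd c \<circ> f) has_vector_derivative velocity_within f a b t c) (at t within {a..b})"
proof -
 obtain D where "\<forall>t\<in>{a..b} \<inter> f -` fst c. ((snd c \<circ> f) has_vector_derivative D t) (at t within {a..b})"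
  using assms(1,4) unfolding C1_curve_on_def by blast
 then have d: "((snd c \<circ> f) has_vector_derivative D t) (at t within {a..b})" using assms by blast
 have "vector_derivative (snd c \<circ> f) (at t within {a..b}) = D t"
  using vector_derivative_within_closed_interval[of a b t "snd c \<circ> f" "D t"] d assms by (simp add: cbox_interval)
 then show ?thesis using d assms by (simp add: velocity_within_def)
qed

lemma C1_curve_derivative_cont:
 assumes "C1_curve_on A f a b" "a < b" "c \<in> A"
 shows "continuous_on ({a..b} \<inter> f -` fst c) (\<lambda>t. velocity_within f a b t c)"
proof -
 obtain D where D: "\<forall>t\<in>{a..b} \<inter> f -` fst c. ((snd c \<circ> f) has_vector_derivative D t) (at t within {a..b})"
  "continuous_on ({a..b} \<inter> f -` fst c) D"
  using assms(1,3) unfolding C1_curve_on_def by blast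
 from D(2) show ?thesis
 proof (rule continuous_on_eq)
  fix t assume t: "t \<in> {a..b} \<inter> f -` fst c"
  then have d: "((snd c \<circ> f) has_vector_derivative D t) (at t within {a..b})" using D(1) by blast
  have "vector_derivative (snd c \<circ> f) (at t within {a..b}) = D t"
   using vector_derivative_within_closed_interval[of a b t "snd c \<circ> f" "D t"] d t assms(2) by (simp add: cbox_interval)
  then show "D t = velocity_within f a b t c" using t assms(3) by (simp add: velocity_within_def)
 qed
qed

text \<open>The transformation law is the chain rule for the transition map; by continuity the curve
  stays in the first chart near t.\<close>

lemma velocity_within_tangent:
 assumes f: "C1_curve_on A f a b" "a < b" "t \<in> {a..b}"
 shows "velocity_within f a b t \<in> tangent_space A (f t)"
 unfolding tangent_space_def
proof (intro CollectI conjI allI ballI impI)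
 fix c assume "c \<notin> A \<or> f t \<notin> fst c"
 then show "velocity_within f a b t c = 0" by (auto simp: velocity_within_def)
next
 fix c c' assume c: "c \<in> A" "c' \<in> A" "f t \<in> fst c \<inter> fst c'"
 then have ct: "f t \<in> fst c" "f t \<in> fst c'" by auto
 let ?\<tau> = "snd c' \<circ> chart_inv c"
 have d: "((snd c \<circ> f) has_derivative (\<lambda>h. h *R velocity_within f a b t c)) (at t within {a..b})"
  using C1_curve_derivative[OF f c(1) ct(1)] by (simp add: has_vector_derivative_def)
 have \<tau>: "(?\<tau> has_derivative transition_derivative c c' (f t)) (at ((snd c \<circ> f) t))"
  using transition_has_derivative[OF c(1,2) ct] by simp
 have lin: "linear (transition_derivative c c' (f t))" by (rule transition_linear[OF c(1,2) ct])
 from has_derivative_compose[OF d \<tau>]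
 have "((\<lambda>s. ?\<tau> ((snd c \<circ> f) s)) has_derivative
   (\<lambda>h. h *R transition_derivative c c' (f t) (velocity_within f a b t c))) (at t within {a..b})"
  by (simp add: linear_cmul[OF lin])
 moreover have "openin (top_of_set {a..b}) ({a..b} \<inter> f -` fst c)"
  using f(1) chart_open(1)[OF c(1)] unfolding C1_curve_on_def by (intro continuous_openin_preimage_gen) auto
 then obtain T where T: "open T" "{a..b} \<inter> f -` fst c = {a..b} \<inter> T" by (auto simp: openin_open)
 have "t \<in> T" using T(2) f(3) ct by blast
 then obtain e where e: "e > 0" "ball t e \<subseteq> T" using T(1) openE by blast
 ultimately have "((snd c' \<circ> f) has_derivative
   (\<lambda>h. h *R transition_derivative c c' (f t) (velocity_within f a b t c))) (at t within {a..b})"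
 proof (elim has_derivative_transform_within[OF _ e(1) f(3)])
  fix s assume s: "s \<in> {a..b}" "dist s t < e"
  then have "s \<in> T" using e(2) by (auto simp: dist_commute)
  then have "f s \<in> fst c" using T(2) s(1) by blast
  then show "?\<tau> ((snd c \<circ> f) s) = (snd c' \<circ> f) s" using c(1) by simp
 qed
 then have "vector_derivative (snd c' \<circ> f) (at t within {a..b}) = transition_derivative c c' (f t) (velocity_within f a b t c)"
  using vector_derivative_within_closed_interval[of a b t "snd c' \<circ> f" _] f(2,3)
  by (simp add: cbox_interval has_vector_derivative_def)
 then show "velocity_within f a b t c' = transition_derivative c c' (f t) (velocity_within f a b t c)"
  using c(2) ct(2) by (simp add: velocity_within_def)
qed

lemma velocity_interior:
 assumes "t \<in> {a<..<b}"
 shows "velocity A f t = velocity_within f a b t"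
proof -
 have "at t within {a..b} = at t"
  using assms by (intro at_within_interior) (simp add: interior_atLeastAtMost_real)
 then show ?thesis by (simp add: velocity_def velocity_within_def fun_eq_iff)
qed

text \<open>Continuity is local, so one chart around f t suffices. In it the speed is a continuous
  function of the position and of the velocity components.\<close>

lemma speed_within_cont:
 assumes f: "C1_curve_on A f a b" "a < b"
 shows "continuous_on {a..b} (speed_within f a b)"
 unfolding continuous_on_eq_continuous_within
proof
 fix t assume t: "t \<in> {a..b}"
 obtain c where c: "c \<in> A" "f t \<in> fst c" using chart_exists by blast
 have fc: "continuous_on {a..b} f" using f(1) by (simp add: C1_curve_on_def)
 let ?S = "{a..b} \<inter> f -` fst c"
 have op: "openin (top_of_set {a..b}) ?S"
  using fc chart_open(1)[OF c(1)] by (intro continuous_openin_preimage_gen)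
 have "continuous_on ?S (\<lambda>s. (snd c (f s), velocity_within f a b s c))"
  by (intro continuous_on_Pair C1_curve_derivative_cont[OF f c(1)] continuous_on_compose2[OF chart_cont(1)[OF c(1)]]
   continuous_on_subset[OF fc]) auto
 then have "continuous_on ?S (\<lambda>s. (\<lambda>(x, w). w \<bullet> (G c (chart_inv c x) *v w)) (snd c (f s), velocity_within f a b s c))"
  by (rule continuous_on_compose2[OF G_quadratic_cont[OF c(1)]]) auto
 then have "continuous_on ?S (\<lambda>s. sqrt (velocity_within f a b s c \<bullet> (G c (chart_inv c (snd c (f s))) *v velocity_within f a b s c)))"
  unfolding prod.case by (rule continuous_on_real_sqrt)
 then have "continuous_on ?S (speed_within f a b)"
 proof (rule continuous_on_eq)
  fix s assume s: "s \<in> ?S"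
  then have s': "s \<in> {a..b}" "f s \<in> fst c" by auto
  show "sqrt (velocity_within f a b s c \<bullet> (G c (chart_inv c (snd c (f s))) *v velocity_within f a b s c)) = speed_within f a b s"
   unfolding speed_within_def using g_tangent[OF velocity_within_tangent[OF f s'(1)] velocity_within_tangent[OF f s'(1)] c(1) s'(2)] c(1) s'
   by simp
 qed
 then have "continuous (at t within ?S) (speed_within f a b)"
  using t c(2) by (auto simp: continuous_on_eq_continuous_within)
 moreover have "at t within ?S = at t within {a..b}"
 proof -
  obtain T where T: "open T" "?S = {a..b} \<inter> T" using op by (auto simp: openin_open)
  have "t \<in> T" using T(2) t c(2) by blast
  then show ?thesis using T by (intro at_within_nhd[OF _ T(1)]) auto
 qed
 ultimately show "continuous (at t within {a..b}) (speed_within f a b)" by simp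
qed

lemma speed_within_nonneg: "speed_within f a b t \<ge> 0" if "C1_curve_on A f a b" "a < b" "t \<in> {a..b}"
 unfolding speed_within_def using g_nonneg[OF velocity_within_tangent[OF that]] by simp

lemma speed_has_integral:
 assumes f: "C1_curve_on A f a b" "a < b"
 shows "(speed f has_integral integral {a..b} (speed_within f a b)) {a..b}"
proof -
 have "(speed_within f a b has_integral integral {a..b} (speed_within f a b)) {a..b}"
  using speed_within_cont[OF f] by (intro integrable_integral integrable_continuous_real)
 then show ?thesis
 proof (rule has_integral_spike_finite[of "{a, b}", rotated 2])
  fix t assume "t \<in> {a..b} - {a, b}"
  then have "t \<in> {a<..<b}" by auto
  then show "speed f t = speed_within f a b t"
   by (simp add: speed_def speed_within_def velocity_interior)
 qed simp
qed

text \<open>Stated for m of either sign, so that it serves both rescaling and reversal: the speed is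
  multiplied by |m| and the length of the parameter interval divided by it.\<close>

lemma C1_curve_affine:
 assumes f: "C1_curve_on A f a b" "a < b" and m: "m \<noteq> 0"
  and ab: "a' < b'" "(\<lambda>t. m * t + k) ` {a'..b'} = {a..b}" and f': "!!t. t \<in> {a'..b'} ==> f' t = f (m * t + k)"
 shows "C1_curve_on A f' a' b'"
  and "integral {a'..b'} (speed_within f' a' b') = integral {a..b} (speed_within f a b)"
proof -
 let ?h = "\<lambda>t. m * t + k"
 have hin: "?h t \<in> {a..b}" if "t \<in> {a'..b'}" for t using ab(2) that by blast
 have der: "((snd c \<circ> f') has_vector_derivative m *R velocity_within f a b (?h t) c) (at t within {a'..b'})"
  if c: "c \<in> A" and t: "t \<in> {a'..b'}" "f' t \<in> fst c" for c t
 proof -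
  have ft: "f (?h t) \<in> fst c" using t f' by simp
  have h: "(?h has_vector_derivative m) (at t within {a'..b'})"
   by (auto intro!: derivative_eq_intros simp: has_real_derivative_iff_has_vector_derivative[symmetric])
  have "((snd c \<circ> f) has_vector_derivative velocity_within f a b (?h t) c) (at (?h t) within ?h ` {a'..b'})"
   unfolding ab(2) by (rule C1_curve_derivative[OF f hin[OF t(1)] c ft])
  from vector_diff_chain_within[OF h this]
  have "(((snd c \<circ> f) \<circ> ?h) has_vector_derivative m *R velocity_within f a b (?h t) c) (at t within {a'..b'})" .
  then show ?thesis
   by (rule has_vector_derivative_transform[OF t(1), rotated]) (use f' in auto)
 qed
 have cont: "continuous_on {a'..b'} f'"
 proof -
  have "continuous_on {a'..b'} (\<lambda>t. f (?h t))"
   by (rule continuous_on_compose2[of "{a..b}"]) (use f(1) hin in \<open>auto simp: C1_curve_on_def intro!: continuous_intros\<close>)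
  then show ?thesis by (rule continuous_on_eq) (simp add: f')
 qed
 show C1: "C1_curve_on A f' a' b'"
  unfolding C1_curve_on_def
 proof (intro conjI cont ballI)
  fix c assume c: "c \<in> A"
  have "continuous_on ({a'..b'} \<inter> f' -` fst c) (\<lambda>t. m *R velocity_within f a b (?h t) c)"
   by (intro continuous_intros continuous_on_compose2[OF C1_curve_derivative_cont[OF f c], of _ ?h])
    (use hin f' in auto)
  then show "\<exists>D. (\<forall>t\<in>{a'..b'} \<inter> f' -` fst c. ((snd c \<circ> f') has_vector_derivative D t) (at t within {a'..b'})) \<and>
    continuous_on ({a'..b'} \<inter> f' -` fst c) D"
   using der[OF c] by (intro exI[of _ "\<lambda>t. m *R velocity_within f a b (?h t) c"]) auto
 qed
 have speed: "speed_within f' a' b' t = \<bar>m\<bar> * speed_within f a b (?h t)" if t: "t \<in> {a'..b'}" for t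
 proof -
  have vt: "velocity_within f a b (?h t) \<in> tangent_space A (f' t)"
   using velocity_within_tangent[OF f hin[OF t]] f'[OF t] by simp
  have "velocity_within f' a' b' t = (\<lambda>c. m *R velocity_within f a b (?h t) c + (0::real ^ 'n))"
  proof
   fix c
   show "velocity_within f' a' b' t c = m *R velocity_within f a b (?h t) c + 0"
   proof (cases "c \<in> A \<and> f' t \<in> fst c")
    case True
    then show ?thesis
     using vector_derivative_within_closed_interval[of a' b' t "snd c \<circ> f'" "m *R velocity_within f a b (?h t) c"]
      der[of c t] t ab(1) by (simp add: velocity_within_def cbox_interval)
   qed (use f'[OF t] in \<open>auto simp: velocity_within_def\<close>)
  qed
  moreover have "g (f' t) (\<lambda>c. m *R velocity_within f a b (?h t) c + 0) (\<lambda>c. m *R velocity_within f a b (?h t) c + 0)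
    = m * (m * g (f' t) (velocity_within f a b (?h t)) (velocity_within f a b (?h t)))"
  proof -
   let ?v = "velocity_within f a b (?h t)" and ?z = "\<lambda>_ :: ('a, 'n) chart. 0 :: real ^ 'n"
   have mv: "(\<lambda>c. m *R ?v c + 0) \<in> tangent_space A (f' t)"
    using tangent_lin[OF vt zero_in_tangent] by simp
   show ?thesis
    using g_lin[OF vt zero_in_tangent mv, of m] g_zero[OF mv] g_lin_right[OF vt zero_in_tangent vt, of m]
     g_zero[OF vt] g_sym[OF vt zero_in_tangent] by simp
  qed
  moreover have "sqrt (m * (m * X)) = \<bar>m\<bar> * sqrt X" for X :: real
   by (simp add: real_sqrt_mult mult.assoc[symmetric] power2_eq_square[symmetric])
  ultimately show ?thesis using f'[OF t] by (simp add: speed_within_def)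
 qed
 have "((\<lambda>t. speed_within f a b (m * t + k)) has_integral (1 / \<bar>m\<bar>) *R integral {a..b} (speed_within f a b)) {a'..b'}"
 proof -
  have "(speed_within f a b has_integral integral {a..b} (speed_within f a b)) (cbox a b)"
   using speed_within_cont[OF f] unfolding cbox_interval
   by (intro integrable_integral integrable_continuous_real)
  from has_integral_affinity[OF this m, of k]
  have "((\<lambda>x. speed_within f a b (m *R x + k)) has_integral (1 / \<bar>m\<bar> ^ DIM(real)) *R integral {a..b} (speed_within f a b))
   ((\<lambda>x. (1 / m) *R x + - ((1 / m) *R k)) ` cbox a b)" .
  moreover have "(\<lambda>x. (1 / m) *R x + - ((1 / m) *R k)) ` cbox a b = {a'..b'}"
  proof -
   have "(1 / m) *R (m * t + k) + - ((1 / m) *R k) = t" for t using m by (simp add: field_simps)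
   then show ?thesis unfolding cbox_interval ab(2)[symmetric] image_image by simp
  qed
  ultimately show ?thesis by simp
 qed
 from has_integral_mult_right[OF this, of "\<bar>m\<bar>"]
 have "((\<lambda>t. \<bar>m\<bar> * speed_within f a b (m * t + k)) has_integral integral {a..b} (speed_within f a b)) {a'..b'}"
  using m by simp
 then have "(speed_within f' a' b' has_integral integral {a..b} (speed_within f a b)) {a'..b'}"
  by (rule has_integral_eq[rotated]) (simp add: speed)
 then show "integral {a'..b'} (speed_within f' a' b') = integral {a..b} (speed_within f a b)"
  by (rule integral_unique)
qed

lemma C1_curve_subinterval:
 assumes f: "C1_curve_on A f a b" "a < b" and a': "a \<le> a'" "a' < b'" "b' \<le> b"
 shows "C1_curve_on A f a' b'"
  "integral {a'..b'} (speed_within f a' b') = integral {a'..b'} (speed_within f a b)"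
proof -
 have sub: "{a'..b'} \<subseteq> {a..b}" using a' by auto
 show C: "C1_curve_on A f a' b'"
  unfolding C1_curve_on_def
 proof (intro conjI ballI)
  show "continuous_on {a'..b'} f" using f(1) sub continuous_on_subset unfolding C1_curve_on_def by blast
  fix c assume "c \<in> A"
  then obtain D where D: "\<forall>t\<in>{a..b} \<inter> f -` fst c. ((snd c \<circ> f) has_vector_derivative D t) (at t within {a..b})"
   "continuous_on ({a..b} \<inter> f -` fst c) D" using f(1) unfolding C1_curve_on_def by blast
  show "\<exists>D. (\<forall>t\<in>{a'..b'} \<inter> f -` fst c. ((snd c \<circ> f) has_vector_derivative D t) (at t within {a'..b'})) \<and>
    continuous_on ({a'..b'} \<inter> f -` fst c) D"
  proof (intro exI[of _ D] conjI ballI)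
   fix t assume "t \<in> {a'..b'} \<inter> f -` fst c"
   then have "t \<in> {a..b} \<inter> f -` fst c" using sub by blast
   then show "((snd c \<circ> f) has_vector_derivative D t) (at t within {a'..b'})"
    using D(1) has_vector_derivative_within_subset[OF _ sub] by blast
  next
   show "continuous_on ({a'..b'} \<inter> f -` fst c) D" by (rule continuous_on_subset[OF D(2)]) (use sub in blast)
  qed
 qed
 have "(speed_within f a b has_integral integral {a'..b'} (speed_within f a b)) {a'..b'}"
  using continuous_on_subset[OF speed_within_cont[OF f] sub] by (intro integrable_integral integrable_continuous_real)
 then have "(speed_within f a' b' has_integral integral {a'..b'} (speed_within f a b)) {a'..b'}"
 proof (rule has_integral_spike_finite[of "{a', b'}", rotated 2])
  fix t assume t: "t \<in> {a'..b'} - {a', b'}"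
  then have "t \<in> {a'<..<b'}" "t \<in> {a<..<b}" using a' by auto
  then show "speed_within f a' b' t = speed_within f a b t"
   unfolding speed_within_def using velocity_interior by metis
 qed simp
 then show "integral {a'..b'} (speed_within f a' b') = integral {a'..b'} (speed_within f a b)"
  by (rule integral_unique)
qed

text \<open>Piecewise C^1 curves on [a, b] with their length l as an index, grown at the right end.
  In this form induction, splitting and concatenation need no sequences of break points.\<close>

inductive pcl :: "(real => 'a) => real => real => real => bool" for f where
 refl: "pcl f a a 0"
| step: "pcl f a b l ==> b < c ==> C1_curve_on A f b c ==> pcl f a c (l + integral {b..c} (speed_within f b c))"

lemma pcl_single: "a < b ==> C1_curve_on A f a b ==> pcl f a b (integral {a..b} (speed_within f a b))"
 using pcl.step[OF pcl.refl] by simp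

lemma pcl_le: "pcl f a b l ==> a \<le> b"
 by (induction rule: pcl.induct) auto

lemma pcl_nonneg: "pcl f a b l ==> 0 \<le> l"
proof (induction rule: pcl.induct)
 case (step a b l c)
 then show ?case using speed_within_nonneg[OF step(3,2)] speed_within_cont[OF step(3,2)]
  by (intro add_nonneg_nonneg integral_nonneg integrable_continuous_real) auto
qed simp

lemma pcl_integral: "pcl f a b l ==> (speed f has_integral l) {a..b}"
proof (induction rule: pcl.induct)
 case (refl a)
 then show ?case using has_integral_refl(2)[of "speed f" a] by simp
next
 case (step a b l c)
 show ?case
  by (rule has_integral_combine[OF pcl_le[OF step(1)] less_imp_le[OF step(2)] step(4) speed_has_integral[OF step(3,2)]])
qed

lemma pcl_continuous: "pcl f a b l ==> continuous_on {a..b} f"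
proof (induction rule: pcl.induct)
 case (step a b l c)
 have "{a..c} = {a..b} \<union> {b..c}" using pcl_le[OF step(1)] step(2) by auto
 then show ?case using step by (auto simp: C1_curve_on_def intro!: continuous_on_closed_Un)
qed simp

lemma pcl_trans: "pcl f b c l' ==> pcl f a b l ==> pcl f a c (l + l')"
proof (induction rule: pcl.induct)
 case (step b c l' d)
 from pcl.step[OF step.IH[OF step.prems] step(2,3)] show ?case by (simp add: add.assoc)
qed simp

lemma pcl_affine:
 assumes "pcl f a b l" and m: "m > 0" and "!!t. t \<in> {(a - k) / m..(b - k) / m} ==> f' t = f (m * t + k)"
 shows "pcl f' ((a - k) / m) ((b - k) / m) l"
 using assms(1,3)
proof (induction rule: pcl.induct)
 case (refl a)
 show ?case by (rule pcl.refl)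
next
 case (step a b l c)
 have ab: "(a - k) / m \<le> (b - k) / m" "(b - k) / m < (c - k) / m"
  using pcl_le[OF step(1)] step(2) m by (simp_all add: divide_le_cancel divide_less_cancel)
 have im: "(\<lambda>t. m * t + k) ` {(b - k) / m..(c - k) / m} = {b..c}"
  using m step(2) by (simp add: image_affinity_atLeastAtMost divide_right_mono)
 have e: "f' t = f (m * t + k)" if "t \<in> {(b - k) / m..(c - k) / m}" for t
  using step.prems that ab by auto
 have "pcl f' ((a - k) / m) ((b - k) / m) l" using step.prems ab by (intro step.IH) auto
 from pcl.step[OF this ab(2) C1_curve_affine(1)[OF step(3,2) _ ab(2) im e]]
 show ?case using C1_curve_affine(2)[OF step(3,2) _ ab(2) im e] m by simp
qed

lemma pcl_reverse:
 assumes "pcl f a b l" and "!!t. t \<in> {- b..- a} ==> f' t = f (- t)"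
 shows "pcl f' (- b) (- a) l"
 using assms
proof (induction rule: pcl.induct)
 case (refl a)
 show ?case by (rule pcl.refl)
next
 case (step a b l c)
 have ab: "- b \<le> - a" "- c < - b" using pcl_le[OF step(1)] step(2) by simp_all
 have im: "(\<lambda>t. (- 1) * t + 0) ` {- c..- b} = {b..c}"
  using step(2) by (simp add: image_uminus_atLeastAtMost)
 have e: "f' t = f ((- 1) * t + 0)" if "t \<in> {- c..- b}" for t
  using step.prems that ab by auto
 have "pcl f' (- b) (- a) l" using step.prems ab by (intro step.IH) auto
 moreover have "pcl f' (- c) (- b) (integral {b..c} (speed_within f b c))"
  using pcl_single[OF ab(2) C1_curve_affine(1)[OF step(3,2) _ ab(2) im e]]
   C1_curve_affine(2)[OF step(3,2) _ ab(2) im e] by simp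
 ultimately show ?case using pcl_trans by (metis add.commute)
qed

lemma pcl_split:
 assumes "pcl f a b l" and "a \<le> t" "t \<le> b"
 shows "\<exists>l1 l2. pcl f a t l1 \<and> pcl f t b l2 \<and> l = l1 + l2"
 using assms
proof (induction arbitrary: rule: pcl.induct)
 case (refl a)
 then show ?case using pcl.refl by force
next
 case (step a b l c)
 show ?case
 proof (cases "t \<le> b")
  case True
  then obtain l1 l2 where l: "pcl f a t l1" "pcl f t b l2" "l = l1 + l2" using step.IH step.prems by blast
  from pcl.step[OF l(2) step(2,3)] l(1,3) show ?thesis by (metis add.assoc)
 next
  case False
  show ?thesis
  proof (cases "t = c")
   case True
   then show ?thesis using pcl.step[OF step(1-3)] pcl.refl by (metis add.right_neutral)
  next
   case neq: False
   have t: "b < t" "t < c" using False neq step.prems by auto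
   have 1: "C1_curve_on A f b t" "C1_curve_on A f t c"
    using C1_curve_subinterval(1)[OF step(3,2)] t by auto
   have "pcl f a t (l + integral {b..t} (speed_within f b t))" by (rule pcl.step[OF step(1) t(1) 1(1)])
   moreover have "pcl f t c (integral {t..c} (speed_within f t c))" by (rule pcl_single[OF t(2) 1(2)])
   moreover have "integral {b..c} (speed_within f b c) = integral {b..t} (speed_within f b t) + integral {t..c} (speed_within f t c)"
   proof -
    have "integral {b..t} (speed_within f b t) = integral {b..t} (speed_within f b c)"
     "integral {t..c} (speed_within f t c) = integral {t..c} (speed_within f b c)"
     using C1_curve_subinterval(2)[OF step(3,2)] t by auto
    moreover have "integral {b..t} (speed_within f b c) + integral {t..c} (speed_within f b c) = integral {b..c} (speed_within f b c)"
     using t speed_within_cont[OF step(3,2)] by (intro Henstock_Kurzweil_Integration.integral_combine integrable_continuous_real) auto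
    ultimately show ?thesis by simp
   qed
   ultimately show ?thesis by (metis add.assoc)
  qed
 qed
qed

lemma piecewise_imp_pcl: "piecewise_C1_curve A f ==> pcl f 0 1 (curve_length A g f)"
proof -
 assume "piecewise_C1_curve A f"
 then obtain n \<tau> where \<tau>: "\<tau> 0 = (0::real)" "\<tau> n = 1" "!!i. i < n ==> \<tau> i < \<tau> (Suc i) \<and> C1_curve_on A f (\<tau> i) (\<tau> (Suc i))"
  unfolding piecewise_C1_curve_def by blast
 have "k \<le> n ==> \<exists>l. pcl f (\<tau> 0) (\<tau> k) l" for k
 proof (induction k)
  case 0
  show ?case using pcl.refl by blast
 next
  case (Suc k)
  then obtain l where "pcl f (\<tau> 0) (\<tau> k) l" by auto
  from pcl.step[OF this] show ?case using \<tau>(3)[of k] Suc.prems by auto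
 qed
 then obtain l where l: "pcl f 0 1 l" using \<tau>(1,2) by (metis order_refl)
 have "curve_length A g f = l"
  unfolding curve_length_def speed_def[symmetric] by (rule integral_unique[OF pcl_integral[OF l]])
 then show ?thesis using l by simp
qed

lemma pcl_imp_piecewise:
 assumes "pcl f 0 1 l"
 shows "piecewise_C1_curve A f" "curve_length A g f = l"
proof -
 have "\<exists>n \<tau>. \<tau> 0 = a \<and> \<tau> n = b \<and> (\<forall>i<n. \<tau> i < \<tau> (Suc i) \<and> C1_curve_on A f (\<tau> i) (\<tau> (Suc i)))"
  if "pcl f a b l" for a b l
  using that
 proof (induction rule: pcl.induct)
  case (refl a)
  show ?case by (intro exI[of _ 0] exI[of _ "\<lambda>_. a"]) simp
 next
  case (step a b l c)
  then obtain n \<tau> where \<tau>: "\<tau> 0 = a" "\<tau> n = b" "\<forall>i<n. \<tau> i < \<tau> (Suc i) \<and> C1_curve_on A f (\<tau> i) (\<tau> (Suc i))" by blast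
  define \<tau>' where "\<tau>' i = (if i \<le> n then \<tau> i else c)" for i
  have "\<tau>' i < \<tau>' (Suc i) \<and> C1_curve_on A f (\<tau>' i) (\<tau>' (Suc i))" if "i < Suc n" for i
   using \<tau> step(2,3) that by (cases "i = n") (auto simp: \<tau>'_def)
  then show ?case using \<tau> by (intro exI[of _ "Suc n"] exI[of _ \<tau>']) (auto simp: \<tau>'_def)
 qed
 from this[OF assms] show "piecewise_C1_curve A f" unfolding piecewise_C1_curve_def .
 show "curve_length A g f = l"
  unfolding curve_length_def speed_def[symmetric] by (rule integral_unique[OF pcl_integral[OF assms]])
qed

section \<open>The distance as an infimum of lengths\<close>

definition joined :: "'a => 'a => real => bool" where
 "joined p q l \<longleftrightarrow> (\<exists>f. pcl f 0 1 l \<and> f 0 = p \<and> f 1 = q)"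

lemma rdist_eq: "rdist A g p q = Inf {l. joined p q l}"
proof -
 have "curve_length A g ` {f. piecewise_C1_curve A f \<and> f 0 = p \<and> f 1 = q} = {l. joined p q l}"
  unfolding joined_def using piecewise_imp_pcl pcl_imp_piecewise by blast
 then show ?thesis unfolding rdist_def by simp
qed

lemma joinedI:
 assumes "pcl f a b l" "a < b"
 shows "joined (f a) (f b) l"
proof -
 define m where "m = b - a"
 have m: "m > 0" using assms(2) by (simp add: m_def)
 have "pcl (\<lambda>t. f (m * t + a)) ((a - a) / m) ((b - a) / m) l"
  by (rule pcl_affine[OF assms(1) m]) simp
 then have "pcl (\<lambda>t. f (m * t + a)) 0 1 l" using m by (simp add: m_def)
 then show ?thesis unfolding joined_def by (intro exI[of _ "\<lambda>t. f (m * t + a)"]) (simp add: m_def)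
qed

lemma joined_nonneg: "joined p q l ==> 0 \<le> l"
 unfolding joined_def using pcl_nonneg by blast

lemma rdist_le: "joined p q l ==> rdist A g p q \<le> l"
 unfolding rdist_eq using joined_nonneg by (intro cInf_lower bdd_belowI[of _ 0]) auto

lemma joined_sym: "joined p q l ==> joined q p l"
proof -
 assume "joined p q l"
 then obtain f where f: "pcl f 0 1 l" "f 0 = p" "f 1 = q" unfolding joined_def by blast
 have "pcl (\<lambda>t. f (- t)) (- 1) (- 0) l" by (rule pcl_reverse[OF f(1)]) simp
 from joinedI[OF this] show ?thesis using f by simp
qed

lemma joined_trans:
 assumes "joined p q l" "joined q r l'"
 shows "joined p r (l + l')"
proof -
 obtain f1 where f1: "pcl f1 0 1 l" "f1 0 = p" "f1 1 = q" using assms unfolding joined_def by blast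
 obtain f2 where f2: "pcl f2 0 1 l'" "f2 0 = q" "f2 1 = r" using assms unfolding joined_def by blast
 define f where "f t = (if t \<le> 1 then f1 t else f2 (t - 1))" for t
 have "pcl f ((0 - 0) / 1) ((1 - 0) / 1) l"
  by (rule pcl_affine[OF f1(1)]) (auto simp: f_def)
 \<comment> \<open>The second path is delayed by one unit, hence k = -1; at parameter 1 both
   branches of f give q.\<close>
 moreover have "pcl f ((0 - (- 1)) / 1) ((1 - (- 1)) / 1) l'"
  by (rule pcl_affine[OF f2(1)]) (use f1 f2 in \<open>auto simp: f_def\<close>)
 ultimately have "pcl f 0 2 (l + l')" by (intro pcl_trans[of f 1]) simp_all
 from joinedI[OF this] show ?thesis using f1 f2 by (simp add: f_def)
qed

text \<open>The straight coordinate segment is a competitor for the distance. Its length is at most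
  the largest speed, as the parameter interval has length 1.\<close>

lemma joined_segment:
 assumes c: "c \<in> A" and seg: "closed_segment y z \<subseteq> snd c ` fst c"
  and M: "!!x. x \<in> closed_segment y z ==> sqrt ((z - y) \<bullet> (G c (chart_inv c x) *v (z - y))) \<le> M"
 shows "\<exists>l\<le>M. joined (chart_inv c y) (chart_inv c z) l"
proof -
 define h where "h t = y + t *R (z - y)" for t :: real
 define f where "f = chart_inv c \<circ> h"
 have hin: "h t \<in> closed_segment y z" if "t \<in> {0..1}" for t
  using that unfolding closed_segment_def h_def by (auto intro!: exI[of _ t] simp: algebra_simps)
 have hin': "h t \<in> snd c ` fst c" if "t \<in> {0..1}" for t using hin[OF that] seg by blast
 have hd: "(h has_vector_derivative (z - y)) (at t within {0..1})" for t
  unfolding h_def by (auto intro!: derivative_eq_intros)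
 have hc: "continuous_on {0..1} h" unfolding h_def by (intro continuous_intros)
 have der: "((snd c' \<circ> f) has_vector_derivative transition_derivative c c' (f t) (z - y)) (at t within {0..1})"
  if c': "c' \<in> A" and t: "t \<in> {0..1}" "f t \<in> fst c'" for c' t
 proof -
  have "h t \<in> snd c ` (fst c \<inter> fst c')"
   using hin'[OF t(1)] t(2) c chart_inv_in[OF c hin'[OF t(1)]] unfolding f_def
   by (intro image_eqI[of _ _ "chart_inv c (h t)"]) auto
  then have "((snd c' \<circ> chart_inv c) has_derivative transition_derivative c c' (f t)) (at (h t) within h ` {0..1})"
   using transition_smooth[OF c c'] has_derivative_at_withinI by (simp add: f_def) blast
  from diff_chain_within[OF hd[unfolded has_vector_derivative_def] this]
  have "((snd c' \<circ> chart_inv c \<circ> h) has_derivative (transition_derivative c c' (f t) \<circ> (\<lambda>s. s *R (z - y)))) (at t within {0..1})" .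
  moreover have "linear (transition_derivative c c' (f t))"
   using transition_linear[OF c c'] t chart_inv_in[OF c hin'[OF t(1)]] by (simp add: f_def)
  ultimately show ?thesis
   by (simp add: has_vector_derivative_def f_def o_def linear_cmul)
 qed
 have C1: "C1_curve_on A f 0 1"
  unfolding C1_curve_on_def
 proof (intro conjI ballI)
  show "continuous_on {0..1} f"
   unfolding f_def by (intro continuous_on_compose hc continuous_on_subset[OF chart_cont(2)[OF c]]) (use hin' in auto)
  fix c' assume c': "c' \<in> A"
  have "continuous_on ({0..1} \<inter> f -` fst c') (\<lambda>t. transition_derivative c c' (chart_inv c (h t)) (z - y))"
  proof (rule continuous_on_compose2[OF transition_derivative_cont[OF c c'] continuous_on_subset[OF hc]])
   show "h ` ({0..1} \<inter> f -` fst c') \<subseteq> snd c ` (fst c \<inter> fst c')"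
   proof
    fix x assume "x \<in> h ` ({0..1} \<inter> f -` fst c')"
    then obtain t where t: "t \<in> {0..1}" "chart_inv c (h t) \<in> fst c'" "x = h t" by (auto simp: f_def)
    show "x \<in> snd c ` (fst c \<inter> fst c')"
     using hin'[OF t(1)] t c chart_inv_in[OF c hin'[OF t(1)]]
     by (intro image_eqI[of _ _ "chart_inv c (h t)"]) auto
   qed
  qed auto
  then show "\<exists>D. (\<forall>t\<in>{0..1} \<inter> f -` fst c'. ((snd c' \<circ> f) has_vector_derivative D t) (at t within {0..1})) \<and>
    continuous_on ({0..1} \<inter> f -` fst c') D"
   using der[OF c'] by (intro exI[of _ "\<lambda>t. transition_derivative c c' (f t) (z - y)"]) (auto simp: f_def)
 qed
 have sp: "speed_within f 0 1 t \<le> M" if t: "t \<in> {0..1}" for t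
 proof -
  have ft: "f t \<in> fst c" using chart_inv_in[OF c hin'[OF t]] by (simp add: f_def)
  have "velocity_within f 0 1 t c = transition_derivative c c (f t) (z - y)"
   using vector_derivative_within_closed_interval[of 0 1 t "snd c \<circ> f" _] der[OF c t ft] t c ft
   by (simp add: velocity_within_def cbox_interval)
  then have "velocity_within f 0 1 t c = z - y" using transition_self[OF c ft] by simp
  then have "speed_within f 0 1 t = sqrt ((z - y) \<bullet> (G c (f t) *v (z - y)))"
   unfolding speed_within_def
   using g_tangent[OF velocity_within_tangent[OF C1 _ t] velocity_within_tangent[OF C1 _ t] c ft] by simp
  then show ?thesis using M[OF hin[OF t]] by (simp add: f_def)
 qed
 have "integral {0..1} (speed_within f 0 1) \<le> integral {0..1::real} (\<lambda>_. M)"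
  using integrable_continuous_real[OF speed_within_cont[OF C1]] sp
  by (intro Henstock_Kurzweil_Integration.integral_le) auto
 moreover have "joined (f 0) (f 1) (integral {0..1} (speed_within f 0 1))"
  by (rule joinedI[OF pcl_single[OF _ C1]]) auto
 ultimately show ?thesis by (auto simp: f_def h_def)
qed

end

section \<open>Comparison with the Euclidean norm in coordinates\<close>

context riemannian
begin

text \<open>The quadratic form attains its minimum and maximum on the compact product of K with the
  unit sphere, and the minimum is positive; homogeneity extends the bounds to all w.\<close>

lemma metric_bounds:
 assumes c: "c \<in> A" and K: "compact K" "K \<subseteq> snd c ` fst c"
 obtains m M where "m > 0" "M > 0"
  "!!x w. x \<in> K ==> m * norm w \<le> sqrt (w \<bullet> (G c (chart_inv c x) *v w))"
  "!!x w. x \<in> K ==> sqrt (w \<bullet> (G c (chart_inv c x) *v w)) \<le> M * norm w"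
proof (cases "K = {}")
 case True
 then show ?thesis using that[of 1 1] by auto
next
 case False
 define q where "q = (\<lambda>(x, w). w \<bullet> (G c (chart_inv c x) *v w))"
 let ?S = "sphere (0 :: real ^ 'n) 1"
 have cp: "compact (K \<times> ?S)" using K(1) by (intro compact_Times) auto
 have ne: "K \<times> ?S \<noteq> {}" using False by auto
 have cont: "continuous_on (K \<times> ?S) q"
  unfolding q_def by (rule continuous_on_subset[OF G_quadratic_cont[OF c]]) (use K in auto)
 obtain a where a: "a \<in> K \<times> ?S" "\<forall>y\<in>K \<times> ?S. q a \<le> q y"
  using continuous_attains_inf[OF cp ne cont] by blast
 obtain b where b: "b \<in> K \<times> ?S" "\<forall>y\<in>K \<times> ?S. q y \<le> q b"
  using continuous_attains_sup[OF cp ne cont] by blast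
 have qpos: "q (x, w) > 0" if "x \<in> K" "w \<noteq> 0" for x w
  unfolding q_def prod.case using that K(2) c by (intro G_pos chart_inv_in) auto
 have "snd a \<noteq> 0" "snd b \<noteq> 0" using a(1) b(1) by auto
 then have apos: "q a > 0" and bpos: "q b > 0"
  using qpos[of "fst a" "snd a"] qpos[of "fst b" "snd b"] a(1) b(1) by auto
 have scale: "sqrt (q (x, w)) = norm w * sqrt (q (x, w /\<^sub>R norm w))" if "w \<noteq> 0" for x w
 proof -
  have "q (x, w) = (norm w)\<^sup>2 * q (x, w /\<^sub>R norm w)"
   using that by (simp add: q_def matrix_vector_mult_scaleR power2_eq_square field_simps)
  then show ?thesis by (simp add: real_sqrt_mult)
 qed
 show ?thesis
 proof (rule that[of "sqrt (q a)" "sqrt (q b)"])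
  fix x w assume x: "x \<in> K"
  have "sqrt (q a) * norm w \<le> sqrt (q (x, w)) \<and> sqrt (q (x, w)) \<le> sqrt (q b) * norm w"
  proof (cases "w = 0")
   case True
   then show ?thesis by (simp add: q_def)
  next
   case False
   then have "(x, w /\<^sub>R norm w) \<in> K \<times> ?S" using x by simp
   then have "q a \<le> q (x, w /\<^sub>R norm w)" "q (x, w /\<^sub>R norm w) \<le> q b" using a b by blast+
   then show ?thesis unfolding scale[OF False] by (simp add: mult.commute mult_left_mono)
  qed
  then show "sqrt (q a) * norm w \<le> sqrt (w \<bullet> (G c (chart_inv c x) *v w))"
   "sqrt (w \<bullet> (G c (chart_inv c x) *v w)) \<le> sqrt (q b) * norm w" by (simp_all add: q_def)
 qed (use apos bpos in auto)
qed

text \<open>By the fundamental theorem of calculus the coordinate displacement is the integral of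
  the coordinate velocity, and m times the norm of the latter is at most the speed while the curve
  stays over K.\<close>

lemma pcl_lower:
 assumes "pcl f a b l" and c: "c \<in> A" and K: "K \<subseteq> snd c ` fst c" and m: "m > 0"
  and lower: "!!x w. x \<in> K ==> m * norm w \<le> sqrt (w \<bullet> (G c (chart_inv c x) *v w))"
  and inK: "!!t. t \<in> {a..b} ==> f t \<in> chart_inv c ` K"
 shows "m * norm (snd c (f b) - snd c (f a)) \<le> l"
 using assms(1) inK
proof (induction rule: pcl.induct)
 case (refl a)
 then show ?case by simp
next
 case (step a b l d)
 have bd: "b < d" and ab: "a \<le> b" using step(2) pcl_le[OF step(1)] by auto
 have IH: "m * norm (snd c (f b) - snd c (f a)) \<le> l"
  using step.IH step.prems bd by auto
 let ?W = "\<lambda>t. velocity_within f b d t c"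
 have in_c: "f t \<in> fst c" "snd c (f t) \<in> K" if "t \<in> {b..d}" for t
 proof -
  have "f t \<in> chart_inv c ` K" using step.prems that ab by auto
  then obtain x where x: "x \<in> K" "f t = chart_inv c x" by blast
  then have "x \<in> snd c ` fst c" using K by blast
  then show "f t \<in> fst c" "snd c (f t) \<in> K" using x c by auto
 qed
 have "(?W has_integral ((snd c \<circ> f) d - (snd c \<circ> f) b)) {b..d}"
 proof (rule fundamental_theorem_of_calculus)
  show "((snd c \<circ> f) has_vector_derivative ?W t) (at t within {b..d})" if "t \<in> {b..d}" for t
   by (rule C1_curve_derivative[OF step(3) bd that c in_c(1)[OF that]])
 qed (use bd in simp)
 moreover have "continuous_on {b..d} ?W"
 proof -
  have "{b..d} \<inter> f -` fst c = {b..d}" using in_c by auto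
  then show ?thesis using C1_curve_derivative_cont[OF step(3) bd c] by simp
 qed
 moreover have "m * norm (?W t) \<le> speed_within f b d t" if t: "t \<in> {b..d}" for t
  using lower[OF in_c(2)[OF t], of "?W t"] in_c(1)[OF t] c
   g_tangent[OF velocity_within_tangent[OF step(3) bd t] velocity_within_tangent[OF step(3) bd t] c in_c(1)[OF t]]
  by (simp add: speed_within_def)
 ultimately have "norm (integral {b..d} ?W) \<le> integral {b..d} (\<lambda>t. speed_within f b d t / m)"
  using m speed_within_cont[OF step(3) bd]
  by (intro integral_norm_bound_integral integrable_continuous_real continuous_intros)
   (auto simp: field_simps)
 moreover have "integral {b..d} ?W = snd c (f d) - snd c (f b)"
  using \<open>(?W has_integral _) _\<close> by (simp add: integral_unique)
 ultimately have "m * norm (snd c (f d) - snd c (f b)) \<le> integral {b..d} (speed_within f b d)"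
  using m by (simp add: field_simps)
 moreover have "norm (snd c (f d) - snd c (f a)) \<le> norm (snd c (f d) - snd c (f b)) + norm (snd c (f b) - snd c (f a))"
  using norm_triangle_ineq[of "snd c (f d) - snd c (f b)" "snd c (f b) - snd c (f a)"] by simp
 then have "m * norm (snd c (f d) - snd c (f a)) \<le> m * norm (snd c (f d) - snd c (f b)) + m * norm (snd c (f b) - snd c (f a))"
  using m by (simp add: distrib_left[symmetric])
 ultimately show ?case using IH by linarith
qed

text \<open>At its first exit time a path out of the coordinate ball has covered coordinate distance
  at least r inside the closed ball, where the metric is bounded below.\<close>

lemma joined_exit:
 assumes c: "c \<in> A" "p \<in> fst c" and r: "r > 0" "cball (snd c p) r \<subseteq> snd c ` fst c" and m: "m > 0"
  and lower: "!!x w. x \<in> cball (snd c p) r ==> m * norm w \<le> sqrt (w \<bullet> (G c (chart_inv c x) *v w))"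
  and q: "q \<notin> chart_inv c ` ball (snd c p) r" and j: "joined p q l"
 shows "m * r \<le> l"
proof -
 let ?U = "chart_inv c ` ball (snd c p) r" and ?K = "chart_inv c ` cball (snd c p) r"
 obtain f where f: "pcl f 0 1 l" "f 0 = p" "f 1 = q" using j unfolding joined_def by blast
 have bsub: "ball (snd c p) r \<subseteq> snd c ` fst c" using r(2) ball_subset_cball by blast
 have Uo: "open ?U" by (rule chart_inv_image_open[OF c(1) open_ball bsub])
 have Kc: "closed ?K"
  using compact_continuous_image[OF continuous_on_subset[OF chart_cont(2)[OF c(1)] r(2)] compact_cball] by (rule compact_imp_closed)
 have fc: "continuous_on {0..1} f" by (rule pcl_continuous[OF f(1)])
 define E where "E = {0..1} \<inter> f -` (- ?U)"
 have "closed E" unfolding E_def using fc Uo by (intro continuous_closed_preimage) auto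
 moreover have "1 \<in> E" using q f by (auto simp: E_def)
 moreover have bb: "bdd_below E" unfolding E_def by (intro bdd_belowI[of _ 0]) auto
 ultimately have T: "Inf E \<in> E" by (intro closed_contains_Inf) auto
 \<comment> \<open>The first exit time. It is attained since E is closed, and up to it the path
   stays in the closed coordinate ball by continuity.\<close>
 define T where "T = Inf E"
 have T01: "T \<in> {0..1}" and TU: "f T \<notin> ?U" using T by (auto simp: E_def T_def)
 have before: "f t \<in> ?U" if "0 \<le> t" "t < T" for t
 proof (rule ccontr)
  assume "f t \<notin> ?U"
  then have "t \<in> E" using that T01 by (auto simp: E_def)
  then show False using cInf_lower[OF _ bb] that by (force simp: T_def)
 qed
 have pU: "p \<in> ?U" using c r by (intro image_eqI[of _ _ "snd c p"]) auto
 have T0: "T > 0" using TU pU f(2) T01 by (cases "T = 0") auto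
 have inK: "f t \<in> ?K" if t: "t \<in> {0..T}" for t
 proof -
  have "{0..T} \<subseteq> {0..1}" using T01 by auto
  then have "continuous_on (closure {0..<T}) f" using continuous_on_subset[OF fc] T0 by simp
  moreover have "f ` {0..<T} \<subseteq> ?K" using before ball_subset_cball by fastforce
  ultimately have "f ` closure {0..<T} \<subseteq> ?K" using Kc by (intro image_closure_subset)
  then show ?thesis using t T0 by (auto simp: image_subset_iff)
 qed
 obtain l1 l2 where l: "pcl f 0 T l1" "pcl f T 1 l2" "l = l1 + l2"
  using pcl_split[OF f(1), of T] T01 by auto
 have "m * norm (snd c (f T) - snd c (f 0)) \<le> l1"
  by (rule pcl_lower[OF l(1) c(1) r(2) m lower inK])
 moreover have "norm (snd c (f T) - snd c p) \<ge> r"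
 proof (rule ccontr)
  assume "\<not> r \<le> norm (snd c (f T) - snd c p)"
  then have "snd c (f T) \<in> ball (snd c p) r" by (simp add: dist_norm norm_minus_commute)
  moreover have "f T \<in> fst c" using inK[of T] T0 r(2) c(1) by auto
  then have "f T = chart_inv c (snd c (f T))" using c(1) by simp
  ultimately have "f T \<in> ?U" by blast
  then show False using TU by simp
 qed
 then have "m * r \<le> m * norm (snd c (f T) - snd c p)" using m by (intro mult_left_mono) auto
 ultimately show ?thesis using f(2) l(3) pcl_nonneg[OF l(2)] by simp
qed

lemma joined_ball:
 assumes c: "c \<in> A" and r: "cball x r \<subseteq> snd c ` fst c" "M > 0"
  and upper: "!!x' w. x' \<in> cball x r ==> sqrt (w \<bullet> (G c (chart_inv c x') *v w)) \<le> M * norm w"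
  and y: "y \<in> cball x r" "z \<in> cball x r"
 shows "\<exists>l \<le> M * norm (z - y). joined (chart_inv c y) (chart_inv c z) l"
proof (rule joined_segment[OF c])
 have "closed_segment y z \<subseteq> cball x r" using y by (simp add: closed_segment_subset)
 then show "closed_segment y z \<subseteq> snd c ` fst c"
  "!!x'. x' \<in> closed_segment y z ==> sqrt ((z - y) \<bullet> (G c (chart_inv c x') *v (z - y))) \<le> M * norm (z - y)"
  using r upper by blast+
qed

end

section \<open>The distance as a metric for the manifold topology\<close>

locale connected_riemannian = riemannian +
 assumes connected: "connected (UNIV :: 'a set)"
begin

text \<open>Being joined is an equivalence relation with open classes. The complement of a class is
  a union of classes, hence open, and connectedness leaves a single one.\<close>

lemma joined_ex: "\<exists>l. joined p q l"
proof -
 let ?R = "\<lambda>p. {q. \<exists>l. joined p q l}"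
 have refl: "joined p p 0" for p
 proof -
  have "pcl (\<lambda>_. p) 0 0 0" by (rule pcl.refl)
  obtain c where c: "c \<in> A" "p \<in> fst c" using chart_exists by blast
  \<comment> \<open>The constant path on [0, 1] arises as a degenerate coordinate segment; the rule
    \<open>pcl.refl\<close> covers only degenerate parameter intervals.\<close>
  have "\<exists>l\<le>0. joined (chart_inv c (snd c p)) (chart_inv c (snd c p)) l"
   by (rule joined_segment[OF c(1)]) (use c in auto)
  then obtain l where "l \<le> 0" "joined p p l" using c by auto
  then show ?thesis using joined_nonneg[of p p l] by (metis order.antisym)
 qed
 have op: "open (?R p)" for p
 proof (rule topological_space_class.openI)
  fix q assume "q \<in> ?R p"
  then obtain l where l: "joined p q l" by blast
  obtain c where c: "c \<in> A" "q \<in> fst c" using chart_exists by blast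
  obtain r where r: "r > 0" "cball (snd c q) r \<subseteq> snd c ` fst c" "chart_inv c ` cball (snd c q) r \<subseteq> UNIV"
   "compact (chart_inv c ` cball (snd c q) r)" "open (chart_inv c ` ball (snd c q) r)" "q \<in> chart_inv c ` ball (snd c q) r"
   by (rule coordinate_ball[OF open_UNIV UNIV_I c])
  obtain m M where M: "M > 0" "!!x w. x \<in> cball (snd c q) r ==> sqrt (w \<bullet> (G c (chart_inv c x) *v w)) \<le> M * norm w"
   using metric_bounds[OF c(1) compact_cball r(2)] by metis
  have "chart_inv c ` ball (snd c q) r \<subseteq> ?R p"
  proof
   fix q' assume "q' \<in> chart_inv c ` ball (snd c q) r"
   then obtain y where y: "y \<in> ball (snd c q) r" "q' = chart_inv c y" by blast
   have "\<exists>l \<le> M * norm (y - snd c q). joined (chart_inv c (snd c q)) (chart_inv c y) l"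
    by (rule joined_ball[OF c(1) r(2) M]) (use y r(1) in auto)
   then obtain l' where "joined q (chart_inv c y) l'" using c by auto
   from joined_trans[OF l this] show "q' \<in> ?R p" using y(2) by blast
  qed
  then show "\<exists>T. open T \<and> q \<in> T \<and> T \<subseteq> ?R p" using r by blast
 qed
 have "- ?R p = \<Union> (?R ` (- ?R p))" for p
 proof (intro set_eqI iffI)
  fix q assume "q \<in> - ?R p"
  then show "q \<in> \<Union> (?R ` (- ?R p))" using refl by blast
 next
  fix q assume "q \<in> \<Union> (?R ` (- ?R p))"
  then obtain q' where q'0: "q' \<in> - ?R p" "q \<in> ?R q'" by (elim UN_E)
  then obtain l where q': "joined q' q l" by auto
  show "q \<in> - ?R p"
  proof
   assume "q \<in> ?R p"
   then obtain l' where "joined p q l'" by auto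
   from joined_trans[OF this joined_sym[OF q']] show False using q'0(1) by auto
  qed
 qed
 then have compl: "- ?R p = \<Union> (?R ` (- ?R p))" .
 have "open (\<Union> (?R ` (- ?R p)))" by (intro open_UN ballI op)
 then have "closed (?R p)" unfolding closed_def by (subst compl)
 then have "closedin (top_of_set UNIV) (?R p)" "openin (top_of_set UNIV) (?R p)" using op[of p] by simp_all
 then have "?R p = UNIV \<or> ?R p = {}"
  using connected[unfolded connected_clopen, rule_format, of "?R p"] by auto
 then have "?R p = UNIV" using refl by blast
 then show ?thesis by blast
qed

abbreviation d :: "'a => 'a => real" where
 "d \<equiv> rdist A g"

lemma d_nonneg: "0 \<le> d p q"
 unfolding rdist_eq using joined_ex joined_nonneg by (intro cInf_greatest) auto

lemma d_less_imp: "d p q < x ==> \<exists>l<x. joined p q l"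
 unfolding rdist_eq using joined_ex joined_nonneg cInf_lessD[of "{l. joined p q l}" x] by blast

lemma d_sym: "d p q = d q p"
proof -
 have "joined p q = joined q p" using joined_sym by (intro ext iffI)
 then show ?thesis by (simp add: rdist_eq)
qed

lemma d_triangle: "d p r \<le> d p q + d q r"
proof (rule field_le_epsilon)
 fix e :: real assume e: "e > 0"
 obtain l where l: "l < d p q + e/2" "joined p q l" using d_less_imp[of p q "d p q + e/2"] e by auto
 obtain l' where l': "l' < d q r + e/2" "joined q r l'" using d_less_imp[of q r "d q r + e/2"] e by auto
 show "d p r \<le> d p q + d q r + e" using rdist_le[OF joined_trans[OF l(2) l'(2)]] l(1) l'(1) by simp
qed

text \<open>By \<open>joined_exit\<close> a path shorter than m r cannot leave a coordinate ball of
  radius r inside S.\<close>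

lemma d_ball_subset:
 assumes "open S" "p \<in> S"
 obtains e where "e > 0" "!!q. d p q < e ==> q \<in> S"
proof -
 obtain c where c: "c \<in> A" "p \<in> fst c" using chart_exists by blast
 obtain r where r: "r > 0" "cball (snd c p) r \<subseteq> snd c ` fst c" "chart_inv c ` cball (snd c p) r \<subseteq> S"
  "compact (chart_inv c ` cball (snd c p) r)" "open (chart_inv c ` ball (snd c p) r)" "p \<in> chart_inv c ` ball (snd c p) r"
  by (rule coordinate_ball[OF assms c])
 obtain m M where m: "m > 0" "!!x w. x \<in> cball (snd c p) r ==> m * norm w \<le> sqrt (w \<bullet> (G c (chart_inv c x) *v w))"
  using metric_bounds[OF c(1) compact_cball r(2)] by metis
 show ?thesis
 proof (rule that[of "m * r"])
  show "m * r > 0" using m(1) r(1) by simp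
  fix q assume "d p q < m * r"
  then obtain l where l: "l < m * r" "joined p q l" using d_less_imp by blast
  have "q \<in> chart_inv c ` ball (snd c p) r"
   using joined_exit[OF c r(1,2) m _ l(2)] l(1) by force
  then show "q \<in> S" using r(3) ball_subset_cball by blast
 qed
qed

lemma d_self: "d p p = 0"
proof -
 obtain l where l: "joined p p l" using joined_ex by blast
 have "d p p \<le> e" if "e > 0" for e
 proof -
  obtain c where c: "c \<in> A" "p \<in> fst c" using chart_exists by blast
  have "\<exists>l\<le>0. joined (chart_inv c (snd c p)) (chart_inv c (snd c p)) l"
   by (rule joined_segment[OF c(1)]) (use c in auto)
  then obtain l where "l \<le> 0" "joined p p l" using c by auto
  then show ?thesis using rdist_le[of p p l] that by simp
 qed
 then have "d p p \<le> 0" by (rule field_le_epsilon[of _ 0, simplified])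
 then show ?thesis using d_nonneg[of p p] by simp
qed

lemma d_zero_imp: "d p q = 0 ==> p = q"
proof (rule ccontr)
 assume d0: "d p q = 0" and neq: "p \<noteq> q"
 have "open (- {q})" "p \<in> - {q}" using neq by auto
 then obtain e where "e > 0" "!!q'. d p q' < e ==> q' \<in> - {q}" using d_ball_subset by metis
 then show False using d0 by force
qed

sublocale MS: Metric_space UNIV d
proof
 show "0 \<le> d x y" for x y by (rule d_nonneg)
 show "d x y = d y x" for x y by (rule d_sym)
 show "(d x y = 0) = (x = y)" if "x \<in> UNIV" "y \<in> UNIV" for x y
  using d_zero_imp d_self by metis
 show "d x z \<le> d x y + d y z" if "x \<in> UNIV" "y \<in> UNIV" "z \<in> UNIV" for x y z by (rule d_triangle)
qed

lemma d_chart_bound: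
 assumes c: "c \<in> A" and r: "cball x r \<subseteq> snd c ` fst c"
 obtains M where "M > 0" "!!y z. y \<in> cball x r ==> z \<in> cball x r ==> d (chart_inv c y) (chart_inv c z) \<le> M * norm (z - y)"
proof -
 obtain m M where M: "M > 0" "!!x' w. x' \<in> cball x r ==> sqrt (w \<bullet> (G c (chart_inv c x') *v w)) \<le> M * norm w"
  using metric_bounds[OF c compact_cball r] by metis
 have "d (chart_inv c y) (chart_inv c z) \<le> M * norm (z - y)" if "y \<in> cball x r" "z \<in> cball x r" for y z
  using joined_ball[OF c r M that] rdist_le by fastforce
 with M(1) show ?thesis by (rule that)
qed

text \<open>The lower comparison with coordinates, in \<open>d_ball_subset\<close>, gives one
  inclusion of the topologies, and the upper one, in \<open>d_chart_bound\<close>, the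
  other.\<close>

lemma open_iff_mopen: "open S \<longleftrightarrow> openin MS.mtopology S"
proof
 assume S: "open S"
 show "openin MS.mtopology S"
  unfolding MS.openin_mtopology
 proof (intro conjI allI impI)
  fix p assume "p \<in> S"
  then obtain e where "e > 0" "!!q. d p q < e ==> q \<in> S" using d_ball_subset[OF S] by metis
  then show "\<exists>r>0. MS.mball p r \<subseteq> S" by (intro exI[of _ e]) (auto simp: MS.mball_def)
 qed simp
next
 assume S: "openin MS.mtopology S"
 show "open S"
 proof (rule topological_space_class.openI)
  fix p assume "p \<in> S"
  then obtain e where e: "e > 0" "MS.mball p e \<subseteq> S" using S unfolding MS.openin_mtopology by blast
  obtain c where c: "c \<in> A" "p \<in> fst c" using chart_exists by blast
  obtain r where r: "r > 0" "cball (snd c p) r \<subseteq> snd c ` fst c" "chart_inv c ` cball (snd c p) r \<subseteq> UNIV"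
   "compact (chart_inv c ` cball (snd c p) r)" "open (chart_inv c ` ball (snd c p) r)" "p \<in> chart_inv c ` ball (snd c p) r"
   by (rule coordinate_ball[OF open_UNIV UNIV_I c])
  obtain M where M: "M > 0" "!!y z. y \<in> cball (snd c p) r ==> z \<in> cball (snd c p) r ==>
    d (chart_inv c y) (chart_inv c z) \<le> M * norm (z - y)" using d_chart_bound[OF c(1) r(2)] by metis
  \<comment> \<open>Within coordinate distance e / M the upper bound keeps the distance below e; the
    minimum with r keeps the ball in the chart.\<close>
  define s where "s = min r (e / M)"
  have s: "s > 0" using r(1) e(1) M(1) by (simp add: s_def)
  have sub: "ball (snd c p) s \<subseteq> snd c ` fst c" using r(2) by (auto simp: s_def subset_iff)
  have "chart_inv c ` ball (snd c p) s \<subseteq> S"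
  proof
   fix q assume "q \<in> chart_inv c ` ball (snd c p) s"
   then obtain y where y: "y \<in> ball (snd c p) s" "q = chart_inv c y" by blast
   have "d (chart_inv c (snd c p)) (chart_inv c y) \<le> M * norm (y - snd c p)"
    by (rule M(2)) (use y r(1) in \<open>auto simp: s_def\<close>)
   also have "\<dots> < e" using y M(1) by (simp add: s_def dist_norm norm_minus_commute field_simps)
   finally have "q \<in> MS.mball p e" using c y by (simp add: MS.mball_def)
   then show "q \<in> S" using e(2) by blast
  qed
  moreover have "open (chart_inv c ` ball (snd c p) s)" by (rule chart_inv_image_open[OF c(1) open_ball sub])
  moreover have "p \<in> chart_inv c ` ball (snd c p) s" using c s by (intro image_eqI[of _ _ "snd c p"]) auto
  ultimately show "\<exists>T. open T \<and> p \<in> T \<and> T \<subseteq> S" by blast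
 qed
qed

lemma mtopology_eq: "MS.mtopology = euclidean"
 unfolding topology_eq using open_iff_mopen open_openin by metis

text \<open>The length-space property: a path of length less than a + b is cut where the accumulated
  length leaves less than a before and less than b after.\<close>

lemma d_intermediate:
 assumes "d p q < a + b" "a > 0" "b > 0"
 shows "\<exists>z. d p z < a \<and> d z q < b"
proof -
 obtain l where l: "l < a + b" "joined p q l" using d_less_imp[OF assms(1)] by blast
 then obtain f where f: "pcl f 0 1 l" "f 0 = p" "f 1 = q" unfolding joined_def by blast
 show ?thesis
 proof (cases "l < b")
  case True
  then show ?thesis using rdist_le[OF l(2)] d_self assms by (intro exI[of _ p]) auto
 next
  case False
  \<comment> \<open>The midpoint of the admissible lengths, which lie between l - b and a and also
    between 0 and l.\<close>
  define x where "x = (max 0 (l - b) + min a l) / 2"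
  have x: "l - b < x" "x < a" "0 \<le> x" "x \<le> l" using False l(1) assms by (auto simp: x_def max_def min_def field_simps)
  have int: "speed f integrable_on {0..1}" using pcl_integral[OF f(1)] by blast
  define F where "F t = integral {0..t} (speed f)" for t
  have cont: "continuous_on {0..1} F" unfolding F_def by (rule indefinite_integral_continuous_1[OF int])
  have "F 0 \<le> x" "x \<le> F 1" using x integral_unique[OF pcl_integral[OF f(1)]] by (simp_all add: F_def)
  then obtain t where t: "0 \<le> t" "t \<le> 1" "F t = x" using IVT'[of F 0 x 1] cont by auto
  obtain l1 l2 where l12: "pcl f 0 t l1" "pcl f t 1 l2" "l = l1 + l2" using pcl_split[OF f(1) t(1,2)] by blast
  have l1: "l1 = x" using integral_unique[OF pcl_integral[OF l12(1)]] t(3) by (simp add: F_def)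
  have "d p (f t) < a"
  proof (cases "t = 0")
   case True
   then show ?thesis using d_self f(2) assms by simp
  next
   case False
   then show ?thesis using rdist_le[OF joinedI[OF l12(1)]] t l1 x f(2) by simp
  qed
  moreover have "d (f t) q < b"
  proof (cases "t = 1")
   case True
   then show ?thesis using d_self f(3) assms by simp
  next
   case False
   then show ?thesis using rdist_le[OF joinedI[OF l12(2)]] t l1 l12(3) x f(3) by simp
  qed
  ultimately show ?thesis by blast
 qed
qed

lemma d_lipschitz: "\<bar>d p x - d p y\<bar> \<le> d x y"
 using d_triangle[of p x y] d_triangle[of p y x] d_sym[of x y] by linarith

lemma d_continuous: "continuous_on UNIV (d p)"
proof -
 have "open (d p -` {x<..<y})" for x y
 proof (subst open_iff_mopen, unfold MS.openin_mtopology, intro conjI allI impI)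
  fix q assume q: "q \<in> d p -` {x<..<y}"
  define e where "e = min (d p q - x) (y - d p q)"
  have "e > 0" using q by (auto simp: e_def)
  moreover have "MS.mball q e \<subseteq> d p -` {x<..<y}"
  proof
   fix z assume "z \<in> MS.mball q e"
   then have "d q z < e" by (simp add: MS.mball_def)
   then show "z \<in> d p -` {x<..<y}" using d_lipschitz[of p q z] by (auto simp: e_def)
  qed
  ultimately show "\<exists>r>0. MS.mball q r \<subseteq> d p -` {x<..<y}" by blast
 qed simp
 then show ?thesis
  unfolding continuous_on_open_vimage[OF open_UNIV]
 proof (intro allI impI)
  fix B :: "real set" assume B: "open B"
  have op: "!!x y. open (d p -` {x<..<y})" by fact
  have "\<exists>T. open T \<and> q \<in> T \<and> T \<subseteq> d p -` B" if "q \<in> d p -` B" for q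
  proof -
   obtain e where e: "e > 0" "ball (d p q) e \<subseteq> B" using B \<open>q \<in> d p -` B\<close> openE by blast
   then show ?thesis using op[of "d p q - e" "d p q + e"]
    by (intro exI[of _ "d p -` {d p q - e<..<d p q + e}"]) (auto simp: subset_iff dist_real_def abs_less_iff)
  qed
  then have "open (d p -` B)" by (rule topological_space_class.openI)
  then show "open (d p -` B \<inter> UNIV)" by simp
 qed
qed

end

section \<open>Completeness and compactness of closed balls\<close>

locale complete_manifold = connected_riemannian +
 assumes complete: "MS.mcomplete"
begin

lemma totally_bounded_imp_compact:
 assumes "MS.mtotally_bounded S"
 obtains K where "compact K" "S \<subseteq> K"
proof -
 have "MS.mtotally_bounded (MS.mtopology closure_of S)" by (rule MS.mtotally_bounded_closure_of[OF assms])
 then have "compactin MS.mtopology (MS.mtopology closure_of S)"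
  using MS.mtotally_bounded_eq_compact_closure_of complete assms by blast
 then have "compact (closure S)" by (simp add: mtopology_eq)
 then show ?thesis using that closure_subset by blast
qed

lemma compact_imp_totally_bounded: "compact K ==> MS.mtotally_bounded K"
 using MS.compactin_imp_mtotally_bounded[of K] by (simp add: mtopology_eq)

text \<open>Hopf--Rinow: the supremum of the radii of relatively compact balls is infinite. If it were a
 finite \<open>R\<close>, the ball of radius \<open>R\<close> would be totally bounded since \<open>d\<close> is a length metric, and a
 neighbourhood of its compact closure would contain a larger ball.\<close>

lemma ball_relatively_compact: "\<exists>K. compact K \<and> {q. d p q < R} \<subseteq> K"
proof -
 define S where "S = {R. R > 0 \<and> (\<exists>K. compact K \<and> {q. d p q < R} \<subseteq> K)}"
 have down: "R' \<in> S" if "R \<in> S" "0 < R'" "R' \<le> R" for R R'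
  using that unfolding S_def by (auto intro: order_less_le_trans subset_trans)
 \<comment> \<open>A Lebesgue-number argument: K is covered by finitely many balls whose doubles are
   relatively compact, and a neighbourhood of K narrower than all their radii lies in the union of
   the doubles.\<close>
 have nbhd: "\<exists>e>0. \<exists>K'. compact K' \<and> {q. \<exists>z\<in>K. d z q < e} \<subseteq> K'" if K: "compact K" for K
 proof -
  have "\<exists>e>0. \<exists>C. compact C \<and> {q. d z q < 2 * e} \<subseteq> C" for z
  proof -
   obtain c where c: "c \<in> A" "z \<in> fst c" using chart_exists by blast
   obtain r where r: "r > 0" "cball (snd c z) r \<subseteq> snd c ` fst c" "chart_inv c ` cball (snd c z) r \<subseteq> UNIV"
    "compact (chart_inv c ` cball (snd c z) r)" "open (chart_inv c ` ball (snd c z) r)" "z \<in> chart_inv c ` ball (snd c z) r"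
    by (rule coordinate_ball[OF open_UNIV UNIV_I c])
   obtain e where e: "e > 0" "!!q. d z q < e ==> q \<in> chart_inv c ` ball (snd c z) r"
    using d_ball_subset[OF r(5,6)] by metis
   have "{q. d z q < 2 * (e / 2)} \<subseteq> chart_inv c ` cball (snd c z) r"
    using e(2) image_mono[OF ball_subset_cball] by fastforce
   then show ?thesis using e(1) r(4) by (intro exI[of _ "e / 2"]) auto
  qed
  then obtain e C where e: "!!z. e z > 0" "!!z. compact (C z)" "!!z. {q. d z q < 2 * e z} \<subseteq> C z" by metis
  have op: "open {q. d z q < e z}" for z
   using continuous_on_open_vimage[OF open_UNIV, of "d z"] d_continuous[of z]
   by (auto simp: vimage_def dest: spec[of _ "{..<e z}"])
  obtain T where T: "T \<subseteq> K" "finite T" "K \<subseteq> (\<Union>z\<in>T. {q. d z q < e z})"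
  proof (rule compactE_image[OF K])
   show "K \<subseteq> (\<Union>z\<in>K. {q. d z q < e z})" using e(1) d_self by auto
  qed (use op in auto)
  define e0 where "e0 = Min (insert 1 (e ` T))"
  have e0: "e0 > 0" "!!z. z \<in> T ==> e0 \<le> e z" using T(2) e(1) by (auto simp: e0_def)
  have "{q. \<exists>z\<in>K. d z q < e0} \<subseteq> (\<Union>z\<in>T. C z)"
  proof
   fix q assume "q \<in> {q. \<exists>z\<in>K. d z q < e0}"
   then obtain z where z: "z \<in> K" "d z q < e0" by blast
   then obtain t where t: "t \<in> T" "d t z < e t" using T(3) by blast
   have "d t q < 2 * e t" using d_triangle[of t q z] t z e0(2)[OF t(1)] by linarith
   then show "q \<in> (\<Union>z\<in>T. C z)" using e(3)[of t] t(1) by blast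
  qed
  moreover have "compact (\<Union>z\<in>T. C z)" using T(2) e(2) by (intro compact_UN) auto
  ultimately show ?thesis using e0(1) by blast
 qed
 obtain e K where e: "e > 0" "compact K" "{q. \<exists>z\<in>{p}. d z q < e} \<subseteq> K"
  using nbhd[of "{p}"] by auto
 then have eS: "e \<in> S" unfolding S_def by auto
 have "\<not> bdd_above S"
 proof
  assume bdd: "bdd_above S"
  define R0 where "R0 = Sup S"
  have R0e: "R0 \<ge> e" unfolding R0_def by (rule cSup_upper[OF eS bdd])
  then have R0: "R0 > 0" using e(1) by (rule less_le_trans[rotated])
  have below: "\<exists>K. compact K \<and> {q. d p q < R} \<subseteq> K" if "R < R0" for R
  proof (cases "R > 0")
   case True
   have "S \<noteq> {}" using eS by auto
   from less_cSupD[OF this that[unfolded R0_def]] obtain R' where "R' \<in> S" "R < R'" by auto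
   then have "R \<in> S" using down[of R' R] True by simp
   then show ?thesis unfolding S_def by blast
  next
   case False
   then have "\<not> d p q < R" for q using d_nonneg[of p q] by linarith
   then have "{q. d p q < R} = {}" by auto
   then show ?thesis by (intro exI[of _ "{}"]) auto
  qed
  have "MS.mtotally_bounded {q. d p q < R0}"
   unfolding MS.mtotally_bounded_def
  proof (intro allI impI)
   fix \<epsilon> :: real assume \<epsilon>: "\<epsilon> > 0"
   \<comment> \<open>Every point of the ball of radius R0 is closer than s to some point of the ball
     of radius R0 - s. As s \<le> \<epsilon>/2, an \<epsilon>/2-net of the smaller ball is an
     \<epsilon>-net of the larger one.\<close>
   define s where "s = min (\<epsilon> / 2) (R0 / 2)"
   have s: "s > 0" "s \<le> \<epsilon> / 2" "s < R0" using \<epsilon> R0 by (auto simp: s_def)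
   obtain K where K: "compact K" "{q. d p q < R0 - s} \<subseteq> K" using below[of "R0 - s"] s by auto
   have "MS.mtotally_bounded {q. d p q < R0 - s}"
    using MS.mtotally_bounded_subset[OF compact_imp_totally_bounded[OF K(1)] K(2)] .
   then obtain F where F: "finite F" "F \<subseteq> {q. d p q < R0 - s}" "{q. d p q < R0 - s} \<subseteq> (\<Union>x\<in>F. MS.mball x (\<epsilon> / 2))"
    unfolding MS.mtotally_bounded_def using \<epsilon> by (meson half_gt_zero)
   have "{q. d p q < R0} \<subseteq> (\<Union>x\<in>F. MS.mball x \<epsilon>)"
   proof
    fix q assume "q \<in> {q. d p q < R0}"
    then have "d p q < (R0 - s) + s" by simp
    then obtain z where z: "d p z < R0 - s" "d z q < s" using d_intermediate s by (metis diff_gt_0_iff_gt)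
    then obtain x where x: "x \<in> F" "d x z < \<epsilon> / 2" using F(3) by (auto simp: MS.mball_def)
    have "d x q < \<epsilon>" using d_triangle[of x q z] x z(2) s(2) by linarith
    then show "q \<in> (\<Union>x\<in>F. MS.mball x \<epsilon>)" using x(1) by (auto simp: MS.mball_def)
   qed
   moreover have "F \<subseteq> {q. d p q < R0}" using F(2) s(1) by auto
   ultimately show "\<exists>K. finite K \<and> K \<subseteq> {q. d p q < R0} \<and> {q. d p q < R0} \<subseteq> (\<Union>x\<in>K. MS.mball x \<epsilon>)"
    using F(1) by blast
  qed
  then obtain K where K: "compact K" "{q. d p q < R0} \<subseteq> K" using totally_bounded_imp_compact by blast
  obtain e' K' where e': "e' > 0" "compact K'" "{q. \<exists>z\<in>K. d z q < e'} \<subseteq> K'" using nbhd[OF K(1)] by blast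
  have "{q. d p q < R0 + e'} \<subseteq> K'"
  proof
   fix q assume "q \<in> {q. d p q < R0 + e'}"
   then obtain z where "d p z < R0" "d z q < e'" using d_intermediate[of p q R0 e'] R0 e'(1) by auto
   then show "q \<in> K'" using K(2) e'(3) by blast
  qed
  then have "R0 + e' \<in> S" using e' R0 unfolding S_def by auto
  then have "R0 + e' \<le> Sup S" by (rule cSup_upper[OF _ bdd])
  then show False using e'(1) by (simp add: R0_def)
 qed
 then obtain R' where R': "R' \<in> S" "R' > R" by (meson bdd_above.I not_le)
 then obtain K where "compact K" "{q. d p q < R'} \<subseteq> K" unfolding S_def by blast
 then show ?thesis using R'(2) by (intro exI[of _ K]) auto
qed

lemma closed_ball_compact: "compact {q. d p q \<le> R}"
proof -
 obtain K where K: "compact K" "{q. d p q < R + 1} \<subseteq> K" using ball_relatively_compact by blast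
 have "closed (d p -` {..R})" using d_continuous[of p] by (intro closed_vimage) auto
 then have "compact (K \<inter> d p -` {..R})" by (rule compact_Int_closed[OF K(1)])
 moreover have "K \<inter> d p -` {..R} = {q. d p q \<le> R}" using K(2) by auto
 ultimately show ?thesis by simp
qed

end

section \<open>Weak gradients\<close>

lemma test_function_product_integrable:
 assumes h: "locally_integrable_on W h" and t: "test_function W \<psi>"
 shows "integrable lborel (\<lambda>x. indicator W x * (h x * \<psi> x))"
  and "integrable lborel (\<lambda>x. indicator W x * (h x * dderiv e \<psi> x))"
proof -
 obtain K where s: "smooth_on UNIV \<psi>" and K: "compact K" "K \<subseteq> W" "!!x. x \<notin> K ==> \<psi> x = 0"
  using t unfolding test_function_def by blast
 obtain C where C: "!!x. \<bar>dderiv e \<psi> x\<bar> \<le> C" "!!x. \<bar>\<psi> x\<bar> \<le> C"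
  using smooth_compact_Lipschitz[OF s K(1,3)] by metis
 have i: "integrable lborel (\<lambda>x. indicator K x * h x)"
  using h K unfolding locally_integrable_on_def set_integrable_def by auto
 have *: "integrable lborel (\<lambda>x. (indicator K x * h x) * f x)"
  if "f \<in> Borel" "!!x. \<bar>f x\<bar> \<le> C" for f
 proof (rule Bochner_Integration.integrable_bound[OF integrable_mult_left[OF i, of C]])
  show "(\<lambda>x. (indicator K x * h x) * f x) \<in> borel_measurable lborel"
   using that(1) borel_measurable_integrable[OF i] by simp
  show "AE x in lborel. norm ((indicator K x * h x) * f x) \<le> norm ((indicator K x * h x) * C)"
  proof (intro AE_I2)
   fix x
   have "\<bar>f x\<bar> \<le> \<bar>C\<bar>" using that(2)[of x] by linarith
   then show "norm ((indicator K x * h x) * f x) \<le> norm ((indicator K x * h x) * C)"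
    unfolding real_norm_def abs_mult[of _ "f x"] abs_mult[of _ C] by (rule mult_left_mono) simp
  qed
 qed
 have z: "dderiv e \<psi> x = 0" if "x \<notin> K" for x
  by (rule smooth_deriv_zero[OF compact_imp_closed[OF K(1)] K(3) that])
 have eq: "(\<lambda>x. (indicator K x * h x) * \<psi> x) = (\<lambda>x. indicator W x * (h x * \<psi> x))"
  "(\<lambda>x. (indicator K x * h x) * dderiv e \<psi> x) = (\<lambda>x. indicator W x * (h x * dderiv e \<psi> x))"
  using K(2,3) z by (auto simp: fun_eq_iff indicator_def)
 show "integrable lborel (\<lambda>x. indicator W x * (h x * \<psi> x))"
  using *[of \<psi>] C(2) borel_measurable_continuous_onI[OF smooth_on_UNIV_imp_continuous[OF s]] by (simp add: eq)
 show "integrable lborel (\<lambda>x. indicator W x * (h x * dderiv e \<psi> x))"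
  using *[of "\<lambda>x. dderiv e \<psi> x"] C(1) borel_measurable_continuous_onI[OF smooth_on_UNIV_imp_deriv_continuous[OF s]]
  by (simp add: eq)
qed

lemma weak_derivative_unique:
 assumes W: "open W" and h: "weak_derivative_on W e f h" and h': "weak_derivative_on W e f h'"
 shows "AE x in lborel. x \<in> W --> h x = h' x"
proof -
 have l: "locally_integrable_on W h" "locally_integrable_on W h'" using h h' by (auto simp: weak_derivative_on_def)
 have "AE x in lborel. x \<in> W --> h x - h' x = 0"
 proof (rule weak_zero_imp_AE_zero[OF W])
  show "locally_integrable_on W (\<lambda>x. h x - h' x)"
   using l unfolding locally_integrable_on_def set_integrable_def
   by (auto simp: right_diff_distrib intro!: Bochner_Integration.integrable_diff)
  fix \<psi> assume t: "test_function W \<psi>"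
  have "(LINT x:W|lborel. (h x - h' x) * \<psi> x) = (LINT x:W|lborel. h x * \<psi> x) - (LINT x:W|lborel. h' x * \<psi> x)"
   using test_function_product_integrable(1)[OF l(1) t] test_function_product_integrable(1)[OF l(2) t]
   unfolding set_lebesgue_integral_def by (simp add: algebra_simps)
  also have "\<dots> = 0" using h h' t by (simp add: weak_derivative_on_def)
  finally show "(LINT x:W|lborel. (h x - h' x) * \<psi> x) = 0" .
 qed
 then show ?thesis by eventually_elim simp
qed

lemma test_function_mono: "test_function W' \<psi> ==> W' \<subseteq> W ==> test_function W \<psi>"
 unfolding test_function_def by blast

lemma test_function_integral_mono:
 assumes "test_function W' \<psi>" "W' \<subseteq> W"
 shows "(LINT x:W'|lborel. f x * dderiv e \<psi> x) = (LINT x:W|lborel. f x * dderiv e \<psi> x)"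
  "(LINT x:W'|lborel. f x * \<psi> x) = (LINT x:W|lborel. f x * \<psi> x)"
proof -
 obtain K where s: "smooth_on UNIV \<psi>" and K: "compact K" "K \<subseteq> W'" "!!x. x \<notin> K ==> \<psi> x = 0"
  using assms(1) unfolding test_function_def by blast
 have z: "dderiv e \<psi> x = 0" if "x \<notin> W'" for x
 proof -
  have x: "x \<notin> K" using K(2) that by blast
  show ?thesis by (rule smooth_deriv_zero[OF compact_imp_closed[OF K(1)] K(3) x])
 qed
 have z': "\<psi> x = 0" if "x \<notin> W'" for x using K that by blast
 show "(LINT x:W'|lborel. f x * dderiv e \<psi> x) = (LINT x:W|lborel. f x * dderiv e \<psi> x)"
  "(LINT x:W'|lborel. f x * \<psi> x) = (LINT x:W|lborel. f x * \<psi> x)"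
  unfolding set_lebesgue_integral_def using assms(2) z z'
  by (auto intro!: Bochner_Integration.integral_cong simp: indicator_def)
qed

lemma weak_derivative_mono:
 assumes "weak_derivative_on W e f h" "W' \<subseteq> W"
 shows "weak_derivative_on W' e f h"
 unfolding weak_derivative_on_def
proof (intro conjI allI impI)
 show "locally_integrable_on W' f" "locally_integrable_on W' h"
  using assms unfolding weak_derivative_on_def locally_integrable_on_def by blast+
 fix \<psi> assume t: "test_function W' \<psi>"
 then have "test_function W \<psi>" using assms(2) by (rule test_function_mono)
 then show "(LINT x:W'|lborel. f x * dderiv e \<psi> x) = - (LINT x:W'|lborel. h x * \<psi> x)"
  unfolding test_function_integral_mono[OF t assms(2)] using assms(1) unfolding weak_derivative_on_def by blast
qed

text \<open>Weak differentiability on an increasing union of open sets may be tested on the members, since a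
 compact support lies in one of them.\<close>

lemma weak_derivative_UN:
 assumes W: "!!n::nat. open (W n)" "!!n. W n \<subseteq> W (Suc n)" and h: "!!n. weak_derivative_on (W n) e f h"
 shows "weak_derivative_on (\<Union>n. W n) e f h"
proof -
 have mono: "W i \<subseteq> W j" if "i \<le> j" for i j using that W(2) by (rule lift_Suc_mono_le[rotated])
 have K: "\<exists>n. K \<subseteq> W n" if K: "compact K" "K \<subseteq> (\<Union>n. W n)" for K
 proof -
  obtain T where T: "finite T" "K \<subseteq> (\<Union>n\<in>T. W n)" by (rule compactE_image[OF K(1), of UNIV W]) (use W(1) K(2) in auto)
  have "W n \<subseteq> W (Max (insert 0 T))" if "n \<in> T" for n using T(1) that by (intro mono) simp
  then show ?thesis using T(2) by blast
 qed
 show ?thesis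
  unfolding weak_derivative_on_def
 proof (intro conjI allI impI)
  have "set_integrable lborel K f \<and> set_integrable lborel K h" if "compact K" "K \<subseteq> (\<Union>n. W n)" for K
  proof -
   have "\<exists>n. K \<subseteq> W n" by (rule K[OF that])
   then obtain n where "K \<subseteq> W n" ..
   then show ?thesis using h[of n] that(1) unfolding weak_derivative_on_def locally_integrable_on_def by blast
  qed
  then show "locally_integrable_on (\<Union>n. W n) f" "locally_integrable_on (\<Union>n. W n) h"
   unfolding locally_integrable_on_def by auto
  fix \<psi> assume "test_function (\<Union>n. W n) \<psi>"
  then obtain K' where "smooth_on UNIV \<psi>" "compact K'" "K' \<subseteq> (\<Union>n. W n)" "\<forall>x. x \<notin> K' --> \<psi> x = 0"
   unfolding test_function_def by blast
  moreover from K[OF this(2,3)] obtain n where "K' \<subseteq> W n" by blast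
  ultimately have t: "test_function (W n) \<psi>" unfolding test_function_def by blast
  have sub: "W n \<subseteq> (\<Union>n. W n)" by blast
  show "(LINT x:(\<Union>n. W n)|lborel. f x * dderiv e \<psi> x) = - (LINT x:(\<Union>n. W n)|lborel. h x * \<psi> x)"
   unfolding test_function_integral_mono[OF t sub, symmetric] using h[of n] t unfolding weak_derivative_on_def by blast
 qed
qed

lemma weak_derivative_cong_AE:
 assumes h: "weak_derivative_on W e f h" and W: "open W"
  and h'm: "(\<lambda>x. indicator W x * h' x) \<in> Borel"
  and eq: "AE x in lborel. x \<in> W --> h x = h' x"
 shows "weak_derivative_on W e f h'"
 unfolding weak_derivative_on_def
proof (intro conjI allI impI)
 show f: "locally_integrable_on W f" using h by (simp add: weak_derivative_on_def)
 show h'l: "locally_integrable_on W h'"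
  unfolding locally_integrable_on_def set_integrable_def
 proof (intro allI impI)
  fix K assume K: "compact K \<and> K \<subseteq> W"
  have [measurable]: "K \<in> sets borel" using K by (simp add: compact_imp_closed)
  have i: "integrable lborel (\<lambda>x. indicator K x *R h x)"
   using h K unfolding weak_derivative_on_def locally_integrable_on_def set_integrable_def by blast
  have m: "(\<lambda>x. indicator K x *R h' x) \<in> borel_measurable lborel"
  proof -
   have "(\<lambda>x. indicator K x * (indicator W x * h' x)) \<in> Borel" using h'm by measurable
   moreover have "(\<lambda>x. indicator K x * (indicator W x * h' x)) = (\<lambda>x. indicator K x *R h' x)"
    using K by (auto simp: indicator_def fun_eq_iff)
   ultimately show ?thesis by simp
  qed
  have "AE x in lborel. indicator K x *R h x = indicator K x *R h' x"
   using eq by eventually_elim (use K in \<open>auto simp: indicator_def\<close>)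
  then show "integrable lborel (\<lambda>x. indicator K x *R h' x)"
   using integrable_cong_AE[OF borel_measurable_integrable[OF i] m] i by blast
 qed
 fix \<psi> assume t: "test_function W \<psi>"
 have hl: "locally_integrable_on W h" using h by (simp add: weak_derivative_on_def)
 have "(LINT x:W|lborel. h x * \<psi> x) = (LINT x:W|lborel. h' x * \<psi> x)"
  unfolding set_lebesgue_integral_def
 proof (rule integral_cong_AE)
  show "(\<lambda>x. indicator W x *R (h x * \<psi> x)) \<in> borel_measurable lborel" "(\<lambda>x. indicator W x *R (h' x * \<psi> x)) \<in> borel_measurable lborel"
   using borel_measurable_integrable[OF test_function_product_integrable(1)[OF hl t]]
    borel_measurable_integrable[OF test_function_product_integrable(1)[OF h'l t]] by simp_all
  show "AE x in lborel. indicator W x *R (h x * \<psi> x) = indicator W x *R (h' x * \<psi> x)"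
   using eq by eventually_elim (auto simp: indicator_def)
 qed
 moreover have "(LINT x:W|lborel. f x * dderiv e \<psi> x) = - (LINT x:W|lborel. h x * \<psi> x)"
  using h t unfolding weak_derivative_on_def by blast
 ultimately show "(LINT x:W|lborel. f x * dderiv e \<psi> x) = - (LINT x:W|lborel. h' x * \<psi> x)" by simp
qed

lemma borel_measurable_component:
 fixes f :: "'a => real ^ 'n"
 assumes "f \<in> borel_measurable M"
 shows "(\<lambda>x. f x $ i) \<in> borel_measurable M"
 by (rule measurable_compose[OF assms]) (intro borel_measurable_continuous_onI continuous_intros)

section \<open>Weak gradients and measurable vector fields on the manifold\<close>

context riemannian
begin

text \<open>The measurability clause of \<open>is_weak_gradient\<close>, isolated so that vector
  fields can be handled before they are known to be gradients.\<close>

definition coords_borel :: "'a set => ('a => ('a, 'n) tangent) => bool" where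
 "coords_borel U X \<longleftrightarrow> (\<forall>c\<in>A. set_borel_measurable borel (fst c \<inter> U) (\<lambda>p. X p c))"

lemma coord_vector_in: "c \<in> A ==> p \<in> fst c ==> coord_vector A c p i \<in> tangent_space A p"
 by (simp add: coord_vector_eq chart_vector_in)

lemma g_coord:
 assumes "v \<in> tangent_space A p" "c \<in> A" "p \<in> fst c"
 shows "g p v (coord_vector A c p i) = v c \<bullet> (G c p *v axis i 1)"
 using g_tangent[OF assms(1) coord_vector_in[OF assms(2,3)] assms(2,3)] chart_vector_self[OF assms(2,3)]
 by (simp add: coord_vector_eq)

text \<open>G is positive definite, so products with the coordinate vectors determine a tangent
  vector. This turns uniqueness of weak partial derivatives into uniqueness of the gradient.\<close>

lemma tangent_eqI:
 assumes v: "v \<in> tangent_space A p" "w \<in> tangent_space A p" and c: "c \<in> A" "p \<in> fst c"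
  and eq: "!!i. g p v (coord_vector A c p i) = g p w (coord_vector A c p i)"
 shows "v = w"
proof -
 define z where "z = v c - w c"
 have "z \<bullet> (G c p *v axis i 1) = 0" for i
  using eq[of i] g_coord[OF v(1) c] g_coord[OF v(2) c] by (simp add: z_def inner_diff_left)
 then have "(z v* G c p) \<bullet> axis i 1 = 0" for i by (simp add: dot_lmul_matrix)
 then have "z v* G c p = 0" by (simp add: inner_axis vec_eq_iff)
 then have "z \<bullet> (G c p *v z) = 0" by (simp add: dot_lmul_matrix[symmetric])
 then have "z = 0" using G_pos[OF c, of z] by fastforce
 then have "v c = w c" by (simp add: z_def)
 then show ?thesis using tangent_eq_chart_vector[OF v(1) c] tangent_eq_chart_vector[OF v(2) c] by metis
qed

lemma borel_on_chart:
 fixes F :: "real ^ 'n => real"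
 assumes c: "c \<in> A" and F: "continuous_on (snd c ` fst c) F"
 shows "(\<lambda>p. indicator (fst c) p *R F (snd c p)) \<in> Borel"
proof (rule borel_measurable_continuous_on_indicator)
 show "fst c \<in> sets borel" using chart_open(1)[OF c] by simp
 show "continuous_on (fst c) (\<lambda>p. F (snd c p))"
  by (rule continuous_on_compose2[OF F chart_cont(1)[OF c]]) auto
qed

lemma G_borel: "c \<in> A ==> (\<lambda>p. indicator (fst c) p * G c p $ i $ j) \<in> Borel"
proof -
 assume c: "c \<in> A"
 have "(\<lambda>p. indicator (fst c) p * G c p $ i $ j) = (\<lambda>p. indicator (fst c) p *R G c (chart_inv c (snd c p)) $ i $ j)"
  using c by (auto simp: indicator_def fun_eq_iff)
 then show ?thesis using borel_on_chart[OF c G_entry_cont[OF c, of i j]] by simp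
qed

text \<open>For quantities such as g(X, Y), whose coordinate formula changes with the chart, while
  each piece fixes one chart.\<close>

lemma borel_by_pieces:
 fixes F :: "'a => 'b::topological_space"
 assumes "!!n. \<exists>h\<in>Borel. \<forall>p\<in>piece n. F p = h p"
 shows "F \<in> Borel"
 using piece(1,4) assms by (intro measurable_piecewise_restrict2[of piece]) auto

lemma g_chart_sum:
 assumes "v \<in> tangent_space A p" "w \<in> tangent_space A p" "c \<in> A" "p \<in> fst c"
 shows "g p v w = (\<Sum>i\<in>UNIV. \<Sum>j\<in>UNIV. v c $ i * G c p $ i $ j * w c $ j)"
 unfolding g_tangent[OF assms] by (simp add: inner_vec_def matrix_vector_mult_def sum_distrib_left mult.assoc)

lemma g_borel:
 assumes X: "!!p. X p \<in> tangent_space A p" "coords_borel UNIV X" and Y: "!!p. Y p \<in> tangent_space A p" "coords_borel UNIV Y"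
 shows "(\<lambda>p. g p (X p) (Y p)) \<in> Borel"
proof (rule borel_by_pieces)
 fix n
 define c where "c = atlas_seq n"
 have c: "c \<in> A" by (simp add: c_def atlas_seq)
 have m: "(\<lambda>p. indicator (fst c) p *R X p c) \<in> Borel" "(\<lambda>p. indicator (fst c) p *R Y p c) \<in> Borel"
  using X(2) Y(2) c unfolding coords_borel_def set_borel_measurable_def by auto
 let ?h = "\<lambda>p. \<Sum>i\<in>UNIV. \<Sum>j\<in>UNIV. (indicator (fst c) p *R X p c) $ i * (indicator (fst c) p * G c p $ i $ j) * (indicator (fst c) p *R Y p c) $ j"
 have "?h \<in> Borel"
  by (intro borel_measurable_sum borel_measurable_times borel_measurable_component m G_borel[OF c])
 moreover have "g p (X p) (Y p) = ?h p" if "p \<in> piece n" for p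
 proof -
  have p: "p \<in> fst c" using subsetD[OF piece(2) that] by (simp only: c_def)
  then have "indicator (fst c) p = (1::real)" by (rule indicator_eq_1_iff[THEN iffD2])
  then show ?thesis unfolding g_chart_sum[OF X(1) Y(1) c p] by (simp only: scaleR_one mult_1)
 qed
 ultimately show "\<exists>h\<in>Borel. \<forall>p\<in>piece n. g p (X p) (Y p) = h p"
  by (intro bexI[of _ ?h] ballI)
qed

lemma chart_pullback_borel:
 fixes F :: "'a => real"
 assumes c: "c \<in> A" and F: "F \<in> Borel"
 shows "(\<lambda>x. indicator (snd c ` fst c) x * F (chart_inv c x)) \<in> Borel"
proof -
 have [measurable]: "snd c ` fst c \<in> sets borel" using chart_open(2)[OF c] by simp
 have "(\<lambda>x. if x \<in> snd c ` fst c then chart_inv c x else undefined) \<in> Borel"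
  using chart_cont(2)[OF c] chart_open(2)[OF c] by (intro borel_measurable_continuous_on_if) auto
 from measurable_compose[OF this F]
 have "(\<lambda>x. indicator (snd c ` fst c) x * F (if x \<in> snd c ` fst c then chart_inv c x else undefined)) \<in> Borel"
  by measurable
 moreover have "(\<lambda>x. indicator (snd c ` fst c) x * F (if x \<in> snd c ` fst c then chart_inv c x else undefined))
   = (\<lambda>x. indicator (snd c ` fst c) x * F (chart_inv c x))" by (auto simp: indicator_def fun_eq_iff)
 ultimately show ?thesis by simp
qed

lemma g_coord_borel:
 assumes c: "c \<in> A" and U: "open U" and X: "!!p. p \<in> U ==> X p \<in> tangent_space A p" "coords_borel U X"
 shows "(\<lambda>x. indicator (snd c ` (fst c \<inter> U)) x * g (chart_inv c x) (X (chart_inv c x)) (coord_vector A c (chart_inv c x) i)) \<in> Borel"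
proof -
 have m: "(\<lambda>p. indicator (fst c \<inter> U) p *R X p c) \<in> Borel"
  using X(2) c unfolding coords_borel_def set_borel_measurable_def by auto
 let ?h = "\<lambda>p. \<Sum>j\<in>UNIV. (indicator (fst c \<inter> U) p *R X p c) $ j * (indicator (fst c) p * G c p $ j $ i)"
 have "?h \<in> Borel"
  by (intro borel_measurable_sum borel_measurable_times borel_measurable_component m G_borel[OF c])
 from chart_pullback_borel[OF c this]
 have "(\<lambda>x. indicator (snd c ` fst c) x * ?h (chart_inv c x)) \<in> Borel" .
 moreover have "(\<lambda>x. indicator (snd c ` fst c) x * ?h (chart_inv c x))
  = (\<lambda>x. indicator (snd c ` (fst c \<inter> U)) x * g (chart_inv c x) (X (chart_inv c x)) (coord_vector A c (chart_inv c x) i))"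
 proof
  fix x
  have iff: "x \<in> snd c ` (fst c \<inter> U) \<longleftrightarrow> x \<in> snd c ` fst c \<and> chart_inv c x \<in> fst c \<inter> U"
   using chart_image_eq[OF c, of "fst c \<inter> U"] by auto
  show "indicator (snd c ` fst c) x * ?h (chart_inv c x)
   = indicator (snd c ` (fst c \<inter> U)) x * g (chart_inv c x) (X (chart_inv c x)) (coord_vector A c (chart_inv c x) i)"
  proof (cases "x \<in> snd c ` (fst c \<inter> U)")
   case True
   then have *: "x \<in> snd c ` fst c" "chart_inv c x \<in> fst c" "chart_inv c x \<in> U" using iff by auto
   then show ?thesis using True g_coord[OF X(1) c, of "chart_inv c x" i]
    by (simp add: inner_vec_def matrix_vector_mult_basis column_def)
  next
   case False
   then have "x \<notin> snd c ` fst c \<or> chart_inv c x \<notin> fst c \<inter> U" using iff by blast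
   then show ?thesis using False by (auto simp: indicator_def)
  qed
 qed
 ultimately show ?thesis by simp
qed

lemma weak_gradient_tangent: "is_weak_gradient A g U u X ==> p \<in> U ==> X p \<in> tangent_space A p"
 unfolding is_weak_gradient_def by blast

lemma weak_gradient_borel: "is_weak_gradient A g U u X ==> coords_borel U X"
 unfolding is_weak_gradient_def coords_borel_def by blast

lemma weak_gradient_derivative:
 "is_weak_gradient A g U u X ==> c \<in> A ==> weak_derivative_on (snd c ` (fst c \<inter> U)) (axis i 1) (u \<circ> chart_inv c)
    (\<lambda>x. g (chart_inv c x) (X (chart_inv c x)) (coord_vector A c (chart_inv c x) i))"
 unfolding is_weak_gradient_def by blast

lemma weak_gradient_unique_chart:
 assumes U: "open U" and X: "is_weak_gradient A g U u X" and Y: "is_weak_gradient A g U u Y" and c: "c \<in> A"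
 shows "AE x in lborel. x \<in> snd c ` (fst c \<inter> U) --> X (chart_inv c x) = Y (chart_inv c x)"
proof -
 have op: "open (snd c ` (fst c \<inter> U))" using chart_open(1)[OF c] U by (intro chart_image_open[OF c]) auto
 have "AE x in lborel. \<forall>i. x \<in> snd c ` (fst c \<inter> U) -->
   g (chart_inv c x) (X (chart_inv c x)) (coord_vector A c (chart_inv c x) i)
  = g (chart_inv c x) (Y (chart_inv c x)) (coord_vector A c (chart_inv c x) i)"
  using weak_derivative_unique[OF op weak_gradient_derivative[OF X c] weak_gradient_derivative[OF Y c]]
  by (subst AE_all_countable) blast
 then show ?thesis
 proof eventually_elim
  case (elim x)
  show ?case
  proof
   assume x: "x \<in> snd c ` (fst c \<inter> U)"
   then have p: "chart_inv c x \<in> fst c" "chart_inv c x \<in> U" using c by auto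
   show "X (chart_inv c x) = Y (chart_inv c x)"
    by (rule tangent_eqI[OF weak_gradient_tangent[OF X p(2)] weak_gradient_tangent[OF Y p(2)] c p(1)]) (use elim x in blast)
  qed
 qed
qed

lemma weak_gradient_unique:
 assumes "open U" "is_weak_gradient A g U u X" "is_weak_gradient A g U u Y"
 shows "AE p in vol. p \<in> U --> X p = Y p"
proof (rule AE_vol_if_AE_charts)
 fix c assume c: "c \<in> A"
 show "AE x in lborel. x \<in> snd c ` fst c --> (chart_inv c x \<in> U --> X (chart_inv c x) = Y (chart_inv c x))"
  using weak_gradient_unique_chart[OF assms c]
 proof eventually_elim
  case (elim x)
  show ?case
  proof (intro impI)
   assume "x \<in> snd c ` fst c" "chart_inv c x \<in> U"
   then have "x \<in> snd c ` (fst c \<inter> U)" using chart_image_eq[OF c, of "fst c \<inter> U"] c by auto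
   then show "X (chart_inv c x) = Y (chart_inv c x)" using elim by blast
  qed
 qed
qed

lemma set_borel_measurable_mono:
 fixes f :: "'a => 'b::{real_normed_vector, second_countable_topology}"
 assumes f: "set_borel_measurable borel S f" and T: "T \<in> sets borel" "T \<subseteq> S"
 shows "set_borel_measurable borel T f"
proof -
 have "(\<lambda>x. indicator T x *R (indicator S x *R f x)) \<in> Borel"
  using f T(1) unfolding set_borel_measurable_def by (rule borel_measurable_scaleR[OF borel_measurable_indicator, rotated])
 moreover have "(\<lambda>x. indicator T x *R (indicator S x *R f x)) = (\<lambda>x. indicator T x *R f x)"
  using T(2) by (auto simp: indicator_def fun_eq_iff)
 ultimately show ?thesis by (simp add: set_borel_measurable_def)
qed

lemma coords_borelD: "coords_borel U X ==> c \<in> A ==> set_borel_measurable borel (fst c \<inter> U) (\<lambda>p. X p c)"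
 unfolding coords_borel_def by blast

lemma coords_borel_mono:
 assumes X: "coords_borel U X" and U': "open U'" "U' \<subseteq> U"
 shows "coords_borel U' X"
 unfolding coords_borel_def
proof
 fix c assume c: "c \<in> A"
 show "set_borel_measurable borel (fst c \<inter> U') (\<lambda>p. X p c)"
 proof (rule set_borel_measurable_mono[OF coords_borelD[OF X c]])
  show "fst c \<inter> U' \<in> sets borel" by (rule borel_open[OF open_Int[OF chart_open(1)[OF c] U'(1)]])
  show "fst c \<inter> U' \<subseteq> fst c \<inter> U" using U'(2) by blast
 qed
qed

lemma weak_gradient_mono:
 assumes X: "is_weak_gradient A g U u X" and U': "open U'" "U' \<subseteq> U"
 shows "is_weak_gradient A g U' u X"
 unfolding is_weak_gradient_def
proof (intro conjI ballI allI)
 show "X p \<in> tangent_space A p" if "p \<in> U'" for p by (rule weak_gradient_tangent[OF X subsetD[OF U'(2) that]])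
 fix c assume c: "c \<in> A"
 show "set_borel_measurable borel (fst c \<inter> U') (\<lambda>p. X p c)"
  by (rule coords_borelD[OF coords_borel_mono[OF weak_gradient_borel[OF X] U'] c])
 have "snd c ` (fst c \<inter> U') \<subseteq> snd c ` (fst c \<inter> U)" using U'(2) by blast
 then show "weak_derivative_on (snd c ` (fst c \<inter> U')) (axis i 1) (u \<circ> chart_inv c)
    (\<lambda>x. g (chart_inv c x) (X (chart_inv c x)) (coord_vector A c (chart_inv c x) i))" for i
  by (rule weak_derivative_mono[OF weak_gradient_derivative[OF X c]])
qed

lemma weak_gradient_cong_AE:
 assumes X: "is_weak_gradient A g U u X" and U: "open U"
  and Y: "!!p. p \<in> U ==> Y p \<in> tangent_space A p" "coords_borel U Y"
  and eq: "!!c. c \<in> A ==> AE x in lborel. x \<in> snd c ` (fst c \<inter> U) --> X (chart_inv c x) = Y (chart_inv c x)"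
 shows "is_weak_gradient A g U u Y"
 unfolding is_weak_gradient_def
proof (intro conjI ballI allI)
 show "Y p \<in> tangent_space A p" if "p \<in> U" for p using Y(1) that .
 fix c assume c: "c \<in> A"
 show "set_borel_measurable borel (fst c \<inter> U) (\<lambda>p. Y p c)" by (rule coords_borelD[OF Y(2) c])
 show "weak_derivative_on (snd c ` (fst c \<inter> U)) (axis i 1) (u \<circ> chart_inv c)
    (\<lambda>x. g (chart_inv c x) (Y (chart_inv c x)) (coord_vector A c (chart_inv c x) i))" for i
 proof (rule weak_derivative_cong_AE[OF weak_gradient_derivative[OF X c] _ g_coord_borel[OF c U Y]])
  show "open (snd c ` (fst c \<inter> U))" using chart_open(1)[OF c] U by (intro chart_image_open[OF c]) auto
  show "AE x in lborel. x \<in> snd c ` (fst c \<inter> U) --> g (chart_inv c x) (X (chart_inv c x)) (coord_vector A c (chart_inv c x) i)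
   = g (chart_inv c x) (Y (chart_inv c x)) (coord_vector A c (chart_inv c x) i)"
   using eq[OF c] by eventually_elim auto
 qed
qed

lemma weak_gradient_UN:
 assumes U: "!!n::nat. open (U n)" "!!n. U n \<subseteq> U (Suc n)" "(\<Union>n. U n) = UNIV"
  and X: "!!n. is_weak_gradient A g (U n) u X"
 shows "is_weak_gradient A g UNIV u X"
 unfolding is_weak_gradient_def
proof (intro conjI ballI allI)
 show "X p \<in> tangent_space A p" for p
 proof -
  obtain n where "p \<in> U n" using U(3) by blast
  then show ?thesis by (rule weak_gradient_tangent[OF X])
 qed
 fix c assume c: "c \<in> A"
 show "set_borel_measurable borel (fst c \<inter> UNIV) (\<lambda>p. X p c)"
  unfolding set_borel_measurable_def
 proof (rule measurable_piecewise_restrict2[of U])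
  show "U n \<in> sets borel" for n using U(1) by simp
  show "space borel = (\<Union>n. U n)" using U(3) by simp
  show "\<exists>h\<in>Borel. \<forall>p\<in>U n. indicator (fst c \<inter> UNIV) p *R X p c = h p" for n
  proof (rule bexI[OF _ coords_borelD[OF weak_gradient_borel[OF X[of n]] c, unfolded set_borel_measurable_def]])
   show "\<forall>p\<in>U n. indicator (fst c \<inter> UNIV) p *R X p c = indicator (fst c \<inter> U n) p *R X p c"
    by (simp add: indicator_def)
  qed
 qed
 fix i
 have "weak_derivative_on (\<Union>n. snd c ` (fst c \<inter> U n)) (axis i 1) (u \<circ> chart_inv c)
    (\<lambda>x. g (chart_inv c x) (X (chart_inv c x)) (coord_vector A c (chart_inv c x) i))"
 proof (rule weak_derivative_UN)
  show "open (snd c ` (fst c \<inter> U n))" for n using chart_open(1)[OF c] U(1) by (intro chart_image_open[OF c]) auto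
  show "snd c ` (fst c \<inter> U n) \<subseteq> snd c ` (fst c \<inter> U (Suc n))" for n using U(2)[of n] by blast
 qed (rule weak_gradient_derivative[OF X c])
 moreover have "(\<Union>n. snd c ` (fst c \<inter> U n)) = snd c ` (fst c \<inter> UNIV)" using U(3) by blast
 ultimately show "weak_derivative_on (snd c ` (fst c \<inter> UNIV)) (axis i 1) (u \<circ> chart_inv c)
    (\<lambda>x. g (chart_inv c x) (X (chart_inv c x)) (coord_vector A c (chart_inv c x) i))" by simp
qed

end

section \<open>The gradient of a locally Sobolev function\<close>

context complete_manifold
begin

lemma exhaustion:
 obtains U :: "nat => 'a set" where "!!n. open (U n)" "!!n. U n \<subseteq> U (Suc n)" "(\<Union>n. U n) = UNIV" "!!n. compact (closure (U n))"
proof -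
 obtain p :: 'a where True by blast
 define U where "U n = d p -` {..<real n}" for n
 have o: "open (U n)" for n unfolding U_def using d_continuous[of p] by (intro open_vimage) auto
 have cl: "compact (closure (U n))" for n
 proof -
  have "closure (U n) \<subseteq> {q. d p q \<le> real n}"
   by (rule closure_minimal) (auto simp: U_def intro: compact_imp_closed[OF closed_ball_compact])
  then show ?thesis using compact_Int_closed[OF closed_ball_compact[of p "real n"] closed_closure[of "U n"]]
   by (simp add: Int_absorb1)
 qed
 have "x \<in> (\<Union>n. U n)" for x
 proof -
  obtain n where "d p x < real n" using reals_Archimedean2 by blast
  then show ?thesis by (auto simp: U_def)
 qed
 then show ?thesis using o cl by (intro that[of U]) (auto simp: U_def)
qed

text \<open>\<open>gradient\<close> is a choice, so a weak gradient on the whole manifold has to be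
  exhibited. Each set of an exhaustion carries one; they agree almost everywhere on overlaps, and
  the glued field takes at p the one of the first set containing p.\<close>

lemma W12_loc_gradient:
 assumes u: "u \<in> W12_loc A g"
 shows "is_weak_gradient A g UNIV u (gradient A g u)"
proof -
 obtain U :: "nat => 'a set" where U: "!!n. open (U n)" "!!n. U n \<subseteq> U (Suc n)" "(\<Union>n. U n) = UNIV" "!!n. compact (closure (U n))"
  using exhaustion by blast
 have mono: "U i \<subseteq> U j" if "i \<le> j" for i j using that U(2) by (rule lift_Suc_mono_le[rotated])
 have "\<exists>X. is_weak_gradient A g (U n) u X" for n
 proof -
  have "u \<in> W12 A g (U n)" using u U(1,4) unfolding W12_loc_def by blast
  then show ?thesis unfolding W12_def by blast
 qed
 then obtain X where X: "!!n. is_weak_gradient A g (U n) u (X n)" by metis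
 define N where "N p = (LEAST n. p \<in> U n)" for p
 have N: "p \<in> U (N p)" "p \<in> U n ==> N p \<le> n" for p n
 proof -
  obtain m where "p \<in> U m" using U(3) by blast
  then show "p \<in> U (N p)" unfolding N_def by (rule LeastI)
  show "p \<in> U n ==> N p \<le> n" unfolding N_def by (rule Least_le)
 qed
 define Y where "Y p = X (N p) p" for p
 have Yt: "Y p \<in> tangent_space A p" for p unfolding Y_def by (rule weak_gradient_tangent[OF X N(1)])
 have Nset: "{p. N p = n} \<in> sets borel" for n
 proof -
  have "{p. N p = n} = U n - (\<Union>k<n. U k)"
  proof (intro set_eqI iffI)
   fix p assume "p \<in> {p. N p = n}"
   then have "p \<in> U n" "!!k. k < n ==> p \<notin> U k" using N(1)[of p] N(2)[of p] by (auto simp: not_le[symmetric])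
   then show "p \<in> U n - (\<Union>k<n. U k)" by blast
  next
   fix p assume p: "p \<in> U n - (\<Union>k<n. U k)"
   then have "N p \<le> n" using N(2) by blast
   moreover have "\<not> N p < n" using p N(1)[of p] by blast
   ultimately show "p \<in> {p. N p = n}" by simp
  qed
  moreover have "U n - (\<Union>k<n. U k) \<in> sets borel" using U(1) by (intro sets.Diff sets.finite_UN) auto
  ultimately show ?thesis by simp
 qed
 have Yb: "coords_borel UNIV Y"
  unfolding coords_borel_def set_borel_measurable_def
 proof
  fix c assume c: "c \<in> A"
  show "(\<lambda>p. indicator (fst c \<inter> UNIV) p *R Y p c) \<in> Borel"
  proof (rule measurable_piecewise_restrict2[of "\<lambda>n. {p. N p = n}"])
   show "\<exists>h\<in>Borel. \<forall>p\<in>{p. N p = n}. indicator (fst c \<inter> UNIV) p *R Y p c = h p" for n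
   proof (rule bexI[OF _ coords_borelD[OF weak_gradient_borel[OF X[of n]] c, unfolded set_borel_measurable_def]], rule ballI)
    fix p assume "p \<in> {p. N p = n}"
    then have "N p = n" "p \<in> U n" using N(1)[of p] by auto
    then show "indicator (fst c \<inter> UNIV) p *R Y p c = indicator (fst c \<inter> U n) p *R X n p c"
     by (simp add: indicator_def Y_def)
   qed
  qed (use Nset in auto)
 qed
 have "is_weak_gradient A g (U n) u Y" for n
 proof (rule weak_gradient_cong_AE[OF X U(1) Yt])
  show "coords_borel (U n) Y" by (rule coords_borel_mono[OF Yb U(1) subset_UNIV])
  fix c assume c: "c \<in> A"
  \<comment> \<open>Only finitely many of the gradients contribute to Y on U n, so their exceptional
    sets unite to a null set.\<close>
  have "AE x in lborel. \<forall>k\<in>{..n}. x \<in> snd c ` (fst c \<inter> U k) --> X k (chart_inv c x) = X n (chart_inv c x)"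
   using weak_gradient_unique_chart[OF U(1) X weak_gradient_mono[OF X U(1) mono] c]
   by (subst AE_ball_countable) auto
  then show "AE x in lborel. x \<in> snd c ` (fst c \<inter> U n) --> X n (chart_inv c x) = Y (chart_inv c x)"
  proof eventually_elim
   case (elim x)
   show ?case
   proof
    assume "x \<in> snd c ` (fst c \<inter> U n)"
    then obtain p where p: "p \<in> fst c" "p \<in> U n" "x = snd c p" by blast
    have "N p \<in> {..n}" using N(2)[OF p(2)] by simp
    moreover have "x \<in> snd c ` (fst c \<inter> U (N p))" using p N(1)[of p] by blast
    ultimately have "X (N p) (chart_inv c x) = X n (chart_inv c x)" using elim by blast
    then show "X n (chart_inv c x) = Y (chart_inv c x)" using p c by (simp add: Y_def)
   qed
  qed
 qed
 from weak_gradient_UN[OF U(1-3) this] have "is_weak_gradient A g UNIV u Y" .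
 then show ?thesis unfolding gradient_def by (rule someI[of "is_weak_gradient A g UNIV u"])
qed

lemma W12_loc_borel: "u \<in> W12_loc A g ==> u \<in> Borel"
proof -
 assume u: "u \<in> W12_loc A g"
 obtain U :: "nat => 'a set" where U: "!!n. open (U n)" "!!n. U n \<subseteq> U (Suc n)" "(\<Union>n. U n) = UNIV" "!!n. compact (closure (U n))"
  using exhaustion by blast
 show ?thesis
 proof (rule measurable_piecewise_restrict2[of U])
  show "U n \<in> sets borel" for n using U(1) by simp
  show "space borel = (\<Union>n. U n)" using U(3) by simp
  show "\<exists>h\<in>Borel. \<forall>p\<in>U n. u p = h p" for n
  proof -
   have "u \<in> W12 A g (U n)" using u U(1,4) unfolding W12_loc_def by blast
   then have "set_borel_measurable borel (U n) u" unfolding W12_def by blast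
   then show ?thesis unfolding set_borel_measurable_def
    by (intro bexI[of _ "\<lambda>p. indicator (U n) p *R u p"]) auto
  qed
 qed
qed

lemma gradient_tangent: "u \<in> W12_loc A g ==> gradient A g u p \<in> tangent_space A p"
 using weak_gradient_tangent[OF W12_loc_gradient] by blast

lemma gradient_borel: "u \<in> W12_loc A g ==> coords_borel UNIV (gradient A g u)"
 by (rule weak_gradient_borel[OF W12_loc_gradient])

text \<open>The energy bound in \<open>W12\<close> belongs to some weak gradient on U; uniqueness
  carries it over to the chosen one.\<close>

lemma gradient_energy:
 assumes u: "u \<in> W12_loc A g" and U: "open U" "compact (closure U)"
 shows "set_integrable vol U (\<lambda>x. g x (gradient A g u x) (gradient A g u x))" "set_integrable vol U (\<lambda>x. (u x)\<^sup>2)"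
proof -
 have W: "u \<in> W12 A g U" using u U unfolding W12_loc_def by blast
 then show "set_integrable vol U (\<lambda>x. (u x)\<^sup>2)" unfolding W12_def by blast
 obtain X where X: "is_weak_gradient A g U u X" "set_integrable vol U (\<lambda>x. g x (X x) (X x))"
  using W unfolding W12_def by blast
 have ae: "AE p in vol. p \<in> U --> X p = gradient A g u p"
  by (rule weak_gradient_unique[OF U(1) X(1) weak_gradient_mono[OF W12_loc_gradient[OF u] U(1)]]) simp
 have gm: "(\<lambda>p. g p (gradient A g u p) (gradient A g u p)) \<in> Borel"
  by (rule g_borel) (use gradient_tangent[OF u] gradient_borel[OF u] in auto)
 have m: "(\<lambda>p. indicator U p *R g p (gradient A g u p) (gradient A g u p)) \<in> borel_measurable vol"
  using gm U(1) by (simp add: measurable_cong_sets[OF sets_vol HOL.refl])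
 have i: "integrable vol (\<lambda>p. indicator U p *R g p (X p) (X p))" using X(2) by (simp add: set_integrable_def)
 have "AE p in vol. indicator U p *R g p (X p) (X p) = indicator U p *R g p (gradient A g u p) (gradient A g u p)"
  using ae by eventually_elim (auto simp: indicator_def)
 then show "set_integrable vol U (\<lambda>x. g x (gradient A g u x) (gradient A g u x))"
  unfolding set_integrable_def using integrable_cong_AE[OF borel_measurable_integrable[OF i] m] i by blast
qed

end

section \<open>The gradient of the distance function\<close>

lemma borel_measurable_det:
 fixes M :: "'a => real ^ 'n ^ 'n"
 assumes "!!i j. (\<lambda>p. M p $ i $ j) \<in> borel_measurable N"
 shows "(\<lambda>p. det (M p)) \<in> borel_measurable N"
 unfolding det_def by (intro borel_measurable_sum borel_measurable_times borel_measurable_prod borel_measurable_const assms)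

lemma has_derivative_line:
 fixes F :: "'a::real_normed_vector => real"
 assumes D: "(F has_derivative L) (at x)"
 shows "((\<lambda>t. F (x + t *R v)) has_real_derivative L v) (at 0)"
proof -
 have "((\<lambda>t. F (x + t *R v)) has_derivative (\<lambda>t. L (t *R v))) (at 0)"
 proof (rule has_derivative_compose[of "\<lambda>t. x + t *R v" "\<lambda>t. t *R v" 0 UNIV F])
  show "((\<lambda>t. x + t *R v) has_derivative (\<lambda>t. t *R v)) (at 0)" by (auto intro!: derivative_eq_intros)
  show "(F has_derivative L) (at (x + 0 *R v))" using D by simp
 qed
 moreover have "(\<lambda>t. L (t *R v)) = (*) (L v)"
  using linear_cmul[OF has_derivative_linear[OF D]] by (simp add: fun_eq_iff mult.commute)
 ultimately show ?thesis by (simp add: has_field_derivative_def)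
qed

context connected_riemannian
begin

lemma chart_vector_transition:
 assumes c: "c \<in> A" "p \<in> fst c" and c': "c' \<in> A" "p \<in> fst c'"
 shows "chart_vector A c p (transition_derivative c' c p v) = chart_vector A c' p v"
proof -
 have "chart_vector A c' p v c = transition_derivative c' c p v" using c by (simp add: chart_vector_def)
 then show ?thesis using tangent_eq_chart_vector[OF chart_vector_in[OF c', of v] c] by simp
qed

text \<open>With F the identity this feeds Rademacher's theorem; with F = \<gamma> it provides the
  Lipschitz factor of the test function.\<close>

lemma distance_local_lipschitz:
 fixes F :: "real => real"
 assumes c: "c \<in> A" and F: "!!s t. \<bar>F s - F t\<bar> \<le> \<Lambda> * \<bar>s - t\<bar>"
 shows "local_lipschitz {0::real} (snd c ` fst c) (\<lambda>_ x. F (d o' (chart_inv c x)))"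
proof (rule local_lipschitzI)
 fix x assume "x \<in> snd c ` fst c"
 then obtain u where u: "u > 0" "cball x u \<subseteq> snd c ` fst c" using chart_open(2)[OF c] open_contains_cball by blast
 obtain M where M: "M > 0" "!!y z. y \<in> cball x u ==> z \<in> cball x u ==> d (chart_inv c y) (chart_inv c z) \<le> M * norm (z - y)"
  by (rule d_chart_bound[OF c u(2)]) (rule that)
 have \<Lambda>: "\<Lambda> \<ge> 0" using F[of 1 0] by simp
 have "(\<Lambda> * M)-lipschitz_on (cball x u \<inter> snd c ` fst c) (\<lambda>x. F (d o' (chart_inv c x)))"
 proof (rule lipschitz_onI)
  fix y z assume yz: "y \<in> cball x u \<inter> snd c ` fst c" "z \<in> cball x u \<inter> snd c ` fst c"
  have "\<bar>F (d o' (chart_inv c y)) - F (d o' (chart_inv c z))\<bar> \<le> \<Lambda> * \<bar>d o' (chart_inv c y) - d o' (chart_inv c z)\<bar>" by (rule F)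
  also have "\<dots> \<le> \<Lambda> * (M * norm (z - y))"
   using d_lipschitz[of o' "chart_inv c y" "chart_inv c z"] M(2)[of y z] yz \<Lambda> by (intro mult_left_mono) auto
  finally show "dist (F (d o' (chart_inv c y))) (F (d o' (chart_inv c z))) \<le> \<Lambda> * M * dist y z"
   by (simp add: dist_real_def dist_norm norm_minus_commute mult.assoc)
 qed (use \<Lambda> M(1) in simp)
 then show "\<exists>u>0. \<exists>L. \<forall>t\<in>cball (t::real) u \<inter> {0}. L-lipschitz_on (cball x u \<inter> snd c ` fst c) (\<lambda>x. F (d o' (chart_inv c x)))" for t
  using u(1) by blast
qed

text \<open>X is the Riesz representative of the classical differential of the distance from o'. By
  \<open>distance_gradient_atI\<close> one chart is enough to verify it.\<close>

definition distance_gradient_at :: "'a => 'a => ('a, 'b) tangent => bool" where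
 "distance_gradient_at o' p X \<longleftrightarrow> X \<in> tangent_space A p \<and> (\<forall>c\<in>A. p \<in> fst c -->
   ((\<lambda>x. d o' (chart_inv c x)) has_derivative (\<lambda>v. g p X (chart_vector A c p v))) (at (snd c p)))"

lemma distance_gradient_atD:
 "distance_gradient_at o' p X ==> c \<in> A ==> p \<in> fst c ==>
  ((\<lambda>x. d o' (chart_inv c x)) has_derivative (\<lambda>v. g p X (chart_vector A c p v))) (at (snd c p))"
 unfolding distance_gradient_at_def by blast

lemma distance_gradient_atI:
 assumes X: "X \<in> tangent_space A p" and c: "c \<in> A" "p \<in> fst c"
  and D: "((\<lambda>x. d o' (chart_inv c x)) has_derivative (\<lambda>v. g p X (chart_vector A c p v))) (at (snd c p))"
 shows "distance_gradient_at o' p X"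
 unfolding distance_gradient_at_def
proof (intro conjI ballI impI X)
 fix c' assume c': "c' \<in> A" "p \<in> fst c'"
 have "((\<lambda>x. d o' (chart_inv c x)) has_derivative (\<lambda>v. g p X (chart_vector A c p v))) (at ((snd c \<circ> chart_inv c') (snd c' p)))"
  using D c' by simp
 from has_derivative_compose[OF transition_has_derivative[OF c'(1) c(1) c'(2) c(2)] this]
 have "((\<lambda>x. d o' (chart_inv c ((snd c \<circ> chart_inv c') x))) has_derivative (\<lambda>v. g p X (chart_vector A c' p v))) (at (snd c' p))"
  by (simp only: chart_vector_transition[OF c c'])
 then show "((\<lambda>x. d o' (chart_inv c' x)) has_derivative (\<lambda>v. g p X (chart_vector A c' p v))) (at (snd c' p))"
 proof (rule has_derivative_transform_within_open)
  show "open (snd c' ` (fst c' \<inter> fst c))" by (rule transition_domain_open[OF c'(1) c(1)])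
  show "snd c' p \<in> snd c' ` (fst c' \<inter> fst c)" using c(2) c'(2) by blast
  fix x assume "x \<in> snd c' ` (fst c' \<inter> fst c)"
  then obtain q where "q \<in> fst c'" "q \<in> fst c" "x = snd c' q" by blast
  then show "d o' (chart_inv c ((snd c \<circ> chart_inv c') x)) = d o' (chart_inv c' x)" using c(1) c'(1) by simp
 qed
qed

text \<open>Differentiate the distance along X itself. Its growth is at most the length of a
  coordinate segment in direction X, whose speed is close to |X| = sqrt N for N = |X|^2. Hence N
  \<le> sqrt N, which forces N \<le> 1.\<close>

lemma distance_gradient_bound:
 assumes X: "distance_gradient_at o' p X"
 shows "g p X X \<le> 1"
proof -
 obtain c where c: "c \<in> A" "p \<in> fst c" using chart_exists by blast
 have Xt: "X \<in> tangent_space A p" using X by (simp add: distance_gradient_at_def)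
 define v where "v = X c"
 define N where "N = g p X X"
 define x where "x = snd c p"
 have x: "x \<in> snd c ` fst c" "chart_inv c x = p" using c by (auto simp: x_def)
 have Xv: "chart_vector A c p v = X" unfolding v_def by (rule tangent_eq_chart_vector[OF Xt c, symmetric])
 have Nv: "N = v \<bullet> (G c p *v v)" unfolding N_def v_def by (rule g_tangent[OF Xt Xt c])
 have "((\<lambda>t. d o' (chart_inv c (x + t *R v))) has_real_derivative N) (at 0)"
  using has_derivative_line[OF distance_gradient_atD[OF X c], of v] by (simp add: x_def Xv N_def)
 then have lim: "((\<lambda>t. (d o' (chart_inv c (x + t *R v)) - d o' p) / t) \<longlongrightarrow> N) (at 0)"
  unfolding has_field_derivative_iff by (simp add: x)
 have "N \<le> sqrt N + e" if e: "e > 0" for e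
 proof -
  have "continuous_on (snd c ` fst c) (\<lambda>y. case (y, v) of (x, w) => w \<bullet> (G c (chart_inv c x) *v w))"
   by (rule continuous_on_compose2[OF G_quadratic_cont[OF c(1)]]) (auto intro!: continuous_intros)
  then have "continuous_on (snd c ` fst c) (\<lambda>y. sqrt (v \<bullet> (G c (chart_inv c y) *v v)))"
   unfolding prod.case by (rule continuous_on_real_sqrt)
  then have "isCont (\<lambda>y. sqrt (v \<bullet> (G c (chart_inv c y) *v v))) x"
   using continuous_on_eq_continuous_at[OF chart_open(2)[OF c(1)]] x(1) by blast
  then have "\<forall>\<^sub>F y in at x. sqrt (v \<bullet> (G c (chart_inv c y) *v v)) < sqrt N + e"
   using e by (intro order_tendstoD(2)) (auto simp: isCont_def x Nv)
  then obtain s where s: "s > 0" "!!y. y \<noteq> x ==> dist y x < s ==> sqrt (v \<bullet> (G c (chart_inv c y) *v v)) < sqrt N + e"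
   by (auto simp: eventually_at)
  have s': "sqrt (v \<bullet> (G c (chart_inv c y) *v v)) \<le> sqrt N + e" if "dist y x < s" for y
   using s(2)[of y] that e by (cases "y = x") (auto simp: x Nv)
  obtain s2 where s2: "s2 > 0" "ball x s2 \<subseteq> snd c ` fst c"
   using chart_open(2)[OF c(1)] x(1) open_contains_ball by blast
  \<comment> \<open>Parameters below \<tau> keep the whole segment in the chart and in the ball
    where the coordinate speed is at most sqrt N + e; the added 1 covers v = 0.\<close>
  define \<tau> where "\<tau> = min s s2 / (norm v + 1)"
  have nv: "norm v + 1 > 0" using norm_ge_zero[of v] by linarith
  have \<tau>: "\<tau> > 0" using s(1) s2(1) nv by (simp add: \<tau>_def)
  have bd: "(d o' (chart_inv c (x + t *R v)) - d o' p) / t \<le> sqrt N + e" if t: "t > 0" "t < \<tau>" for t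
  proof -
   have "t * norm v \<le> t * (norm v + 1)" using t by (simp add: mult_left_mono)
   also have "t * (norm v + 1) < min s s2" using t(2) nv by (simp add: \<tau>_def pos_less_divide_eq)
   finally have n: "norm (t *R v) < min s s2" using t(1) by simp
   have seg: "closed_segment x (x + t *R v) \<subseteq> ball x (min s s2)"
   proof -
    have "x + t *R v \<in> ball x (min s s2)" using n by (simp add: dist_norm)
    moreover have "x \<in> ball x (min s s2)" using s(1) s2(1) by simp
    ultimately show ?thesis using closed_segment_subset[OF _ _ convex_ball] by blast
   qed
   have "\<exists>l\<le>t * (sqrt N + e). joined (chart_inv c x) (chart_inv c (x + t *R v)) l"
   proof (rule joined_segment[OF c(1)])
    show "closed_segment x (x + t *R v) \<subseteq> snd c ` fst c" by (rule order_trans[OF seg order_trans[OF subset_ball s2(2)]]) simp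
    fix y assume "y \<in> closed_segment x (x + t *R v)"
    then have "dist y x < s" using seg by (auto simp: dist_commute)
    have "sqrt ((x + t *R v - x) \<bullet> (G c (chart_inv c y) *v (x + t *R v - x))) = sqrt (t\<^sup>2 * (v \<bullet> (G c (chart_inv c y) *v v)))"
     by (simp add: matrix_vector_mult_scaleR power2_eq_square)
    also have "\<dots> = t * sqrt (v \<bullet> (G c (chart_inv c y) *v v))" using t(1) by (simp add: real_sqrt_mult)
    also have "\<dots> \<le> t * (sqrt N + e)" using s'[OF \<open>dist y x < s\<close>] t(1) by simp
    finally show "sqrt ((x + t *R v - x) \<bullet> (G c (chart_inv c y) *v (x + t *R v - x))) \<le> t * (sqrt N + e)" .
   qed
   then obtain l where l: "l \<le> t * (sqrt N + e)" "joined p (chart_inv c (x + t *R v)) l" using x(2) by auto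
   have "d o' (chart_inv c (x + t *R v)) - d o' p \<le> d p (chart_inv c (x + t *R v))"
    using d_lipschitz[of o' p "chart_inv c (x + t *R v)"] by linarith
   also have "\<dots> \<le> t * (sqrt N + e)" using rdist_le[OF l(2)] l(1) by linarith
   finally show ?thesis using t(1) by (simp add: pos_divide_le_eq mult.commute)
  qed
  have lim': "((\<lambda>t. (d o' (chart_inv c (x + t *R v)) - d o' p) / t) \<longlongrightarrow> N) (at_right 0)"
   by (rule tendsto_mono[OF at_le lim]) simp
  have "\<forall>\<^sub>F t in at_right 0. (d o' (chart_inv c (x + t *R v)) - d o' p) / t \<le> sqrt N + e"
   unfolding eventually_at_right_field using bd \<tau> by blast
  then show ?thesis by (rule tendsto_upperbound[OF lim']) simp
 qed
 then have le: "N \<le> sqrt N" by (rule field_le_epsilon)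
 have "N \<ge> 0" unfolding N_def by (rule g_nonneg[OF Xt])
 have "N \<le> 1"
 proof (rule ccontr)
  assume "\<not> N \<le> 1"
  then have "sqrt N * 1 < sqrt N * sqrt N" by (intro mult_strict_left_mono) auto
  then show False using le \<open>N \<ge> 0\<close> by simp
 qed
 then show ?thesis by (simp add: N_def)
qed

text \<open>The value 0 off the chart image makes it a Borel function on the whole space, so shifted
  arguments carry no side condition.\<close>

definition distance_pullback :: "'a => ('a, 'b) chart => real ^ 'b => real" where
 "distance_pullback o' c x = indicator (snd c ` fst c) x * d o' (chart_inv c x)"

text \<open>A fixed sequence of increments yields a Borel function defined everywhere; it is the
  partial derivative at points of differentiability.\<close>

definition distance_partial :: "'a => ('a, 'b) chart => 'b => real ^ 'b => real" where
 "distance_partial o' c i x =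
  lim (\<lambda>n. (distance_pullback o' c (x + inverse (real (Suc n)) *R axis i 1) - distance_pullback o' c x) / inverse (real (Suc n)))"

lemma distance_partial_eq:
 assumes c: "c \<in> A" "x \<in> snd c ` fst c" and D: "((\<lambda>x. d o' (chart_inv c x)) has_derivative L) (at x)"
 shows "distance_partial o' c i x = L (axis i 1)"
proof -
 let ?e = "axis i 1 :: real ^ 'b"
 have D': "(distance_pullback o' c has_derivative L) (at x)"
  by (rule has_derivative_transform_within_open[OF D chart_open(2)[OF c(1)] c(2)]) (simp add: distance_pullback_def)
 have "((\<lambda>t. distance_pullback o' c (x + t *R ?e)) has_real_derivative L ?e) (at 0)"
  by (rule has_derivative_line[OF D'])
 then have lim: "((\<lambda>t. (distance_pullback o' c (x + t *R ?e) - distance_pullback o' c x) / t) \<longlongrightarrow> L ?e) (at 0)"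
  unfolding has_field_derivative_iff by simp
 have "filterlim (\<lambda>n. inverse (real (Suc n))) (at 0) sequentially"
  unfolding filterlim_at using LIMSEQ_inverse_real_of_nat by (auto intro!: always_eventually)
 from limI[OF filterlim_compose[OF lim this]] show ?thesis by (simp add: distance_partial_def)
qed

lemma distance_partial_borel:
 assumes c: "c \<in> A"
 shows "(\<lambda>p. indicator (fst c) p * distance_partial o' c i (snd c p)) \<in> Borel"
proof -
 have [measurable]: "d o' \<in> Borel" by (rule borel_measurable_continuous_onI[OF d_continuous])
 have [measurable]: "distance_pullback o' c \<in> Borel"
  using chart_pullback_borel[OF c, of "d o'"] by (simp add: distance_pullback_def[abs_def])
 have m: "distance_partial o' c i \<in> Borel"
  unfolding distance_partial_def[abs_def] by measurable
 have f[measurable]: "fst c \<in> sets borel" using chart_open(1)[OF c] by simp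
 have "(\<lambda>p. if p \<in> fst c then snd c p else 0) \<in> Borel"
  by (rule borel_measurable_continuous_on_if[OF f chart_cont(1)[OF c]]) (rule continuous_on_const)
 from measurable_compose[OF this m]
 have "(\<lambda>p. indicator (fst c) p * distance_partial o' c i (if p \<in> fst c then snd c p else 0)) \<in> Borel"
  by measurable
 moreover have "(\<lambda>p. indicator (fst c) p * distance_partial o' c i (if p \<in> fst c then snd c p else 0))
  = (\<lambda>p. indicator (fst c) p * distance_partial o' c i (snd c p))" by (auto simp: fun_eq_iff indicator_def)
 ultimately show ?thesis by simp
qed

text \<open>Cramer's rule makes the measurability of the gradient evident.\<close>

definition distance_gradient_coords :: "'a => ('a, 'b) chart => 'a => real ^ 'b" where
 "distance_gradient_coords o' c p =
  (\<chi> k. det (\<chi> i j. if j = k then distance_partial o' c i (snd c p) else G c p $ i $ j) / det (G c p))"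

lemma distance_gradient_coords_borel:
 assumes c: "c \<in> A"
 shows "(\<lambda>p. indicator (fst c) p * distance_gradient_coords o' c p $ k) \<in> Borel"
proof -
 let ?I = "\<lambda>p. indicator (fst c) p :: real"
 have f[measurable]: "fst c \<in> sets borel" using chart_open(1)[OF c] by simp
 \<comment> \<open>The entries are known to be measurable only after restriction to the chart, so
   the indicator multiplies every entry; on the chart it is 1 and changes nothing.\<close>
 have 1: "(\<lambda>p. det (\<chi> i j. if j = k then ?I p * distance_partial o' c i (snd c p) else ?I p * G c p $ i $ j)) \<in> Borel"
 proof (rule borel_measurable_det)
  show "(\<lambda>p. (\<chi> i j. if j = k then ?I p * distance_partial o' c i (snd c p) else ?I p * G c p $ i $ j) $ i $ j) \<in> Borel" for i j
   using distance_partial_borel[OF c, of o' i] G_borel[OF c, of i j] by (cases "j = k") simp_all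
 qed
 have 2: "(\<lambda>p. det (\<chi> i j. ?I p * G c p $ i $ j)) \<in> Borel"
  by (rule borel_measurable_det) (simp add: G_borel[OF c])
 have "(\<lambda>p. ?I p * (det (\<chi> i j. if j = k then ?I p * distance_partial o' c i (snd c p) else ?I p * G c p $ i $ j)
   / det (\<chi> i j. ?I p * G c p $ i $ j))) \<in> Borel"
  using 1 2 by measurable
 moreover have "(\<lambda>p. ?I p * (det (\<chi> i j. if j = k then ?I p * distance_partial o' c i (snd c p) else ?I p * G c p $ i $ j)
   / det (\<chi> i j. ?I p * G c p $ i $ j))) = (\<lambda>p. ?I p * distance_gradient_coords o' c p $ k)"
 proof
  fix p
  show "?I p * (det (\<chi> i j. if j = k then ?I p * distance_partial o' c i (snd c p) else ?I p * G c p $ i $ j)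
   / det (\<chi> i j. ?I p * G c p $ i $ j)) = ?I p * distance_gradient_coords o' c p $ k"
   by (cases "p \<in> fst c") (simp_all add: distance_gradient_coords_def cong: if_cong)
 qed
 ultimately show ?thesis by simp
qed

text \<open>The chart at p is that of the piece containing p, so that a single field arises on the
  whole manifold.\<close>

definition distance_gradient :: "'a => 'a => ('a, 'b) tangent" where
 "distance_gradient o' p =
  (let c = atlas_seq (LEAST n. p \<in> piece n) in chart_vector A c p (distance_gradient_coords o' c p))"

lemma piece_Least: "p \<in> piece n ==> (LEAST n. p \<in> piece n) = n"
proof (rule Least_equality)
 fix m assume "p \<in> piece n" "p \<in> piece m"
 then have "m = n" using piece(3) unfolding disjoint_family_on_def by blast
 then show "n \<le> m" by simp
qed

lemma distance_gradient_piece: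
 "p \<in> piece n ==> distance_gradient o' p = chart_vector A (atlas_seq n) p (distance_gradient_coords o' (atlas_seq n) p)"
 by (simp add: distance_gradient_def piece_Least Let_def)

lemma distance_gradient_tangent: "distance_gradient o' p \<in> tangent_space A p"
proof -
 obtain n where n: "p \<in> piece n" using piece(4) by blast
 show ?thesis unfolding distance_gradient_piece[OF n] by (rule chart_vector_in[OF atlas_seq(1) subsetD[OF piece(2) n]])
qed

lemma distance_gradient_borel: "coords_borel UNIV (distance_gradient o')"
 unfolding coords_borel_def set_borel_measurable_def
proof (intro ballI borel_by_pieces)
 fix c' n assume c': "c' \<in> A"
 define c where "c = atlas_seq n"
 have c: "c \<in> A" by (simp add: c_def atlas_seq)
 let ?h = "\<lambda>p. \<Sum>j\<in>UNIV. (indicator (fst c) p * distance_gradient_coords o' c p $ j) *R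
   (indicator (fst c \<inter> fst c') p *R transition_derivative c c' p (axis j 1))"
 have t: "(\<lambda>p. indicator (fst c \<inter> fst c') p *R transition_derivative c c' p v) \<in> Borel" for v
 proof (rule borel_measurable_continuous_on_indicator)
  show "fst c \<inter> fst c' \<in> sets borel" using chart_open(1)[OF c] chart_open(1)[OF c'] by (intro borel_open open_Int)
  have "continuous_on (fst c \<inter> fst c') (\<lambda>p. transition_derivative c c' (chart_inv c (snd c p)) v)"
   by (rule continuous_on_compose2[OF transition_derivative_cont[OF c c'] continuous_on_subset[OF chart_cont(1)[OF c]]]) auto
  then show "continuous_on (fst c \<inter> fst c') (\<lambda>p. transition_derivative c c' p v)"
   by (rule continuous_on_eq) (simp add: c)
 qed
 have "?h \<in> Borel"
  by (intro borel_measurable_sum borel_measurable_scaleR distance_gradient_coords_borel[OF c] t)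
 moreover have "indicator (fst c' \<inter> UNIV) p *R distance_gradient o' p c' = ?h p" if p: "p \<in> piece n" for p
 proof (cases "p \<in> fst c'")
  case True
  have pc: "p \<in> fst c" using subsetD[OF piece(2) p] by (simp only: c_def)
  define w where "w = distance_gradient_coords o' c p"
  have "distance_gradient o' p c' = transition_derivative c c' p w"
   unfolding distance_gradient_piece[OF p] using True c' by (simp add: chart_vector_def c_def w_def)
  also have "\<dots> = transition_derivative c c' p (\<Sum>j\<in>UNIV. w $ j *R axis j 1)"
   using basis_expansion[of w] by (simp add: scalar_mult_eq_scaleR)
  also have "\<dots> = (\<Sum>j\<in>UNIV. w $ j *R transition_derivative c c' p (axis j 1))"
   using transition_linear[OF c c' pc True] by (simp add: linear_sum linear_cmul)
  finally show ?thesis using True pc by (simp add: w_def)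
 qed simp
 ultimately show "\<exists>h\<in>Borel. \<forall>p\<in>piece n. indicator (fst c' \<inter> UNIV) p *R distance_gradient o' p c' = h p"
  by (intro bexI[of _ ?h] ballI)
qed

text \<open>The differential is rewritten from the given chart to the chart of the piece. There
  Cramer's rule solves for the vector w whose image under G consists of the partial derivatives, and
  this w represents the differential.\<close>

lemma distance_gradient_differentiable:
 assumes c': "c' \<in> A" "p \<in> fst c'" and D: "(\<lambda>x. d o' (chart_inv c' x)) differentiable (at (snd c' p))"
 shows "distance_gradient_at o' p (distance_gradient o' p)"
proof -
 obtain n where n: "p \<in> piece n" using piece(4) by blast
 define c where "c = atlas_seq n"
 have c: "c \<in> A" "p \<in> fst c" using subsetD[OF piece(2) n] by (simp_all add: c_def atlas_seq)
 obtain L' where L': "((\<lambda>x. d o' (chart_inv c' x)) has_derivative L') (at (snd c' p))" using D unfolding differentiable_def by blast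
 then have "((\<lambda>x. d o' (chart_inv c' x)) has_derivative L') (at ((snd c' \<circ> chart_inv c) (snd c p)))" using c by simp
 from has_derivative_compose[OF transition_has_derivative[OF c(1) c'(1) c(2) c'(2)] this]
 have "((\<lambda>x. d o' (chart_inv c' ((snd c' \<circ> chart_inv c) x))) has_derivative (\<lambda>v. L' (transition_derivative c c' p v))) (at (snd c p))" .
 then have L: "((\<lambda>x. d o' (chart_inv c x)) has_derivative (\<lambda>v. L' (transition_derivative c c' p v))) (at (snd c p))"
 proof (rule has_derivative_transform_within_open)
  show "open (snd c ` (fst c \<inter> fst c'))" by (rule transition_domain_open[OF c(1) c'(1)])
  show "snd c p \<in> snd c ` (fst c \<inter> fst c')" using c(2) c'(2) by blast
  fix x assume "x \<in> snd c ` (fst c \<inter> fst c')"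
  then obtain q where "q \<in> fst c'" "q \<in> fst c" "x = snd c q" by blast
  then show "d o' (chart_inv c' ((snd c' \<circ> chart_inv c) x)) = d o' (chart_inv c x)" using c(1) c'(1) by simp
 qed
 define M where "M v = L' (transition_derivative c c' p v)" for v
 define w where "w = distance_gradient_coords o' c p"
 have M: "((\<lambda>x. d o' (chart_inv c x)) has_derivative M) (at (snd c p))" using L by (simp add: M_def[abs_def])
 have part: "distance_partial o' c i (snd c p) = M (axis i 1)" for i
  by (rule distance_partial_eq[OF c(1) _ M]) (use c in blast)
 have "G c p *v w = (\<chi> i. M (axis i 1))"
  unfolding cramer[OF G_invertible[OF c]] w_def distance_gradient_coords_def by (simp add: part cong: if_cong)
 then have "v \<bullet> (G c p *v w) = M v" for v
 proof -
  assume "G c p *v w = (\<chi> i. M (axis i 1))"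
  then have "v \<bullet> (G c p *v w) = (\<Sum>i\<in>UNIV. v $ i * M (axis i 1))" by (simp add: inner_vec_def)
  also have "\<dots> = M (\<Sum>i\<in>UNIV. v $ i *R axis i 1)"
   using has_derivative_linear[OF M] by (simp add: linear_sum linear_cmul)
  also have "\<dots> = M v" using basis_expansion[of v] by (simp add: scalar_mult_eq_scaleR)
  finally show ?thesis .
 qed
 then have gM: "g p (chart_vector A c p w) (chart_vector A c p v) = M v" for v
  using g_sym[OF chart_vector_in[OF c, of v] chart_vector_in[OF c, of w]] g_chart[OF c, of v w] by simp
 have "distance_gradient o' p = chart_vector A c p w" unfolding distance_gradient_piece[OF n] w_def c_def ..
 then show ?thesis using distance_gradient_atI[OF chart_vector_in[OF c, of w] c, of o'] M gM by simp
qed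

lemma distance_gradient_AE:
 assumes c: "c \<in> A"
 shows "AE x in lborel. x \<in> snd c ` fst c --> distance_gradient_at o' (chart_inv c x) (distance_gradient o' (chart_inv c x))"
proof -
 have "local_lipschitz {0::real} (snd c ` fst c) (\<lambda>_ x. d o' (chart_inv c x))"
  by (rule distance_local_lipschitz[OF c, of "\<lambda>x. x" 1]) simp
 from Rademacher_local[OF chart_open(2)[OF c] this] show ?thesis
 proof eventually_elim
  case (elim x)
  show ?case
  proof
   assume x: "x \<in> snd c ` fst c"
   show "distance_gradient_at o' (chart_inv c x) (distance_gradient o' (chart_inv c x))"
    by (rule distance_gradient_differentiable[OF c chart_inv_in[OF c x]]) (use elim x c in simp)
  qed
 qed
qed

theorem distance_gradient_exists:
 obtains R where "!!p. R p \<in> tangent_space A p" "coords_borel UNIV R" "!!p. g p (R p) (R p) \<le> 1"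
  "!!c. c \<in> A ==> AE x in lborel. x \<in> snd c ` fst c --> distance_gradient_at o' (chart_inv c x) (R (chart_inv c x))"
proof -
 \<comment> \<open>The norm bound comes from differentiability of the distance. Setting the field to
   0 off S makes the bound hold everywhere and alters no value at a point of
   differentiability.\<close>
 define S where "S = {p. g p (distance_gradient o' p) (distance_gradient o' p) \<le> 1}"
 define R where "R p = (if p \<in> S then distance_gradient o' p else (\<lambda>_. 0))" for p
 have [measurable]: "(\<lambda>p. g p (distance_gradient o' p) (distance_gradient o' p)) \<in> Borel"
  by (rule g_borel[OF distance_gradient_tangent distance_gradient_borel distance_gradient_tangent distance_gradient_borel])
 have S: "S \<in> sets borel" unfolding S_def by simp
 show ?thesis
 proof (rule that[of R])
  show "R p \<in> tangent_space A p" for p by (simp add: R_def distance_gradient_tangent zero_in_tangent)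
  show "coords_borel UNIV R"
   unfolding coords_borel_def set_borel_measurable_def
  proof
   fix c assume c: "c \<in> A"
   have "(\<lambda>p. indicator S p *R (indicator (fst c \<inter> UNIV) p *R distance_gradient o' p c)) \<in> Borel"
    by (rule borel_measurable_scaleR[OF borel_measurable_indicator[OF S]
     coords_borelD[OF distance_gradient_borel c, unfolded set_borel_measurable_def]])
   moreover have "(\<lambda>p. indicator S p *R (indicator (fst c \<inter> UNIV) p *R distance_gradient o' p c))
    = (\<lambda>p. indicator (fst c \<inter> UNIV) p *R R p c)" by (auto simp: fun_eq_iff R_def indicator_def)
   ultimately show "(\<lambda>p. indicator (fst c \<inter> UNIV) p *R R p c) \<in> Borel" by simp
  qed
  show "g p (R p) (R p) \<le> 1" for p by (cases "p \<in> S") (simp_all add: R_def S_def g_zero[OF zero_in_tangent])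
  fix c assume "c \<in> A"
  from distance_gradient_AE[OF this, of o']
  show "AE x in lborel. x \<in> snd c ` fst c --> distance_gradient_at o' (chart_inv c x) (R (chart_inv c x))"
  proof eventually_elim
   case (elim x)
   show ?case
   proof
    assume "x \<in> snd c ` fst c"
    then have *: "distance_gradient_at o' (chart_inv c x) (distance_gradient o' (chart_inv c x))" using elim by blast
    then have "chart_inv c x \<in> S" unfolding S_def using distance_gradient_bound[OF *] by blast
    then show "distance_gradient_at o' (chart_inv c x) (R (chart_inv c x))" using * by (simp only: R_def if_True)
   qed
  qed
 qed
qed

end

section \<open>The test functions\<close>

context riemannian
begin

lemma tangent_comb:
 assumes "v \<in> tangent_space A p" "w \<in> tangent_space A p"
 shows "(\<lambda>c. a *R v c + b *R w c) \<in> tangent_space A p"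
 using tangent_lin[OF assms(1) tangent_lin[OF assms(2) zero_in_tangent, of b], of a] by simp

lemma g_comb:
 assumes "v \<in> tangent_space A p" "w \<in> tangent_space A p" "z \<in> tangent_space A p"
 shows "g p (\<lambda>c. a *R v c + b *R w c) z = a * g p v z + b * g p w z"
 using g_lin[OF assms(1) tangent_lin[OF assms(2) zero_in_tangent, of b] assms(3), of a]
  g_lin[OF assms(2) zero_in_tangent assms(3), of b] g_zero[OF assms(3)] by simp

lemma g_comb_right:
 assumes "v \<in> tangent_space A p" "w \<in> tangent_space A p" "z \<in> tangent_space A p"
 shows "g p z (\<lambda>c. a *R v c + b *R w c) = a * g p z v + b * g p z w"
 using g_comb[OF assms, of a b] g_sym[OF assms(3) tangent_comb[OF assms(1,2), of a b]]
  g_sym[OF assms(3,1)] g_sym[OF assms(3,2)] by simp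

text \<open>The mixed term is controlled by the nonnegative value of the form at a v - b w.\<close>

lemma g_comb_self_le:
 assumes v: "v \<in> tangent_space A p" "w \<in> tangent_space A p"
 shows "g p (\<lambda>c. a *R v c + b *R w c) (\<lambda>c. a *R v c + b *R w c) \<le> 2 * (a\<^sup>2 * g p v v + b\<^sup>2 * g p w w)"
proof -
 have e: "g p (\<lambda>c. a *R v c + b *R w c) (\<lambda>c. a *R v c + b *R w c) = a\<^sup>2 * g p v v + 2 * a * b * g p v w + b\<^sup>2 * g p w w" for a b
  using g_comb[OF v tangent_comb[OF v]] g_comb_right[OF v v(1)] g_comb_right[OF v v(2)] g_sym[OF v]
  by (simp add: algebra_simps power2_eq_square)
 have "0 \<le> a\<^sup>2 * g p v v - 2 * a * b * g p v w + b\<^sup>2 * g p w w"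
  using g_nonneg[OF tangent_comb[OF v, of a "- b"]] e[of a "- b"] by simp
 then show ?thesis unfolding e by argo
qed

lemma coords_borel_comb:
 assumes [measurable]: "a \<in> Borel" "b \<in> Borel"
  and X: "coords_borel UNIV X" and Y: "coords_borel UNIV Y"
 shows "coords_borel UNIV (\<lambda>p c. a p *R X p c + b p *R Y p c)"
 unfolding coords_borel_def set_borel_measurable_def
proof
 fix c assume c: "c \<in> A"
 have "(\<lambda>p. a p *R (indicator (fst c \<inter> UNIV) p *R X p c) + b p *R (indicator (fst c \<inter> UNIV) p *R Y p c)) \<in> Borel"
  by (intro borel_measurable_add borel_measurable_scaleR assms(1,2)
   coords_borelD[OF X c, unfolded set_borel_measurable_def] coords_borelD[OF Y c, unfolded set_borel_measurable_def])
 then show "(\<lambda>p. indicator (fst c \<inter> UNIV) p *R (a p *R X p c + b p *R Y p c)) \<in> Borel"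
  by (simp add: scaleR_add_right mult.commute)
qed

lemma borel_vol: "borel_measurable vol = Borel"
 by (rule measurable_cong_sets[OF sets_vol HOL.refl])

end

text \<open>Here \<gamma> stands for the squared cutoff \<eta>^2. The common bound C on all four
  functions makes the test function and its gradient square integrable for u merely in W^{1,2}_loc.
  As f and f' vanish for t \<le> 0, the test function is admissible on the set where u > 0.\<close>

locale cutoff_test = complete_manifold A g
 for A :: "('a::{t2_space, second_countable_topology}, 'b::finite) chart set" and g :: "('a, 'b) metric" +
 fixes x0 :: 'a and u :: "'a => real" and R :: "'a => ('a, 'b) tangent"
  and f f' \<gamma> \<gamma>' :: "real => real" and C T :: real
 assumes u: "u \<in> W12_loc A g"
  and R_tangent: "!!p. R p \<in> tangent_space A p"
  and R_borel: "coords_borel UNIV R"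
  and R_le: "!!p. g p (R p) (R p) \<le> 1"
  and R_gradient: "!!c. c \<in> A ==>
   AE x in lborel. x \<in> snd c ` fst c --> distance_gradient_at x0 (chart_inv c x) (R (chart_inv c x))"
  and f: "!!t. (f has_real_derivative f' t) (at t)" "continuous_on UNIV f'"
  and f_le: "!!t. \<bar>f t\<bar> \<le> C" "!!t. \<bar>f' t\<bar> \<le> C"
  and f_0: "!!t. t \<le> 0 ==> f t = 0" "!!t. t \<le> 0 ==> f' t = 0" and f_nonneg: "!!t. f t \<ge> 0"
  and \<gamma>: "!!t. (\<gamma> has_real_derivative \<gamma>' t) (at t)" "continuous_on UNIV \<gamma>'"
  and \<gamma>_le: "!!t. \<bar>\<gamma> t\<bar> \<le> C" "!!t. \<bar>\<gamma>' t\<bar> \<le> C"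
  and \<gamma>_0: "!!t. t \<ge> T ==> \<gamma> t = 0" "!!t. t \<ge> T ==> \<gamma>' t = 0" and \<gamma>_nonneg: "!!t. \<gamma> t \<ge> 0"
begin

abbreviation U where "U \<equiv> gradient A g u"
abbreviation r where "r \<equiv> d x0"

definition "\<phi> p = f (u p) * \<gamma> (r p)"
definition "X p = (\<lambda>c. (f' (u p) * \<gamma> (r p)) *R U p c + (f (u p) * \<gamma>' (r p)) *R R p c)"

lemma C_nonneg: "C \<ge> 0" using f_le(1)[of 0] by linarith

lemma U_tangent: "U p \<in> tangent_space A p" by (rule gradient_tangent[OF u])

lemma X_tangent: "X p \<in> tangent_space A p" unfolding X_def by (rule tangent_comb[OF U_tangent R_tangent])

lemma g_X: "v \<in> tangent_space A p ==> g p (X p) v = (f' (u p) * \<gamma> (r p)) * g p (U p) v + (f (u p) * \<gamma>' (r p)) * g p (R p) v"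
 unfolding X_def by (rule g_comb[OF U_tangent R_tangent])

lemma u_borel [measurable]: "u \<in> Borel" by (rule W12_loc_borel[OF u])

lemma real_borel [measurable]:
 "f \<in> Borel" "f' \<in> Borel" "\<gamma> \<in> Borel" "\<gamma>' \<in> Borel"
 "r \<in> Borel"
 by (rule borel_measurable_continuous_onI, rule DERIV_continuous_on, rule f(1))
  (rule borel_measurable_continuous_onI, rule f(2),
   rule borel_measurable_continuous_onI, rule DERIV_continuous_on, rule \<gamma>(1),
   rule borel_measurable_continuous_onI, rule \<gamma>(2),
   rule borel_measurable_continuous_onI, rule d_continuous)

lemma X_borel: "coords_borel UNIV X"
 unfolding X_def by (rule coords_borel_comb[OF _ _ gradient_borel[OF u] R_borel]) measurable

text \<open>Cauchy-Schwarz with |R| \<le> 1, together with 2 |x| \<le> 1 + x^2. Since G is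
  continuous, the coordinate components of R are bounded on compact sets, as the product rule
  demands.\<close>

lemma R_coord_le:
 assumes "c \<in> A" "p \<in> fst c"
 shows "\<bar>g p (R p) (coord_vector A c p i)\<bar> \<le> 1 + G c p $ i $ i"
proof -
 let ?x = "g p (R p) (coord_vector A c p i)"
 have "?x\<^sup>2 \<le> g p (R p) (R p) * G c p $ i $ i"
  using g_Cauchy_Schwarz[OF R_tangent[of p] coord_vector_in[OF assms, of i]] by (simp add: metric_matrix_def)
 also have "\<dots> \<le> 1 * G c p $ i $ i"
  using R_le[of p] g_nonneg[OF coord_vector_in[OF assms, of i]] by (intro mult_right_mono) (simp_all add: metric_matrix_def)
 finally have "?x\<^sup>2 \<le> G c p $ i $ i" by simp
 moreover have "0 \<le> (\<bar>?x\<bar> - 1)\<^sup>2" by simp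
 then have "2 * \<bar>?x\<bar> \<le> 1 + ?x\<^sup>2" by (simp add: power2_diff)
 ultimately show ?thesis by linarith
qed

text \<open>The chain and product rule in each chart, with \<gamma>(r) as the locally Lipschitz
  factor; its partial derivatives exist almost everywhere and are given by R.\<close>

lemma weak_gradient_\<phi>: "is_weak_gradient A g UNIV \<phi> X"
 unfolding is_weak_gradient_def
proof (intro conjI ballI allI X_tangent)
 fix c assume c: "c \<in> A"
 show "set_borel_measurable borel (fst c \<inter> UNIV) (\<lambda>p. X p c)" by (rule coords_borelD[OF X_borel c])
 fix i
 let ?W = "snd c ` (fst c \<inter> UNIV)"
 have op: "open ?W" using chart_open(2)[OF c] by simp
 let ?b = "\<lambda>x. \<gamma>' (r (chart_inv c x)) * g (chart_inv c x) (R (chart_inv c x)) (coord_vector A c (chart_inv c x) i)"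
 have "weak_derivative_on ?W (axis i 1) (\<lambda>x. f ((u \<circ> chart_inv c) x) * \<gamma> (r (chart_inv c x)))
   (\<lambda>x. f' ((u \<circ> chart_inv c) x) * g (chart_inv c x) (U (chart_inv c x)) (coord_vector A c (chart_inv c x) i) * \<gamma> (r (chart_inv c x))
    + f ((u \<circ> chart_inv c) x) * ?b x)"
 proof (rule weak_derivative_chain_product[OF op weak_gradient_derivative[OF W12_loc_gradient[OF u] c] f f_le])
  have "\<bar>\<gamma> s - \<gamma> t\<bar> \<le> C * \<bar>s - t\<bar>" for s t
   using field_differentiable_bound[of UNIV \<gamma> \<gamma>' C s t] \<gamma>(1) \<gamma>_le(2) by simp
  from distance_local_lipschitz[OF c this]
  show "local_lipschitz {0::real} ?W (\<lambda>_ x. \<gamma> (r (chart_inv c x)))" by simp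
  have m1: "(\<lambda>x. indicator ?W x * g (chart_inv c x) (R (chart_inv c x)) (coord_vector A c (chart_inv c x) i)) \<in> Borel"
   by (rule g_coord_borel[OF c open_UNIV R_tangent R_borel])
  have m2: "(\<lambda>x. indicator (snd c ` fst c) x * \<gamma>' (r (chart_inv c x))) \<in> Borel"
   by (rule chart_pullback_borel[OF c]) measurable
  have "(\<lambda>x. indicator ?W x * ?b x) = (\<lambda>x. (indicator (snd c ` fst c) x * \<gamma>' (r (chart_inv c x))) *
    (indicator ?W x * g (chart_inv c x) (R (chart_inv c x)) (coord_vector A c (chart_inv c x) i)))"
   by (auto simp: fun_eq_iff indicator_def)
  then show "(\<lambda>x. indicator ?W x * ?b x) \<in> Borel"
   using borel_measurable_times[OF m2 m1] by simp
  show "\<exists>M. \<forall>x\<in>K. \<bar>?b x\<bar> \<le> M" if K: "compact K" "K \<subseteq> ?W" for K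
  proof -
   have K': "K \<subseteq> snd c ` fst c" using K(2) by simp
   have "continuous_on K (\<lambda>x. G c (chart_inv c x) $ i $ i)" by (rule continuous_on_subset[OF G_entry_cont[OF c] K'])
   from compact_imp_bounded[OF compact_continuous_image[OF this K(1)]]
   obtain B where B: "\<forall>y\<in>(\<lambda>x. G c (chart_inv c x) $ i $ i) ` K. norm y \<le> B" unfolding bounded_iff by blast
   have "\<bar>?b x\<bar> \<le> C * (1 + B)" if x: "x \<in> K" for x
    unfolding abs_mult
   proof (rule mult_mono[OF \<gamma>_le(2)])
    have "norm (G c (chart_inv c x) $ i $ i) \<le> B" by (rule bspec[OF B imageI[OF x]])
    then show "\<bar>g (chart_inv c x) (R (chart_inv c x)) (coord_vector A c (chart_inv c x) i)\<bar> \<le> 1 + B"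
     using R_coord_le[OF c chart_inv_in[OF c subsetD[OF K' x]], of i] by simp
   qed (use C_nonneg in simp_all)
   then show ?thesis by blast
  qed
  show "AE x in lborel. x \<in> ?W --> ((\<lambda>s. \<gamma> (r (chart_inv c (x + s *R axis i 1)))) has_real_derivative ?b x) (at 0)"
   using R_gradient[OF c]
  proof eventually_elim
   case (elim x)
   show ?case
   proof
    assume "x \<in> ?W"
    then have x: "x \<in> snd c ` fst c" by simp
    have "((\<lambda>x. r (chart_inv c x)) has_derivative (\<lambda>v. g (chart_inv c x) (R (chart_inv c x)) (chart_vector A c (chart_inv c x) v))) (at x)"
     using distance_gradient_atD[OF elim[rule_format, OF x] c chart_inv_in[OF c x]] chart_chart_inv[OF c x] by simp
    from has_derivative_line[OF this, of "axis i 1"]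
    have "((\<lambda>s. r (chart_inv c (x + s *R axis i 1))) has_real_derivative
      g (chart_inv c x) (R (chart_inv c x)) (coord_vector A c (chart_inv c x) i)) (at 0)"
     by (simp add: coord_vector_eq)
    from DERIV_chain2[OF \<gamma>(1) this] show "((\<lambda>s. \<gamma> (r (chart_inv c (x + s *R axis i 1)))) has_real_derivative ?b x) (at 0)"
     by simp
   qed
  qed
 qed
 then have wd: "weak_derivative_on ?W (axis i 1) (\<phi> \<circ> chart_inv c)
   (\<lambda>x. f' ((u \<circ> chart_inv c) x) * g (chart_inv c x) (U (chart_inv c x)) (coord_vector A c (chart_inv c x) i) * \<gamma> (r (chart_inv c x))
    + f ((u \<circ> chart_inv c) x) * ?b x)"
  by (simp add: \<phi>_def o_def)
 show "weak_derivative_on ?W (axis i 1) (\<phi> \<circ> chart_inv c)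
    (\<lambda>x. g (chart_inv c x) (X (chart_inv c x)) (coord_vector A c (chart_inv c x) i))"
 proof (rule weak_derivative_cong_AE[OF wd op g_coord_borel[OF c open_UNIV X_tangent X_borel]], rule AE_I2, rule impI)
  fix x assume "x \<in> ?W"
  then have "chart_inv c x \<in> fst c" using c by simp
  then show "f' ((u \<circ> chart_inv c) x) * g (chart_inv c x) (U (chart_inv c x)) (coord_vector A c (chart_inv c x) i) * \<gamma> (r (chart_inv c x))
    + f ((u \<circ> chart_inv c) x) * ?b x = g (chart_inv c x) (X (chart_inv c x)) (coord_vector A c (chart_inv c x) i)"
   using g_X[OF coord_vector_in[OF c]] by simp
 qed
qed

definition "\<Omega> = {p. r p < T + 1}"
text \<open>A common majorant: the constant dominates the terms with bounded factors only, the other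
  two summands those that involve u and its gradient.\<close>

definition "H p = indicator \<Omega> p * (1 + (u p)\<^sup>2 + g p (U p) (U p))"

lemma \<Omega>: "open \<Omega>" "compact (closure \<Omega>)"
proof -
 have "open (r -` {..<T + 1})" using d_continuous by (intro open_vimage) auto
 then show "open \<Omega>" by (simp add: \<Omega>_def vimage_def)
 have cl: "closed {p. r p \<le> T + 1}" by (rule compact_imp_closed[OF closed_ball_compact])
 have "closure \<Omega> \<subseteq> {p. r p \<le> T + 1}" by (rule closure_minimal[OF _ cl]) (auto simp: \<Omega>_def)
 then show "compact (closure \<Omega>)"
  using compact_Int_closed[OF closed_ball_compact[of x0 "T + 1"] closed_closure[of \<Omega>]] by (simp add: Int_absorb1)
qed

lemma gUU_borel [measurable]: "(\<lambda>p. g p (U p) (U p)) \<in> Borel"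
 by (rule g_borel[OF U_tangent gradient_borel[OF u] U_tangent gradient_borel[OF u]])

lemma H_integrable: "integrable vol H"
proof -
 have "emeasure vol \<Omega> \<le> emeasure vol (closure \<Omega>)" by (rule emeasure_mono[OF closure_subset]) (simp add: sets_vol)
 then have "emeasure vol \<Omega> < \<infinity>" using vol_compact_finite[OF \<Omega>(2)] by (rule le_less_trans)
 then have 1: "integrable vol (\<lambda>p. indicator \<Omega> p :: real)"
  using \<Omega>(1) by (intro integrable_real_indicator) (simp_all add: sets_vol)
 have "integrable vol (\<lambda>p. indicator \<Omega> p + indicator \<Omega> p *R (u p)\<^sup>2 + indicator \<Omega> p *R g p (U p) (U p))"
  using gradient_energy[OF u \<Omega>] 1 unfolding set_integrable_def by (intro Bochner_Integration.integrable_add)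
 moreover have "(\<lambda>p. indicator \<Omega> p + indicator \<Omega> p *R (u p)\<^sup>2 + indicator \<Omega> p *R g p (U p) (U p)) = H"
  by (auto simp: H_def fun_eq_iff algebra_simps)
 ultimately show ?thesis by simp
qed

lemma H_bound_integrable:
 assumes F: "F \<in> Borel" and le: "!!p. p \<in> \<Omega> ==> \<bar>F p\<bar> \<le> M * (1 + (u p)\<^sup>2 + g p (U p) (U p))"
  and z: "!!p. p \<notin> \<Omega> ==> F p = 0"
 shows "integrable vol F"
proof (rule Bochner_Integration.integrable_bound[OF integrable_mult_right[OF H_integrable, of M]])
 show "F \<in> borel_measurable vol" using F by (simp add: borel_vol)
 show "AE p in vol. norm (F p) \<le> norm (M * H p)"
 proof (rule AE_I2)
  fix p
  show "norm (F p) \<le> norm (M * H p)"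
   using le[of p] z[of p] by (cases "p \<in> \<Omega>") (simp_all add: H_def)
 qed
qed

lemma outside_\<Omega>: "p \<notin> \<Omega> ==> \<gamma> (r p) = 0" "p \<notin> \<Omega> ==> \<gamma>' (r p) = 0"
 using \<gamma>_0 by (auto simp: \<Omega>_def)

lemma coefficient_le: "\<bar>f' (u p) * \<gamma> (r p)\<bar> \<le> C\<^sup>2" "\<bar>f (u p) * \<gamma>' (r p)\<bar> \<le> C\<^sup>2" "\<bar>f (u p) * \<gamma> (r p)\<bar> \<le> C\<^sup>2"
 unfolding abs_mult power2_eq_square using f_le \<gamma>_le C_nonneg by (auto intro!: mult_mono)

lemma g_U_nonneg: "g p (U p) (U p) \<ge> 0" by (rule g_nonneg[OF U_tangent])

lemma X_energy_integrable: "integrable vol (\<lambda>p. g p (X p) (X p))"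
proof (rule H_bound_integrable[of _ "2 * C ^ 4"])
 show "(\<lambda>p. g p (X p) (X p)) \<in> Borel" by  (rule g_borel[OF X_tangent X_borel X_tangent X_borel])
 show "g p (X p) (X p) = 0" if "p \<notin> \<Omega>" for p
  using outside_\<Omega>[OF that] g_X[OF X_tangent[of p]] by simp
 fix p
 have sq: "(f' (u p) * \<gamma> (r p))\<^sup>2 \<le> C ^ 4" "(f (u p) * \<gamma>' (r p))\<^sup>2 \<le> C ^ 4"
  using power_mono[OF coefficient_le(1)[of p], of 2] power_mono[OF coefficient_le(2)[of p], of 2] by (simp_all flip: power_mult)
 have "g p (X p) (X p) \<le> 2 * ((f' (u p) * \<gamma> (r p))\<^sup>2 * g p (U p) (U p) + (f (u p) * \<gamma>' (r p))\<^sup>2 * g p (R p) (R p))"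
  unfolding X_def by (rule g_comb_self_le[OF U_tangent R_tangent])
 also have "\<dots> \<le> 2 * (C ^ 4 * g p (U p) (U p) + C ^ 4 * 1)"
  by (intro mult_left_mono add_mono mult_mono sq g_U_nonneg R_le g_nonneg[OF R_tangent]) simp_all
 also have "\<dots> \<le> 2 * C ^ 4 * (1 + (u p)\<^sup>2 + g p (U p) (U p))"
  using mult_left_mono[of "g p (U p) (U p) + 1" "1 + (u p)\<^sup>2 + g p (U p) (U p)" "2 * C ^ 4"] by (simp add: algebra_simps)
 finally show "\<bar>g p (X p) (X p)\<bar> \<le> 2 * C ^ 4 * (1 + (u p)\<^sup>2 + g p (U p) (U p))"
  using g_nonneg[OF X_tangent[of p]] by simp
qed

lemma UX_integrable: "integrable vol (\<lambda>p. g p (U p) (X p))"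
proof (rule H_bound_integrable[of _ "2 * C\<^sup>2"])
 show "(\<lambda>p. g p (U p) (X p)) \<in> Borel" by (rule g_borel[OF U_tangent gradient_borel[OF u] X_tangent X_borel])
 have e: "g p (U p) (X p) = (f' (u p) * \<gamma> (r p)) * g p (U p) (U p) + (f (u p) * \<gamma>' (r p)) * g p (U p) (R p)" for p
  using g_X[OF U_tangent[of p]] g_sym[OF U_tangent X_tangent, of p] g_sym[OF U_tangent R_tangent, of p] by simp
 show "g p (U p) (X p) = 0" if "p \<notin> \<Omega>" for p using outside_\<Omega>[OF that] e by simp
 fix p
 have "(g p (U p) (R p))\<^sup>2 \<le> g p (U p) (U p)"
  using g_Cauchy_Schwarz[OF U_tangent R_tangent, of p] mult_left_mono[OF R_le[of p] g_U_nonneg[of p]] by simp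
 moreover have "0 \<le> (\<bar>g p (U p) (R p)\<bar> - 1)\<^sup>2" by simp
 then have "2 * \<bar>g p (U p) (R p)\<bar> \<le> 1 + (g p (U p) (R p))\<^sup>2" by (simp add: power2_diff)
 ultimately have UR: "\<bar>g p (U p) (R p)\<bar> \<le> 1 + g p (U p) (U p)" by linarith
 have "\<bar>g p (U p) (X p)\<bar> \<le> \<bar>f' (u p) * \<gamma> (r p)\<bar> * g p (U p) (U p) + \<bar>f (u p) * \<gamma>' (r p)\<bar> * \<bar>g p (U p) (R p)\<bar>"
  unfolding e using g_U_nonneg[of p] abs_triangle_ineq[of "(f' (u p) * \<gamma> (r p)) * g p (U p) (U p)" "(f (u p) * \<gamma>' (r p)) * g p (U p) (R p)"]
  by (simp add: abs_mult)
 also have "\<dots> \<le> C\<^sup>2 * g p (U p) (U p) + C\<^sup>2 * (1 + g p (U p) (U p))"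
  by (intro add_mono mult_mono coefficient_le g_U_nonneg UR) simp_all
 also have "\<dots> \<le> 2 * C\<^sup>2 * (1 + (u p)\<^sup>2 + g p (U p) (U p))"
  using mult_left_mono[of "2 * g p (U p) (U p) + 1" "2 * (1 + (u p)\<^sup>2 + g p (U p) (U p))" "C\<^sup>2"] by (simp add: algebra_simps)
 finally show "\<bar>g p (U p) (X p)\<bar> \<le> 2 * C\<^sup>2 * (1 + (u p)\<^sup>2 + g p (U p) (U p))" .
qed

lemma \<phi>_borel [measurable]: "\<phi> \<in> Borel" unfolding \<phi>_def[abs_def] by measurable

lemma \<phi>_integrable: "integrable vol (\<lambda>p. (\<phi> p)\<^sup>2)"
proof (rule H_bound_integrable[of _ "C ^ 4"])
 show "(\<phi> p)\<^sup>2 = 0" if "p \<notin> \<Omega>" for p using outside_\<Omega>[OF that] by (simp add: \<phi>_def)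
 fix p
 have "(\<phi> p)\<^sup>2 \<le> C ^ 4 * 1" using power_mono[OF coefficient_le(3)[of p], of 2] by (simp add: \<phi>_def flip: power_mult)
 also have "\<dots> \<le> C ^ 4 * (1 + (u p)\<^sup>2 + g p (U p) (U p))" using g_U_nonneg[of p] by (intro mult_left_mono) simp_all
 finally show "\<bar>(\<phi> p)\<^sup>2\<bar> \<le> C ^ 4 * (1 + (u p)\<^sup>2 + g p (U p) (U p))" by simp
qed (rule borel_measurable_power[OF \<phi>_borel])

lemma \<phi>_W12_loc: "\<phi> \<in> W12_loc A g"
 unfolding W12_loc_def
proof (intro CollectI allI impI)
 fix \<Omega>' :: "'a set" assume o: "open \<Omega>' \<and> compact (closure \<Omega>')"
 have s: "\<Omega>' \<in> sets vol" using o by (simp add: sets_vol)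
 have i: "set_integrable vol \<Omega>' F" if "integrable vol F" for F :: "'a => real"
  unfolding set_integrable_def by (rule integrable_mult_indicator[OF s that])
 have w: "is_weak_gradient A g \<Omega>' \<phi> X" using o by (intro weak_gradient_mono[OF weak_gradient_\<phi>]) auto
 have m: "set_borel_measurable borel \<Omega>' \<phi>" unfolding set_borel_measurable_def
  using o by (intro borel_measurable_scaleR[OF borel_measurable_indicator \<phi>_borel]) simp
 show "\<phi> \<in> W12 A g \<Omega>'"
  unfolding W12_def by (intro CollectI conjI m i \<phi>_integrable exI[of _ X] w X_energy_integrable)
qed

lemma gradient_\<phi>: "AE p in vol. gradient A g \<phi> p = X p"
 using weak_gradient_unique[OF open_UNIV W12_loc_gradient[OF \<phi>_W12_loc] weak_gradient_\<phi>] by simp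

lemma \<phi>_D_plus: "\<phi> \<in> D_plus A g {x. u x > 0}"
 unfolding D_plus_def W12_c_def
proof (intro CollectI conjI \<phi>_W12_loc exI[of _ "{p. r p \<le> T}"])
 show "compact {p. r p \<le> T}" by (rule closed_ball_compact)
 show "AE p in vol. p \<notin> {p. r p \<le> T} --> \<phi> p = 0" using \<gamma>_0 by (intro AE_I2) (simp add: \<phi>_def)
 show "AE p in vol. \<phi> p \<ge> 0" using f_nonneg \<gamma>_nonneg by (intro AE_I2) (simp add: \<phi>_def)
 \<comment> \<open>Where u \<le> 0 both coefficients of X vanish, as f and f' do, and the chosen
   gradient of \<phi> equals X almost everywhere.\<close>
 show "AE p in vol. p \<notin> {x. u x > 0} --> \<phi> p = 0 \<and> gradient A g \<phi> p = (\<lambda>_. 0)"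
  using gradient_\<phi> by eventually_elim (simp add: \<phi>_def X_def f_0)
qed

text \<open>The weak inequality involves the chosen gradient of \<phi>, which is exchanged for X
  almost everywhere. V is bounded on the compact closure of \<Omega>, which makes the left-hand
  integrand integrable.\<close>

lemma energy_inequality:
 assumes sub: "weakly_subsolution_on A g V {x. u x > 0} u" and V: "continuous_on UNIV V"
 shows "(LINT p|vol. V p * u p * \<phi> p) \<le> - (LINT p|vol. g p (U p) (X p))" "integrable vol (\<lambda>p. V p * u p * \<phi> p)"
proof -
 have eq: "(LINT p|vol. g p (U p) (gradient A g \<phi> p)) = (LINT p|vol. g p (U p) (X p))"
 proof (rule integral_cong_AE)
  show "(\<lambda>p. g p (U p) (gradient A g \<phi> p)) \<in> borel_measurable vol"
   unfolding borel_vol by (rule g_borel[OF U_tangent gradient_borel[OF u] gradient_tangent[OF \<phi>_W12_loc] gradient_borel[OF \<phi>_W12_loc]])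
  show "(\<lambda>p. g p (U p) (X p)) \<in> borel_measurable vol" by (rule borel_measurable_integrable[OF UX_integrable])
  show "AE p in vol. g p (U p) (gradient A g \<phi> p) = g p (U p) (X p)" using gradient_\<phi> by eventually_elim simp
 qed
 show "(LINT p|vol. V p * u p * \<phi> p) \<le> - (LINT p|vol. g p (U p) (X p))"
  by (rule bspec[OF sub[unfolded weakly_subsolution_on_def] \<phi>_D_plus, unfolded eq])
 have "compact (V ` closure \<Omega>)" by (rule compact_continuous_image[OF continuous_on_subset[OF V subset_UNIV] \<Omega>(2)])
 from compact_imp_bounded[OF this] obtain B where B: "\<forall>y\<in>V ` closure \<Omega>. norm y \<le> B" unfolding bounded_iff ..
 show "integrable vol (\<lambda>p. V p * u p * \<phi> p)"
 proof (rule H_bound_integrable[of _ "B * C\<^sup>2"])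
  show "V p * u p * \<phi> p = 0" if "p \<notin> \<Omega>" for p using outside_\<Omega>[OF that] by (simp add: \<phi>_def)
  fix p assume p: "p \<in> \<Omega>"
  have "norm (V p) \<le> B" by (rule bspec[OF B imageI[OF subsetD[OF closure_subset p]]])
  then have Bp: "\<bar>V p\<bar> \<le> B" by simp
  have "0 \<le> (\<bar>u p\<bar> - 1)\<^sup>2" by simp
  then have "2 * \<bar>u p\<bar> \<le> 1 + (u p)\<^sup>2" by (simp add: power2_diff)
  then have up: "\<bar>u p\<bar> \<le> 1 + (u p)\<^sup>2 + g p (U p) (U p)" using g_U_nonneg[of p] by linarith
  have "\<bar>V p * u p * \<phi> p\<bar> = \<bar>V p\<bar> * \<bar>u p\<bar> * \<bar>\<phi> p\<bar>" by (simp add: abs_mult)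
  also have "\<dots> \<le> B * (1 + (u p)\<^sup>2 + g p (U p) (U p)) * C\<^sup>2"
   using Bp up coefficient_le(3)[of p] unfolding \<phi>_def by (intro mult_mono) auto
  finally show "\<bar>V p * u p * \<phi> p\<bar> \<le> B * C\<^sup>2 * (1 + (u p)\<^sup>2 + g p (U p) (U p))" by (simp add: mult_ac)
 qed (rule borel_measurable_times[OF borel_measurable_times[OF _ u_borel] \<phi>_borel], rule borel_measurable_continuous_onI[OF V])
qed

text \<open>Put a = f'(u) and m = g(U, R). Multiplied by a, the quantity g(U, X) + s \<eta>'^2
  dominates the square of a \<eta> m + f(u) \<eta>', because m^2 \<le> |U|^2 and f(u)^2 \<le> a s.
  If a = 0, then f(u) = 0 as well.\<close>

lemma minus_UX_le:
 assumes \<eta>: "\<gamma> (r p) = \<eta>\<^sup>2" "\<gamma>' (r p) = 2 * \<eta> * \<eta>'" and f: "f' (u p) \<ge> 0" "(f (u p))\<^sup>2 \<le> f' (u p) * s" and s: "s \<ge> 0"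
 shows "- g p (U p) (X p) \<le> s * \<eta>'\<^sup>2"
proof -
 let ?a = "f' (u p)" and ?N = "g p (U p) (U p)" and ?m = "g p (U p) (R p)" and ?f = "f (u p)"
 have e: "g p (U p) (X p) = (?a * \<eta>\<^sup>2) * ?N + (?f * (2 * \<eta> * \<eta>')) * ?m"
  using g_X[OF U_tangent[of p]] g_sym[OF U_tangent X_tangent, of p] g_sym[OF U_tangent R_tangent, of p] \<eta> by simp
 have mN: "?m\<^sup>2 \<le> ?N"
  using g_Cauchy_Schwarz[OF U_tangent R_tangent, of p] mult_left_mono[OF R_le[of p] g_U_nonneg[of p]] by simp
 show ?thesis
 proof (cases "?a = 0")
  case True
  then have "?f = 0" using f(2) by simp
  then show ?thesis using True s e by simp
 next
  case False
  then have a: "?a > 0" using f(1) by simp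
  have "0 \<le> (?a * \<eta> * ?m + ?f * \<eta>')\<^sup>2" by simp
  also have "\<dots> = (?a * \<eta>)\<^sup>2 * ?m\<^sup>2 + ?a * (?f * (2 * \<eta> * \<eta>') * ?m) + ?f\<^sup>2 * \<eta>'\<^sup>2" by (simp add: power2_eq_square algebra_simps)
  also have "\<dots> \<le> (?a * \<eta>)\<^sup>2 * ?N + ?a * (?f * (2 * \<eta> * \<eta>') * ?m) + (?a * s) * \<eta>'\<^sup>2"
   using mult_left_mono[OF mN zero_le_power2[of "?a * \<eta>"]] mult_right_mono[OF f(2) zero_le_power2[of \<eta>']] by simp
  also have "\<dots> = ?a * (g p (U p) (X p) + s * \<eta>'\<^sup>2)" unfolding e by (simp add: power2_eq_square algebra_simps)
  finally have "0 \<le> g p (U p) (X p) + s * \<eta>'\<^sup>2" using a by (simp add: zero_le_mult_iff)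
  then show ?thesis by simp
 qed
qed

end

section \<open>Truncated powers and cutoff functions\<close>

text \<open>The \<open>C\<^sup>1\<close> truncation \<open>f\<close> of \<open>t\<^sup>p\<close> is chosen such that \<open>f'/f\<^sup>2 \<ge> p t\<^sup>-\<^sup>p\<^sup>-\<^sup>1\<close>.\<close>

definition trunc_power :: "real => real => real => real" where
 "trunc_power p d t = (if t > 0 then 1 / (t powr (- p) + d + d * t powr (- 2)) else 0)"

definition trunc_power_deriv :: "real => real => real => real" where
 "trunc_power_deriv p d t =
  (if t > 0 then (p * t powr (- p - 1) + 2 * d * t powr (- 3)) * (trunc_power p d t)\<^sup>2 else 0)"

context
 fixes p d :: real
 assumes p: "p > 0" and d: "d > 0"
begin

lemma trunc_power_nonneg: "trunc_power p d t \<ge> 0"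
 using d by (simp add: trunc_power_def)

lemma trunc_power_le: "trunc_power p d t \<le> 1 / d"
 using d by (auto simp: trunc_power_def intro!: divide_left_mono mult_pos_pos add_pos_pos)

lemma trunc_power_le_powr: "t > 0 ==> trunc_power p d t \<le> t powr p"
proof -
 assume t: "t > 0"
 have "1 / (t powr (- p) + d + d * t powr (- 2)) \<le> 1 / t powr (- p)"
  using d t by (intro divide_left_mono mult_pos_pos add_pos_pos) simp_all
 then show ?thesis using t by (simp add: trunc_power_def powr_minus_divide)
qed

text \<open>The term d t^(-2) in the denominator provides this bound. It makes the truncation C^1 at
  0 also for p \<le> 1, where the positive part of t^p is not; the constant d provides the upper
  bound 1/d.\<close>

lemma trunc_power_le_square: "trunc_power p d t \<le> t\<^sup>2 / d"
proof (cases "t > 0")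
 case True
 have "1 / (t powr (- p) + d + d * t powr (- 2)) \<le> 1 / (d * t powr (- 2))"
  using d True by (intro divide_left_mono mult_pos_pos add_pos_pos) simp_all
 also have "\<dots> = t\<^sup>2 / d" using True by (simp add: powr_minus_divide)
 finally show ?thesis using True by (simp add: trunc_power_def)
qed (use d in \<open>simp add: trunc_power_def\<close>)

lemma trunc_power_deriv_nonneg: "trunc_power_deriv p d t \<ge> 0"
 using p d by (simp add: trunc_power_deriv_def)

text \<open>Each of the two terms of f'/f^2 is paired with its own bound on f^2, the first with t^p
  t^2 / d and the second with (t^2 / d)^2; each product is a multiple of t.\<close>

lemma trunc_power_deriv_le_linear: "trunc_power_deriv p d t \<le> (p + 2) / d * \<bar>t\<bar>"
proof (cases "t > 0")
 case True
 let ?f = "trunc_power p d t"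
 have "?f\<^sup>2 \<le> t powr p * (t\<^sup>2 / d)"
  unfolding power2_eq_square[of ?f] by (intro mult_mono trunc_power_le_powr[OF True] trunc_power_le_square trunc_power_nonneg) simp
 then have "(p * t powr (- p - 1)) * ?f\<^sup>2 \<le> (p * t powr (- p - 1)) * (t powr p * (t\<^sup>2 / d))" using p by (intro mult_left_mono) simp_all
 also have "\<dots> = p * (t powr (- p - 1) * t powr p * t powr 2) / d" using True by simp
 also have "t powr (- p - 1) * t powr p * t powr 2 = t" using True by (simp add: power2_eq_square flip: powr_add)
 finally have 1: "(p * t powr (- p - 1)) * ?f\<^sup>2 \<le> p * t / d" .
 have "?f\<^sup>2 \<le> (t\<^sup>2 / d) * (t\<^sup>2 / d)"
  unfolding power2_eq_square[of ?f] using d by (intro mult_mono trunc_power_le_square trunc_power_nonneg) simp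
 then have "(2 * d * t powr (- 3)) * ?f\<^sup>2 \<le> (2 * d * t powr (- 3)) * ((t\<^sup>2 / d) * (t\<^sup>2 / d))" using d by (intro mult_left_mono) simp_all
 also have "\<dots> = 2 * (t powr (- 3) * t powr 2 * t powr 2) / d" using True d by (simp add: field_simps)
 also have "t powr (- 3) * t powr 2 * t powr 2 = t powr (- 3 + 2 + 2)" by (simp only: powr_add)
 also have "\<dots> = t" using True by simp
 finally have 2: "(2 * d * t powr (- 3)) * ?f\<^sup>2 \<le> 2 * t / d" .
 show ?thesis using 1 2 True by (simp add: trunc_power_deriv_def distrib_right add_divide_distrib)
next
 case False
 have "0 \<le> (p + 2) / d * \<bar>t\<bar>" using p d by (intro mult_nonneg_nonneg) simp_all
 then show ?thesis using False by (simp only: trunc_power_deriv_def if_False)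
qed

text \<open>Near 0 the linear bound applies. For t \<ge> 1 the negative powers are at most 1 and f
  is at most 1/d.\<close>

lemma trunc_power_deriv_le: "trunc_power_deriv p d t \<le> (p + 2) / d + (p + 2 * d) / d\<^sup>2"
proof (cases "\<bar>t\<bar> \<le> 1")
 case True
 have "trunc_power_deriv p d t \<le> (p + 2) / d * 1"
  using trunc_power_deriv_le_linear[of t] mult_left_mono[OF True, of "(p + 2) / d"] p d by simp
 moreover have "(p + 2 * d) / d\<^sup>2 \<ge> 0" using p d by simp
 ultimately show ?thesis by linarith
next
 case False
 have b: "(p + 2) / d \<ge> 0" "(p + 2 * d) / d\<^sup>2 \<ge> 0" using p d by simp_all
 show ?thesis
 proof (cases "t > 0")
  case True
  then have t: "t \<ge> 1" using False by simp
  have le1: "t powr a \<le> 1" if "a \<le> 0" for a using powr_mono[OF that t] t by simp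
  have "(p * t powr (- p - 1) + 2 * d * t powr (- 3)) * (trunc_power p d t)\<^sup>2 \<le> (p * 1 + 2 * d * 1) * (1 / d)\<^sup>2"
   using p d by (intro mult_mono add_mono le1 power_mono trunc_power_le trunc_power_nonneg) simp_all
  then show ?thesis using True b by (simp add: trunc_power_deriv_def power_divide)
 qed (use b in \<open>simp add: trunc_power_deriv_def\<close>)
qed

lemma trunc_power_has_derivative: "(trunc_power p d has_real_derivative trunc_power_deriv p d t) (at t)"
proof (cases t "0 :: real" rule: linorder_cases)
 case greater
 define D where "D t = t powr (- p) + d + d * t powr (- 2)" for t
 have D: "D t > 0" using d by (simp add: D_def add_nonneg_pos add_pos_nonneg)
 have "((\<lambda>t. 1 / D t) has_real_derivative (p * t powr (- p - 1) + 2 * d * t powr (- 3)) * (1 / D t)\<^sup>2) (at t)"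
  using D greater unfolding D_def
  by (auto intro!: derivative_eq_intros simp: power2_eq_square divide_simps)
 then have "((\<lambda>t. 1 / D t) has_real_derivative trunc_power_deriv p d t) (at t)"
  using greater by (simp add: trunc_power_deriv_def trunc_power_def D_def)
 then show ?thesis
  by (rule has_field_derivative_transform_within_open[where S = "{0<..}"]) (use greater in \<open>auto simp: trunc_power_def D_def\<close>)
next
 case less
 have "((\<lambda>_. 0 :: real) has_real_derivative trunc_power_deriv p d t) (at t)" using less by (simp add: trunc_power_deriv_def)
 then show ?thesis
  by (rule has_field_derivative_transform_within_open[where S = "{..<0}"]) (use less in \<open>auto simp: trunc_power_def\<close>)
next
 case equal
 have "((\<lambda>h. trunc_power p d h / h) \<longlongrightarrow> 0) (at 0)"
 proof (rule Lim_null_comparison)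
  show "\<forall>\<^sub>F h in at 0. norm (trunc_power p d h / h) \<le> \<bar>h\<bar> / d"
  proof (rule always_eventually, rule allI)
   fix h
   have "\<bar>trunc_power p d h\<bar> \<le> h\<^sup>2 / d" using trunc_power_le_square[of h] trunc_power_nonneg[of h] by simp
   then have "\<bar>trunc_power p d h\<bar> / \<bar>h\<bar> \<le> (h\<^sup>2 / d) / \<bar>h\<bar>" by (rule divide_right_mono) simp
   also have "h\<^sup>2 / d / \<bar>h\<bar> = \<bar>h\<bar> / d" by (cases "h = 0") (simp_all add: power2_eq_square abs_if)
   finally show "norm (trunc_power p d h / h) \<le> \<bar>h\<bar> / d" by simp
  qed
  have "((\<lambda>h. \<bar>h\<bar> / d) \<longlongrightarrow> \<bar>0\<bar> / d) (at 0)" using d by (intro tendsto_intros) simp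
  then show "((\<lambda>h. \<bar>h\<bar> / d) \<longlongrightarrow> 0) (at 0)" by simp
 qed
 then show ?thesis using equal unfolding has_field_derivative_iff by (simp add: trunc_power_def trunc_power_deriv_def)
qed

lemma trunc_power_deriv_continuous: "continuous_on UNIV (trunc_power_deriv p d)"
 unfolding continuous_on_eq_continuous_at[OF open_UNIV]
proof
 fix t :: real
 show "isCont (trunc_power_deriv p d) t"
 proof (cases t "0 :: real" rule: linorder_cases)
  case greater
  have "isCont (\<lambda>t. (p * t powr (- p - 1) + 2 * d * t powr (- 3)) * (trunc_power p d t)\<^sup>2) t"
   using greater DERIV_isCont[OF trunc_power_has_derivative, of t] by (intro continuous_intros) simp_all
  moreover have "\<forall>\<^sub>F s in nhds t. (p * s powr (- p - 1) + 2 * d * s powr (- 3)) * (trunc_power p d s)\<^sup>2 = trunc_power_deriv p d s"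
   by (rule eventually_nhds_in_open[of "{0<..}", THEN eventually_mono]) (use greater in \<open>auto simp: trunc_power_deriv_def\<close>)
  ultimately show ?thesis by (rule isCont_cong[THEN iffD1, rotated])
 next
  case less
  have "\<forall>\<^sub>F s in nhds t. 0 = trunc_power_deriv p d s"
   by (rule eventually_nhds_in_open[of "{..<0}", THEN eventually_mono]) (use less in \<open>auto simp: trunc_power_deriv_def\<close>)
  moreover have "isCont (\<lambda>_. 0 :: real) t" by simp
  ultimately show ?thesis by (rule isCont_cong[THEN iffD1])
 next
  case equal
  have "(trunc_power_deriv p d \<longlongrightarrow> 0) (at 0)"
  proof (rule Lim_null_comparison)
   show "\<forall>\<^sub>F t in at 0. norm (trunc_power_deriv p d t) \<le> (p + 2) / d * \<bar>t\<bar>"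
    using trunc_power_deriv_le_linear trunc_power_deriv_nonneg by (intro always_eventually) simp
   have "((\<lambda>t. (p + 2) / d * \<bar>t\<bar>) \<longlongrightarrow> (p + 2) / d * \<bar>0\<bar>) (at 0)" by (intro tendsto_intros)
   then show "((\<lambda>t. (p + 2) / d * \<bar>t\<bar>) \<longlongrightarrow> 0) (at 0)" by simp
  qed
  then show ?thesis using equal by (simp add: isCont_def trunc_power_deriv_def)
 qed
qed

text \<open>Differentiating 1/f gives f'/f^2 = p t^(-p-1) + 2 d t^(-3) for t > 0, and the correction
  has the favourable sign. This is the inequality that completing the square requires.\<close>

lemma trunc_power_square_le: "(trunc_power p d t)\<^sup>2 \<le> trunc_power_deriv p d t * (max t 0 powr (p + 1) / p)"
proof (cases "t > 0")
 case True
 let ?F = "(trunc_power p d t)\<^sup>2"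
 have "t powr (- p - 1) * t powr (p + 1) = 1" using True by (simp flip: powr_add)
 then have "?F = p * t powr (- p - 1) * ?F * (t powr (p + 1) / p)" using p by simp
 also have "\<dots> \<le> trunc_power_deriv p d t * (t powr (p + 1) / p)"
  using True p d by (intro mult_right_mono) (simp_all add: trunc_power_deriv_def mult_right_mono)
 finally show ?thesis using True by simp
qed (simp add: trunc_power_def)

end

lemma trunc_power_tendsto:
 assumes p: "p > 0"
 shows "(\<lambda>n. t * trunc_power p (inverse (real (Suc n))) t) ----> max t 0 powr (p + 1)"
proof (cases "t > 0")
 case True
 have "(\<lambda>n. t * (1 / (t powr (- p) + inverse (real (Suc n)) + inverse (real (Suc n)) * t powr (- 2))))
   ----> t * (1 / (t powr (- p) + 0 + 0 * t powr (- 2)))"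
  using True by (intro tendsto_intros LIMSEQ_inverse_real_of_nat) simp
 also have "t * (1 / (t powr (- p) + 0 + 0 * t powr (- 2))) = max t 0 powr (p + 1)"
  using True by (simp add: powr_minus_divide powr_add)
 finally show ?thesis using True by (simp add: trunc_power_def)
qed (simp add: trunc_power_def)

text \<open>Equal to 1 for t \<le> 0 and to 0 for t \<ge> 1, and (1 - t^2)^2 in between. The squares
  make it C^1 at both junctions.\<close>

definition cutoff :: "real => real" where
 "cutoff t = (max 0 (1 - (max 0 t)\<^sup>2))\<^sup>2"

definition cutoff_deriv :: "real => real" where
 "cutoff_deriv t = - 4 * max 0 (1 - (max 0 t)\<^sup>2) * max 0 t"

lemma max_square_has_derivative: "((\<lambda>x. (max 0 x)\<^sup>2) has_real_derivative 2 * max 0 x) (at x)" for x :: real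
proof (cases x "0 :: real" rule: linorder_cases)
 case greater
 have "((\<lambda>x. x\<^sup>2) has_real_derivative 2 * max 0 x) (at x)" using greater by (auto intro!: derivative_eq_intros)
 then show ?thesis
  by (rule has_field_derivative_transform_within_open[where S = "{0<..}"]) (use greater in \<open>auto simp: max_def\<close>)
next
 case less
 have "((\<lambda>_. 0 :: real) has_real_derivative 2 * max 0 x) (at x)" using less by simp
 then show ?thesis
  by (rule has_field_derivative_transform_within_open[where S = "{..<0}"]) (use less in \<open>auto simp: max_def\<close>)
next
 case equal
 have "((\<lambda>h :: real. (max 0 h)\<^sup>2 / h) \<longlongrightarrow> 0) (at 0)"
 proof (rule Lim_null_comparison)
  show "\<forall>\<^sub>F h :: real in at 0. norm ((max 0 h)\<^sup>2 / h) \<le> \<bar>h\<bar>"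
   by (intro always_eventually allI) (auto simp: max_def power2_eq_square)
  show "((\<lambda>h :: real. \<bar>h\<bar>) \<longlongrightarrow> 0) (at 0)" using tendsto_rabs[OF tendsto_ident_at, of "0 :: real" UNIV] by simp
 qed
 then show ?thesis using equal unfolding has_field_derivative_iff by simp
qed

lemma cutoff_has_derivative: "(cutoff has_real_derivative cutoff_deriv t) (at t)"
proof -
 have "((\<lambda>t. 1 - (max 0 t)\<^sup>2) has_real_derivative - (2 * max 0 t)) (at t)"
  using DERIV_diff[OF DERIV_const max_square_has_derivative, of 1 t] by simp
 from DERIV_chain2[OF max_square_has_derivative this] show ?thesis
  unfolding cutoff_def[abs_def] cutoff_deriv_def by (simp add: mult.assoc)
qed

lemma cutoff_deriv_continuous: "continuous_on UNIV cutoff_deriv"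
 unfolding cutoff_deriv_def[abs_def] by (intro continuous_intros)

lemma cutoff_bounds: "0 \<le> cutoff t" "cutoff t \<le> 1" "\<bar>cutoff_deriv t\<bar> \<le> 4"
proof -
 let ?m = "max 0 (1 - (max 0 t)\<^sup>2)"
 have m: "0 \<le> ?m" "?m \<le> 1" by simp_all
 show "0 \<le> cutoff t" by (simp add: cutoff_def)
 show "cutoff t \<le> 1" unfolding cutoff_def using m by (rule power_le_one)
 show "\<bar>cutoff_deriv t\<bar> \<le> 4"
 proof (cases "max 0 t \<le> 1")
  case True
  have "?m * max 0 t \<le> 1 * 1" using m True by (intro mult_mono) simp_all
  then show ?thesis by (simp add: cutoff_deriv_def abs_mult)
 next
  case False
  then have "1\<^sup>2 \<le> (max 0 t)\<^sup>2" by (intro power_mono) simp_all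
  then show ?thesis by (simp add: cutoff_deriv_def)
 qed
qed

lemma cutoff_eq_1: "t \<le> 0 ==> cutoff t = 1" "t \<le> 0 ==> cutoff_deriv t = 0"
 by (simp_all add: cutoff_def cutoff_deriv_def)

lemma cutoff_eq_0: "t \<ge> 1 ==> cutoff t = 0" "t \<ge> 1 ==> cutoff_deriv t = 0"
proof -
 assume "t \<ge> 1"
 then have "1\<^sup>2 \<le> (max 0 t)\<^sup>2" by (intro power_mono) simp_all
 then have "max 0 (1 - (max 0 t)\<^sup>2) = 0" by simp
 then show "cutoff t = 0" "cutoff_deriv t = 0" by (simp_all add: cutoff_def cutoff_deriv_def)
qed

text \<open>A smooth substitute for |t| with values at least 1. It is defined on all of the real
  line, as test profiles are, and keeps powers and logarithms away from their singularity at
  0.\<close>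

definition smooth_abs :: "real => real" where "smooth_abs t = sqrt (1 + t\<^sup>2)"

lemma smooth_abs: "smooth_abs t \<ge> 1" "smooth_abs t \<ge> t" "0 \<le> s ==> s \<le> t ==> smooth_abs s \<le> smooth_abs t"
 "(smooth_abs has_real_derivative t / smooth_abs t) (at t)" "\<bar>t / smooth_abs t\<bar> \<le> 1" "continuous_on S smooth_abs"
proof -
 show "smooth_abs t \<ge> 1" by (simp add: smooth_abs_def)
 have "\<bar>t\<bar> = sqrt (t\<^sup>2)" by simp
 also have "\<dots> \<le> smooth_abs t" unfolding smooth_abs_def by (intro real_sqrt_le_mono) simp
 finally have a: "\<bar>t\<bar> \<le> smooth_abs t" .
 then show "smooth_abs t \<ge> t" by simp
 show "\<bar>t / smooth_abs t\<bar> \<le> 1" using a \<open>smooth_abs t \<ge> 1\<close> by simp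
 show "smooth_abs s \<le> smooth_abs t" if "0 \<le> s" "s \<le> t" for s t
  unfolding smooth_abs_def using that by (intro real_sqrt_le_mono add_left_mono power_mono)
 have "1 + t\<^sup>2 > 0" using zero_le_power2[of t] by linarith
 then show "(smooth_abs has_real_derivative t / smooth_abs t) (at t)"
  unfolding smooth_abs_def[abs_def] by (auto intro!: derivative_eq_intros simp: field_simps)
 show "continuous_on S smooth_abs" unfolding smooth_abs_def[abs_def] by (intro continuous_intros)
qed

lemma ext_ln_ge:
 assumes "y > 0" "ennreal y \<le> x"
 shows "ereal (ln y) \<le> ext_ln x"
proof (cases "x = \<infinity>")
 case False
 then have x: "x = ennreal (enn2real x)" by (simp add: less_top)
 then have "y \<le> enn2real x" using assms by (metis enn2real_nonneg ennreal_le_iff)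
 moreover have "x \<noteq> 0" using assms by auto
 ultimately show ?thesis using assms False by (simp add: ext_ln_def)
qed (simp add: ext_ln_def)

text \<open>An explicit positive minorant h with known logarithmic growth replaces the integral,
  which may itself be infinite.\<close>

lemma Liminf_ext_ln_ge:
 fixes I :: "real => ennreal"
 assumes I: "\<forall>\<^sub>F R in at_top. h R > 0 \<and> ennreal (h R) \<le> I R" and a: "\<forall>\<^sub>F R in at_top. a R \<ge> 0"
  and lim: "((\<lambda>R. a R * ln (h R)) \<longlongrightarrow> L) at_top"
 shows "ereal L \<le> Liminf at_top (\<lambda>R. ereal (a R) * ext_ln (I R))"
proof -
 have "((\<lambda>R. ereal (a R * ln (h R))) \<longlongrightarrow> ereal L) at_top" using lim by simp
 then have "ereal L = Liminf at_top (\<lambda>R. ereal (a R * ln (h R)))" by (intro lim_imp_Liminf[symmetric]) simp_all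
 also have "\<dots> \<le> Liminf at_top (\<lambda>R. ereal (a R) * ext_ln (I R))"
 proof (rule Liminf_mono)
  show "\<forall>\<^sub>F R in at_top. ereal (a R * ln (h R)) \<le> ereal (a R) * ext_ln (I R)"
   using I a
  proof eventually_elim
   case (elim R)
   have "ereal (a R) * ereal (ln (h R)) \<le> ereal (a R) * ext_ln (I R)"
    using elim ext_ln_ge by (intro ereal_mult_left_mono) auto
   then show ?case by simp
  qed
 qed
 finally show ?thesis .
qed

text \<open>Lets b tend to the threshold b0, which the growth estimates do not reach. Both rates
  have this form, with k = 2 / (1 - \<mu>/2) and c = 0 for \<mu> < 2, and k = c = 2 for \<mu> =
  2.\<close>

lemma ereal_le_by_scaling:
 fixes x :: ereal
 assumes "!!b. 0 < b ==> b < b0 ==> ereal (k * b + c) \<le> x" "b0 > 0"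
 shows "ereal (k * b0 + c) \<le> x"
proof (rule LIMSEQ_le_const2)
 \<comment> \<open>The halving keeps the approximants positive from n = 0 on.\<close>
 show "(\<lambda>n. ereal (k * (b0 * (1 - inverse (real (Suc n)) / 2)) + c)) ----> ereal (k * b0 + c)"
 proof -
  have "(\<lambda>n. k * (b0 * (1 - inverse (real (Suc n)) / 2)) + c) ----> k * (b0 * (1 - 0 / 2)) + c"
   by (intro tendsto_intros LIMSEQ_inverse_real_of_nat) simp
  then show ?thesis by simp
 qed
 show "\<exists>N. \<forall>n\<ge>N. ereal (k * (b0 * (1 - inverse (real (Suc n)) / 2)) + c) \<le> x"
 proof (intro exI allI impI assms(1))
  fix n
  have "0 < inverse (real (Suc n))" "inverse (real (Suc n)) \<le> 1" by (simp_all add: inverse_le_1_iff)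
  then have *: "0 < 1 - inverse (real (Suc n)) / 2" "1 - inverse (real (Suc n)) / 2 < 1" by linarith+
  show "0 < b0 * (1 - inverse (real (Suc n)) / 2)" using * assms(2) by simp
  show "b0 * (1 - inverse (real (Suc n)) / 2) < b0" using mult_strict_left_mono[OF *(2) assms(2)] by simp
 qed
qed

section \<open>The weighted inequality and growth\<close>

context complete_manifold
begin

context
 fixes x0 :: 'a and u V :: "'a => real" and q :: real
 assumes u: "u \<in> W12_loc A g" and sub: "weakly_subsolution_on A g V {x. u x > 0} u"
  and V: "continuous_on UNIV V" "!!x. V x > 0" and q: "q > 1"
begin

text \<open>Test with \<open>f(u) \<eta>(r)\<^sup>2\<close>, where \<open>f\<close> is a truncation of \<open>t\<^sup>q\<^sup>-\<^sup>1\<close>: completing the square removes \<open>\<nabla>u\<close>, and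
 Fatou's lemma removes the truncation.\<close>

lemma weighted_inequality:
 assumes \<eta>: "!!t. (\<eta> has_real_derivative \<eta>' t) (at t)" "continuous_on UNIV \<eta>'"
  and le: "!!t. \<bar>\<eta> t\<bar> \<le> B" "!!t. \<bar>\<eta>' t\<bar> \<le> B" and z: "!!t. t \<ge> T ==> \<eta> t = 0" "!!t. t \<ge> T ==> \<eta>' t = 0"
 shows "(\<integral>\<^sup>+p. ennreal ((q - 1) * V p * max (u p) 0 powr q * (\<eta> (d x0 p))\<^sup>2) \<partial>vol)
  \<le> (\<integral>\<^sup>+p. ennreal (max (u p) 0 powr q * (\<eta>' (d x0 p))\<^sup>2) \<partial>vol)"
proof -
 define P where "P = q - 1"
 have P: "P > 0" using q by (simp add: P_def)
 \<comment> \<open>The quantity s for which \<open>trunc_power_square_le\<close> reads f^2 \<le> f'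
   s.\<close>
 define s where "s p = max (u p) 0 powr q / P" for p
 define F where "F n p = V p * u p * (trunc_power P (inverse (real (Suc n))) (u p) * (\<eta> (d x0 p))\<^sup>2)" for n p
 have \<eta>c: "continuous_on UNIV \<eta>" by (rule DERIV_continuous_on) (rule \<eta>(1))
 have bm: "u \<in> Borel" "\<eta> \<in> Borel" "\<eta>' \<in> Borel" "d x0 \<in> Borel" "V \<in> Borel"
  by (rule W12_loc_borel[OF u], (rule borel_measurable_continuous_onI, rule \<eta>c \<eta>(2) d_continuous V(1))+)
 have s\<eta>_borel: "(\<lambda>p. s p * (\<eta>' (d x0 p))\<^sup>2) \<in> Borel"
  unfolding s_def using bm by measurable
 have s0: "s p \<ge> 0" for p using P by (simp add: s_def)
 have F_borel: "F n \<in> Borel" for n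
 proof -
  have "trunc_power P (inverse (real (Suc n))) \<in> Borel"
   by (rule borel_measurable_continuous_onI, rule DERIV_continuous_on, rule trunc_power_has_derivative[OF P]) simp
  then show ?thesis unfolding F_def[abs_def] using bm by measurable
 qed
 obtain R where R: "!!p. R p \<in> tangent_space A p" "coords_borel UNIV R" "!!p. g p (R p) (R p) \<le> 1"
  "!!c. c \<in> A ==> AE x in lborel. x \<in> snd c ` fst c --> distance_gradient_at x0 (chart_inv c x) (R (chart_inv c x))"
  by (rule distance_gradient_exists[of x0]) (rule that)
 have step: "(\<integral>\<^sup>+p. ennreal (F n p) \<partial>vol) \<le> (\<integral>\<^sup>+p. ennreal (s p * (\<eta>' (d x0 p))\<^sup>2) \<partial>vol)" for n
 \<comment> \<open>u_+^q need not be locally integrable for q > 2. An infinite right-hand side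
   leaves nothing to show; otherwise both sides are ordinary integrals.\<close>
 proof (cases "(\<integral>\<^sup>+p. ennreal (s p * (\<eta>' (d x0 p))\<^sup>2) \<partial>vol) = \<infinity>")
  case False
  define \<delta> where "\<delta> = inverse (real (Suc n))"
  have \<delta>: "\<delta> > 0" by (simp add: \<delta>_def)
  \<comment> \<open>The sum of the separate bounds; all summands are nonnegative, so each bound lies
    below C.\<close>
  define C where "C = 1 / \<delta> + ((P + 2) / \<delta> + (P + 2 * \<delta>) / \<delta>\<^sup>2) + 2 * B\<^sup>2"
  have C: "1 / \<delta> \<le> C" "(P + 2) / \<delta> + (P + 2 * \<delta>) / \<delta>\<^sup>2 \<le> C" "B\<^sup>2 \<le> C" "2 * B\<^sup>2 \<le> C"
  proof -
   have "0 \<le> 1 / \<delta>" "0 \<le> (P + 2) / \<delta>" "0 \<le> (P + 2 * \<delta>) / \<delta>\<^sup>2" "0 \<le> B\<^sup>2" using P \<delta> by simp_all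
   then show "1 / \<delta> \<le> C" "(P + 2) / \<delta> + (P + 2 * \<delta>) / \<delta>\<^sup>2 \<le> C" "B\<^sup>2 \<le> C" "2 * B\<^sup>2 \<le> C" unfolding C_def by linarith+
  qed
  have \<eta>2: "\<bar>(\<eta> t)\<^sup>2\<bar> \<le> B\<^sup>2" "\<bar>2 * \<eta> t * \<eta>' t\<bar> \<le> 2 * B\<^sup>2" for t
   using power_mono[OF le(1)[of t], of 2] mult_mono[OF le(1)[of t] le(2)[of t]] abs_ge_zero[of "\<eta> t"] le(1)[of t]
   by (simp_all add: abs_mult power2_eq_square)
  interpret ct: cutoff_test A g x0 u R "trunc_power P \<delta>" "trunc_power_deriv P \<delta>" "\<lambda>t. (\<eta> t)\<^sup>2" "\<lambda>t. 2 * \<eta> t * \<eta>' t" C T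
  proof
   show "\<bar>trunc_power P \<delta> t\<bar> \<le> C" "\<bar>trunc_power_deriv P \<delta> t\<bar> \<le> C" for t
    using trunc_power_le[OF P \<delta>, of t] trunc_power_nonneg[OF P \<delta>, of t] C
     trunc_power_deriv_le[OF P \<delta>, of t] trunc_power_deriv_nonneg[OF P \<delta>, of t] by linarith+
   show "\<bar>(\<eta> t)\<^sup>2\<bar> \<le> C" "\<bar>2 * \<eta> t * \<eta>' t\<bar> \<le> C" for t
    using \<eta>2[of t] C by linarith+
   show "((\<lambda>t. (\<eta> t)\<^sup>2) has_real_derivative 2 * \<eta> t * \<eta>' t) (at t)" for t
    using DERIV_power[OF \<eta>(1)[of t], of 2] by (simp add: mult_ac)
   show "continuous_on UNIV (\<lambda>t. 2 * \<eta> t * \<eta>' t)" by (intro continuous_intros \<eta>c \<eta>(2))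
  qed (use u R z trunc_power_has_derivative[OF P \<delta>] trunc_power_deriv_continuous[OF P \<delta>] trunc_power_nonneg[OF P \<delta>] in
   \<open>auto simp: trunc_power_def trunc_power_deriv_def\<close>)
  have F_eq: "F n p = V p * u p * ct.\<phi> p" for p unfolding F_def ct.\<phi>_def unfolding \<delta>_def ..
  have i1: "integrable vol (F n)" unfolding F_eq[abs_def] by (rule ct.energy_inequality(2)[OF sub V(1)])
  have i2: "integrable vol (\<lambda>p. s p * (\<eta>' (d x0 p))\<^sup>2)"
  proof (rule integrableI_nonneg)
   show "(\<lambda>p. s p * (\<eta>' (d x0 p))\<^sup>2) \<in> borel_measurable vol" unfolding borel_vol by (rule s\<eta>_borel)
   show "AE p in vol. 0 \<le> s p * (\<eta>' (d x0 p))\<^sup>2" using s0 by simp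
   show "(\<integral>\<^sup>+p. ennreal (s p * (\<eta>' (d x0 p))\<^sup>2) \<partial>vol) < \<infinity>" using False by (simp add: less_top)
  qed
  have "(LINT p|vol. F n p) \<le> - (LINT p|vol. g p (ct.U p) (ct.X p))"
   unfolding F_eq by (rule ct.energy_inequality(1)[OF sub V(1)])
  also have "\<dots> = (LINT p|vol. - g p (ct.U p) (ct.X p))" by simp
  also have "\<dots> \<le> (LINT p|vol. s p * (\<eta>' (d x0 p))\<^sup>2)"
  proof (rule integral_mono[OF integrable_minus[OF ct.UX_integrable] i2])
   fix p
   have "q = P + 1" by (simp add: P_def)
   then show "- g p (ct.U p) (ct.X p) \<le> s p * (\<eta>' (d x0 p))\<^sup>2"
    using trunc_power_square_le[OF P \<delta>, of "u p"] trunc_power_deriv_nonneg[OF P \<delta>, of "u p"] s0[of p]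
    by (intro ct.minus_UX_le[where \<eta> = "\<eta> (d x0 p)"]) (simp_all add: s_def)
  qed
  finally have le: "(LINT p|vol. F n p) \<le> (LINT p|vol. s p * (\<eta>' (d x0 p))\<^sup>2)" .
  have F0: "F n p \<ge> 0" for p
  proof (cases "u p > 0")
   case True
   then show ?thesis using V(2)[of p] trunc_power_nonneg[OF P \<delta>, of "u p"] by (simp add: F_def \<delta>_def)
  qed (simp add: F_def trunc_power_def)
  show ?thesis
   using nn_integral_eq_integral[OF i1] nn_integral_eq_integral[OF i2] F0 s0 le by (simp add: ennreal_leI)
 qed simp
 have lim: "(\<lambda>n. F n p) ----> V p * max (u p) 0 powr q * (\<eta> (d x0 p))\<^sup>2" for p
 proof -
  have "(\<lambda>n. V p * (u p * trunc_power P (inverse (real (Suc n))) (u p)) * (\<eta> (d x0 p))\<^sup>2) ----> V p * max (u p) 0 powr (P + 1) * (\<eta> (d x0 p))\<^sup>2"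
   by (intro tendsto_intros trunc_power_tendsto P)
  then show ?thesis by (simp add: F_def P_def mult.assoc)
 qed
 have "(\<integral>\<^sup>+p. ennreal (V p * max (u p) 0 powr q * (\<eta> (d x0 p))\<^sup>2) \<partial>vol) = (\<integral>\<^sup>+p. liminf (\<lambda>n. ennreal (F n p)) \<partial>vol)"
  by (intro nn_integral_cong lim_imp_Liminf[symmetric] tendsto_ennrealI lim) simp
 also have "\<dots> \<le> liminf (\<lambda>n. \<integral>\<^sup>+p. ennreal (F n p) \<partial>vol)"
  by (rule nn_integral_liminf) (use F_borel in \<open>simp add: measurable_cong_sets[OF sets_vol HOL.refl]\<close>)
 also have "\<dots> \<le> limsup (\<lambda>n. \<integral>\<^sup>+p. ennreal (F n p) \<partial>vol)" by (rule Liminf_le_Limsup) simp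
 also have "\<dots> \<le> (\<integral>\<^sup>+p. ennreal (s p * (\<eta>' (d x0 p))\<^sup>2) \<partial>vol)" by (rule Limsup_bounded) (simp add: step)
 finally have le: "ennreal P * (\<integral>\<^sup>+p. ennreal (V p * max (u p) 0 powr q * (\<eta> (d x0 p))\<^sup>2) \<partial>vol)
   \<le> ennreal P * (\<integral>\<^sup>+p. ennreal (s p * (\<eta>' (d x0 p))\<^sup>2) \<partial>vol)" by (rule mult_left_mono) simp
 have bmv: "(\<lambda>p. ennreal (V p * max (u p) 0 powr q * (\<eta> (d x0 p))\<^sup>2)) \<in> borel_measurable vol"
  "(\<lambda>p. ennreal (s p * (\<eta>' (d x0 p))\<^sup>2)) \<in> borel_measurable vol"
  unfolding measurable_cong_sets[OF sets_vol HOL.refl] using bm s\<eta>_borel by measurable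
 have "ennreal P * (\<integral>\<^sup>+p. ennreal (V p * max (u p) 0 powr q * (\<eta> (d x0 p))\<^sup>2) \<partial>vol)
   = (\<integral>\<^sup>+p. ennreal ((q - 1) * V p * max (u p) 0 powr q * (\<eta> (d x0 p))\<^sup>2) \<partial>vol)"
  unfolding nn_integral_cmult[OF bmv(1), symmetric] using P by (simp add: P_def mult.assoc flip: ennreal_mult')
 moreover have "ennreal P * (\<integral>\<^sup>+p. ennreal (s p * (\<eta>' (d x0 p))\<^sup>2) \<partial>vol)
   = (\<integral>\<^sup>+p. ennreal (max (u p) 0 powr q * (\<eta>' (d x0 p))\<^sup>2) \<partial>vol)"
  unfolding nn_integral_cmult[OF bmv(2), symmetric] using P by (simp add: s_def flip: ennreal_mult')
 ultimately show ?thesis using le by simp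
qed

abbreviation mass where
 "mass R \<equiv> (\<integral>\<^sup>+x\<in>geodesic_ball A g x0 R. ennreal (max (u x) 0 powr q) \<partial>vol)"

text \<open>A common frame for all \<mu>: later w is the power with exponent -\<mu>/2 and \<Phi> a
  primitive of it, a power for \<mu> < 2 and the logarithm for \<mu> = 2. The shift c makes the
  lower bound on V hold at every point, and \<delta> is the margin left after absorption.\<close>

context
 fixes \<Phi> w :: "real => real" and b \<delta> c :: real
 assumes \<Phi>: "!!y. y > 0 ==> (\<Phi> has_real_derivative w y) (at y)"
  and w: "continuous_on {0<..} w" "!!y. y > 0 ==> w y > 0" "!!y z. 0 < y ==> y \<le> z ==> w z \<le> w y"
  and b: "b > 0" "\<delta> > 0" "c \<ge> 0"
  and Vw: "!!p. (b\<^sup>2 + \<delta>) * (w (smooth_abs (d x0 p) + c))\<^sup>2 \<le> (q - 1) * V p"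
begin

definition "\<sigma> t = smooth_abs t + c"
definition "\<psi> t = exp (- b * \<Phi> (\<sigma> t))"
definition "\<psi>' t = - b * (w (\<sigma> t) * (t / smooth_abs t)) * \<psi> t"

lemma \<sigma>: "\<sigma> t \<ge> 1" "\<sigma> t > 0" "t \<le> \<sigma> t" "0 \<le> s ==> s \<le> t ==> \<sigma> s \<le> \<sigma> t"
 using smooth_abs(1)[of t] smooth_abs(2)[of t] smooth_abs(3)[of s t] b(3) by (auto simp: \<sigma>_def)

lemma w_\<sigma>: "w (\<sigma> t) > 0" "0 \<le> s ==> s \<le> t ==> w (\<sigma> t) \<le> w (\<sigma> s)" "w (\<sigma> t) \<le> w (\<sigma> 0)"
proof -
 show "w (\<sigma> t) > 0" by (rule w(2)[OF \<sigma>(2)])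
 show "0 \<le> s ==> s \<le> t ==> w (\<sigma> t) \<le> w (\<sigma> s)" by (rule w(3)[OF \<sigma>(2) \<sigma>(4)])
 have "\<sigma> 0 \<le> \<sigma> t" using smooth_abs(1)[of t] by (simp add: \<sigma>_def smooth_abs_def)
 then show "w (\<sigma> t) \<le> w (\<sigma> 0)" by (rule w(3)[OF \<sigma>(2)])
qed

lemma \<Phi>_mono: "0 < y ==> y \<le> z ==> \<Phi> y \<le> \<Phi> z"
proof (rule DERIV_nonneg_imp_nondecreasing[of y z \<Phi>])
 fix x assume "0 < y" "y \<le> x"
 then have "x > 0" by linarith
 then show "\<exists>D. (\<Phi> has_real_derivative D) (at x) \<and> 0 \<le> D" using \<Phi> w(2) less_imp_le by blast
qed

lemma \<psi>_pos: "\<psi> t > 0" by (simp add: \<psi>_def)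

lemma \<psi>_le: "0 \<le> s ==> s \<le> t ==> \<psi> t \<le> \<psi> s" "\<psi> t \<le> \<psi> 0"
proof -
 show "0 \<le> s ==> s \<le> t ==> \<psi> t \<le> \<psi> s" using \<Phi>_mono[OF \<sigma>(2) \<sigma>(4)[of s t]] b by (simp add: \<psi>_def)
 have "\<sigma> 0 \<le> \<sigma> t" using smooth_abs(1)[of t] by (simp add: \<sigma>_def smooth_abs_def)
 from \<Phi>_mono[OF \<sigma>(2) this] show "\<psi> t \<le> \<psi> 0" using b by (simp add: \<psi>_def)
qed

lemma \<psi>_has_derivative: "(\<psi> has_real_derivative \<psi>' t) (at t)"
proof -
 have "(\<sigma> has_real_derivative t / smooth_abs t) (at t)"
  unfolding \<sigma>_def[abs_def] using DERIV_add[OF smooth_abs(4)[of t] DERIV_const[of c]] by simp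
 from DERIV_chain2[OF \<Phi>[OF \<sigma>(2)] this]
 have "((\<lambda>t. - b * \<Phi> (\<sigma> t)) has_real_derivative - b * (w (\<sigma> t) * (t / smooth_abs t))) (at t)" by (rule DERIV_cmult)
 from DERIV_chain2[OF DERIV_exp this] show ?thesis unfolding \<psi>_def[abs_def] \<psi>'_def by (simp add: mult.commute \<psi>_def)
qed

lemma \<psi>'_le: "\<bar>\<psi>' t\<bar> \<le> b * w (\<sigma> t) * \<psi> t"
proof -
 have "\<bar>\<psi>' t\<bar> = b * w (\<sigma> t) * \<psi> t * \<bar>t / smooth_abs t\<bar>"
  using b w_\<sigma>(1)[of t] \<psi>_pos[of t] by (simp add: \<psi>'_def abs_mult)
 also have "\<dots> \<le> b * w (\<sigma> t) * \<psi> t * 1"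
  using b w_\<sigma>(1)[of t] \<psi>_pos[of t] by (intro mult_left_mono smooth_abs(5)) simp
 finally show ?thesis by simp
qed

lemma \<psi>_continuous: "continuous_on UNIV \<psi>" by (rule DERIV_continuous_on) (rule \<psi>_has_derivative)

lemma w\<sigma>_continuous: "continuous_on UNIV (\<lambda>t. w (\<sigma> t))"
proof (rule continuous_on_compose2[OF w(1)])
 show "continuous_on UNIV \<sigma>" unfolding \<sigma>_def[abs_def] by (intro continuous_intros smooth_abs(6))
qed (use \<sigma>(2) in auto)

lemma \<psi>'_continuous: "continuous_on UNIV \<psi>'"
 unfolding \<psi>'_def[abs_def]
 using smooth_abs(1) by (intro continuous_intros w\<sigma>_continuous \<psi>_continuous smooth_abs(6)) (metis not_one_le_zero)

abbreviation weighted_mass where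
 "weighted_mass R \<equiv> (\<integral>\<^sup>+p. ennreal ((w (\<sigma> (d x0 p)))\<^sup>2 * (\<psi> (d x0 p))\<^sup>2 * max (u p) 0 powr q) * indicator {p. d x0 p < R} p \<partial>vol)"

text \<open>Bounds \<eta>'^2 on the region where the cutoff varies: b w comes from the exponential
  and 4/S from a cutoff of width S. As \<psi> and w decrease, both are evaluated at the inner
  radius.\<close>

definition "decay R S = (\<psi> R)\<^sup>2 * (b * w (\<sigma> R) + 4 / S)\<^sup>2"

lemma decay_pos: "S > 0 ==> decay R S > 0"
proof -
 assume S: "S > 0"
 have "b * w (\<sigma> R) + 4 / S > 0" using b w_\<sigma>(1)[of R] S by (simp add: add_pos_pos)
 then show ?thesis using \<psi>_pos[of R] by (simp add: decay_def)
qed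

lemma borels:
 "u \<in> Borel" "V \<in> Borel" "d x0 \<in> Borel"
 "\<psi> \<in> Borel" "(\<lambda>t. w (\<sigma> t)) \<in> Borel"
 by (rule W12_loc_borel[OF u], (rule borel_measurable_continuous_onI, rule V(1) d_continuous \<psi>_continuous w\<sigma>_continuous)+)

lemma ball_borel: "{p. d x0 p < R} \<in> sets borel"
 using borels(3) by measurable

text \<open>Inside radius R the cutoff is 1 and \<eta>'^2 is at most b^2 times the weight, so the
  right-hand side is absorbed and \<delta> times the weighted mass survives. Between R and R + S the
  decay bound applies, and beyond that everything vanishes.\<close>

lemma weighted_mass_le:
 assumes R: "R > 0" and S: "S > 0"
 shows "ennreal \<delta> * weighted_mass R \<le> ennreal (decay R S) * mass (R + S)"
proof -
 let ?F = "\<lambda>p. max (u p) 0 powr q" and ?W = "\<lambda>p. (w (\<sigma> (d x0 p)))\<^sup>2 * (\<psi> (d x0 p))\<^sup>2"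
 let ?i = "\<lambda>R p. indicator {p. d x0 p < R} p :: ennreal"
 define k where "k t = cutoff ((t - R) / S)" for t
 define k' where "k' t = cutoff_deriv ((t - R) / S) / S" for t
 have k: "(k has_real_derivative k' t) (at t)" for t
 proof -
  have "((\<lambda>t. (t - R) / S) has_real_derivative 1 / S) (at t)" using S by (auto intro!: derivative_eq_intros)
  from DERIV_chain2[OF cutoff_has_derivative this] show ?thesis unfolding k_def[abs_def] k'_def by simp
 qed
 have k_le: "0 \<le> k t" "k t \<le> 1" "\<bar>k' t\<bar> \<le> 4 / S" for t
  using cutoff_bounds[of "(t - R) / S"] S by (simp_all add: k_def k'_def divide_right_mono)
 have k1: "k t = 1" "k' t = 0" if "t \<le> R" for t
  using cutoff_eq_1[of "(t - R) / S"] that S by (simp_all add: k_def k'_def divide_nonpos_pos)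
 have k0: "k t = 0" "k' t = 0" if "t \<ge> R + S" for t
  using cutoff_eq_0[of "(t - R) / S"] that S by (simp_all add: k_def k'_def le_divide_eq)
 define \<eta> where "\<eta> t = \<psi> t * k t" for t
 define \<eta>' where "\<eta>' t = \<psi>' t * k t + k' t * \<psi> t" for t
 have \<eta>'_le: "\<bar>\<eta>' t\<bar> \<le> \<psi> t * (b * w (\<sigma> t) + 4 / S)" for t
 proof -
  have "\<bar>\<eta>' t\<bar> \<le> \<bar>\<psi>' t\<bar> * \<bar>k t\<bar> + \<bar>k' t\<bar> * \<bar>\<psi> t\<bar>" unfolding \<eta>'_def by (metis abs_mult abs_triangle_ineq)
  also have "\<dots> \<le> (b * w (\<sigma> t) * \<psi> t) * 1 + (4 / S) * \<psi> t"
   using \<psi>_pos[of t] w_\<sigma>(1)[of t] b S k_le[of t] by (intro add_mono mult_mono \<psi>'_le) auto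
  finally show ?thesis by (simp add: algebra_simps)
 qed
 have B: "\<psi> t * (b * w (\<sigma> t) + 4 / S) \<le> \<psi> s * (b * w (\<sigma> s) + 4 / S)"
  if "\<psi> t \<le> \<psi> s" "w (\<sigma> t) \<le> w (\<sigma> s)" for s t
  using that \<psi>_pos w_\<sigma>(1)[of t] b S by (intro mult_mono add_mono mult_left_mono) (auto intro: less_imp_le add_nonneg_nonneg)
 define M where "M = \<psi> 0 * (b * w (\<sigma> 0) + 4 / S) + \<psi> 0"
 have main: "(\<integral>\<^sup>+p. ennreal ((q - 1) * V p * ?F p * (\<eta> (d x0 p))\<^sup>2) \<partial>vol) \<le> (\<integral>\<^sup>+p. ennreal (?F p * (\<eta>' (d x0 p))\<^sup>2) \<partial>vol)"
 proof (rule weighted_inequality[of \<eta> \<eta>' M "R + S"])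
  show "(\<eta> has_real_derivative \<eta>' t) (at t)" for t
   unfolding \<eta>_def[abs_def] \<eta>'_def by (rule DERIV_mult[OF \<psi>_has_derivative k])
  have "continuous_on UNIV k'"
   unfolding k'_def[abs_def] using S by (intro continuous_intros continuous_on_compose2[OF cutoff_deriv_continuous]) auto
  moreover have "continuous_on UNIV k" by (rule DERIV_continuous_on) (rule k)
  ultimately show "continuous_on UNIV \<eta>'"
   unfolding \<eta>'_def[abs_def] by (intro continuous_intros \<psi>'_continuous \<psi>_continuous)
  have nn: "0 \<le> \<psi> 0 * (b * w (\<sigma> 0) + 4 / S)" using \<psi>_pos[of 0] b w_\<sigma>(1)[of 0] S by simp
  show "\<bar>\<eta> t\<bar> \<le> M" for t
  proof -
   have "\<psi> t * k t \<le> \<psi> 0 * 1" using \<psi>_le(2)[of t] \<psi>_pos[of 0] k_le by (intro mult_mono) simp_all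
   moreover have "0 \<le> \<psi> t * k t" using \<psi>_pos[of t] k_le(1)[of t] by simp
   ultimately show ?thesis using nn by (simp add: \<eta>_def M_def)
  qed
  show "\<bar>\<eta>' t\<bar> \<le> M" for t
   using \<eta>'_le[of t] B[OF \<psi>_le(2) w_\<sigma>(3), of t] \<psi>_pos[of 0] by (simp add: M_def)
  show "\<eta> t = 0" "\<eta>' t = 0" if "t \<ge> R + S" for t using k0[OF that] by (simp_all add: \<eta>_def \<eta>'_def)
 qed
 note [measurable] = borels ball_borel
 have meas: "(\<lambda>p. ennreal (?W p * ?F p) * ?i R p) \<in> borel_measurable vol" "(\<lambda>p. ennreal (?F p) * ?i (R + S) p) \<in> borel_measurable vol"
  unfolding measurable_cong_sets[OF sets_vol HOL.refl] by measurable
 have r0: "d x0 p \<ge> 0" for p by (rule d_nonneg)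
 have "ennreal (b\<^sup>2 + \<delta>) * weighted_mass R = (\<integral>\<^sup>+p. ennreal (b\<^sup>2 + \<delta>) * (ennreal (?W p * ?F p) * ?i R p) \<partial>vol)"
  by (rule nn_integral_cmult[OF meas(1), symmetric])
 also have "\<dots> \<le> (\<integral>\<^sup>+p. ennreal ((q - 1) * V p * ?F p * (\<eta> (d x0 p))\<^sup>2) \<partial>vol)"
 proof (rule nn_integral_mono)
  fix p
  show "ennreal (b\<^sup>2 + \<delta>) * (ennreal (?W p * ?F p) * ?i R p) \<le> ennreal ((q - 1) * V p * ?F p * (\<eta> (d x0 p))\<^sup>2)"
  proof (cases "d x0 p < R")
   case True
   have "(b\<^sup>2 + \<delta>) * (?W p * ?F p) = (b\<^sup>2 + \<delta>) * (w (\<sigma> (d x0 p)))\<^sup>2 * ((\<psi> (d x0 p))\<^sup>2 * ?F p)" by (simp add: mult_ac)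
   also have "\<dots> \<le> (q - 1) * V p * ((\<psi> (d x0 p))\<^sup>2 * ?F p)"
    using Vw[of p] by (intro mult_right_mono) (simp_all add: \<sigma>_def)
   also have "\<dots> = (q - 1) * V p * ?F p * (\<eta> (d x0 p))\<^sup>2" using True k1 by (simp add: \<eta>_def mult_ac)
   finally have "ennreal ((b\<^sup>2 + \<delta>) * (?W p * ?F p)) \<le> ennreal ((q - 1) * V p * ?F p * (\<eta> (d x0 p))\<^sup>2)" by (rule ennreal_leI)
   moreover have "ennreal ((b\<^sup>2 + \<delta>) * (?W p * ?F p)) = ennreal (b\<^sup>2 + \<delta>) * ennreal (?W p * ?F p)"
    using b by (intro ennreal_mult) simp_all
   ultimately show ?thesis using True by (simp only: indicator_simps mem_Collect_eq mult_1_right)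
  qed simp
 qed
 also have "\<dots> \<le> (\<integral>\<^sup>+p. ennreal (?F p * (\<eta>' (d x0 p))\<^sup>2) \<partial>vol)" by (rule main)
 also have "\<dots> \<le> (\<integral>\<^sup>+p. ennreal (b\<^sup>2) * (ennreal (?W p * ?F p) * ?i R p) + ennreal (decay R S) * (ennreal (?F p) * ?i (R + S) p) \<partial>vol)"
 proof (rule nn_integral_mono)
  fix p
  show "ennreal (?F p * (\<eta>' (d x0 p))\<^sup>2) \<le> ennreal (b\<^sup>2) * (ennreal (?W p * ?F p) * ?i R p) + ennreal (decay R S) * (ennreal (?F p) * ?i (R + S) p)"
  proof -
   consider "d x0 p < R" | "R \<le> d x0 p" "d x0 p < R + S" | "R + S \<le> d x0 p" by linarith
   then show ?thesis
   proof cases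
    case 1
    have "\<bar>\<eta>' (d x0 p)\<bar> \<le> b * w (\<sigma> (d x0 p)) * \<psi> (d x0 p)" using \<psi>'_le[of "d x0 p"] k1[of "d x0 p"] 1 by (simp add: \<eta>'_def)
    from power_mono[OF this, of 2] have "(\<eta>' (d x0 p))\<^sup>2 \<le> b\<^sup>2 * ?W p" by (simp add: power_mult_distrib mult.assoc)
    then have "?F p * (\<eta>' (d x0 p))\<^sup>2 \<le> ?F p * (b\<^sup>2 * ?W p)" by (rule mult_left_mono) simp
    then have "ennreal (?F p * (\<eta>' (d x0 p))\<^sup>2) \<le> ennreal (b\<^sup>2) * (ennreal (?W p * ?F p) * ?i R p)"
     using 1 by (simp add: ennreal_leI mult_ac flip: ennreal_mult')
    then show ?thesis by (rule order_trans) simp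
   next
    case 2
    have "\<bar>\<eta>' (d x0 p)\<bar> \<le> \<psi> R * (b * w (\<sigma> R) + 4 / S)"
     by (rule order_trans[OF \<eta>'_le B]) (use 2 R \<psi>_le(1)[of R "d x0 p"] w_\<sigma>(2)[of R "d x0 p"] in simp_all)
    from power_mono[OF this, of 2] have "(\<eta>' (d x0 p))\<^sup>2 \<le> decay R S" by (simp add: power_mult_distrib decay_def)
    then have "?F p * (\<eta>' (d x0 p))\<^sup>2 \<le> ?F p * decay R S" by (rule mult_left_mono) simp
    then have "ennreal (?F p * (\<eta>' (d x0 p))\<^sup>2) \<le> ennreal (decay R S) * (ennreal (?F p) * ?i (R + S) p)"
     using 2 decay_pos[OF S, of R] by (simp add: ennreal_leI mult_ac flip: ennreal_mult')
    then show ?thesis using 2 by simp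
   next
    case 3
    then show ?thesis using k0[of "d x0 p"] by (simp add: \<eta>'_def)
   qed
  qed
 qed
 also have "\<dots> = ennreal (b\<^sup>2) * weighted_mass R + ennreal (decay R S) * mass (R + S)"
  using meas by (simp add: nn_integral_add nn_integral_cmult geodesic_ball_def)
 finally have "ennreal (b\<^sup>2 + \<delta>) * weighted_mass R \<le> ennreal (b\<^sup>2) * weighted_mass R + ennreal (decay R S) * mass (R + S)" .
 moreover have "ennreal (b\<^sup>2 + \<delta>) = ennreal (b\<^sup>2) + ennreal \<delta>" using b by (intro ennreal_plus) simp_all
 ultimately have ineq: "ennreal (b\<^sup>2) * weighted_mass R + ennreal \<delta> * weighted_mass R
   \<le> ennreal (b\<^sup>2) * weighted_mass R + ennreal (decay R S) * mass (R + S)"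
  by (simp only: distrib_right)
 \<comment> \<open>The common term may be cancelled only if it is finite. If the weighted mass is
   infinite, then so is the mass, because the weight is bounded by K, and the claim is
   trivial.\<close>
 show ?thesis
 proof (cases "weighted_mass R = \<infinity>")
  case False
  then have "ennreal (b\<^sup>2) * weighted_mass R \<noteq> \<infinity>" by (simp add: ennreal_mult_eq_top_iff)
  then show ?thesis using ineq by (simp add: ennreal_add_left_cancel_le)
 next
  case True
  define K where "K = (w (\<sigma> 0))\<^sup>2 * (\<psi> 0)\<^sup>2"
  have "weighted_mass R \<le> (\<integral>\<^sup>+p. ennreal K * (ennreal (?F p) * ?i (R + S) p) \<partial>vol)"
  proof (rule nn_integral_mono)
   fix p
   have "?W p \<le> K" unfolding K_def
    using w_\<sigma>(3)[of "d x0 p"] w_\<sigma>(1)[of "d x0 p"] \<psi>_le(2)[of "d x0 p"] \<psi>_pos[of "d x0 p"]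
    by (intro mult_mono power_mono) simp_all
   then have "?W p * ?F p \<le> K * ?F p" by (rule mult_right_mono) simp
   then show "ennreal (?W p * ?F p) * ?i R p \<le> ennreal K * (ennreal (?F p) * ?i (R + S) p)"
    using S by (auto simp: indicator_def K_def ennreal_leI simp flip: ennreal_mult')
  qed
  also have "\<dots> = ennreal K * mass (R + S)" using nn_integral_cmult[OF meas(2), of "ennreal K"] by (simp add: geodesic_ball_def)
  finally have "ennreal K * mass (R + S) = \<infinity>" using True by (simp add: top_unique)
  then have "mass (R + S) = \<infinity>" by (auto simp: ennreal_mult_eq_top_iff)
  then show ?thesis using decay_pos[OF S, of R] by (simp add: ennreal_mult_top)
 qed
qed

text \<open>Positive measure of the set where u > 0 enters here: some ball has nonzero weighted
  mass, and the weighted mass grows with the radius, which gives a constant m valid for all larger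
  R.\<close>

lemma mass_growth:
 assumes pos: "emeasure vol {x. u x > 0} > 0"
 obtains m R0 where "m > 0" "R0 > 0" "!!R S. R \<ge> R0 ==> S > 0 ==>
  ennreal (m / ((exp (- b * \<Phi> (smooth_abs R + c)))\<^sup>2 * (b * w (smooth_abs R + c) + 4 / S)\<^sup>2)) \<le> mass (R + S)"
proof -
 let ?G = "\<lambda>p. (w (\<sigma> (d x0 p)))\<^sup>2 * (\<psi> (d x0 p))\<^sup>2 * max (u p) 0 powr q"
 note [measurable] = borels ball_borel
 have meas: "(\<lambda>p. ennreal (?G p) * indicator {p. d x0 p < R} p) \<in> borel_measurable vol" for R
  unfolding measurable_cong_sets[OF sets_vol HOL.refl] by measurable
 have "\<exists>n. weighted_mass (real (Suc n)) \<noteq> 0"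
 proof (rule ccontr)
  assume "\<not> ?thesis"
  then have "AE p in vol. ennreal (?G p) * indicator {p. d x0 p < real (Suc n)} p = 0" for n
   using nn_integral_0_iff_AE[OF meas] by blast
  then have "AE p in vol. \<forall>n. ennreal (?G p) * indicator {p. d x0 p < real (Suc n)} p = 0" unfolding AE_all_countable ..
  then have "AE p in vol. \<not> u p > 0"
  proof eventually_elim
   case (elim p)
   obtain n where "d x0 p < real n" using reals_Archimedean2 by blast
   then have n: "d x0 p < real (Suc n)" by simp
   have "ennreal (?G p) = 0" using spec[OF elim, of n] n by simp
   then have "?G p \<le> 0" by (simp add: ennreal_eq_0_iff)
   then have "?G p = 0" by (intro antisym) simp_all
   then show ?case using w_\<sigma>(1)[of "d x0 p"] \<psi>_pos[of "d x0 p"] by auto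
  qed
  moreover have "{x. u x > 0} \<in> sets vol" unfolding sets_vol by measurable
  ultimately have "emeasure vol {x. u x > 0} = 0"
   by (subst AE_iff_measurable[symmetric, where P = "\<lambda>p. \<not> u p > 0"]) simp_all
  then show False using pos by simp
 qed
 then obtain n where n: "weighted_mass (real (Suc n)) \<noteq> 0" by blast
 define a where "a = ennreal \<delta> * weighted_mass (real (Suc n))"
 have a: "a \<noteq> 0" using n b unfolding a_def by simp
 \<comment> \<open>A finite positive constant below a; the value 1 serves when a is
   infinite.\<close>
 define m where "m = (if a = \<infinity> then 1 else enn2real a)"
 have m: "m > 0" using a by (auto simp: m_def enn2real_positive_iff less_top zero_less_iff_neq_zero)
 have ma: "ennreal m \<le> a" by (simp add: m_def less_top)
 show ?thesis
 proof (rule that[OF m])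
  show "real (Suc n) > 0" by simp
  fix R S :: real assume R: "R \<ge> real (Suc n)" and S: "S > 0"
  have R0: "R > 0" using R by linarith
  have "weighted_mass (real (Suc n)) \<le> weighted_mass R"
   using R by (intro nn_integral_mono) (auto simp: indicator_def)
  then have "a \<le> ennreal \<delta> * weighted_mass R" unfolding a_def by (rule mult_left_mono) simp
  also have "\<dots> \<le> ennreal (decay R S) * mass (R + S)" by (rule weighted_mass_le[OF R0 S])
  finally have le: "ennreal m \<le> ennreal (decay R S) * mass (R + S)" using ma by (rule order_trans[rotated])
  have D: "decay R S > 0" by (rule decay_pos[OF S])
  have "ennreal (m / decay R S) \<le> mass (R + S)"
  proof (cases "mass (R + S)")
   case (real i)
   then have "ennreal m \<le> ennreal (decay R S * i)" using le D by (simp add: ennreal_mult')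
   then have "m \<le> decay R S * i" using real D by (subst (asm) ennreal_le_iff) simp_all
   then show ?thesis using D real by (simp add: ennreal_leI pos_divide_le_eq mult.commute)
  qed simp
  then show "ennreal (m / ((exp (- b * \<Phi> (smooth_abs R + c)))\<^sup>2 * (b * w (smooth_abs R + c) + 4 / S)\<^sup>2)) \<le> mass (R + S)"
   unfolding decay_def \<psi>_def \<sigma>_def .
 qed
qed

end

end

end

section \<open>Growth rates\<close>

lemma powr_growth_limit:
 fixes a k \<alpha> :: real
 assumes "\<alpha> > 0"
 shows "((\<lambda>R. 1 / R powr \<alpha> * (a + k * (R - 1) powr \<alpha>)) \<longlongrightarrow> k) at_top"
proof (rule Lim_transform_eventually)
 have "((\<lambda>R. a * R powr (- \<alpha>) + k * (1 - inverse R) powr \<alpha>) \<longlongrightarrow> a * 0 + k * (1 - 0) powr \<alpha>) at_top"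
  using assms by (intro tendsto_intros tendsto_neg_powr tendsto_inverse_0_at_top filterlim_ident) simp_all
 then show "((\<lambda>R. a * R powr (- \<alpha>) + k * (1 - inverse R) powr \<alpha>) \<longlongrightarrow> k) at_top" by simp
 show "\<forall>\<^sub>F R in at_top. a * R powr (- \<alpha>) + k * (1 - inverse R) powr \<alpha> = 1 / R powr \<alpha> * (a + k * (R - 1) powr \<alpha>)"
  using eventually_gt_at_top[of 1]
 proof eventually_elim
  case (elim R)
  have "1 - inverse R = (R - 1) / R" using elim by (simp add: field_simps)
  then show ?case by (simp only: powr_divide powr_minus_divide) (simp add: distrib_left)
 qed
qed

lemma ln_growth_limit:
 fixes a k :: real
 shows "((\<lambda>R. 1 / ln R * (a + k * ln (R / 2))) \<longlongrightarrow> k) at_top"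
proof (rule Lim_transform_eventually)
 have "((\<lambda>R. (a - k * ln 2) / ln R + k) \<longlongrightarrow> 0 + k) at_top"
  by (intro tendsto_add tendsto_const tendsto_divide_0[OF tendsto_const filterlim_at_top_imp_at_infinity[OF ln_at_top]])
 then show "((\<lambda>R. (a - k * ln 2) / ln R + k) \<longlongrightarrow> k) at_top" by simp
 show "\<forall>\<^sub>F R in at_top. (a - k * ln 2) / ln R + k = 1 / ln R * (a + k * ln (R / 2))"
  using eventually_gt_at_top[of 1]
 proof eventually_elim
  case (elim R)
  then have n: "ln R \<noteq> 0" and l: "ln (R / 2) = ln R - ln 2" by (simp_all add: ln_div)
  show ?case unfolding l using n by (simp add: field_simps)
 qed
qed

text \<open>Applied to the bound of \<open>mass_growth\<close>: a smaller exponential and a larger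
  denominator give a minorant with an explicit logarithm.\<close>

lemma quotient_ge:
 fixes m e x z z0 :: real
 assumes "m > 0" "0 < e" "e \<le> exp x" "0 < z" "z \<le> z0"
 shows "m * (e / z0)\<^sup>2 \<le> m / ((exp (- x))\<^sup>2 * z\<^sup>2)"
proof -
 have "(e / z0)\<^sup>2 \<le> (exp x / z)\<^sup>2" using assms by (intro power_mono frac_le) simp_all
 then have "m * (e / z0)\<^sup>2 \<le> m * (exp x / z)\<^sup>2" using assms(1) by simp
 also have "\<dots> = m / ((exp (- x))\<^sup>2 * z\<^sup>2)" by (simp add: exp_minus power_divide field_simps)
 finally show ?thesis .
qed

context complete_manifold
begin

text \<open>Far from p the lower limit gives the bound, and the triangle inequality moves the base
  point to x0 at the cost of a shift. On the remaining compact ball V has a positive minimum, and a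
  larger shift brings the left-hand side below it.\<close>

lemma potential_bound:
 assumes \<mu>: "0 \<le> \<mu>" and V: "continuous_on UNIV V" "!!x. V x > 0" and l: "0 < l" "l < lam"
  and V0: "\<mu> = 0 --> (\<forall>x. V x \<ge> lam)"
  and V1: "\<mu> > 0 --> (\<exists>p. Liminf (at_manifold_infinity A g p) (\<lambda>x. ereal (rdist A g x p powr \<mu> * V x)) \<ge> ereal lam)"
 obtains c where "c \<ge> 0" "!!p. l * (smooth_abs (d x0 p) + c) powr (- \<mu>) \<le> V p"
proof (cases "\<mu> = 0")
 case True
 have "l * (smooth_abs (d x0 p) + 0) powr (- \<mu>) \<le> V p" for p
  using True V0 l smooth_abs(1)[of "d x0 p"] by (simp add: order_trans[OF less_imp_le])
 then show ?thesis by (rule that[OF order_refl])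
next
 case False
 then have \<mu>': "\<mu> > 0" using \<mu> by simp
 obtain p where p: "ereal lam \<le> Liminf (at_manifold_infinity A g p) (\<lambda>x. ereal (rdist A g x p powr \<mu> * V x))"
  using V1 \<mu>' by blast
 have "ereal l < Liminf (at_manifold_infinity A g p) (\<lambda>x. ereal (rdist A g x p powr \<mu> * V x))"
  by (rule less_le_trans[OF _ p]) (simp add: l)
 from less_LiminfD[OF this]
 obtain T where T: "!!x. d x p \<ge> T ==> l < d x p powr \<mu> * V x"
  unfolding at_manifold_infinity_def eventually_filtercomap_at_top_linorder by auto
 \<comment> \<open>The maximum with 1 makes the distance to p positive outside the ball, where its
   powers are compared.\<close>
 let ?K = "{x. d p x \<le> max T 1}"
 have "?K \<noteq> {}" using d_self[of p] by (metis (mono_tags, lifting) empty_iff max.coboundedI2 mem_Collect_eq zero_le_one)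
 from continuous_attains_inf[OF closed_ball_compact this continuous_on_subset[OF V(1) subset_UNIV]]
 obtain x1 where x1: "!!x. x \<in> ?K ==> V x1 \<le> V x" by blast
 \<comment> \<open>The solution of l e^(-\<mu>) = V x1, where x1 minimizes V on the ball.\<close>
 define e where "e = (l / V x1) powr (1 / \<mu>)"
 have e: "e > 0" using l V(2)[of x1] by (simp add: e_def)
 define c where "c = d x0 p + e"
 show ?thesis
 proof (rule that[of c])
  show "c \<ge> 0" using e d_nonneg[of x0 p] by (simp add: c_def)
  fix x
  let ?y = "smooth_abs (d x0 x) + c"
  show "l * ?y powr (- \<mu>) \<le> V x"
  proof (cases "x \<in> ?K")
   case True
   have "e \<le> ?y" using smooth_abs(1)[of "d x0 x"] d_nonneg[of x0 p] by (simp add: c_def)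
   then have "?y powr (- \<mu>) \<le> e powr (- \<mu>)" using \<mu>' e by (intro powr_mono2') simp_all
   also have "\<dots> = V x1 / l" using \<mu>' l V(2)[of x1] by (simp add: e_def powr_powr powr_minus_divide)
   finally have "l * ?y powr (- \<mu>) \<le> V x1" using l by (simp add: pos_le_divide_eq mult.commute)
   then show ?thesis using x1[OF True] by (rule order_trans)
  next
   case False
   then have D: "d x p \<ge> T" "d x p > 1" using d_sym[of x p] by auto
   have "d x p \<le> d x0 x + d x0 p" using d_triangle[of x p x0] d_sym[of x x0] by simp
   then have "d x p \<le> ?y" using smooth_abs(2)[of "d x0 x"] e by (simp add: c_def)
   then have "?y powr (- \<mu>) \<le> d x p powr (- \<mu>)" using \<mu>' D(2) by (intro powr_mono2') linarith+
   then have "l * ?y powr (- \<mu>) \<le> l * d x p powr (- \<mu>)" using l by simp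
   also have "\<dots> \<le> V x"
   proof -
    have "d x p powr \<mu> > 0" unfolding powr_gt_zero using D(2) by linarith
    then show ?thesis using less_imp_le[OF T[OF D(1)]] by (simp add: powr_minus_divide pos_divide_le_eq mult.commute)
   qed
   finally show ?thesis .
  qed
 qed
qed

context
 fixes x0 :: 'a and u V :: "'a => real" and q \<mu> lam :: real
 assumes u: "u \<in> W12_loc A g" and sub: "weakly_subsolution_on A g V {x. u x > 0} u"
  and V: "continuous_on UNIV V" "!!x. V x > 0" and q: "q > 1"
  and pos: "emeasure vol {x. u x > 0} > 0" and \<mu>: "0 \<le> \<mu>" and lam: "lam > 0"
  and V0: "\<mu> = 0 --> (\<forall>x. V x \<ge> lam)"
  and V1: "\<mu> > 0 --> (\<exists>p. Liminf (at_manifold_infinity A g p) (\<lambda>x. ereal (rdist A g x p powr \<mu> * V x)) \<ge> ereal lam)"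
begin

abbreviation I where
 "I R \<equiv> (\<integral>\<^sup>+x\<in>geodesic_ball A g x0 R. ennreal (max (u x) 0 powr q) \<partial>vol)"

lemma mass_growth_powr:
 assumes b: "0 < b" "b < sqrt ((q - 1) * lam)"
  and \<Phi>: "!!y. y > 0 ==> (\<Phi> has_real_derivative y powr (- \<mu> / 2)) (at y)"
 obtains m R0 c where "m > 0" "R0 > 0" "c \<ge> 0" "!!R S. R \<ge> R0 ==> S > 0 ==>
  ennreal (m / ((exp (- b * \<Phi> (smooth_abs R + c)))\<^sup>2 * (b * (smooth_abs R + c) powr (- \<mu> / 2) + 4 / S)\<^sup>2)) \<le> I (R + S)"
proof -
 have "b\<^sup>2 < (sqrt ((q - 1) * lam))\<^sup>2" using b by (intro power_strict_mono) simp_all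
 then have b2: "b\<^sup>2 / (q - 1) < lam" using q lam by (simp add: pos_divide_less_eq mult.commute)
 \<comment> \<open>l is the midpoint of x and lam. It lies strictly below lam, as
   \<open>potential_bound\<close> requires, and strictly above b^2 / (q - 1), which makes \<delta>
   positive.\<close>
 define x where "x = b\<^sup>2 / (q - 1)"
 define l where "l = (x + lam) / 2"
 define \<delta> where "\<delta> = (q - 1) * l - b\<^sup>2"
 have l: "l > 0" "l < lam" "b\<^sup>2 / (q - 1) < l"
 proof -
  have "x \<ge> 0" "x < lam" using b2 q by (simp_all add: x_def)
  then show "l > 0" "l < lam" "b\<^sup>2 / (q - 1) < l" unfolding x_def[symmetric] l_def using lam by (simp_all add: field_simps)
 qed
 have \<delta>: "\<delta> > 0" using l(3) q by (simp add: \<delta>_def pos_divide_less_eq mult.commute)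
 obtain c where c: "c \<ge> 0" "!!p. l * (smooth_abs (d x0 p) + c) powr (- \<mu>) \<le> V p"
  using potential_bound[OF \<mu> V l(1,2) V0 V1, of x0] by metis
 have Vw: "(b\<^sup>2 + \<delta>) * ((smooth_abs (d x0 p) + c) powr (- \<mu> / 2))\<^sup>2 \<le> (q - 1) * V p" for p
 proof -
  have "(b\<^sup>2 + \<delta>) * ((smooth_abs (d x0 p) + c) powr (- \<mu> / 2))\<^sup>2 = (q - 1) * (l * (smooth_abs (d x0 p) + c) powr (- \<mu>))"
   by (simp add: \<delta>_def power2_eq_square flip: powr_add)
  also have "\<dots> \<le> (q - 1) * V p" using c(2) q by simp
  finally show ?thesis .
 qed
 have w: "continuous_on {0<..} (\<lambda>y :: real. y powr (- \<mu> / 2))" "!!y :: real. y > 0 ==> y powr (- \<mu> / 2) > 0"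
  "!!y z :: real. 0 < y ==> y \<le> z ==> z powr (- \<mu> / 2) \<le> y powr (- \<mu> / 2)"
  using \<mu> by (auto intro!: continuous_intros powr_mono2')
 show ?thesis
 proof (rule mass_growth[OF u sub V q \<Phi> w b(1) \<delta> c(1) Vw pos])
  fix m R0 :: real
  assume m: "m > 0" "R0 > 0" and le: "!!R S. R \<ge> R0 ==> S > 0 ==>
   ennreal (m / ((exp (- b * \<Phi> (smooth_abs R + c)))\<^sup>2 * (b * (smooth_abs R + c) powr (- \<mu> / 2) + 4 / S)\<^sup>2)) \<le> I (R + S)"
  show thesis by (rule that[OF m c(1) le])
 qed
qed

lemma mass_liminf_lt_2:
 assumes \<mu>2: "\<mu> < 2"
 shows "ereal (2 * sqrt (q - 1) * sqrt lam / (1 - \<mu> / 2)) \<le> Liminf at_top (\<lambda>R. ereal (1 / R powr (1 - \<mu> / 2)) * ext_ln (I R))"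
proof -
 define \<alpha> where "\<alpha> = 1 - \<mu> / 2"
 have \<alpha>: "\<alpha> > 0" using \<mu>2 by (simp add: \<alpha>_def)
 have "ereal (2 / \<alpha> * sqrt ((q - 1) * lam) + 0) \<le> Liminf at_top (\<lambda>R. ereal (1 / R powr \<alpha>) * ext_ln (I R))"
 proof (rule ereal_le_by_scaling)
  show "sqrt ((q - 1) * lam) > 0" using q lam by simp
  fix b assume b: "0 < b" "b < sqrt ((q - 1) * lam)"
  have \<Phi>: "((\<lambda>y. y powr \<alpha> / \<alpha>) has_real_derivative y powr (- \<mu> / 2)) (at y)" if "y > 0" for y :: real
   using that \<alpha> by (auto intro!: derivative_eq_intros simp: \<alpha>_def)
  obtain m R0 c where m: "m > 0" "R0 > 0" "c \<ge> 0" "!!R S. R \<ge> R0 ==> S > 0 ==>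
   ennreal (m / ((exp (- b * ((smooth_abs R + c) powr \<alpha> / \<alpha>)))\<^sup>2 * (b * (smooth_abs R + c) powr (- \<mu> / 2) + 4 / S)\<^sup>2)) \<le> I (R + S)"
   by (rule mass_growth_powr[OF b \<Phi>]) (auto intro: that)
  \<comment> \<open>The cutoff has width S = 1 and starts at radius R - 1. The weight is at most 1
    there, which gives the factor b + 4, and a constant factor does not affect the rate for \<mu> <
    2.\<close>
  define h where "h R = m * (exp (b * ((R - 1) powr \<alpha> / \<alpha>)) / (b + 4))\<^sup>2" for R
  have "ennreal (h R) \<le> I R" if R: "R \<ge> R0 + 1" for R
  proof -
   define \<rho> where "\<rho> = R - 1"
   have \<rho>: "\<rho> \<ge> R0" "\<rho> > 0" using R m(2) by (simp_all add: \<rho>_def)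
   let ?y = "smooth_abs \<rho> + c"
   have y: "?y \<ge> 1" "?y \<ge> \<rho>" using smooth_abs(1,2)[of \<rho>] m(3) by simp_all
   have "\<rho> powr \<alpha> / \<alpha> \<le> ?y powr \<alpha> / \<alpha>" using y \<rho> \<alpha> by (intro divide_right_mono powr_mono2) simp_all
   from mult_left_mono[OF this, of b] have e: "exp (b * (\<rho> powr \<alpha> / \<alpha>)) \<le> exp (b * (?y powr \<alpha> / \<alpha>))" using b by simp
   have "?y powr (- \<mu> / 2) \<le> ?y powr 0" using y \<mu> by (intro powr_mono) simp_all
   then have "b * ?y powr (- \<mu> / 2) + 4 / 1 \<le> b + 4" using b y(1) by simp
   moreover have "0 < b * ?y powr (- \<mu> / 2) + 4 / 1" using b by (simp add: add_nonneg_pos)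
   ultimately have "m * (exp (b * (\<rho> powr \<alpha> / \<alpha>)) / (b + 4))\<^sup>2
     \<le> m / ((exp (- (b * (?y powr \<alpha> / \<alpha>))))\<^sup>2 * (b * ?y powr (- \<mu> / 2) + 4 / 1)\<^sup>2)"
    using quotient_ge[OF m(1) exp_gt_zero e] by blast
   then have "ennreal (h R) \<le> ennreal (m / ((exp (- b * (?y powr \<alpha> / \<alpha>)))\<^sup>2 * (b * ?y powr (- \<mu> / 2) + 4 / 1)\<^sup>2))"
    by (intro ennreal_leI) (simp add: h_def \<rho>_def)
   also have "\<dots> \<le> I (\<rho> + 1)" by (rule m(4)[OF \<rho>(1)]) simp
   finally show ?thesis by (simp add: \<rho>_def)
  qed
  moreover have "h R > 0" for R using m(1) b by (simp add: h_def)
  ultimately have "h R > 0 \<and> ennreal (h R) \<le> I R" if "R \<ge> R0 + 1" for R using that by blast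
  then have ev: "\<forall>\<^sub>F R in at_top. h R > 0 \<and> ennreal (h R) \<le> I R"
   by (rule eventually_mono[OF eventually_ge_at_top[of "R0 + 1"]])
  have "ln (h R) = ln m - 2 * ln (b + 4) + 2 / \<alpha> * b * (R - 1) powr \<alpha>" for R
   using m(1) b by (simp add: h_def ln_mult ln_realpow ln_div algebra_simps)
  then have "((\<lambda>R. 1 / R powr \<alpha> * ln (h R)) \<longlongrightarrow> 2 / \<alpha> * b) at_top" by (simp only: powr_growth_limit[OF \<alpha>])
  from Liminf_ext_ln_ge[OF ev _ this]
  show "ereal (2 / \<alpha> * b + 0) \<le> Liminf at_top (\<lambda>R. ereal (1 / R powr \<alpha>) * ext_ln (I R))" by simp
 qed
 then show ?thesis by (simp add: \<alpha>_def real_sqrt_mult mult.assoc)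
qed

lemma mass_liminf_2:
 assumes \<mu>2: "\<mu> = 2"
 shows "ereal (2 * (1 + sqrt (q - 1) * sqrt lam)) \<le> Liminf at_top (\<lambda>R. ereal (1 / ln R) * ext_ln (I R))"
proof -
 have "ereal (2 * sqrt ((q - 1) * lam) + 2) \<le> Liminf at_top (\<lambda>R. ereal (1 / ln R) * ext_ln (I R))"
 proof (rule ereal_le_by_scaling)
  show "sqrt ((q - 1) * lam) > 0" using q lam by simp
  fix b assume b: "0 < b" "b < sqrt ((q - 1) * lam)"
  have \<Phi>: "(ln has_real_derivative y powr (- \<mu> / 2)) (at y)" if "y > 0" for y :: real
   using that \<mu>2 by (auto intro!: derivative_eq_intros simp: powr_minus_divide)
  obtain m R0 c where m: "m > 0" "R0 > 0" "c \<ge> 0" "!!R S. R \<ge> R0 ==> S > 0 ==>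
   ennreal (m / ((exp (- b * ln (smooth_abs R + c)))\<^sup>2 * (b * (smooth_abs R + c) powr (- \<mu> / 2) + 4 / S)\<^sup>2)) \<le> I (R + S)"
   by (rule mass_growth_powr[OF b \<Phi>]) (auto intro: that)
  \<comment> \<open>The cutoff runs from R/2 to R, so its slope 4/S is of the same order 1/R as the
    weight and the sum is at most (b + 4) / (R/2). The squared denominator contributes the 2 in the
    exponent 2b + 2.\<close>
  define h where "h R = m * (exp (b * ln (R / 2)) / ((b + 4) / (R / 2)))\<^sup>2" for R
  have "h R > 0 \<and> ennreal (h R) \<le> I R" if R: "R \<ge> 2 * R0" for R
  proof -
   define \<rho> where "\<rho> = R / 2"
   have \<rho>: "\<rho> \<ge> R0" "\<rho> > 0" using R m(2) by (simp_all add: \<rho>_def)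
   let ?y = "smooth_abs \<rho> + c"
   have y: "?y \<ge> 1" "?y \<ge> \<rho>" using smooth_abs(1,2)[of \<rho>] m(3) by simp_all
   have e: "exp (b * ln \<rho>) \<le> exp (b * ln ?y)" using b y \<rho> by simp
   have "?y powr (- \<mu> / 2) = 1 / ?y" using y \<mu>2 by (simp add: powr_minus_divide)
   also have "\<dots> \<le> 1 / \<rho>" using y \<rho> by (intro divide_left_mono mult_pos_pos) linarith+
   finally have "b * ?y powr (- \<mu> / 2) + 4 / \<rho> \<le> b * (1 / \<rho>) + 4 / \<rho>" using b by (intro add_right_mono mult_left_mono) simp_all
   then have "b * ?y powr (- \<mu> / 2) + 4 / \<rho> \<le> (b + 4) / \<rho>" by (simp add: add_divide_distrib)
   moreover have "0 < b * ?y powr (- \<mu> / 2) + 4 / \<rho>" using b \<rho> by (simp add: add_nonneg_pos)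
   ultimately have "m * (exp (b * ln \<rho>) / ((b + 4) / \<rho>))\<^sup>2
     \<le> m / ((exp (- (b * ln ?y)))\<^sup>2 * (b * ?y powr (- \<mu> / 2) + 4 / \<rho>)\<^sup>2)"
    using quotient_ge[OF m(1) exp_gt_zero e] by blast
   then have "ennreal (h R) \<le> ennreal (m / ((exp (- b * ln ?y))\<^sup>2 * (b * ?y powr (- \<mu> / 2) + 4 / \<rho>)\<^sup>2))"
    by (intro ennreal_leI) (simp add: h_def \<rho>_def)
   also have "\<dots> \<le> I (\<rho> + \<rho>)" by (rule m(4)[OF \<rho>])
   finally have "ennreal (h R) \<le> I R" by (simp add: \<rho>_def)
   moreover have "h R > 0" using m(1) b \<rho>(2) by (simp add: h_def \<rho>_def)
   ultimately show ?thesis by blast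
  qed
  then have ev: "\<forall>\<^sub>F R in at_top. h R > 0 \<and> ennreal (h R) \<le> I R"
   by (rule eventually_mono[OF eventually_ge_at_top[of "2 * R0"]])
  have h: "ln (m * (exp (b * ln x) / ((b + 4) / x))\<^sup>2) = ln m - 2 * ln (b + 4) + (2 * b + 2) * ln x" if "x > 0" for x
   using m(1) b(1) that by (simp add: ln_mult ln_realpow ln_div algebra_simps)
  have ln: "ln m - 2 * ln (b + 4) + (2 * b + 2) * ln (R / 2) = ln (h R)" if "R > 0" for R
   using h[OF half_gt_zero[OF that]] by (simp only: h_def)
  have "((\<lambda>R. 1 / ln R * ln (h R)) \<longlongrightarrow> 2 * b + 2) at_top"
  proof (rule Lim_transform_eventually[OF ln_growth_limit[of "ln m - 2 * ln (b + 4)"]])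
   show "\<forall>\<^sub>F R in at_top. 1 / ln R * (ln m - 2 * ln (b + 4) + (2 * b + 2) * ln (R / 2)) = 1 / ln R * ln (h R)"
    using eventually_gt_at_top[of 0] by eventually_elim (simp only: ln)
  qed
  moreover have "\<forall>\<^sub>F R :: real in at_top. 1 / ln R \<ge> 0" using eventually_ge_at_top[of 1] by eventually_elim simp
  ultimately show "ereal (2 * b + 2) \<le> Liminf at_top (\<lambda>R. ereal (1 / ln R) * ext_ln (I R))"
   by (rule Liminf_ext_ln_ge[OF ev, rotated])
 qed
 then show ?thesis by (simp add: real_sqrt_mult distrib_left add.commute mult.assoc)
qed

end

end
theorem theorem3:
  fixes A :: "('a::{t2_space, second_countable_topology}, 'n::finite) chart set"
    and g :: "('a, 'n) metric"
    and \<mu> lam q :: real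
    and V u :: "'a \<Rightarrow> real"
    and x0 :: 'a
  assumes "complete_connected_riemannian_manifold A g"
    and "0 \<le> \<mu>" and "\<mu> \<le> 2" and "lam > 0"
    and "continuous_on UNIV V" and "\<forall>x. V x > 0"
    and "\<mu> = 0 \<longrightarrow> (\<forall>x. V x \<ge> lam)"
    and "\<mu> > 0 \<longrightarrow> (\<exists>p. Liminf (at_manifold_infinity A g p)
           (\<lambda>x. ereal (rdist A g x p powr \<mu> * V x)) \<ge> ereal lam)"
    and "u \<in> W12_loc A g"
    and "emeasure (riemannian_volume A g) {x. u x > 0} > 0"
    and "weakly_subsolution_on A g V {x. u x > 0} u"
    and "q > 1"
  shows "(\<mu> < 2 \<longrightarrow>
      Liminf at_top (\<lambda>R. ereal (1 / R powr (1 - \<mu> / 2)) *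
        ext_ln (\<integral>\<^sup>+x\<in>geodesic_ball A g x0 R. ennreal (max (u x) 0 powr q) \<partial>riemannian_volume A g))
      \<ge> ereal (2 * sqrt (q - 1) * sqrt lam / (1 - \<mu> / 2))) \<and>
    (\<mu> = 2 \<longrightarrow>
      Liminf at_top (\<lambda>R. ereal (1 / ln R) *
        ext_ln (\<integral>\<^sup>+x\<in>geodesic_ball A g x0 R. ennreal (max (u x) 0 powr q) \<partial>riemannian_volume A g))
      \<ge> ereal (1 + sqrt (1 + 4 * (q - 1) * lam)) \<and>
      1 + sqrt (1 + 4 * (q - 1) * lam) > 2) \<and>
    (\<mu> = 2 \<longrightarrow>
      (\<forall>L. ((\<lambda>R. ereal (1 / ln R) *
        ext_ln (\<integral>\<^sup>+x\<in>geodesic_ball A g x0 R. ennreal (max (u x) 0 powr q) \<partial>riemannian_volume A g))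
          \<longlongrightarrow> L) at_top
        \<longrightarrow> L \<ge> ereal (2 * (1 + sqrt (q - 1) * sqrt lam))))"
proof -
  interpret complete_manifold A g
    using assms(1) unfolding complete_connected_riemannian_manifold_def riemannian_manifold_def
    by unfold_locales auto
  define b where "b = sqrt (q - 1) * sqrt lam"
  have b: "b > 0" "b\<^sup>2 = (q - 1) * lam" using assms by (simp_all add: b_def power_mult_distrib)
  \<comment> \<open>The right-hand side exceeds the left by 4b, so the constant of the last claim
    dominates that of the second one.\<close>
  have "1 + 4 * (q - 1) * lam \<le> (1 + 2 * b)\<^sup>2"
    using b by (simp add: power2_sum power_mult_distrib algebra_simps)
  then have "sqrt (1 + 4 * (q - 1) * lam) \<le> sqrt ((1 + 2 * b)\<^sup>2)" by (rule real_sqrt_le_mono)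
  then have s: "1 + sqrt (1 + 4 * (q - 1) * lam) \<le> 2 * (1 + sqrt (q - 1) * sqrt lam)" using b(1) by (simp flip: b_def)
  have "1 < sqrt (1 + 4 * (q - 1) * lam)" using assms by simp
  then have gt: "1 + sqrt (1 + 4 * (q - 1) * lam) > 2" by simp
  have V: "V x > 0" for x using assms by blast
  note * = assms(9,11,5) V assms(12,10,2,4,7,8)
  show ?thesis
  proof (intro conjI impI allI gt)
    assume "\<mu> < 2"
    then show "ereal (2 * sqrt (q - 1) * sqrt lam / (1 - \<mu> / 2)) \<le> Liminf at_top (\<lambda>R. ereal (1 / R powr (1 - \<mu> / 2)) *
        ext_ln (\<integral>\<^sup>+x\<in>geodesic_ball A g x0 R. ennreal (max (u x) 0 powr q) \<partial>vol))"
      by (rule mass_liminf_lt_2[OF *])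
  next
    assume \<mu>: "\<mu> = 2"
    note L = mass_liminf_2[OF * \<mu>, of x0]
    show "ereal (1 + sqrt (1 + 4 * (q - 1) * lam)) \<le> Liminf at_top (\<lambda>R. ereal (1 / ln R) *
        ext_ln (\<integral>\<^sup>+x\<in>geodesic_ball A g x0 R. ennreal (max (u x) 0 powr q) \<partial>vol))"
      by (rule order_trans[OF _ L]) (use s in simp)
    fix l assume "((\<lambda>R. ereal (1 / ln R) *
        ext_ln (\<integral>\<^sup>+x\<in>geodesic_ball A g x0 R. ennreal (max (u x) 0 powr q) \<partial>vol)) \<longlongrightarrow> l) at_top"
    from lim_imp_Liminf[OF _ this] show "ereal (2 * (1 + sqrt (q - 1) * sqrt lam)) \<le> l" using L by simp
  qed
qed

end
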